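(* There is a positive constant $C$ depending only on $n$ such that the following holds. Let $\lambda>1$, $0<r_0<1$, and let $u$ be an eigenfunction on $B_{r_0}(0)\subset\mathbb{R}^n$ with corresponding eigenvalue $\lambda^2$, i.e. a nonzero solution of $\triangle^2u=\lambda^2u$ (on a neighbourhood of $\overline{B_{r_0}(0)}$). Then for every fixed $0<r<r_0/4$, $$\mathcal{H}^{n-1}\left(\{x: u(x)=0\}\cap B_{\frac{r}{16}}(0)\right)\le C\left(\max\{N(0,r_0),C_0\}+\ln\lambda+\sqrt\lambda\, r-\ln r\right)r^{n-1},$$ where $N(0,r_0)$ is the frequency function of $u$ centered at the origin of $\mathbb{R}^{n+1}$ with radius $r_0$.
   Context: Let $n\ge2$ and let $\Omega\subseteq\mathbb{R}^n$ be a bounded domain. For $\lambda>0$ and $u$ a nonzero solution of $\triangle^2u=\lambda^2u$ in $\Omega$, put $v=\triangle u-\lambda u$, and for $y=(x,x_{n+1})\in\Omega\times\mathbb{R}$ define $g(y)=u(x)e^{\sqrt\lambda x_{n+1}}$ and $h(y)=v(x)e^{\sqrt\lambda x_{n+1}}$. For a ball $B_r(y_0)\subset\mathbb{R}^{n+1}$ with $\overline{B_r(y_0)}\subset\Omega\times\mathbb{R}$ the frequency function is $$N(y_0,r)=r\,\frac{\int_{B_r(y_0)}\left(|\nabla g|^2+|\nabla h|^2+gh+2\lambda g^2\right)dy}{\int_{\partial B_r(y_0)}(g^2+h^2)\,d\sigma},$$ where $d\sigma$ is $n$-dimensional Hausdorff measure. $C_0$ is a fixed positive constant depending only on $n$ with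 the property (monotonicity formula): there is a constant $C_*>0$ depending only on $n$ such that, for all such $\Omega$, $u$ and all $\lambda>1$, $0<r\le1$, $N(y_0,r)\ge C_0$ implies $\frac{d\ln N(y_0,r)}{dr}\ge -C_*$. Here, in $\mathbb{R}^n$, $B_\rho(0)$ is the $n$-dimensional ball; $\mathcal{H}^{n-1}$ is Hausdorff measure. *)

theory Defs
  imports "HOL-Analysis.Analysis"
begin

section \<open>Hausdorff measure\<close>

text \<open>The normalisation is the one for which the \<open>s\<close>-dimensional measure on \<open>s\<close>-dimensional
  Euclidean space is Lebesgue measure. The empty set is treated separately because
  \<open>diameter {} ^ 0 = 1\<close>, and boundedness is required explicitly because \<open>diameter\<close> is
  unspecified on unbounded sets.\<close>

definition hausdorff_premeasure :: "nat \<Rightarrow> real \<Rightarrow> 'a::metric_space set \<Rightarrow> ennreal" where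
  "hausdorff_premeasure s \<delta> A =
     (INF C \<in> {C :: nat \<Rightarrow> 'a set. A \<subseteq> (\<Union>i. C i) \<and> (\<forall>i. bounded (C i) \<and> diameter (C i) \<le> \<delta>)}.
        \<Sum>i. if C i = {} then 0
             else ennreal (unit_ball_vol (real s) * (diameter (C i) / 2) ^ s))"

definition hausdorff_outer :: "nat \<Rightarrow> 'a::metric_space set \<Rightarrow> ennreal" where
  "hausdorff_outer s A = (SUP \<delta>\<in>{0<..}. hausdorff_premeasure s \<delta> A)"

text \<open>The restriction to the Borel sets, on which this metric outer measure is countably
  additive; it is only used to integrate.\<close>

definition hausdorff_measure :: "nat \<Rightarrow> 'a::metric_space measure" where
  "hausdorff_measure s = measure_of UNIV (sets borel) (hausdorff_outer s)"


section \<open>Classical partial derivatives\<close>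

definition partial_deriv ::
    "'a::euclidean_space \<Rightarrow> ('a \<Rightarrow> real) \<Rightarrow> 'a \<Rightarrow> real" where
  "partial_deriv b f x = frechet_derivative f (at x) b"

definition grad :: "('a::euclidean_space \<Rightarrow> real) \<Rightarrow> 'a \<Rightarrow> 'a" where
  "grad f x = (\<Sum>b\<in>Basis. partial_deriv b f x *\<^sub>R b)"

definition laplacian :: "('a::euclidean_space \<Rightarrow> real) \<Rightarrow> 'a \<Rightarrow> real" where
  "laplacian f x = (\<Sum>b\<in>Basis. partial_deriv b (partial_deriv b f) x)"

text \<open>\<open>C_k_on k S f\<close>, for open \<open>S\<close>: \<open>f\<close> is of class \<open>C\<^sup>k\<close> on \<open>S\<close>.\<close>

fun C_k_on :: "nat \<Rightarrow> 'a::euclidean_space set \<Rightarrow> ('a \<Rightarrow> real) \<Rightarrow> bool" where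
  "C_k_on 0 S f \<longleftrightarrow> continuous_on S f"
| "C_k_on (Suc k) S f \<longleftrightarrow>
     (\<forall>x\<in>S. f differentiable (at x)) \<and> (\<forall>b\<in>Basis. C_k_on k S (partial_deriv b f))"


section \<open>Bi-Laplace eigenfunctions and the frequency function\<close>

text \<open>\<open>u\<close> is a nonzero classical solution of \<open>\<triangle>\<^sup>2 u = \<lambda>\<^sup>2 u\<close> in \<open>\<Omega>\<close>.\<close>

definition eigenfunction_on ::
    "'a::euclidean_space set \<Rightarrow> real \<Rightarrow> ('a \<Rightarrow> real) \<Rightarrow> bool" where
  "eigenfunction_on \<Omega> lam u \<longleftrightarrow>
     C_k_on 4 \<Omega> u \<and>
     (\<forall>x\<in>\<Omega>. laplacian (laplacian u) x = lam\<^sup>2 * u x) \<and>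
     (\<exists>x\<in>\<Omega>. u x \<noteq> 0)"

text \<open>\<open>\<real>\<^sup>n\<^sup>+\<^sup>1\<close> is rendered as \<open>\<real>\<^sup>n \<times> \<real>\<close>, with the Euclidean structure of the product.\<close>

definition lift_g :: "real \<Rightarrow> (real^'n \<Rightarrow> real) \<Rightarrow> (real^'n) \<times> real \<Rightarrow> real" where
  "lift_g lam u y = u (fst y) * exp (sqrt lam * snd y)"

definition lift_h :: "real \<Rightarrow> (real^'n \<Rightarrow> real) \<Rightarrow> (real^'n) \<times> real \<Rightarrow> real" where
  "lift_h lam u = lift_g lam (\<lambda>x. laplacian u x - lam * u x)"

definition frequency ::
    "real \<Rightarrow> (real^'n \<Rightarrow> real) \<Rightarrow> (real^'n) \<times> real \<Rightarrow> real \<Rightarrow> real" where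
  "frequency lam u y0 r =
     (let g = lift_g lam u; h = lift_h lam u in
      r * (LINT y:ball y0 r|lborel.
             (norm (grad g y))\<^sup>2 + (norm (grad h y))\<^sup>2 + g y * h y + 2 * lam * (g y)\<^sup>2)
        / (LINT y:sphere y0 r|hausdorff_measure CARD('n). (g y)\<^sup>2 + (h y)\<^sup>2))"

text \<open>The property of the threshold \<open>C\<^sub>0\<close> (monotonicity formula) in dimension \<open>n = CARD('n)\<close>.
  The bound on \<open>d ln N / dr\<close> includes the existence of this derivative.\<close>

definition monotonicity_threshold :: "'n::finite itself \<Rightarrow> real \<Rightarrow> bool" where
  "monotonicity_threshold _ C0 \<longleftrightarrow>
     (\<exists>Cstar>0. \<forall>(\<Omega> :: (real^'n) set) lam u y0 r.
        open \<Omega> \<and> connected \<Omega> \<and> bounded \<Omega> \<and> lam > 1 \<and> eigenfunction_on \<Omega> lam u \<and>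
        0 < r \<and> r \<le> 1 \<and> cball y0 r \<subseteq> \<Omega> \<times> UNIV \<and> frequency lam u y0 r \<ge> C0 \<longrightarrow>
        (\<exists>D. ((\<lambda>s. ln (frequency lam u y0 s)) has_real_derivative D) (at r) \<and> D \<ge> - Cstar))"

end

theory Submission
  imports Defs
begin

text \<open>
  Let \<open>F\<close> be the integral of \<open>g\<^sup>2 + h\<^sup>2\<close> over the ball of radius \<open>t\<close> about the origin. The numerator of the frequency
  is half the integral of \<open>\<triangle>(g\<^sup>2 + h\<^sup>2)\<close>, and the sphere integral in its denominator is at most
  a constant times \<open>F'\<close>; so the almost monotone bound on the frequency turns into the
  differential inequality \<open>t F' \<le> (n + 1 + 2 K) F\<close>, that is, polynomial growth of \<open>F\<close>.

  The eigenfunction is the trace \<open>u(x) = U(x, 0)\<close> of a harmonic function on \<open>\<Omega> \<times> \<real>\<close>, hence analytic with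
  explicit bounds, and growth gives a point near the origin where \<open>|u| \<ge> S exp(-C M)\<close>. Here
  \<open>S\<close> bounds \<open>|U|\<close> on the ball of radius \<open>2 r\<close> and \<open>M\<close> is the bracket of the estimate.
  Interpolation along segments carries this lower bound to points near any given point of the
  ball of radius \<open>r / 8\<close>, and by Rolle's theorem a ray starting at such a point meets
  the zero set at most \<open>C M\<close> times.

  Finally the zero set is cut into countably many pieces, each with a Lipschitz inverse of the
  radial projection from one of \<open>n\<close> base points. The measure of a piece is bounded by the volume of
  the cone over its projection, and the cones over disjoint pieces overlap at most as often as a
  ray meets the zero set.
\<close>

section \<open>Differentiation under the integral and integration by parts\<close>

text \<open>Each term of the bracket has its own source. The frequency enters through the growth
  exponent alone, and \<open>C0\<close> replaces it at radii where it lies below the threshold and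
  nothing is known of its derivative. The frequency controls g^2 + h^2, but g is not harmonic (its
  Laplacian is h + 2 lam g), so interior estimates are applied to another extension of u; comparing
  the two costs factors exp(c sqrt(lam) r). A large value of g^2 + h^2 may be due to the Laplacian
  of u instead of u; separating off lam u and returning from a second derivative to u costs powers
  of lam and of 1/r, which become ln lam and - ln r. On the side of measure theory, upper bounds
  come from one inequality, which compares a compact subset of the unit sphere with the cone over
  it. It is used twice: for the spheres in R^{n+1} over which the frequency is normalised, and for
  the radial projections of pieces of the zero set in R^n. A one-sided bound with some constant is
  enough in both places, so no area formula enters.\<close>

lemma has_derivative_integral_parameter:
  fixes f :: "'a::euclidean_space \<Rightarrow> 'b \<Rightarrow> real"
  assumes W: "open W" "x0 \<in> W"
    and int: "\<And>x. x \<in> W \<Longrightarrow> integrable M (f x)"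
    and G: "G \<in> borel_measurable M"
    and B: "integrable M B"
    and der: "AE z in M. ((\<lambda>x. f x z) has_derivative (\<lambda>v. G z \<bullet> v)) (at x0)"
    and lip: "\<And>x. x \<in> W \<Longrightarrow> AE z in M. \<bar>f x z - f x0 z\<bar> \<le> B z * norm (x - x0)"
    and Gb: "AE z in M. norm (G z) \<le> B z"
  shows "integrable M G" "((\<lambda>x. integral\<^sup>L M (f x)) has_derivative (\<lambda>v. integral\<^sup>L M G \<bullet> v)) (at x0)"
proof -
  show iG: "integrable M G"
    by (rule Bochner_Integration.integrable_bound[OF B G]) (use Gb in \<open>auto elim!: eventually_mono\<close>)
  obtain e where e: "e > 0" "ball x0 e \<subseteq> W" using W openE by blast
  define Q where "Q x z = (f x z - f x0 z - G z \<bullet> (x - x0)) / norm (x - x0)" for x z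
  have lim: "((\<lambda>x. integral\<^sup>L M (Q x)) \<longlongrightarrow> 0) (at x0)"
    unfolding tendsto_at_iff_sequentially
  proof (intro allI impI)
    fix X assume X: "\<forall>i. X i \<in> UNIV - {x0}" "X \<longlonglongrightarrow> x0"
    then have ev: "\<forall>\<^sub>F i in sequentially. X i \<in> ball x0 e"
      using e(1) by (intro topological_tendstoD) auto
    then obtain N where "\<And>i. i \<ge> N \<Longrightarrow> X i \<in> ball x0 e" unfolding eventually_sequentially by blast
    then have N: "X i \<in> W" if "i \<ge> N" for i using e that by blast
    have "(\<lambda>i. integral\<^sup>L M (Q (X (i + N)))) \<longlonglongrightarrow> integral\<^sup>L M (\<lambda>z. 0)"
    proof (rule integral_dominated_convergence[where w = "\<lambda>z. 2 * B z"])
      show "integrable M (\<lambda>z. 2 * B z)" using B by simp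
      show "Q (X (i + N)) \<in> borel_measurable M" for i
        unfolding Q_def using int[of "X (i+N)"] int[OF W(2)] N[of "i+N"] G by (auto intro!: borel_measurable_divide borel_measurable_diff)
      show "AE z in M. (\<lambda>i. Q (X (i + N)) z) \<longlonglongrightarrow> 0"
        using der
      proof eventually_elim
        case (elim z)
        then have "((\<lambda>x. Q x z) \<longlongrightarrow> 0) (at x0)"
          unfolding has_derivative_at2 Q_def by (simp add: divide_inverse mult.commute diff_diff_eq)
        then have "(\<lambda>i. Q (X i) z) \<longlonglongrightarrow> 0"
          using X unfolding tendsto_at_iff_sequentially by (auto simp: o_def)
        then show ?case by (rule LIMSEQ_ignore_initial_segment)
      qed
      show "AE z in M. norm (Q (X (i + N)) z) \<le> 2 * B z" for i
        using lip[of "X (i+N)", OF N[of "i+N", simplified]] Gb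
      proof eventually_elim
        case (elim z)
        have nz: "norm (X (i+N) - x0) > 0" using X(1) by auto
        have "\<bar>G z \<bullet> (X (i+N) - x0)\<bar> \<le> norm (G z) * norm (X (i+N) - x0)"
          by (rule Cauchy_Schwarz_ineq2)
        also have "\<dots> \<le> B z * norm (X (i+N) - x0)" using elim by (simp add: mult_right_mono)
        finally have "\<bar>f (X (i+N)) z - f x0 z - G z \<bullet> (X (i+N) - x0)\<bar> \<le> 2 * B z * norm (X (i+N) - x0)"
          using elim(1) by linarith
        then show ?case using nz by (simp add: Q_def divide_simps)
      qed
    qed (simp)
    then have "(\<lambda>i. integral\<^sup>L M (Q (X (i + N)))) \<longlonglongrightarrow> 0" by simp
    then have "(\<lambda>i. integral\<^sup>L M (Q (X i))) \<longlonglongrightarrow> 0"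
      by (rule LIMSEQ_offset)
    then show "((\<lambda>x. integral\<^sup>L M (Q x)) \<circ> X) \<longlonglongrightarrow> 0" by (simp add: o_def)
  qed
  have "((\<lambda>x. (integral\<^sup>L M (f x) - integral\<^sup>L M (f x0) - integral\<^sup>L M G \<bullet> (x - x0)) /\<^sub>R norm (x - x0)) \<longlongrightarrow> 0) (at x0)"
  proof (rule Lim_transform_eventually[OF lim])
    have "\<forall>\<^sub>F x in at x0. x \<in> W" using W by (simp add: eventually_at_in_open')
    then show "\<forall>\<^sub>F x in at x0. integral\<^sup>L M (Q x) = (integral\<^sup>L M (f x) - integral\<^sup>L M (f x0) - integral\<^sup>L M G \<bullet> (x - x0)) /\<^sub>R norm (x - x0)"
    proof eventually_elim
      case (elim x)
      show ?case unfolding Q_def using int[OF elim] int[OF W(2)] iG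
        by (simp add: divide_inverse mult.commute)
    qed
  qed
  then show "((\<lambda>x. integral\<^sup>L M (f x)) has_derivative (\<lambda>v. integral\<^sup>L M G \<bullet> v)) (at x0)"
    unfolding has_derivative_at2 by (simp add: bounded_linear_inner_right divide_inverse mult.commute diff_diff_eq)
qed

lemma integral_lborel_translation:
  fixes f :: "'a::euclidean_space \<Rightarrow> real"
  assumes "f \<in> borel_measurable borel"
  shows "(\<integral>z. f (z + c) \<partial>lborel) = integral\<^sup>L lborel f"
proof -
  have "integral\<^sup>L lborel f = integral\<^sup>L (distr lborel borel ((+) c)) f" by (simp add: lborel_distr_plus)
  also have "\<dots> = (\<integral>z. f (c + z) \<partial>lborel)" by (rule integral_distr) (use assms in auto)
  finally show ?thesis by (simp add: add.commute)
qed

lemma integral_lborel_scale: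
  fixes f :: "'a::euclidean_space \<Rightarrow> real"
  assumes "f \<in> borel_measurable borel" "c > 0"
  shows "integral\<^sup>L lborel f = c ^ DIM('a) * (\<integral>z. f (t + c *\<^sub>R z) \<partial>lborel)"
proof -
  have "integral\<^sup>L lborel f = integral\<^sup>L (density (distr lborel borel (\<lambda>x. t + c *\<^sub>R x)) (\<lambda>_. ennreal (c^DIM('a)))) f"
    using lborel_affine[of c t] assms by (simp add: ennreal_power)
  also have "\<dots> = integral\<^sup>L (distr lborel borel (\<lambda>x. t + c *\<^sub>R x)) (\<lambda>x. c^DIM('a) *\<^sub>R f x)"
    by (rule integral_density) (use assms in auto)
  also have "\<dots> = (\<integral>z. c^DIM('a) * f (t + c *\<^sub>R z) \<partial>lborel)"
    by (subst integral_distr) (use assms in auto)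
  finally show ?thesis by simp
qed

lemma emeasure_lborel_scale:
  fixes A :: "'a::euclidean_space set"
  assumes "A \<in> sets borel" "c > 0"
  shows "emeasure lborel {x. t + c *\<^sub>R x \<in> A} = emeasure lborel A / ennreal (c ^ DIM('a))"
proof -
  have "emeasure lborel A = emeasure (density (distr lborel borel (\<lambda>x. t + c *\<^sub>R x)) (\<lambda>_. ennreal (c^DIM('a)))) A"
    using lborel_affine[of c t] assms by (simp add: ennreal_power)
  also have "\<dots> = ennreal (c^DIM('a)) * emeasure (distr lborel borel (\<lambda>x. t + c *\<^sub>R x)) A"
    by (subst emeasure_density_const) (use assms in auto)
  also have "emeasure (distr lborel borel (\<lambda>x. t + c *\<^sub>R x)) A = emeasure lborel {x. t + c *\<^sub>R x \<in> A}"
    by (subst emeasure_distr) (use assms in \<open>auto simp: vimage_def\<close>)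
  finally have "emeasure lborel A = ennreal (c^DIM('a)) * emeasure lborel {x. t + c *\<^sub>R x \<in> A}" .
  moreover have "ennreal (c^DIM('a)) \<noteq> 0" "ennreal (c^DIM('a)) \<noteq> top" using assms by auto
  ultimately show ?thesis by (metis mult.commute ennreal_mult_divide_eq)
qed

lemma AE_not_on_sphere: "AE z in (lborel :: 'a::euclidean_space measure). z \<notin> sphere a r"
proof (rule AE_I[of _ _ "sphere a r"])
  show "emeasure lborel (sphere a r) = 0"
    using negligible_sphere[of a r] by (simp add: negligible_iff_emeasure0 borel_closed)
qed (auto simp: borel_closed)

text \<open>The divergence theorem in one direction, without a boundary term. Extended by zero,
  \<open>X\<close> is Lipschitz on the whole space, and the integral of a translate does not depend
  on the translation. Differentiating in the translation at 0 gives the claim; the extension can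
  fail to be differentiable only on the unit sphere, a null set.\<close>

lemma integral_directional_derivative_ball:
  fixes X :: "'a::euclidean_space \<Rightarrow> real"
  assumes cont: "continuous_on (cball 0 1) X" and zero: "\<And>z. norm z = 1 \<Longrightarrow> X z = 0"
    and der: "\<And>z. norm z < 1 \<Longrightarrow> (X has_derivative (\<lambda>v. G z \<bullet> v)) (at z)"
    and bnd: "\<And>z. norm z < 1 \<Longrightarrow> norm (G z) \<le> L"
    and Gc: "continuous_on (ball 0 1) G"
  shows "(\<integral>z. indicator (ball 0 1) z * (G z \<bullet> e) \<partial>lborel) = 0"
proof -
  define Y where "Y z = (if norm z \<le> 1 then X z else 0)" for z
  define H where "H z = (if norm z < 1 then G z else 0)" for z
  have L0: "L \<ge> 0" using bnd[of 0] norm_ge_zero by (metis norm_zero order_trans zero_less_one)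
  have onb: "\<bar>X x - X y\<bar> \<le> L * norm (x - y)" if x: "norm x \<le> 1" and y: "norm y \<le> 1" for x y
  proof -
    have ins: "\<bar>X x - X y\<bar> \<le> L * norm (x - y)" if "norm x < 1" "norm y < 1" for x y
    proof -
      have "norm (X x - X y) \<le> L * norm (x - y)"
      proof (rule differentiable_bound[of "ball 0 1"])
        show "(X has_derivative (\<lambda>v. G z \<bullet> v)) (at z within ball 0 1)" if "z \<in> ball 0 1" for z
          using der that by (auto intro: has_derivative_at_withinI)
        show "onorm (\<lambda>v. G z \<bullet> v) \<le> L" if "z \<in> ball 0 1" for z
        proof (rule onorm_bound)
          show "norm (G z \<bullet> v) \<le> L * norm v" for v
            using bnd[of z] that Cauchy_Schwarz_ineq2[of "G z" v]
            by (smt (verit, best) dist_0_norm mem_ball mult_right_mono norm_ge_zero real_norm_def)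
        qed (rule L0)
      qed (use that in auto)
      then show ?thesis by simp
    qed
    \<comment> \<open>Points of the closed ball are reached by shrinking them to
      \<open>t *\<^sub>R x\<close> with \<open>t < 1\<close> and letting \<open>t\<close> tend to
      1.\<close>
    have c1: "((\<lambda>t. \<bar>X (t *\<^sub>R x) - X (t *\<^sub>R y)\<bar>) \<longlongrightarrow> \<bar>X (1 *\<^sub>R x) - X (1 *\<^sub>R y)\<bar>) (at 1 within {0<..<1})"
    proof -
      have "continuous_on {0..1} (\<lambda>t. \<bar>X (t *\<^sub>R x) - X (t *\<^sub>R y)\<bar>)"
        by (intro continuous_intros continuous_on_compose2[OF cont])
          (use x y in \<open>auto intro!: mult_le_one\<close>)
      then have "((\<lambda>t. \<bar>X (t *\<^sub>R x) - X (t *\<^sub>R y)\<bar>) \<longlongrightarrow> \<bar>X (1 *\<^sub>R x) - X (1 *\<^sub>R y)\<bar>) (at 1 within {0..1})"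
        unfolding continuous_on_def by (rule bspec) simp
      then show ?thesis by (rule tendsto_within_subset) auto
    qed
    have c2: "((\<lambda>t. L * norm (t *\<^sub>R x - t *\<^sub>R y)) \<longlongrightarrow> L * norm (1 *\<^sub>R x - 1 *\<^sub>R y)) (at 1 within {0<..<1})"
      by (intro tendsto_intros)
    have nt: "at (1::real) within {0<..<1} \<noteq> bot" by (simp add: at_within_eq_bot_iff)
    have "\<bar>X (1 *\<^sub>R x) - X (1 *\<^sub>R y)\<bar> \<le> L * norm (1 *\<^sub>R x - 1 *\<^sub>R y)"
    proof (rule tendsto_le[OF nt c2 c1])
      have "norm (t *\<^sub>R z) < 1" if "t \<in> {0<..<1}" "norm z \<le> 1" for t and z :: 'a
        using that mult_less_le_imp_less[of t 1 "norm z" 1] 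
        by (cases "z = 0") (auto intro: le_less_trans[of _ "t * 1"] mult_left_mono)
      then show "\<forall>\<^sub>F t in at 1 within {0<..<1}. \<bar>X (t *\<^sub>R x) - X (t *\<^sub>R y)\<bar> \<le> L * norm (t *\<^sub>R x - t *\<^sub>R y)"
        unfolding eventually_at_filter by (intro always_eventually) (use ins x y in auto)
    qed
    then show ?thesis by simp
  qed
  \<comment> \<open>A segment that leaves the ball crosses the sphere, where \<open>X\<close>
    vanishes; the bound inside the ball applies up to the crossing point.\<close>
  have mix: "\<bar>X x\<bar> \<le> L * norm (x - y)" if x: "norm x \<le> 1" and y: "norm y > 1" for x y
  proof -
    define \<phi> where "\<phi> t = norm (x + t *\<^sub>R (y - x))" for t :: real
    have "\<exists>t\<ge>0. t \<le> 1 \<and> \<phi> t = 1"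
      by (rule IVT') (use x y in \<open>auto simp: \<phi>_def intro!: continuous_intros\<close>)
    then obtain t where t: "0 \<le> t" "t \<le> 1" "norm (x + t *\<^sub>R (y - x)) = 1" by (auto simp: \<phi>_def)
    have "\<bar>X x - X (x + t *\<^sub>R (y - x))\<bar> \<le> L * norm (x - (x + t *\<^sub>R (y - x)))"
      by (rule onb) (use x t in auto)
    also have "\<dots> \<le> L * norm (x - y)"
      using t L0 by (auto intro!: mult_left_mono mult_left_le_one_le simp: norm_minus_commute)
    finally show ?thesis using zero[OF t(3)] by simp
  qed
  have lip: "\<bar>Y x - Y y\<bar> \<le> L * norm (x - y)" for x y
    using onb[of x y] mix[of x y] mix[of y x] L0 by (auto simp: Y_def norm_minus_commute)
  have Yc: "continuous_on UNIV Y"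
  proof (rule lipschitz_on_continuous_on)
    show "L-lipschitz_on UNIV Y" using lip L0 by (auto simp: lipschitz_on_def dist_norm)
  qed
  then have Ym: "Y \<in> borel_measurable borel" by (rule borel_measurable_continuous_onI)
  have Hm: "H \<in> borel_measurable borel"
  proof -
    have "(\<lambda>x. indicator (ball 0 1) x *\<^sub>R G x) \<in> borel_measurable borel"
      by (rule borel_measurable_continuous_on_indicator) (use Gc in auto)
    also have "(\<lambda>x. indicator (ball 0 1) x *\<^sub>R G x) = H" by (auto simp: H_def fun_eq_iff)
    finally show ?thesis .
  qed
  have Yint: "integrable lborel Y"
  proof -
    have "integrable lborel (\<lambda>x. indicator (cball 0 1) x *\<^sub>R X x)"
      by (rule borel_integrable_compact) (use cont in auto)
    also have "(\<lambda>x. indicator (cball 0 1) x *\<^sub>R X x) = Y" by (auto simp: Y_def fun_eq_iff)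
    finally show ?thesis .
  qed
  \<comment> \<open>For |t| < 1 the translates of \<open>Y\<close> by multiples of \<open>e\<close>
    vanish outside the ball of radius \<open>1 + norm e\<close>.\<close>
  define B where "B z = (L * norm e) * indicator (cball 0 (1 + norm e)) z" for z :: 'a
  have conv: "(\<lambda>t. integral\<^sup>L lborel (\<lambda>z. Y (z + t *\<^sub>R e))) = (\<lambda>t. integral\<^sup>L lborel Y)"
    by (intro ext integral_lborel_translation Ym)
  have "((\<lambda>t::real. integral\<^sup>L lborel (\<lambda>z. Y (z + t *\<^sub>R e))) has_derivative (\<lambda>v. integral\<^sup>L lborel (\<lambda>z. H z \<bullet> e) \<bullet> v)) (at 0)"
  proof (rule has_derivative_integral_parameter(2)[of "{-1<..<1}" _ _ _ _ B])
    show "integrable lborel (\<lambda>z. Y (z + x *\<^sub>R e))" for x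
      using Yint integrable_distr_eq[of "(+) (x *\<^sub>R e)" lborel borel Y] Ym
      by (auto simp: lborel_distr_plus add.commute)
    show "(\<lambda>z. H z \<bullet> e) \<in> borel_measurable lborel" using Hm by simp
    show "integrable lborel B" unfolding B_def
      by (intro integrable_mult_right integrable_real_indicator) (use emeasure_bounded_finite[OF bounded_cball[of 0 "1 + norm e"]] in auto)
    show "AE z in lborel. ((\<lambda>t. Y (z + t *\<^sub>R e)) has_derivative (\<bullet>) (H z \<bullet> e)) (at 0)"
      using AE_not_on_sphere[of 0 1]
    proof eventually_elim
      case (elim z)
      have "(Y has_derivative (\<lambda>v. H z \<bullet> v)) (at z)"
      proof (cases "norm z < 1")
        case True
        have "(X has_derivative (\<lambda>v. H z \<bullet> v)) (at z)" using der True by (simp add: H_def)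
        then show ?thesis
          by (rule has_derivative_transform_within_open[of _ _ _ UNIV "ball 0 1"]) (use True in \<open>auto simp: Y_def\<close>)
      next
        case False
        then have z: "norm z > 1" using elim by (auto simp: sphere_def)
        have "((\<lambda>x. 0::real) has_derivative (\<lambda>v. H z \<bullet> v)) (at z)" using False by (simp add: H_def)
        then show ?thesis
          by (rule has_derivative_transform_within_open[of _ _ _ UNIV "- cball 0 1"]) (use z in \<open>auto simp: Y_def\<close>)
      qed
      then have Yd: "(Y has_derivative (\<lambda>v. H z \<bullet> v)) (at (z + 0 *\<^sub>R e))" by simp
      have "((\<lambda>t. z + t *\<^sub>R e) has_derivative (\<lambda>t. t *\<^sub>R e)) (at 0)"
        by (auto intro!: derivative_eq_intros)
      note 1 = this
      show ?case
        by (rule has_derivative_eq_rhs[OF has_derivative_compose[OF 1 Yd]]) (auto simp: fun_eq_iff)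
    qed
    show "AE z in lborel. \<bar>Y (z + x *\<^sub>R e) - Y (z + 0 *\<^sub>R e)\<bar> \<le> B z * norm (x - 0)" if "x \<in> {-1<..<1}" for x
    proof (rule AE_I2)
      fix z
      show "\<bar>Y (z + x *\<^sub>R e) - Y (z + 0 *\<^sub>R e)\<bar> \<le> B z * norm (x - 0)"
      proof (cases "norm z \<le> 1 + norm e")
        case True
        then show ?thesis using lip[of "z + x *\<^sub>R e" "z"] by (simp add: B_def mult_ac)
      next
        case False
        have "norm z \<le> norm (z + x *\<^sub>R e) + norm (x *\<^sub>R e)"
          by (metis add_diff_cancel norm_triangle_ineq4)
        also have "norm (x *\<^sub>R e) \<le> norm e" using that by (auto intro!: mult_left_le_one_le)
        finally have "norm (z + x *\<^sub>R e) > 1" using False by linarith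
        moreover have "norm z > 1" using False by (smt (verit) norm_ge_zero)
        ultimately show ?thesis using L0 by (simp add: Y_def B_def)
      qed
    qed
    show "AE z in lborel. norm (H z \<bullet> e) \<le> B z"
    proof (rule AE_I2)
      fix z
      show "norm (H z \<bullet> e) \<le> B z"
      proof (cases "norm z < 1")
        case True
        have "\<bar>G z \<bullet> e\<bar> \<le> norm (G z) * norm e" by (rule Cauchy_Schwarz_ineq2)
        also have "\<dots> \<le> L * norm e" using bnd[OF True] by (simp add: mult_right_mono)
        finally have "\<bar>G z \<bullet> e\<bar> \<le> L * norm e" .
        moreover have "norm z \<le> 1 + norm e" using True norm_ge_zero[of e] by linarith
        ultimately show ?thesis using True by (simp add: H_def B_def indicator_def)
      qed (auto simp: H_def B_def L0)
    qed
  qed (auto)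
  moreover have "((\<lambda>t::real. integral\<^sup>L lborel (\<lambda>z. Y (z + t *\<^sub>R e))) has_derivative (\<lambda>v. 0)) (at 0)"
    unfolding conv by simp
  ultimately have "(\<lambda>v::real. integral\<^sup>L lborel (\<lambda>z. H z \<bullet> e) \<bullet> v) = (\<lambda>v. 0)"
    by (rule has_derivative_unique)
  then have "integral\<^sup>L lborel (\<lambda>z. H z \<bullet> e) = 0" by (metis inner_real_def mult.right_neutral)
  moreover have "(\<lambda>z. H z \<bullet> e) = (\<lambda>z. indicator (ball 0 1) z * (G z \<bullet> e))" by (auto simp: H_def fun_eq_iff)
  ultimately show ?thesis by simp
qed

section \<open>Gradients, partial derivatives and the classes C^k\<close>

lemma grad_inner_Basis: "b \<in> Basis \<Longrightarrow> grad f x \<bullet> b = partial_deriv b f x"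
  by (simp add: grad_def inner_sum_left_Basis)

lemma has_derivative_grad:
  assumes "f differentiable (at x)"
  shows "(f has_derivative (\<lambda>v. grad f x \<bullet> v)) (at x)"
proof -
  let ?D = "frechet_derivative f (at x)"
  have d: "(f has_derivative ?D) (at x)" using assms by (simp add: frechet_derivative_works)
  have lin: "linear ?D" by (rule has_derivative_linear[OF d])
  have "?D v = grad f x \<bullet> v" for v
  proof -
    have "?D v = ?D (\<Sum>b\<in>Basis. (v \<bullet> b) *\<^sub>R b)" by (simp add: euclidean_representation)
    also have "\<dots> = (\<Sum>b\<in>Basis. (v \<bullet> b) * ?D b)" by (simp add: linear_sum[OF lin] linear_cmul[OF lin])
    also have "\<dots> = grad f x \<bullet> v"
      by (simp add: grad_def inner_sum_left partial_deriv_def inner_commute[of v] mult.commute)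
    finally show ?thesis .
  qed
  then have "?D = (\<lambda>v. grad f x \<bullet> v)" by auto
  then show ?thesis using d by simp
qed

lemma partial_deriv_eq:
  assumes "(f has_derivative (\<lambda>v. G \<bullet> v)) (at x)"
  shows "partial_deriv e f x = G \<bullet> e"
  using frechet_derivative_at[OF assms] by (metis partial_deriv_def)

lemma grad_eq:
  assumes "(f has_derivative (\<lambda>v. G \<bullet> v)) (at x)"
  shows "grad f x = G"
  unfolding grad_def partial_deriv_eq[OF assms] by (simp add: euclidean_representation)

lemma continuous_on_grad:
  assumes "\<And>b. b \<in> Basis \<Longrightarrow> continuous_on W (partial_deriv b f)"
  shows "continuous_on W (grad f)"
  unfolding grad_def by (intro continuous_intros assms)

lemma C_k_on_Suc_has_derivative:
  "C_k_on (Suc k) W f \<Longrightarrow> x \<in> W \<Longrightarrow> (f has_derivative (\<lambda>v. grad f x \<bullet> v)) (at x)"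
  by (rule has_derivative_grad) simp

lemma C_k_on_imp_continuous_on: "C_k_on k W f \<Longrightarrow> continuous_on W f"
  proof (cases k)
  case (Suc j)
  assume "C_k_on k W f"
  then have "\<forall>x\<in>W. f differentiable (at x)" using Suc by simp
  then show ?thesis by (intro continuous_at_imp_continuous_on ballI differentiable_imp_continuous_within) auto
qed simp

lemma C_k_on_Suc_partial: "C_k_on (Suc k) W f \<Longrightarrow> b \<in> Basis \<Longrightarrow> C_k_on k W (partial_deriv b f)"
  by simp

lemma C_k_on_Suc_continuous_on_grad: "C_k_on (Suc k) W f \<Longrightarrow> continuous_on W (grad f)"
  by (intro continuous_on_grad C_k_on_imp_continuous_on C_k_on_Suc_partial)

lemma C_k_on_lower: "C_k_on (Suc k) W f \<Longrightarrow> C_k_on k W f"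
proof (induction k arbitrary: f)
  case 0 then show ?case using C_k_on_imp_continuous_on[OF 0] by (simp only: C_k_on.simps(1))
next
  case (Suc k)
  have "C_k_on k W (partial_deriv b f)" if "b \<in> Basis" for b
    by (rule Suc.IH[OF C_k_on_Suc_partial[OF Suc.prems that]])
  moreover have "\<forall>x\<in>W. f differentiable (at x)" using Suc.prems unfolding C_k_on.simps(2) by blast
  ultimately show ?case unfolding C_k_on.simps(2) by blast
qed

lemma C_k_on_subset: "C_k_on k W f \<Longrightarrow> V \<subseteq> W \<Longrightarrow> C_k_on k V f"
  by (induction k arbitrary: f) (auto intro: continuous_on_subset)

lemma partial_deriv_cong_open:
  assumes "open W" "x \<in> W" "\<And>y. y \<in> W \<Longrightarrow> f y = g y"
  shows "partial_deriv e f x = partial_deriv e g x"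
proof -
  have "(f has_derivative D) (at x) \<longleftrightarrow> (g has_derivative D) (at x)" for D
    using has_derivative_transform_within_open[of f D x UNIV W g] has_derivative_transform_within_open[of g D x UNIV W f] assms
    by auto
  then show ?thesis by (simp add: partial_deriv_def frechet_derivative_def)
qed

lemma C_k_on_cong:
  assumes "open W" "\<And>y. y \<in> W \<Longrightarrow> f y = g y"
  shows "C_k_on k W f \<Longrightarrow> C_k_on k W g"
  using assms(2)
proof (induction k arbitrary: f g)
  case 0 then show ?case using continuous_on_cong by force
next
  case (Suc k)
  have "g differentiable (at x)" if "x \<in> W" for x
  proof -
    obtain D where "(f has_derivative D) (at x)" using Suc.prems(1) \<open>x \<in> W\<close> by (auto simp: differentiable_def)
    then have "(g has_derivative D) (at x)"
      by (rule has_derivative_transform_within_open[of _ _ _ UNIV W]) (use assms(1) Suc.prems(2) \<open>x \<in> W\<close> in auto)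
    then show ?thesis by (auto simp: differentiable_def)
  qed
  moreover have "C_k_on k W (partial_deriv b g)" if "b \<in> Basis" for b
    by (rule Suc.IH[of "partial_deriv b f"]) (use Suc.prems(1) that partial_deriv_cong_open[OF assms(1) _ Suc.prems(2), where e = b] in auto)
  ultimately show ?case by auto
qed

lemma C_k_on_SucI:
  assumes "open W" "\<And>x. x \<in> W \<Longrightarrow> (f has_derivative (\<lambda>v. G x \<bullet> v)) (at x)"
    and "\<And>b. b \<in> Basis \<Longrightarrow> C_k_on k W (\<lambda>x. G x \<bullet> b)"
  shows "C_k_on (Suc k) W f"
proof -
  have "C_k_on k W (partial_deriv b f)" if "b \<in> Basis" for b
    by (rule C_k_on_cong[OF assms(1) _ assms(3)[OF that]]) (use partial_deriv_eq[OF assms(2)] in auto)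
  moreover have "\<forall>x\<in>W. f differentiable (at x)" using assms(2) unfolding differentiable_def by blast
  ultimately show ?thesis by simp
qed

text \<open>Room beyond the radius: derivatives in the radius are two-sided, so an identity at
  radius \<open>r\<close> is obtained on a slightly longer interval of radii.\<close>

lemma cball_subset_open_enlarge:
  fixes y :: "'a::euclidean_space"
  assumes "open W" "cball y r \<subseteq> W" "0 \<le> r"
  obtains r' where "r' > r" "cball y r' \<subseteq> W"
proof (cases "W = UNIV")
  case True
  then show ?thesis using that[of "r+1"] by auto
next
  case False
  have "\<exists>e>0. \<forall>x\<in>cball y r. \<forall>z\<in>-W. e \<le> dist x z"
    using separate_compact_closed[of "cball y r" "- W"] assms by auto
  then obtain e where e: "e > 0" "\<And>x z. x \<in> cball y r \<Longrightarrow> z \<notin> W \<Longrightarrow> e \<le> dist x z" by auto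
  show ?thesis
  proof (rule that[of "r + e / 2"])
    show "cball y (r + e/2) \<subseteq> W"
    proof
      fix z assume z: "z \<in> cball y (r + e/2)"
      show "z \<in> W"
      proof (cases "dist y z \<le> r")
        case True then show ?thesis using assms by auto
      next
        case False
        define x where "x = y + (r / dist y z) *\<^sub>R (z - y)"
        have d: "dist y z > 0" using False assms by linarith
        have "dist y x = r" using assms d by (simp add: x_def dist_norm norm_minus_commute)
        moreover have "dist x z = dist y z - r"
        proof -
          have "z - x = (1 - r / dist y z) *\<^sub>R (z - y)" by (simp add: x_def algebra_simps)
          moreover have "dist x z = norm (z - x)" "dist y z = norm (z - y)" by (auto simp: dist_norm norm_minus_commute)
          moreover have "r / dist y z \<le> 1" using d False by simp
          ultimately have "dist x z = (1 - r / dist y z) * dist y z" by simp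
          then show ?thesis using d by (simp add: field_simps)
        qed
        ultimately show ?thesis using e(2)[of x z] z e(1) by force
      qed
    qed
  qed (use e in auto)
qed

lemma continuous_on_cball_norm_bound:
  fixes f :: "'a::euclidean_space \<Rightarrow> 'b::real_normed_vector"
  assumes "continuous_on (cball a r) f"
  obtains L where "L \<ge> 0" "\<And>x. x \<in> cball a r \<Longrightarrow> norm (f x) \<le> L"
proof -
  have "bounded (f ` cball a r)" by (intro compact_imp_bounded compact_continuous_image compact_cball assms)
  then obtain L where "\<forall>x\<in>f ` cball a r. norm x \<le> L" unfolding bounded_iff by blast
  then show thesis by (intro that[of "max L 0"]) force+
qed

lemma one_minus_inner_nonneg: "norm z \<le> 1 \<Longrightarrow> 0 \<le> 1 - z \<bullet> z"
  by (simp add: dot_square_norm power_le_one)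

lemma integrable_ball_continuous:
  fixes f :: "'a::euclidean_space \<Rightarrow> real"
  assumes "continuous_on (cball a r) f"
  shows "integrable lborel (\<lambda>x. indicator (ball a r) x * f x)"
proof -
  have "integrable lborel (\<lambda>x. indicator (cball a r) x *\<^sub>R f x)"
    by (rule borel_integrable_compact) (use assms in auto)
  then show ?thesis
  proof (rule Bochner_Integration.integrable_bound)
    have "(\<lambda>x. indicator (ball a r) x *\<^sub>R f x) \<in> borel_measurable borel"
      by (rule borel_measurable_continuous_on_indicator) (use assms continuous_on_subset[OF assms ball_subset_cball] in auto)
    then show "(\<lambda>x. indicator (ball a r) x * f x) \<in> borel_measurable lborel" by simp
  qed (auto simp: indicator_def)
qed

lemma affine_mem_cball:
  fixes z :: "'a::euclidean_space"
  shows "norm z \<le> 1 \<Longrightarrow> \<bar>s\<bar> \<le> r \<Longrightarrow> y + s *\<^sub>R z \<in> cball y r"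
  by (simp add: dist_norm mult_left_le mult_mono[of "\<bar>s\<bar>" r "norm z" 1, simplified])

text \<open>The weight vanishes on the unit sphere, so the divergence of \<open>(1 - z \<bullet> z)
  ^ Suc k *\<^sub>R grad U (y + s *\<^sub>R z)\<close> has integral zero. The factor
  \<open>s\<close> is the chain rule, the factor \<open>2 * Suc k\<close> comes from the gradient of
  the weight. This stands in for the passage from the Laplacian on a ball to the normal derivative
  on its boundary.\<close>

lemma laplacian_weight_by_parts:
  fixes U :: "'a::euclidean_space \<Rightarrow> real"
  assumes W: "open W" "C_k_on 2 W U" "cball y \<bar>s\<bar> \<subseteq> W"
  shows "s * (\<integral>z. indicator (ball 0 1) z * (laplacian U (y + s *\<^sub>R z) * (1 - z \<bullet> z) ^ Suc k) \<partial>lborel)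
    = 2 * Suc k * (\<integral>z. indicator (ball 0 1) z * ((grad U (y + s *\<^sub>R z) \<bullet> z) * (1 - z \<bullet> z) ^ k) \<partial>lborel)"
proof -
  have C: "C_k_on (Suc (Suc 0)) W U" using W(2) by (simp add: numeral_2_eq_2)
  have Cb: "C_k_on (Suc 0) W (partial_deriv b U)" if "b \<in> Basis" for b
    using C that by simp
  have mem: "y + s *\<^sub>R z \<in> W" if "norm z \<le> 1" for z
    using affine_mem_cball[OF that order_refl] W(3) by blast
  define P where "P b z = s * (1 - z \<bullet> z) ^ Suc k" for b z :: 'a
  define G where "G b z = (s * (1 - z \<bullet> z) ^ Suc k) *\<^sub>R grad (partial_deriv b U) (y + s *\<^sub>R z)
      - (2 * Suc k * (1 - z \<bullet> z) ^ k * partial_deriv b U (y + s *\<^sub>R z)) *\<^sub>R z" for b z :: 'a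
  have cg: "continuous_on (cball 0 1) (\<lambda>z. grad U (y + s *\<^sub>R z))"
    by (rule continuous_on_compose2[OF C_k_on_Suc_continuous_on_grad[OF C]])
      (auto intro!: continuous_intros mem)
  have cgb: "continuous_on (cball 0 1) (\<lambda>z. grad (partial_deriv b U) (y + s *\<^sub>R z))" if "b \<in> Basis" for b
    by (rule continuous_on_compose2[OF C_k_on_Suc_continuous_on_grad[OF Cb[OF that]]])
      (auto intro!: continuous_intros mem)
  have cb: "continuous_on (cball 0 1) (\<lambda>z. partial_deriv b U (y + s *\<^sub>R z))" if "b \<in> Basis" for b
    by (rule continuous_on_compose2[OF C_k_on_imp_continuous_on[OF Cb[OF that]]])
      (auto intro!: continuous_intros mem)
  have Gc: "continuous_on (cball 0 1) (G b)" if "b \<in> Basis" for b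
    unfolding G_def by (intro continuous_intros cgb cb that)
  have zero: "(\<integral>z. indicator (ball 0 1) z * (G b z \<bullet> b) \<partial>lborel) = 0" if b: "b \<in> Basis" for b
  proof -
    obtain L where L: "\<And>z. z \<in> cball 0 1 \<Longrightarrow> norm (G b z) \<le> L"
      using continuous_on_cball_norm_bound[OF Gc[OF b]] by blast
    show ?thesis
    proof (rule integral_directional_derivative_ball[where X = "\<lambda>z. partial_deriv b U (y + s *\<^sub>R z) * (1 - z \<bullet> z) ^ Suc k" and L = L])
      show "continuous_on (cball 0 1) (\<lambda>z. partial_deriv b U (y + s *\<^sub>R z) * (1 - z \<bullet> z) ^ Suc k)"
        by (intro continuous_intros cb b)
      show "continuous_on (ball 0 1) (G b)" using Gc[OF b] continuous_on_subset by fastforce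
      fix z :: 'a
      show "norm (G b z) \<le> L" if "norm z < 1" using L that by simp
      show "partial_deriv b U (y + s *\<^sub>R z) * (1 - z \<bullet> z) ^ Suc k = 0" if "norm z = 1"
        using that by (simp add: dot_square_norm)
      show "((\<lambda>z. partial_deriv b U (y + s *\<^sub>R z) * (1 - z \<bullet> z) ^ Suc k) has_derivative (\<lambda>v. G b z \<bullet> v)) (at z)"
        if z: "norm z < 1"
      proof -
        have 1: "((\<lambda>z. y + s *\<^sub>R z) has_derivative (\<lambda>v. s *\<^sub>R v)) (at z)"
          by (auto intro!: derivative_eq_intros)
        have 2: "(partial_deriv b U has_derivative (\<lambda>v. grad (partial_deriv b U) (y + s *\<^sub>R z) \<bullet> v)) (at (y + s *\<^sub>R z))"
          by (rule C_k_on_Suc_has_derivative[OF Cb[OF b] mem]) (use z in simp)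
        have 3: "((\<lambda>z. partial_deriv b U (y + s *\<^sub>R z)) has_derivative (\<lambda>v. grad (partial_deriv b U) (y + s *\<^sub>R z) \<bullet> (s *\<^sub>R v))) (at z)"
          by (rule has_derivative_compose[OF 1 2])
        have 4: "((\<lambda>z. (1 - z \<bullet> z) ^ Suc k) has_derivative (\<lambda>v. Suc k * (- (z \<bullet> v + v \<bullet> z)) * (1 - z \<bullet> z) ^ k)) (at z)"
          by (rule has_derivative_eq_rhs[OF has_derivative_power[OF has_derivative_diff[OF has_derivative_const has_derivative_inner[OF has_derivative_ident has_derivative_ident]]]])
            (simp add: fun_eq_iff)
        show ?thesis
          by (rule has_derivative_eq_rhs[OF has_derivative_mult[OF 3 4]])
            (simp add: G_def fun_eq_iff inner_diff_left algebra_simps inner_commute)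
      qed
    qed
  qed
  have iA: "integrable lborel (\<lambda>z. indicator (ball 0 1) z * (laplacian U (y + s *\<^sub>R z) * (1 - z \<bullet> z) ^ Suc k))"
  proof (rule integrable_ball_continuous, intro continuous_intros)
    have "continuous_on (cball 0 1) (\<lambda>z. \<Sum>b\<in>Basis. grad (partial_deriv b U) (y + s *\<^sub>R z) \<bullet> b)"
      by (intro continuous_intros cgb)
    then show "continuous_on (cball 0 1) (\<lambda>z. laplacian U (y + s *\<^sub>R z))"
      by (simp add: laplacian_def grad_inner_Basis)
  qed
  have iB: "integrable lborel (\<lambda>z. indicator (ball 0 1) z * ((grad U (y + s *\<^sub>R z) \<bullet> z) * (1 - z \<bullet> z) ^ k))"
    by (intro integrable_ball_continuous continuous_intros cg)
  have "0 = (\<Sum>b\<in>Basis. \<integral>z. indicator (ball 0 1) z * (G b z \<bullet> b) \<partial>lborel)" by (simp add: zero)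
  also have "\<dots> = (\<integral>z. (\<Sum>b\<in>Basis. indicator (ball 0 1) z * (G b z \<bullet> b)) \<partial>lborel)"
    by (rule Bochner_Integration.integral_sum[symmetric])
      (intro integrable_ball_continuous continuous_intros Gc, auto)
  also have "\<dots> = (\<integral>z. s * (indicator (ball 0 1) z * (laplacian U (y + s *\<^sub>R z) * (1 - z \<bullet> z) ^ Suc k))
      - 2 * Suc k * (indicator (ball 0 1) z * ((grad U (y + s *\<^sub>R z) \<bullet> z) * (1 - z \<bullet> z) ^ k)) \<partial>lborel)"
  proof (rule Bochner_Integration.integral_cong[OF refl])
    fix z :: 'a
    have "(\<Sum>b\<in>Basis. G b z \<bullet> b) = s * (1 - z \<bullet> z) ^ Suc k * laplacian U (y + s *\<^sub>R z)
        - 2 * Suc k * (1 - z \<bullet> z) ^ k * (\<Sum>b\<in>Basis. partial_deriv b U (y + s *\<^sub>R z) * (z \<bullet> b))"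
      by (simp add: G_def inner_diff_left sum_subtractf laplacian_def grad_inner_Basis sum_distrib_left mult_ac)
    also have "(\<Sum>b\<in>Basis. partial_deriv b U (y + s *\<^sub>R z) * (z \<bullet> b)) = grad U (y + s *\<^sub>R z) \<bullet> z"
      by (subst euclidean_inner[of "grad U (y + s *\<^sub>R z)"]) (simp add: grad_inner_Basis)
    finally show "(\<Sum>b\<in>Basis. indicator (ball 0 1) z * (G b z \<bullet> b)) =
      s * (indicator (ball 0 1) z * (laplacian U (y + s *\<^sub>R z) * (1 - z \<bullet> z) ^ Suc k))
      - 2 * Suc k * (indicator (ball 0 1) z * ((grad U (y + s *\<^sub>R z) \<bullet> z) * (1 - z \<bullet> z) ^ k))"
      unfolding sum_distrib_left[symmetric] by (cases "z \<in> ball 0 1") (auto simp: mult_ac)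
  qed
  also have "\<dots> = s * (\<integral>z. indicator (ball 0 1) z * (laplacian U (y + s *\<^sub>R z) * (1 - z \<bullet> z) ^ Suc k) \<partial>lborel)
    - 2 * Suc k * (\<integral>z. indicator (ball 0 1) z * ((grad U (y + s *\<^sub>R z) \<bullet> z) * (1 - z \<bullet> z) ^ k) \<partial>lborel)"
    by (subst Bochner_Integration.integral_diff) (use iA iB in \<open>auto simp del: of_nat_Suc\<close>)
  finally show ?thesis by simp
qed

text \<open>After rescaling to the unit ball the domain of integration is fixed, so the radius is
  differentiated through the integrand only.\<close>

lemma radial_integral_has_derivative:
  fixes U :: "'a::euclidean_space \<Rightarrow> real"
  assumes W: "open W" "C_k_on 1 W U" "cball y r \<subseteq> W" "\<bar>s\<bar> < r"
    and w: "continuous_on (cball 0 1) w"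
  shows "((\<lambda>s. \<integral>z. indicator (ball 0 1) z * (U (y + s *\<^sub>R z) * w z) \<partial>lborel) has_real_derivative
     (\<integral>z. indicator (ball 0 1) z * ((grad U (y + s *\<^sub>R z) \<bullet> z) * w z) \<partial>lborel)) (at s)"
proof -
  have C: "C_k_on (Suc 0) W U" using W(2) by simp
  have mem: "y + t *\<^sub>R z \<in> cball y r" if "norm z \<le> 1" "\<bar>t\<bar> < r" for z t
    using affine_mem_cball[OF that(1), of t r y] that by auto
  have gc: "continuous_on W (grad U)" by (rule C_k_on_Suc_continuous_on_grad[OF C])
  have Uc: "continuous_on W U" by (rule C_k_on_imp_continuous_on[OF C])
  have cg: "continuous_on (cball 0 1) (\<lambda>z. grad U (y + t *\<^sub>R z))" if "\<bar>t\<bar> < r" for t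
    by (rule continuous_on_compose2[OF gc]) (use that mem W(3) in \<open>auto intro!: continuous_intros\<close>)
  have cU: "continuous_on (cball 0 1) (\<lambda>z. U (y + t *\<^sub>R z))" if "\<bar>t\<bar> < r" for t
    by (rule continuous_on_compose2[OF Uc]) (use that mem W(3) in \<open>auto intro!: continuous_intros\<close>)
  obtain L where L0: "L \<ge> 0" and L: "\<And>x. x \<in> cball y r \<Longrightarrow> norm (grad U x) \<le> L"
    using continuous_on_cball_norm_bound[OF continuous_on_subset[OF gc W(3)]] by blast
  obtain K where K0: "K \<ge> 0" and K': "\<And>x. x \<in> cball 0 1 \<Longrightarrow> norm (w x) \<le> K"
    using continuous_on_cball_norm_bound[OF w] by blast
  have K: "\<bar>w x\<bar> \<le> K" if "norm x \<le> 1" for x using K'[of x] that by simp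
  have Ulip: "\<bar>U a - U b\<bar> \<le> L * norm (a - b)" if "a \<in> cball y r" "b \<in> cball y r" for a b
  proof -
    have "norm (U a - U b) \<le> L * norm (a - b)"
    proof (rule differentiable_bound[of "cball y r"])
      show "(U has_derivative (\<lambda>v. grad U x \<bullet> v)) (at x within cball y r)" if "x \<in> cball y r" for x
        using C_k_on_Suc_has_derivative[OF C] that W(3) has_derivative_at_withinI by blast
      show "onorm (\<lambda>v. grad U x \<bullet> v) \<le> L" if "x \<in> cball y r" for x
      proof (rule onorm_bound[OF L0])
        show "norm (grad U x \<bullet> v) \<le> L * norm v" for v
          using L[OF that] Cauchy_Schwarz_ineq2[of "grad U x" v] mult_right_mono[of "norm (grad U x)" L "norm v"] by auto
      qed
    qed (use that in auto)
    then show ?thesis by simp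
  qed
  have "((\<lambda>t. \<integral>z. indicator (ball 0 1) z * (U (y + t *\<^sub>R z) * w z) \<partial>lborel) has_derivative
     (\<lambda>v. (\<integral>z. indicator (ball 0 1) z * ((grad U (y + s *\<^sub>R z) \<bullet> z) * w z) \<partial>lborel) \<bullet> v)) (at s)"
  proof (rule has_derivative_integral_parameter(2)[of "{-r<..<r}" _ _ _ _ "\<lambda>z. indicator (ball 0 1) z * (L * K)"])
    show "integrable lborel (\<lambda>z. indicator (ball 0 1) z * (U (y + x *\<^sub>R z) * w z))" if "x \<in> {-r<..<r}" for x
      using that by (intro integrable_ball_continuous continuous_intros cU w) auto
    show "(\<lambda>z. indicator (ball 0 1) z * ((grad U (y + s *\<^sub>R z) \<bullet> z) * w z)) \<in> borel_measurable lborel"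
      by (rule borel_measurable_integrable) (intro integrable_ball_continuous continuous_intros cg w W(4))
    show "integrable lborel (\<lambda>z. indicator (ball (0::'a) 1) z * (L * K))"
      by (intro integrable_ball_continuous continuous_intros)
    show "AE z in lborel. ((\<lambda>t. indicator (ball 0 1) z * (U (y + t *\<^sub>R z) * w z)) has_derivative
        (\<bullet>) (indicator (ball 0 1) z * ((grad U (y + s *\<^sub>R z) \<bullet> z) * w z))) (at s)"
    proof (rule AE_I2)
      fix z :: 'a
      show "((\<lambda>t. indicator (ball 0 1) z * (U (y + t *\<^sub>R z) * w z)) has_derivative
        (\<bullet>) (indicator (ball 0 1) z * ((grad U (y + s *\<^sub>R z) \<bullet> z) * w z))) (at s)"
      proof (cases "norm z < 1")
        case True
        have 1: "((\<lambda>t. y + t *\<^sub>R z) has_derivative (\<lambda>v. v *\<^sub>R z)) (at s)"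
          by (auto intro!: derivative_eq_intros)
        have 2: "(U has_derivative (\<lambda>v. grad U (y + s *\<^sub>R z) \<bullet> v)) (at (y + s *\<^sub>R z))"
          by (rule C_k_on_Suc_has_derivative[OF C]) (use mem[of z s] True W in auto)
        show ?thesis
          by (rule has_derivative_eq_rhs[OF has_derivative_mult_right[OF has_derivative_mult_left[OF has_derivative_compose[OF 1 2]]]])
            (auto simp: fun_eq_iff)
      next
        case False
        moreover have "(*) (0::real) = (\<lambda>x. 0)" by auto
        ultimately show ?thesis by simp
      qed
    qed
    show "AE z in lborel. \<bar>indicator (ball 0 1) z * (U (y + x *\<^sub>R z) * w z) - indicator (ball 0 1) z * (U (y + s *\<^sub>R z) * w z)\<bar>
        \<le> indicator (ball 0 1) z * (L * K) * norm (x - s)" if x: "x \<in> {-r<..<r}" for x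
    proof (rule AE_I2)
      fix z :: 'a
      show "\<bar>indicator (ball 0 1) z * (U (y + x *\<^sub>R z) * w z) - indicator (ball 0 1) z * (U (y + s *\<^sub>R z) * w z)\<bar>
        \<le> indicator (ball 0 1) z * (L * K) * norm (x - s)"
      proof (cases "norm z < 1")
        case True
        have "\<bar>U (y + x *\<^sub>R z) - U (y + s *\<^sub>R z)\<bar> \<le> L * norm ((y + x *\<^sub>R z) - (y + s *\<^sub>R z))"
          by (rule Ulip) (use mem[of z] True W(4) x in auto)
        also have "(y + x *\<^sub>R z) - (y + s *\<^sub>R z) = (x - s) *\<^sub>R z" by (simp add: algebra_simps)
        also have "L * norm ((x - s) *\<^sub>R z) \<le> L * norm (x - s)"
          using True L0 by (intro mult_left_mono) (auto intro!: mult_left_le)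
        finally have "\<bar>U (y + x *\<^sub>R z) - U (y + s *\<^sub>R z)\<bar> * \<bar>w z\<bar> \<le> (L * norm (x - s)) * K"
          using K[of z] True L0 by (intro mult_mono) auto
        then show ?thesis using True by (simp add: abs_mult[symmetric] right_diff_distrib mult_ac)
      qed auto
    qed
    show "AE z in lborel. norm (indicator (ball 0 1) z * ((grad U (y + s *\<^sub>R z) \<bullet> z) * w z)) \<le> indicator (ball 0 1) z * (L * K)"
    proof (rule AE_I2)
      fix z :: 'a
      show "norm (indicator (ball 0 1) z * ((grad U (y + s *\<^sub>R z) \<bullet> z) * w z)) \<le> indicator (ball 0 1) z * (L * K)"
      proof (cases "norm z < 1")
        case True
        have "\<bar>grad U (y + s *\<^sub>R z) \<bullet> z\<bar> \<le> norm (grad U (y + s *\<^sub>R z)) * norm z" by (rule Cauchy_Schwarz_ineq2)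
        also have "\<dots> \<le> L * 1" using L[OF mem[of z s]] True W(4) L0 by (intro mult_mono) auto
        finally have "\<bar>grad U (y + s *\<^sub>R z) \<bullet> z\<bar> * \<bar>w z\<bar> \<le> L * K"
          using K[of z] True L0 by (intro mult_mono) auto
        then show ?thesis using True by (simp add: abs_mult)
      qed auto
    qed
  qed (use W(4) in auto)
  then show ?thesis unfolding has_field_derivative_def by (simp add: inner_real_def mult.commute[of _ "integral\<^sup>L lborel _"])
qed

section \<open>Harmonic functions and a weighted mean value property\<close>

definition mv_const :: "'a::euclidean_space itself \<Rightarrow> real" where
  "mv_const _ = (\<integral>z. indicator (ball 0 1) z * (1 - z \<bullet> z) ^ 3 \<partial>(lborel :: 'a measure))"

text \<open>Averaging against \<open>(1 - |z|\<^sup>2)\<^sup>3\<close> instead of a characteristic function lets the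
  averaging kernel be differentiated; so the property, which implies smoothness, is inherited
  by partial derivatives, and interior gradient bounds come with it.\<close>

definition mv_on :: "'a::euclidean_space set \<Rightarrow> ('a \<Rightarrow> real) \<Rightarrow> bool" where
  "mv_on W U \<longleftrightarrow> open W \<and> continuous_on W U \<and>
     (\<forall>x \<rho>. 0 < \<rho> \<longrightarrow> cball x \<rho> \<subseteq> W \<longrightarrow>
        (\<integral>z. indicator (ball 0 1) z * (U (x + \<rho> *\<^sub>R z) * (1 - z \<bullet> z) ^ 3) \<partial>lborel) = mv_const TYPE('a) * U x)"

lemma mv_const_pos: "mv_const TYPE('a::euclidean_space) > 0"
proof -
  let ?f = "\<lambda>z::'a. indicator (ball 0 1) z * (1 - z \<bullet> z) ^ 3"
  have i: "integrable lborel ?f" by (intro integrable_ball_continuous continuous_intros)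
  have "measure lborel (ball (0::'a) (1/2)) * (27/64) = (\<integral>z. indicator (ball 0 (1/2)) z * (27/64) \<partial>(lborel :: 'a measure))"
    by simp
  also have "\<dots> \<le> (\<integral>z. ?f z \<partial>lborel)"
  proof (rule integral_mono[OF _ i])
    show "integrable lborel (\<lambda>z::'a. indicator (ball 0 (1/2)) z * (27/64 :: real))"
      by (intro integrable_ball_continuous continuous_intros)
    fix z :: 'a
    show "indicator (ball 0 (1/2)) z * (27/64) \<le> ?f z"
    proof (cases "norm z < 1/2")
      case True
      have "z \<bullet> z \<le> (1/2)^2" unfolding dot_square_norm using True by (intro power_mono) auto
      then have "(3/4)^3 \<le> (1 - z \<bullet> z)^3" by (intro power_mono) (auto simp: power2_eq_square)
      then show ?thesis using True by (simp add: power_divide)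
    next
      case False
      then show ?thesis using one_minus_inner_nonneg[of z] by (auto simp: indicator_def)
    qed
  qed
  finally have "measure lborel (ball (0::'a) (1/2)) * (27/64) \<le> mv_const TYPE('a)" by (simp add: mv_const_def)
  moreover have "measure lborel (ball (0::'a) (1/2)) > 0" by (simp add: content_ball_pos)
  ultimately show ?thesis by (smt (verit) divide_pos_pos mult_pos_pos)
qed

text \<open>By the integration by parts with \<open>k = 3\<close>, the derivative of the weighted
  mean in the radius is a multiple of a weighted integral of the Laplacian, hence zero. The constant
  value is read off at radius 0.\<close>

lemma harmonic_imp_mv_on:
  fixes U :: "'a::euclidean_space \<Rightarrow> real"
  assumes W: "open W" "C_k_on 2 W U" and h: "\<And>x. x \<in> W \<Longrightarrow> laplacian U x = 0"
  shows "mv_on W U"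
proof -
  have C1: "C_k_on 1 W U" using W(2) C_k_on_lower[of 1 W U] by (simp add: numeral_2_eq_2)
  have "(\<integral>z. indicator (ball 0 1) z * (U (x + \<rho> *\<^sub>R z) * (1 - z \<bullet> z) ^ 3) \<partial>lborel) = mv_const TYPE('a) * U x"
    if r: "0 < \<rho>" "cball x \<rho> \<subseteq> W" for x \<rho>
  proof -
    obtain r where r': "r > \<rho>" "cball x r \<subseteq> W"
      using cball_subset_open_enlarge[OF W(1) r(2)] r(1) by auto
    define \<psi> where "\<psi> s = (\<integral>z. indicator (ball 0 1) z * (U (x + s *\<^sub>R z) * (1 - z \<bullet> z) ^ 3) \<partial>lborel)" for s
    have d: "(\<psi> has_real_derivative 0) (at s)" if "\<bar>s\<bar> < r" for s
    proof -
      have mem: "x + s *\<^sub>R z \<in> W" if "norm z \<le> 1" for z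
        using affine_mem_cball[OF that, of s r x] \<open>\<bar>s\<bar> < r\<close> r'(2) by auto
      have "cball x \<bar>s\<bar> \<subseteq> W" using that r'(2) by (auto simp: subset_iff)
      from laplacian_weight_by_parts[OF W this, of 3]
      have "2 * 4 * (\<integral>z. indicator (ball 0 1) z * ((grad U (x + s *\<^sub>R z) \<bullet> z) * (1 - z \<bullet> z) ^ 3) \<partial>lborel)
        = s * (\<integral>z. indicator (ball 0 1) z * (laplacian U (x + s *\<^sub>R z) * (1 - z \<bullet> z) ^ Suc 3) \<partial>lborel)" by simp
      also have "(\<lambda>z. indicator (ball 0 1) z * (laplacian U (x + s *\<^sub>R z) * (1 - z \<bullet> z) ^ Suc 3)) = (\<lambda>z. 0)"
        using h mem by (auto simp: fun_eq_iff indicator_def)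
      finally have "(\<integral>z. indicator (ball 0 1) z * ((grad U (x + s *\<^sub>R z) \<bullet> z) * (1 - z \<bullet> z) ^ 3) \<partial>lborel) = 0" by simp
      moreover have "(\<psi> has_real_derivative
         (\<integral>z. indicator (ball 0 1) z * ((grad U (x + s *\<^sub>R z) \<bullet> z) * (1 - z \<bullet> z) ^ 3) \<partial>lborel)) (at s)"
        unfolding \<psi>_def
        by (rule radial_integral_has_derivative[OF W(1) C1 r'(2) that]) (intro continuous_intros)
      ultimately show ?thesis by simp
    qed
    have "\<exists>c. \<forall>s\<in>{-r<..<r}. \<psi> s = c"
      by (rule has_field_derivative_zero_constant) (use d in \<open>auto intro: has_field_derivative_at_within\<close>)
    then have "\<psi> \<rho> = \<psi> 0" using r r' by auto
    also have "\<psi> 0 = mv_const TYPE('a) * U x"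
    proof -
      have "\<psi> 0 = (\<integral>z. (indicator (ball (0::'a) 1) z * (1 - z \<bullet> z) ^ 3) * U x \<partial>lborel)"
        by (simp add: \<psi>_def mult_ac)
      also have "\<dots> = mv_const TYPE('a) * U x" by (simp add: mv_const_def)
      finally show ?thesis .
    qed
    finally show ?thesis by (simp add: \<psi>_def)
  qed
  then show ?thesis using W C_k_on_imp_continuous_on[OF W(2)] by (auto simp: mv_on_def)
qed

section \<open>Kernel representation, smoothness and interior gradient bounds\<close>

lemma has_derivative_pos_part_power:
  fixes f :: "'a::euclidean_space \<Rightarrow> real"
  assumes "(f has_derivative D) (at x)"
  shows "((\<lambda>x. (max 0 (f x)) ^ Suc (Suc k)) has_derivative (\<lambda>v. Suc (Suc k) * (max 0 (f x)) ^ Suc k * D v)) (at x)"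
proof -
  have "((\<lambda>t::real. (max 0 t) ^ Suc (Suc k)) has_real_derivative Suc (Suc k) * (max 0 t) ^ Suc k) (at t)" for t :: real
  proof -
    consider "t > 0" | "t < 0" | "t = 0" by linarith
    then show ?thesis
    proof cases
      case 1
      have "((\<lambda>t. t ^ Suc (Suc k)) has_real_derivative Suc (Suc k) * (max 0 t) ^ Suc k) (at t)"
        using 1 DERIV_power[OF DERIV_ident, of "Suc (Suc k)" t] by (simp add: max_def)
      then show ?thesis
        by (rule has_field_derivative_transform_within_open[of _ _ _ "{0<..}"]) (use 1 in auto)
    next
      case 2
      have "((\<lambda>t. 0::real) has_real_derivative Suc (Suc k) * (max 0 t) ^ Suc k) (at t)"
        using 2 by simp
      then show ?thesis
        by (rule has_field_derivative_transform_within_open[of _ _ _ "{..<0}"]) (use 2 in auto)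
    next
      \<comment> \<open>At the kink the difference quotient is itself the positive part to the power
        \<open>Suc k\<close> and tends to 0; here the exponent has to be at least 2.\<close>
      case 3
      have "((\<lambda>y::real. (max 0 y) ^ Suc k) \<longlongrightarrow> (max 0 0) ^ Suc k) (at 0)" by (intro tendsto_intros)
      then have "((\<lambda>y::real. (max 0 y) ^ Suc k) \<longlongrightarrow> 0) (at 0)" by simp
      moreover have "\<forall>\<^sub>F y in at (0::real). (max 0 y) ^ Suc k = ((max 0 y) ^ Suc (Suc k) - (max 0 0) ^ Suc (Suc k)) / (y - 0)"
        unfolding eventually_at_filter by (intro always_eventually) (auto simp: max_def)
      ultimately have "((\<lambda>y::real. ((max 0 y) ^ Suc (Suc k) - (max 0 0) ^ Suc (Suc k)) / (y - 0)) \<longlongrightarrow> 0) (at 0)"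
        by (rule Lim_transform_eventually)
      then show ?thesis unfolding has_field_derivative_iff using 3 by simp
    qed
  qed
  from has_derivative_compose[OF assms this[unfolded has_field_derivative_def]] show ?thesis by simp
qed

lemma gradient_bound_lipschitz:
  fixes f :: "'a::euclidean_space \<Rightarrow> real"
  assumes "convex S" "\<And>x. x \<in> S \<Longrightarrow> (f has_derivative (\<lambda>v. G x \<bullet> v)) (at x within S)"
    and "\<And>x. x \<in> S \<Longrightarrow> norm (G x) \<le> L" "x \<in> S" "y \<in> S"
  shows "\<bar>f x - f y\<bar> \<le> L * norm (x - y)"
proof -
  have L0: "L \<ge> 0" using order_trans[OF norm_ge_zero assms(3)[OF assms(4)]] .
  have "norm (f x - f y) \<le> L * norm (x - y)"
  proof (rule differentiable_bound[OF assms(1,2)])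
    show "onorm (\<lambda>v. G z \<bullet> v) \<le> L" if "z \<in> S" for z
    proof (rule onorm_bound[OF L0])
      show "norm (G z \<bullet> v) \<le> L * norm v" for v
        using order_trans[OF Cauchy_Schwarz_ineq2 mult_right_mono[OF assms(3)[OF that] norm_ge_zero]] by simp
    qed
  qed (use assms in auto)
  then show ?thesis by simp
qed

text \<open>The parameter occurs in the kernel alone, so continuity of \<open>U\<close> is enough to
  differentiate the integral; the derivative brings down a factor
  \<open>- 1 / \<rho>\<close>.\<close>

lemma kernel_integral_has_derivative:
  fixes \<kappa> :: "'a::euclidean_space \<Rightarrow> real" and \<gamma> :: "'a \<Rightarrow> 'a"
  assumes U: "continuous_on (cball a R) U"
    and d: "\<And>z. (\<kappa> has_derivative (\<lambda>v. \<gamma> z \<bullet> v)) (at z)"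
    and c: "continuous_on UNIV \<gamma>" and L: "\<And>z. norm (\<gamma> z) \<le> L" and \<rho>: "\<rho> > 0"
  shows "((\<lambda>x. \<integral>w. indicator (ball a R) w * (U w * \<kappa> ((w - x) /\<^sub>R \<rho>)) \<partial>lborel) has_derivative
    (\<lambda>v. (\<integral>w. indicator (ball a R) w *\<^sub>R (- (U w / \<rho>) *\<^sub>R \<gamma> ((w - x) /\<^sub>R \<rho>)) \<partial>lborel) \<bullet> v)) (at x)"
proof -
  obtain K where K0: "K \<ge> 0" and K: "\<And>x. x \<in> cball a R \<Longrightarrow> norm (U x) \<le> K"
    using continuous_on_cball_norm_bound[OF U] by blast
  have L0: "L \<ge> 0" using order_trans[OF norm_ge_zero L] .
  have \<kappa>c: "continuous_on UNIV \<kappa>"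
    using d by (intro continuous_at_imp_continuous_on ballI) (auto intro: has_derivative_continuous)
  have lip: "\<bar>\<kappa> z - \<kappa> z'\<bar> \<le> L * norm (z - z')" for z z'
    by (rule gradient_bound_lipschitz[of UNIV _ \<gamma>]) (use d L in auto)
  have ints: "integrable lborel (\<lambda>w. indicator (ball a R) w * (K * (L / \<rho>)))"
    by (intro integrable_ball_continuous continuous_intros)
  show ?thesis
  proof (rule has_derivative_integral_parameter(2)[of UNIV _ _ _ _ "\<lambda>w. indicator (ball a R) w * (K * (L / \<rho>))"])
    show "integrable lborel (\<lambda>w. indicator (ball a R) w * (U w * \<kappa> ((w - x) /\<^sub>R \<rho>)))" for x
      by (intro integrable_ball_continuous continuous_intros U continuous_on_compose2[OF \<kappa>c]) auto
    have "continuous_on (ball a R) (\<lambda>w. - (U w / \<rho>) *\<^sub>R \<gamma> ((w - x) /\<^sub>R \<rho>))"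
      using \<rho> by (intro continuous_intros continuous_on_subset[OF U] continuous_on_compose2[OF c]) auto
    then show "(\<lambda>w. indicator (ball a R) w *\<^sub>R (- (U w / \<rho>) *\<^sub>R \<gamma> ((w - x) /\<^sub>R \<rho>))) \<in> borel_measurable lborel"
      unfolding measurable_lborel2 by (intro borel_measurable_continuous_on_indicator) auto
    show "AE w in lborel. ((\<lambda>x. indicator (ball a R) w * (U w * \<kappa> ((w - x) /\<^sub>R \<rho>))) has_derivative
        (\<bullet>) (indicator (ball a R) w *\<^sub>R (- (U w / \<rho>) *\<^sub>R \<gamma> ((w - x) /\<^sub>R \<rho>)))) (at x)"
    proof (rule AE_I2)
      fix w
      have 1: "((\<lambda>x. (w - x) /\<^sub>R \<rho>) has_derivative (\<lambda>v. (- v) /\<^sub>R \<rho>)) (at x)"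
        by (auto intro!: derivative_eq_intros)
      show "((\<lambda>x. indicator (ball a R) w * (U w * \<kappa> ((w - x) /\<^sub>R \<rho>))) has_derivative
        (\<bullet>) (indicator (ball a R) w *\<^sub>R (- (U w / \<rho>) *\<^sub>R \<gamma> ((w - x) /\<^sub>R \<rho>)))) (at x)"
        by (rule has_derivative_eq_rhs[OF has_derivative_mult_right[OF has_derivative_mult_right[OF has_derivative_compose[OF 1 d]]]])
          (simp add: fun_eq_iff divide_inverse)
    qed
    show "AE w in lborel. \<bar>indicator (ball a R) w * (U w * \<kappa> ((w - x') /\<^sub>R \<rho>)) - indicator (ball a R) w * (U w * \<kappa> ((w - x) /\<^sub>R \<rho>))\<bar>
      \<le> indicator (ball a R) w * (K * (L / \<rho>)) * norm (x' - x)" for x'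
    proof (rule AE_I2)
      fix w
      show "\<bar>indicator (ball a R) w * (U w * \<kappa> ((w - x') /\<^sub>R \<rho>)) - indicator (ball a R) w * (U w * \<kappa> ((w - x) /\<^sub>R \<rho>))\<bar>
      \<le> indicator (ball a R) w * (K * (L / \<rho>)) * norm (x' - x)"
      proof (cases "w \<in> ball a R")
        case True
        have "\<bar>\<kappa> ((w - x') /\<^sub>R \<rho>) - \<kappa> ((w - x) /\<^sub>R \<rho>)\<bar> \<le> L * norm ((w - x') /\<^sub>R \<rho> - (w - x) /\<^sub>R \<rho>)" by (rule lip)
        also have "(w - x') /\<^sub>R \<rho> - (w - x) /\<^sub>R \<rho> = (x - x') /\<^sub>R \<rho>" by (simp add: algebra_simps)
        also have "L * norm ((x - x') /\<^sub>R \<rho>) = L / \<rho> * norm (x' - x)"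
          using \<rho> by (simp add: norm_minus_commute divide_inverse)
        finally have "\<bar>U w\<bar> * \<bar>\<kappa> ((w - x') /\<^sub>R \<rho>) - \<kappa> ((w - x) /\<^sub>R \<rho>)\<bar> \<le> K * (L / \<rho> * norm (x' - x))"
          using K[of w] True K0 L0 \<rho> by (intro mult_mono) auto
        then show ?thesis using True by (simp add: abs_mult[symmetric] right_diff_distrib)
      qed auto
    qed
    show "AE w in lborel. norm (indicator (ball a R) w *\<^sub>R (- (U w / \<rho>) *\<^sub>R \<gamma> ((w - x) /\<^sub>R \<rho>))) \<le> indicator (ball a R) w * (K * (L / \<rho>))"
    proof (rule AE_I2)
      fix w
      show "norm (indicator (ball a R) w *\<^sub>R (- (U w / \<rho>) *\<^sub>R \<gamma> ((w - x) /\<^sub>R \<rho>))) \<le> indicator (ball a R) w * (K * (L / \<rho>))"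
      proof (cases "w \<in> ball a R")
        case True
        have "\<bar>U w\<bar> * (norm (\<gamma> ((w - x) /\<^sub>R \<rho>)) / \<rho>) \<le> K * (L / \<rho>)"
          using K[of w] True K0 L0 \<rho> L by (intro mult_mono divide_right_mono) auto
        then show ?thesis using True \<rho> by (simp add: abs_mult divide_inverse mult_ac)
      qed auto
    qed
  qed (use ints in auto)
qed

text \<open>The substitution \<open>w = x + \<rho> *\<^sub>R z\<close> moves \<open>x\<close> out of
  the argument of \<open>U\<close> and into the kernel, over a domain common to all \<open>x\<close>
  near \<open>a\<close>. The positive part cuts the kernel off outside the ball of radius
  \<open>\<rho>\<close> around \<open>x\<close>.\<close>

lemma mv_on_kernel_formula:
  fixes U :: "'a::euclidean_space \<Rightarrow> real"
  assumes mv: "mv_on W U" and \<rho>: "0 < \<rho>" "\<rho> < R" "cball a R \<subseteq> W" and x: "x \<in> ball a (R - \<rho>)"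
  shows "U x = (\<integral>w. indicator (ball a R) w * (U w * (max 0 (1 - ((w - x) /\<^sub>R \<rho>) \<bullet> ((w - x) /\<^sub>R \<rho>))) ^ 3) \<partial>lborel) / (\<rho> ^ DIM('a) * mv_const TYPE('a))"
proof -
  have Uc: "continuous_on (cball a R) U" using mv \<rho>(3) continuous_on_subset by (auto simp: mv_on_def)
  define g where "g w = indicator (ball a R) w * (U w * (max 0 (1 - ((w - x) /\<^sub>R \<rho>) \<bullet> ((w - x) /\<^sub>R \<rho>))) ^ 3)" for w
  have gm: "g \<in> borel_measurable borel"
  proof -
    have "integrable lborel g" unfolding g_def by (intro integrable_ball_continuous continuous_intros Uc)
    then show ?thesis using borel_measurable_integrable by fastforce
  qed
  have sub: "cball x \<rho> \<subseteq> ball a R"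
  proof
    fix y assume "y \<in> cball x \<rho>"
    then show "y \<in> ball a R" using x dist_triangle[of a y x] by auto
  qed
  have eq: "g (x + \<rho> *\<^sub>R z) = indicator (ball 0 1) z * (U (x + \<rho> *\<^sub>R z) * (1 - z \<bullet> z) ^ 3)" for z
  proof (cases "norm z < 1")
    case True
    then have "x + \<rho> *\<^sub>R z \<in> ball a R" using affine_mem_cball[of z \<rho> \<rho> x] sub \<rho> by auto
    then show ?thesis using True \<rho> one_minus_inner_nonneg[of z] by (simp add: g_def max_absorb2)
  next
    case False
    then have "1 \<le> z \<bullet> z" by (simp add: dot_square_norm)
    then show ?thesis using False \<rho> by (simp add: g_def max_absorb1)
  qed
  have "integral\<^sup>L lborel g = \<rho> ^ DIM('a) * (\<integral>z. g (x + \<rho> *\<^sub>R z) \<partial>lborel)"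
    by (rule integral_lborel_scale[OF gm \<rho>(1)])
  also have "(\<integral>z. g (x + \<rho> *\<^sub>R z) \<partial>lborel) = mv_const TYPE('a) * U x"
    using mv \<rho>(1) sub \<rho>(3) unfolding eq mv_on_def by (meson ball_subset_cball order_trans)
  finally have "integral\<^sup>L lborel g = \<rho> ^ DIM('a) * mv_const TYPE('a) * U x" by simp
  then show ?thesis unfolding g_def[symmetric] using \<rho> mv_const_pos[where 'a='a] by simp
qed

text \<open>This is what the exponent 3 is chosen for: the kernel can be differentiated twice, once
  to represent the gradient of \<open>U\<close> and once more to make that gradient
  continuous.\<close>

lemma bump_has_derivative:
  fixes z :: "'a::euclidean_space"
  shows "((\<lambda>z. (max 0 (1 - z \<bullet> z)) ^ 3) has_derivative (\<lambda>v. ((- 6 * (max 0 (1 - z \<bullet> z)) ^ 2) *\<^sub>R z) \<bullet> v)) (at z)"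
    "((\<lambda>z. ((- 6 * (max 0 (1 - z \<bullet> z)) ^ 2) *\<^sub>R z) \<bullet> b) has_derivative
       (\<lambda>v. ((24 * max 0 (1 - z \<bullet> z) * (z \<bullet> b)) *\<^sub>R z - (6 * (max 0 (1 - z \<bullet> z)) ^ 2) *\<^sub>R b) \<bullet> v)) (at z)"
proof -
  have d: "((\<lambda>z. 1 - z \<bullet> z) has_derivative (\<lambda>v. - 2 * (z \<bullet> v))) (at z)"
    by (rule has_derivative_eq_rhs[OF has_derivative_diff[OF has_derivative_const has_derivative_inner[OF has_derivative_ident has_derivative_ident]]])
      (simp add: fun_eq_iff inner_commute)
  have 3: "(3::nat) = Suc (Suc 1)" and 2: "(2::nat) = Suc (Suc 0)" by simp_all
  show "((\<lambda>z. (max 0 (1 - z \<bullet> z)) ^ 3) has_derivative (\<lambda>v. ((- 6 * (max 0 (1 - z \<bullet> z)) ^ 2) *\<^sub>R z) \<bullet> v)) (at z)"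
    unfolding 3 by (rule has_derivative_eq_rhs[OF has_derivative_pos_part_power[OF d]])
      (simp add: fun_eq_iff power2_eq_square)
  have d2: "((\<lambda>z. (max 0 (1 - z \<bullet> z)) ^ 2) has_derivative (\<lambda>v. 2 * (max 0 (1 - z \<bullet> z)) * (- 2 * (z \<bullet> v)))) (at z)"
    unfolding 2 by (rule has_derivative_eq_rhs[OF has_derivative_pos_part_power[OF d]]) (simp add: fun_eq_iff)
  have d3: "((\<lambda>z. z \<bullet> b) has_derivative (\<lambda>v. v \<bullet> b)) (at z)" by (auto intro!: derivative_eq_intros)
  have e: "(\<lambda>z. ((- 6 * (max 0 (1 - z \<bullet> z)) ^ 2) *\<^sub>R z) \<bullet> b) = (\<lambda>z. - 6 * ((max 0 (1 - z \<bullet> z)) ^ 2 * (z \<bullet> b)))"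
    by (simp add: fun_eq_iff)
  show "((\<lambda>z. ((- 6 * (max 0 (1 - z \<bullet> z)) ^ 2) *\<^sub>R z) \<bullet> b) has_derivative
       (\<lambda>v. ((24 * max 0 (1 - z \<bullet> z) * (z \<bullet> b)) *\<^sub>R z - (6 * (max 0 (1 - z \<bullet> z)) ^ 2) *\<^sub>R b) \<bullet> v)) (at z)"
    unfolding e by (rule has_derivative_eq_rhs[OF has_derivative_mult_right[OF has_derivative_mult[OF d2 d3]]])
      (simp add: fun_eq_iff inner_diff_left algebra_simps inner_commute)
qed

text \<open>Where the positive part is nonzero, \<open>z\<close> lies in the unit ball; hence 6 in
  the first bound and 24 + 6 in the second.\<close>

lemma bump_bounds:
  fixes z :: "'a::euclidean_space"
  shows "norm ((- 6 * (max 0 (1 - z \<bullet> z)) ^ 2) *\<^sub>R z) \<le> 6"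
    "norm ((24 * max 0 (1 - z \<bullet> z) * (z \<bullet> b)) *\<^sub>R z - (6 * (max 0 (1 - z \<bullet> z)) ^ 2) *\<^sub>R b) \<le> 30 * norm b"
proof -
  have m: "0 \<le> max 0 (1 - z \<bullet> z)" "max 0 (1 - z \<bullet> z) \<le> 1" by auto
  have z1: "norm z \<le> 1" if "max 0 (1 - z \<bullet> z) \<noteq> 0"
  proof (rule ccontr)
    assume "\<not> norm z \<le> 1"
    then have "1 \<le> z \<bullet> z" by (simp add: dot_square_norm)
    then show False using that by simp
  qed
  show "norm ((- 6 * (max 0 (1 - z \<bullet> z)) ^ 2) *\<^sub>R z) \<le> 6"
  proof (cases "max 0 (1 - z \<bullet> z) = 0")
    case False
    have "(max 0 (1 - z \<bullet> z)) ^ 2 * norm z \<le> 1 * 1"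
      using z1[OF False] m by (intro mult_mono power_le_one) auto
    then show ?thesis by simp
  qed (simp only: norm_scaleR, simp)
  show "norm ((24 * max 0 (1 - z \<bullet> z) * (z \<bullet> b)) *\<^sub>R z - (6 * (max 0 (1 - z \<bullet> z)) ^ 2) *\<^sub>R b) \<le> 30 * norm b"
  proof (cases "max 0 (1 - z \<bullet> z) = 0")
    case True
    then show ?thesis unfolding True by simp
  next
    case False
    have zb: "\<bar>z \<bullet> b\<bar> \<le> norm b"
      using Cauchy_Schwarz_ineq2[of z b] mult_right_mono[OF z1[OF False] norm_ge_zero[of b]] by linarith
    have "norm ((24 * max 0 (1 - z \<bullet> z) * (z \<bullet> b)) *\<^sub>R z) = 24 * (max 0 (1 - z \<bullet> z) * (\<bar>z \<bullet> b\<bar> * norm z))"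
      using m by (simp add: abs_mult)
    also have "\<dots> \<le> 24 * (1 * (norm b * 1))"
      using z1[OF False] m zb by (intro mult_left_mono mult_mono) auto
    finally have 1: "norm ((24 * max 0 (1 - z \<bullet> z) * (z \<bullet> b)) *\<^sub>R z) \<le> 24 * norm b" by simp
    have "(max 0 (1 - z \<bullet> z)) ^ 2 * norm b \<le> 1 * norm b"
      using m by (intro mult_right_mono power_le_one) auto
    then have 2: "norm ((6 * (max 0 (1 - z \<bullet> z)) ^ 2) *\<^sub>R b) \<le> 6 * norm b" by simp
    show ?thesis using norm_triangle_ineq4 1 2 by (smt (verit))
  qed
qed

lemma kernel_gradient_integrable:
  fixes U :: "'a::euclidean_space \<Rightarrow> real"
  assumes Uc: "continuous_on (cball a R) U" and \<rho>: "\<rho> > 0"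
  shows "integrable lborel (\<lambda>w. indicator (ball a R) w *\<^sub>R (- (U w / \<rho>) *\<^sub>R
    ((- 6 * (max 0 (1 - ((w - x) /\<^sub>R \<rho>) \<bullet> ((w - x) /\<^sub>R \<rho>))) ^ 2) *\<^sub>R ((w - x) /\<^sub>R \<rho>))))"
    (is "integrable _ ?F")
proof -
  have "integrable lborel (\<lambda>w. indicator (cball a R) w *\<^sub>R (- (U w / \<rho>) *\<^sub>R
    ((- 6 * (max 0 (1 - ((w - x) /\<^sub>R \<rho>) \<bullet> ((w - x) /\<^sub>R \<rho>))) ^ 2) *\<^sub>R ((w - x) /\<^sub>R \<rho>))))"
    by (rule borel_integrable_compact) (use \<rho> in \<open>auto intro!: continuous_intros Uc\<close>)
  moreover have "?F \<in> borel_measurable lborel"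
    unfolding measurable_lborel2
    by (intro borel_measurable_continuous_on_indicator continuous_intros continuous_on_subset[OF Uc]) (use \<rho> in auto)
  ultimately show ?thesis
    by (rule Bochner_Integration.integrable_bound) (auto simp: indicator_def)
qed

text \<open>The kernel is differentiated in place of \<open>U\<close>, which is only known to be
  continuous. The gradient is continuous because each of its components can be differentiated once
  more by the same argument.\<close>

lemma mv_on_grad_formula:
  fixes U :: "'a::euclidean_space \<Rightarrow> real"
  assumes mv: "mv_on W U" and \<rho>: "0 < \<rho>" "\<rho> < R" "cball a R \<subseteq> W" and x: "x \<in> ball a (R - \<rho>)"
  defines "G \<equiv> \<lambda>x. (\<integral>w. indicator (ball a R) w *\<^sub>R (- (U w / \<rho>) *\<^sub>R
      ((- 6 * (max 0 (1 - ((w - x) /\<^sub>R \<rho>) \<bullet> ((w - x) /\<^sub>R \<rho>))) ^ 2) *\<^sub>R ((w - x) /\<^sub>R \<rho>))) \<partial>lborel) /\<^sub>R (\<rho> ^ DIM('a) * mv_const TYPE('a))"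
  shows "(U has_derivative (\<lambda>v. G x \<bullet> v)) (at x)" "grad U x = G x" "continuous (at x) (grad U)"
proof -
  let ?c = "\<rho> ^ DIM('a) * mv_const TYPE('a)"
  have Uc: "continuous_on (cball a R) U" using mv \<rho>(3) continuous_on_subset by (auto simp: mv_on_def)
  have gc: "continuous_on UNIV (\<lambda>z::'a. (- 6 * (max 0 (1 - z \<bullet> z)) ^ 2) *\<^sub>R z)" by (intro continuous_intros)
  have d: "(U has_derivative (\<lambda>v. G x \<bullet> v)) (at x)" if x: "x \<in> ball a (R - \<rho>)" for x
  proof -
    have "((\<lambda>x. (\<integral>w. indicator (ball a R) w * (U w * (max 0 (1 - ((w - x) /\<^sub>R \<rho>) \<bullet> ((w - x) /\<^sub>R \<rho>))) ^ 3) \<partial>lborel) / ?c)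
      has_derivative (\<lambda>v. G x \<bullet> v)) (at x)"
      unfolding divide_inverse
      by (rule has_derivative_eq_rhs[OF has_derivative_mult_left[OF kernel_integral_has_derivative[OF Uc bump_has_derivative(1) gc bump_bounds(1) \<rho>(1)]]])
        (simp add: G_def fun_eq_iff divide_inverse)
    then show ?thesis
      by (rule has_derivative_transform_within_open[of _ _ _ UNIV "ball a (R - \<rho>)"])
        (use x mv_on_kernel_formula[OF mv \<rho>] in auto)
  qed
  then show "(U has_derivative (\<lambda>v. G x \<bullet> v)) (at x)" using x by blast
  show gx: "grad U x = G x" by (rule grad_eq[OF d[OF x]])
  have "continuous (at x) (\<lambda>x. G x \<bullet> b)" if "b \<in> Basis" for b
  proof -
    have bb: "continuous_on UNIV (\<lambda>z::'a. (24 * max 0 (1 - z \<bullet> z) * (z \<bullet> b)) *\<^sub>R z - (6 * (max 0 (1 - z \<bullet> z)) ^ 2) *\<^sub>R b)"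
      by (intro continuous_intros)
    have K: "continuous (at x) (\<lambda>x. (\<integral>w. indicator (ball a R) w * ((- (U w / \<rho>)) *
      (((- 6 * (max 0 (1 - ((w - x) /\<^sub>R \<rho>) \<bullet> ((w - x) /\<^sub>R \<rho>))) ^ 2) *\<^sub>R ((w - x) /\<^sub>R \<rho>)) \<bullet> b)) \<partial>lborel))"
      by (rule has_derivative_continuous, rule kernel_integral_has_derivative[OF _ bump_has_derivative(2) bb bump_bounds(2) \<rho>(1)])
        (use \<rho> in \<open>intro continuous_intros Uc, auto\<close>)
    have eq: "(\<lambda>x. G x \<bullet> b) = (\<lambda>x. (\<integral>w. indicator (ball a R) w * ((- (U w / \<rho>)) *
      (((- 6 * (max 0 (1 - ((w - x) /\<^sub>R \<rho>) \<bullet> ((w - x) /\<^sub>R \<rho>))) ^ 2) *\<^sub>R ((w - x) /\<^sub>R \<rho>)) \<bullet> b)) \<partial>lborel) / ?c)"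
    proof
      fix x
      let ?F = "\<lambda>w. indicator (ball a R) w *\<^sub>R (- (U w / \<rho>) *\<^sub>R
        ((- 6 * (max 0 (1 - ((w - x) /\<^sub>R \<rho>) \<bullet> ((w - x) /\<^sub>R \<rho>))) ^ 2) *\<^sub>R ((w - x) /\<^sub>R \<rho>)))"
      have i: "integrable lborel ?F" by (rule kernel_gradient_integrable[OF Uc \<rho>(1)])
      have "integral\<^sup>L lborel ?F \<bullet> b = (\<integral>w. ?F w \<bullet> b \<partial>lborel)" by (rule integral_inner_left[symmetric]) (use i in auto)
      then show "G x \<bullet> b = (\<integral>w. indicator (ball a R) w * ((- (U w / \<rho>)) *
      (((- 6 * (max 0 (1 - ((w - x) /\<^sub>R \<rho>) \<bullet> ((w - x) /\<^sub>R \<rho>))) ^ 2) *\<^sub>R ((w - x) /\<^sub>R \<rho>)) \<bullet> b)) \<partial>lborel) / ?c"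
        unfolding G_def inner_scaleR_left by (simp only: inner_scaleR_left divide_inverse mult.commute)
    qed
    have "?c \<noteq> 0" using \<rho> mv_const_pos[where 'a='a] by simp
    then show ?thesis unfolding eq by (rule isCont_divide[OF K continuous_const])
  qed
  then have "continuous (at x) G" by (subst continuous_componentwise) simp
  moreover have "\<forall>\<^sub>F y in nhds x. G y = grad U y"
    unfolding eventually_nhds by (rule exI[of _ "ball a (R - \<rho>)"]) (use x grad_eq[OF d] in auto)
  ultimately show "continuous (at x) (grad U)" using isCont_cong by force
qed

lemma mv_on_grad:
  assumes mv: "mv_on W U"
  shows "continuous_on W (grad U)" "x \<in> W \<Longrightarrow> (U has_derivative (\<lambda>v. grad U x \<bullet> v)) (at x)"
proof -
  have *: "(U has_derivative (\<lambda>v. grad U x \<bullet> v)) (at x) \<and> continuous (at x) (grad U)" if "x \<in> W" for x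
  proof -
    have "open W" using mv by (simp add: mv_on_def)
    then obtain R where R: "R > 0" "cball x R \<subseteq> W" using \<open>x \<in> W\<close> open_contains_cball by blast
    have 1: "0 < R / 2" "R / 2 < R" "x \<in> ball x (R - R / 2)" using R by auto
    show ?thesis using mv_on_grad_formula[OF mv 1(1,2) R(2) 1(3)] by simp
  qed
  then show "x \<in> W \<Longrightarrow> (U has_derivative (\<lambda>v. grad U x \<bullet> v)) (at x)" by blast
  show "continuous_on W (grad U)" using * by (intro continuous_at_imp_continuous_on) auto
qed

text \<open>The bound 6 for the gradient of the kernel, times the volume of its support, over the
  normalisation of the mean.\<close>

definition grad_const :: "'a::euclidean_space itself \<Rightarrow> real" where
  "grad_const _ = 6 * unit_ball_vol (DIM('a)) / mv_const TYPE('a)"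

lemma grad_const_pos: "grad_const TYPE('a::euclidean_space) > 0"
  using mv_const_pos[where 'a='a] by (simp add: grad_const_def)

text \<open>The gradient kernel is bounded by 6 and supported in the ball of radius
  \<open>\<rho>\<close>. The powers of \<open>\<rho>\<close> from the volume and from the
  normalisation cancel, and one factor \<open>1 / \<rho>\<close> from the chain rule
  remains.\<close>

lemma mv_on_grad_bound:
  fixes U :: "'a::euclidean_space \<Rightarrow> real"
  assumes mv: "mv_on W U" and \<rho>: "0 < \<rho>" "cball x \<rho> \<subseteq> W" and S: "\<And>y. y \<in> cball x \<rho> \<Longrightarrow> \<bar>U y\<bar> \<le> S"
  shows "norm (grad U x) \<le> grad_const TYPE('a) * S / \<rho>"
proof -
  have "open W" using mv by (simp add: mv_on_def)
  then obtain R where R: "R > \<rho>" "cball x R \<subseteq> W" using cball_subset_open_enlarge[OF _ \<rho>(2)] \<rho>(1) by auto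
  have S0: "S \<ge> 0" using S[of x] \<rho> by auto
  let ?F = "\<lambda>w. indicator (ball x R) w *\<^sub>R (- (U w / \<rho>) *\<^sub>R
      ((- 6 * (max 0 (1 - ((w - x) /\<^sub>R \<rho>) \<bullet> ((w - x) /\<^sub>R \<rho>))) ^ 2) *\<^sub>R ((w - x) /\<^sub>R \<rho>)))"
  have "norm (integral\<^sup>L lborel ?F) \<le> (\<integral>w. indicator (ball x \<rho>) w * (6 * S / \<rho>) \<partial>lborel)"
  proof (rule Bochner_Integration.integral_norm_bound_integral)
    show "integrable lborel ?F"
      by (rule kernel_gradient_integrable[OF _ \<rho>(1)]) (use mv R(2) continuous_on_subset in \<open>auto simp: mv_on_def\<close>)
    show "integrable lborel (\<lambda>w. indicator (ball x \<rho>) w * (6 * S / \<rho>))"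
      by (intro integrable_ball_continuous continuous_intros)
    fix w
    show "norm (?F w) \<le> indicator (ball x \<rho>) w * (6 * S / \<rho>)"
    proof (cases "w \<in> ball x \<rho>")
      case True
      have "norm (?F w) = \<bar>U w\<bar> / \<rho> * norm ((- 6 * (max 0 (1 - ((w - x) /\<^sub>R \<rho>) \<bullet> ((w - x) /\<^sub>R \<rho>))) ^ 2) *\<^sub>R ((w - x) /\<^sub>R \<rho>))"
        using True R \<rho> unfolding norm_scaleR by (simp add: abs_mult)
      also have "\<dots> \<le> S / \<rho> * 6"
        using S[of w] True \<rho> S0 by (intro mult_mono divide_right_mono bump_bounds(1)) auto
      finally show ?thesis using True by (simp add: mult.commute)
    next
      case False
      have "((w - x) /\<^sub>R \<rho>) \<bullet> ((w - x) /\<^sub>R \<rho>) = (dist x w / \<rho>)^2"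
        using \<rho> by (simp add: dot_square_norm dist_norm norm_minus_commute divide_inverse mult.commute)
      also have "\<dots> \<ge> 1" using False \<rho> by (intro one_le_power) auto
      finally have "max 0 (1 - ((w - x) /\<^sub>R \<rho>) \<bullet> ((w - x) /\<^sub>R \<rho>)) = 0" by simp
      then show ?thesis using False by simp
    qed
  qed
  also have "\<dots> = 6 * S / \<rho> * (unit_ball_vol DIM('a) * \<rho> ^ DIM('a))"
    using \<rho> by (simp add: content_ball)
  finally have "norm (integral\<^sup>L lborel ?F) \<le> 6 * S / \<rho> * (unit_ball_vol DIM('a) * \<rho> ^ DIM('a))" .
  then have "norm (integral\<^sup>L lborel ?F) / (\<rho> ^ DIM('a) * mv_const TYPE('a)) \<le>
      6 * S / \<rho> * (unit_ball_vol DIM('a) * \<rho> ^ DIM('a)) / (\<rho> ^ DIM('a) * mv_const TYPE('a))"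
    using \<rho> mv_const_pos[where 'a='a] by (intro divide_right_mono) auto
  also have "\<dots> = grad_const TYPE('a) * S / \<rho>"
    using \<rho> by (simp add: grad_const_def mult_ac)
  finally show ?thesis
    using mv_on_grad_formula(2)[OF mv \<rho>(1) R(1,2), of x] R(1) \<rho> mv_const_pos[where 'a='a] by (simp add: divide_inverse mult.commute)
qed

text \<open>Both sides of the mean value identity are differentiated in the centre; the weight does
  not move with it, so the derivative satisfies the same identity. By iteration the gradient bound
  becomes available for derivatives of every order.\<close>

lemma mv_on_partial_deriv:
  fixes U :: "'a::euclidean_space \<Rightarrow> real"
  assumes mv: "mv_on W U"
  shows "mv_on W (partial_deriv e U)"
proof -
  have W: "open W" using mv by (simp add: mv_on_def)
  have pe: "partial_deriv e U x = grad U x \<bullet> e" if "x \<in> W" for x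
    by (rule partial_deriv_eq[OF mv_on_grad(2)[OF mv that]])
  have gc: "continuous_on W (grad U)" by (rule mv_on_grad(1)[OF mv])
  have "continuous_on W (\<lambda>x. grad U x \<bullet> e)" by (intro continuous_intros gc)
  then have c: "continuous_on W (partial_deriv e U)" by (subst continuous_on_cong[OF refl pe]) auto
  have "(\<integral>z. indicator (ball 0 1) z * (partial_deriv e U (x + \<rho> *\<^sub>R z) * (1 - z \<bullet> z) ^ 3) \<partial>lborel) = mv_const TYPE('a) * partial_deriv e U x"
    if \<rho>: "0 < \<rho>" "cball x \<rho> \<subseteq> W" for x \<rho>
  proof -
    obtain R where R: "R > \<rho>" "cball x R \<subseteq> W" using cball_subset_open_enlarge[OF W \<rho>(2)] \<rho>(1) by auto
    have mem: "y + \<rho> *\<^sub>R z \<in> cball x R" if "norm z \<le> 1" "y \<in> ball x (R - \<rho>)" for y z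
    proof -
      have "dist y (y + \<rho> *\<^sub>R z) \<le> \<rho>" using affine_mem_cball[OF that(1), of \<rho> \<rho> y] \<rho> by simp
      then show ?thesis using that(2) dist_triangle[of x "y + \<rho> *\<^sub>R z" y] by auto
    qed
    obtain L where L0: "L \<ge> 0" and L: "\<And>y. y \<in> cball x R \<Longrightarrow> norm (grad U y) \<le> L"
      using continuous_on_cball_norm_bound[OF continuous_on_subset[OF gc R(2)]] by blast
    let ?G = "\<lambda>z. indicator (ball 0 1) z *\<^sub>R ((1 - z \<bullet> z) ^ 3 *\<^sub>R grad U (x + \<rho> *\<^sub>R z))"
    have xx: "x \<in> ball x (R - \<rho>)" using R \<rho> by simp
    have Uc: "continuous_on W U" using mv by (simp add: mv_on_def)
    have cU: "continuous_on (cball 0 1) (\<lambda>z. U (y + \<rho> *\<^sub>R z))" if "y \<in> ball x (R - \<rho>)" for y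
      by (rule continuous_on_compose2[OF Uc]) (use that mem R(2) in \<open>auto intro!: continuous_intros\<close>)
    have cG: "continuous_on (cball 0 1) (\<lambda>z. grad U (x + \<rho> *\<^sub>R z))"
      by (rule continuous_on_compose2[OF gc]) (use mem xx R(2) in \<open>auto intro!: continuous_intros\<close>)
    have w1: "0 \<le> (1 - z \<bullet> z) ^ 3" "(1 - z \<bullet> z) ^ 3 \<le> 1" if "norm z \<le> 1" for z :: 'a
      using one_minus_inner_nonneg[OF that] by (auto intro!: power_le_one)
    have I: "integrable lborel (\<lambda>z. indicator (ball 0 1) z * (U (y + \<rho> *\<^sub>R z) * (1 - z \<bullet> z) ^ 3))" if "y \<in> ball x (R - \<rho>)" for y
      by (intro integrable_ball_continuous continuous_intros cU that)
    have m: "?G \<in> borel_measurable lborel"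
      unfolding measurable_lborel2
      by (intro borel_measurable_continuous_on_indicator continuous_intros continuous_on_subset[OF cG]) auto
    have i: "integrable lborel (\<lambda>z. indicator (ball (0::'a) 1) z * L)"
      by (intro integrable_ball_continuous continuous_intros)
    have a: "AE z in lborel. ((\<lambda>y. indicator (ball 0 1) z * (U (y + \<rho> *\<^sub>R z) * (1 - z \<bullet> z) ^ 3)) has_derivative (\<bullet>) (?G z)) (at x)"
    proof (rule AE_I2)
      fix z :: 'a
      show "((\<lambda>y. indicator (ball 0 1) z * (U (y + \<rho> *\<^sub>R z) * (1 - z \<bullet> z) ^ 3)) has_derivative (\<bullet>) (?G z)) (at x)"
      proof (cases "norm z < 1")
        case True
        have 1: "((\<lambda>y. y + \<rho> *\<^sub>R z) has_derivative (\<lambda>v. v)) (at x)" by (auto intro!: derivative_eq_intros)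
        have 2: "(U has_derivative (\<lambda>v. grad U (x + \<rho> *\<^sub>R z) \<bullet> v)) (at (x + \<rho> *\<^sub>R z))"
          by (rule mv_on_grad(2)[OF mv]) (use mem[of z x] xx True R in auto)
        show ?thesis
          by (rule has_derivative_eq_rhs[OF has_derivative_mult_right[OF has_derivative_mult_left[OF has_derivative_compose[OF 1 2]]]])
            (auto simp: fun_eq_iff)
      next
        case False
        moreover have "(\<bullet>) (0::'a) = (\<lambda>x. 0)" by auto
        ultimately show ?thesis by simp
      qed
    qed
    have b: "AE z in lborel. \<bar>indicator (ball 0 1) z * (U (y + \<rho> *\<^sub>R z) * (1 - z \<bullet> z) ^ 3) - indicator (ball 0 1) z * (U (x + \<rho> *\<^sub>R z) * (1 - z \<bullet> z) ^ 3)\<bar>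
       \<le> indicator (ball 0 1) z * L * norm (y - x)" if y: "y \<in> ball x (R - \<rho>)" for y
    proof (rule AE_I2)
      fix z :: 'a
      show "\<bar>indicator (ball 0 1) z * (U (y + \<rho> *\<^sub>R z) * (1 - z \<bullet> z) ^ 3) - indicator (ball 0 1) z * (U (x + \<rho> *\<^sub>R z) * (1 - z \<bullet> z) ^ 3)\<bar>
       \<le> indicator (ball 0 1) z * L * norm (y - x)"
      proof (cases "norm z < 1")
        case True
        have "\<bar>U (y + \<rho> *\<^sub>R z) - U (x + \<rho> *\<^sub>R z)\<bar> \<le> L * norm ((y + \<rho> *\<^sub>R z) - (x + \<rho> *\<^sub>R z))"
        proof (rule gradient_bound_lipschitz[of "cball x R" _ "grad U"])
          show "(U has_derivative (\<lambda>v. grad U w \<bullet> v)) (at w within cball x R)" if "w \<in> cball x R" for w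
            using mv_on_grad(2)[OF mv] that R(2) has_derivative_at_withinI by blast
        qed (use mem[of z] True xx y L in auto)
        then have "\<bar>U (y + \<rho> *\<^sub>R z) - U (x + \<rho> *\<^sub>R z)\<bar> * (1 - z \<bullet> z) ^ 3 \<le> (L * norm (y - x)) * 1"
          using w1[of z] True L0 by (intro mult_mono) auto
        moreover have "\<bar>U (y + \<rho> *\<^sub>R z) * (1 - z \<bullet> z) ^ 3 - U (x + \<rho> *\<^sub>R z) * (1 - z \<bullet> z) ^ 3\<bar> = \<bar>U (y + \<rho> *\<^sub>R z) - U (x + \<rho> *\<^sub>R z)\<bar> * (1 - z \<bullet> z) ^ 3"
          using w1[of z] True by (simp add: left_diff_distrib[symmetric] abs_mult)
        ultimately show ?thesis using True by simp
      qed auto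
    qed
    have c: "AE z in lborel. norm (?G z) \<le> indicator (ball 0 1) z * L"
    proof (rule AE_I2)
      fix z :: 'a
      show "norm (?G z) \<le> indicator (ball 0 1) z * L"
      proof (cases "norm z < 1")
        case True
        have "(1 - z \<bullet> z) ^ 3 * norm (grad U (x + \<rho> *\<^sub>R z)) \<le> 1 * L"
          using w1[of z] True L[OF mem[of z x]] xx by (intro mult_mono) auto
        then show ?thesis using True w1[of z] by simp
      qed auto
    qed
    note * = has_derivative_integral_parameter[where f = "\<lambda>y z. indicator (ball 0 1) z * (U (y + \<rho> *\<^sub>R z) * (1 - z \<bullet> z) ^ 3)"
      and G = ?G and B = "\<lambda>z. indicator (ball 0 1) z * L", OF open_ball xx I m i a b c]
    have "((\<lambda>y. \<integral>z. indicator (ball 0 1) z * (U (y + \<rho> *\<^sub>R z) * (1 - z \<bullet> z) ^ 3) \<partial>lborel)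
      has_derivative (\<lambda>v. mv_const TYPE('a) * (grad U x \<bullet> v))) (at x)"
    proof (rule has_derivative_transform_within_open[of _ _ _ UNIV "ball x (R - \<rho>)"])
      show "((\<lambda>y. mv_const TYPE('a) * U y) has_derivative (\<lambda>v. mv_const TYPE('a) * (grad U x \<bullet> v))) (at x)"
        by (rule has_derivative_mult_right[OF mv_on_grad(2)[OF mv]]) (use R(2) \<rho> in auto)
      show "mv_const TYPE('a) * U y = (\<integral>z. indicator (ball 0 1) z * (U (y + \<rho> *\<^sub>R z) * (1 - z \<bullet> z) ^ 3) \<partial>lborel)"
        if "y \<in> ball x (R - \<rho>)" for y
      proof -
        have "cball y \<rho> \<subseteq> W"
        proof
          fix z assume "z \<in> cball y \<rho>"
          then have "z \<in> cball x R" using that dist_triangle[of x z y] by auto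
          then show "z \<in> W" using R(2) by auto
        qed
        then show ?thesis using mv \<rho> by (simp add: mv_on_def)
      qed
    qed (use R in auto)
    from has_derivative_unique[OF *(2) this] have "integral\<^sup>L lborel ?G \<bullet> e = mv_const TYPE('a) * (grad U x \<bullet> e)" by metis
    moreover have "integral\<^sup>L lborel ?G \<bullet> e = (\<integral>z. ?G z \<bullet> e \<partial>lborel)" by (rule integral_inner_left[symmetric]) (use *(1) in auto)
    moreover have "(\<lambda>z. ?G z \<bullet> e) = (\<lambda>z. indicator (ball 0 1) z * (partial_deriv e U (x + \<rho> *\<^sub>R z) * (1 - z \<bullet> z) ^ 3))"
    proof
      fix z :: 'a
      show "?G z \<bullet> e = indicator (ball 0 1) z * (partial_deriv e U (x + \<rho> *\<^sub>R z) * (1 - z \<bullet> z) ^ 3)"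
        using pe[of "x + \<rho> *\<^sub>R z"] mem[of z x] xx R(2) by (cases "norm z < 1") (auto simp: subset_iff)
    qed
    moreover have "partial_deriv e U x = grad U x \<bullet> e" by (rule pe) (use \<rho> in auto)
    ultimately show ?thesis by simp
  qed
  then show ?thesis using W c by (auto simp: mv_on_def)
qed

section \<open>Iterated derivatives and Cauchy estimates\<close>

lemma mv_on_iterated: "mv_on W U \<Longrightarrow> mv_on W ((partial_deriv e ^^ k) U)"
  by (induction k) (auto intro: mv_on_partial_deriv)

lemma mv_on_partial_deriv_eq: "mv_on W U \<Longrightarrow> x \<in> W \<Longrightarrow> partial_deriv e U x = grad U x \<bullet> e"
  by (rule partial_deriv_eq[OF mv_on_grad(2)])

lemma mv_on_DERIV_line:
  assumes "mv_on W U" "y + t *\<^sub>R e \<in> W"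
  shows "((\<lambda>t. U (y + t *\<^sub>R e)) has_real_derivative partial_deriv e U (y + t *\<^sub>R e)) (at t)"
proof -
  have 1: "((\<lambda>t. y + t *\<^sub>R e) has_derivative (\<lambda>v. v *\<^sub>R e)) (at t)" by (auto intro!: derivative_eq_intros)
  show ?thesis
    unfolding has_field_derivative_def
    by (rule has_derivative_eq_rhs[OF has_derivative_compose[OF 1 mv_on_grad(2)[OF assms]]])
      (simp add: fun_eq_iff mv_on_partial_deriv_eq[OF assms])
qed

text \<open>A single term, that of index \<open>k\<close>, of the exponential series of
  \<open>k\<close>.\<close>

lemma power_self_le_exp_fact: "real k ^ k \<le> exp 1 ^ k * fact k"
proof -
  have s: "(\<lambda>n. inverse (fact n) * real k ^ n) sums exp (real k)"
    using exp_converges[of "real k"] by simp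
  have "(\<Sum>n\<in>{k}. inverse (fact n) * real k ^ n) \<le> (\<Sum>n. inverse (fact n) * real k ^ n)"
    by (rule sum_le_suminf) (use s in \<open>auto simp: sums_iff\<close>)
  then have "inverse (fact k) * real k ^ k \<le> exp (real k)" using s by (simp add: sums_iff)
  then have "real k ^ k \<le> exp (real k) * fact k" by (simp add: field_simps)
  also have "exp (real k) = exp 1 ^ k" by (simp add: exp_of_nat_mult[symmetric])
  finally show ?thesis .
qed

text \<open>The radius is spent in \<open>k\<close> equal portions \<open>\<rho> / k\<close>, one
  for each derivative, at the price of a factor \<open>grad_const * k / \<rho>\<close> each. The
  resulting \<open>k ^ k\<close> is at most \<open>exp 1 ^ k * fact k\<close>. This is the
  quantitative analyticity behind all estimates along segments.\<close>

lemma mv_on_iterated_bound: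
  fixes U :: "'a::euclidean_space \<Rightarrow> real"
  assumes mv: "mv_on W U" and \<rho>: "0 < \<rho>" "cball x \<rho> \<subseteq> W" and S: "\<And>y. y \<in> cball x \<rho> \<Longrightarrow> \<bar>U y\<bar> \<le> S"
    and e: "norm e \<le> 1"
  shows "\<bar>(partial_deriv e ^^ k) U x\<bar> \<le> S * fact k * (grad_const TYPE('a) * exp 1 / \<rho>) ^ k"
proof (cases "k = 0")
  case True
  then show ?thesis using S[of x] \<rho> by simp
next
  case False
  then have k: "real k > 0" by simp
  let ?c = "grad_const TYPE('a)"
  have S0: "S \<ge> 0" using S[of x] \<rho> by auto
  have "\<bar>(partial_deriv e ^^ j) U y\<bar> \<le> S * (?c * k / \<rho>) ^ j" if "j \<le> k" "y \<in> cball x (\<rho> * (1 - j / k))" for j y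
    using that
  proof (induction j arbitrary: y)
    case 0
    then show ?case using S by simp
  next
    case (Suc j)
    have sub: "cball y (\<rho> / k) \<subseteq> cball x (\<rho> * (1 - j / k))"
    proof
      fix z assume "z \<in> cball y (\<rho> / k)"
      then have "dist x z \<le> \<rho> * (1 - Suc j / k) + \<rho> / k"
        using Suc.prems(2) dist_triangle[of x z y] by auto
      also have "\<dots> = \<rho> * (1 - j / k)" using k by (simp add: field_simps)
      finally show "z \<in> cball x (\<rho> * (1 - j / k))" by simp
    qed
    have "\<rho> * (1 - j / k) \<le> \<rho>" using \<rho> by (intro mult_left_le) auto
    then have sub2: "cball x (\<rho> * (1 - j / k)) \<subseteq> cball x \<rho>" by auto
    have rk: "0 < \<rho> / k" using \<rho> k by simp
    have yW: "y \<in> W" using sub sub2 \<rho> rk by (metis centre_in_cball less_imp_le subsetD)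
    have "norm (grad ((partial_deriv e ^^ j) U) y) \<le> ?c * (S * (?c * k / \<rho>) ^ j) / (\<rho> / k)"
      by (rule mv_on_grad_bound[OF mv_on_iterated[OF mv] rk]) (use sub sub2 \<rho> Suc in \<open>auto simp del: mem_cball\<close>)
    also have "\<dots> = S * (?c * k / \<rho>) ^ Suc j" by simp
    finally have "norm (grad ((partial_deriv e ^^ j) U) y) * norm e \<le> (S * (?c * k / \<rho>) ^ Suc j) * 1"
      using e by (intro mult_mono) (auto intro: order_trans[OF norm_ge_zero])
    moreover have "\<bar>grad ((partial_deriv e ^^ j) U) y \<bullet> e\<bar> \<le> norm (grad ((partial_deriv e ^^ j) U) y) * norm e"
      by (rule Cauchy_Schwarz_ineq2)
    ultimately show ?case using mv_on_partial_deriv_eq[OF mv_on_iterated[OF mv] yW] by simp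
  qed
  from this[of k x] have "\<bar>(partial_deriv e ^^ k) U x\<bar> \<le> S * (?c * k / \<rho>) ^ k" using k by simp
  also have "\<dots> = S * ((?c / \<rho>) ^ k * real k ^ k)" by (simp add: power_mult_distrib power_divide)
  also have "\<dots> \<le> S * ((?c / \<rho>) ^ k * (exp 1 ^ k * fact k))"
    using S0 \<rho> grad_const_pos[where 'a='a] power_self_le_exp_fact[of k] by (intro mult_left_mono) auto
  also have "\<dots> = S * fact k * (?c * exp 1 / \<rho>) ^ k" by (simp add: power_mult_distrib power_divide)
  finally show ?thesis .
qed

text \<open>The weighted variance of \<open>U\<close> about its mean \<open>U x\<close> is
  nonnegative, and the weight is at most 1.\<close>

lemma mv_on_square_bound:
  fixes U :: "'a::euclidean_space \<Rightarrow> real"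
  assumes mv: "mv_on W U" and \<rho>: "0 < \<rho>" "cball x \<rho> \<subseteq> W"
  shows "mv_const TYPE('a) * \<rho> ^ DIM('a) * (U x)\<^sup>2 \<le> (\<integral>w. indicator (ball x \<rho>) w * (U w)\<^sup>2 \<partial>lborel)"
proof -
  have Uc: "continuous_on (cball x \<rho>) U" using mv \<rho>(2) continuous_on_subset by (auto simp: mv_on_def)
  have cU: "continuous_on (cball 0 1) (\<lambda>z. U (x + \<rho> *\<^sub>R z))"
    by (rule continuous_on_compose2[OF Uc]) (use affine_mem_cball[of _ \<rho> \<rho> x] \<rho> in \<open>auto intro!: continuous_intros\<close>)
  let ?c = "mv_const TYPE('a)"
  define A where "A = (\<integral>z. indicator (ball 0 1) z * ((U (x + \<rho> *\<^sub>R z))\<^sup>2 * (1 - z \<bullet> z) ^ 3) \<partial>lborel)"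
  have m: "(\<integral>z. indicator (ball 0 1) z * (U (x + \<rho> *\<^sub>R z) * (1 - z \<bullet> z) ^ 3) \<partial>lborel) = ?c * U x"
    using mv \<rho> by (simp add: mv_on_def)
  have i1: "integrable lborel (\<lambda>z. indicator (ball 0 1) z * ((U (x + \<rho> *\<^sub>R z))\<^sup>2 * (1 - z \<bullet> z) ^ 3))"
    and i2: "integrable lborel (\<lambda>z. indicator (ball 0 1) z * (U (x + \<rho> *\<^sub>R z) * (1 - z \<bullet> z) ^ 3))"
    and i3: "integrable lborel (\<lambda>z::'a. indicator (ball 0 1) z * (1 - z \<bullet> z) ^ 3)"
    and i4: "integrable lborel (\<lambda>z. indicator (ball 0 1) z * (U (x + \<rho> *\<^sub>R z))\<^sup>2)"
    by (intro integrable_ball_continuous continuous_intros cU)+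
  have "0 \<le> (\<integral>z. indicator (ball 0 1) z * ((U (x + \<rho> *\<^sub>R z) - U x)\<^sup>2 * (1 - z \<bullet> z) ^ 3) \<partial>lborel)"
  proof (rule Bochner_Integration.integral_nonneg)
    fix z :: 'a
    show "0 \<le> indicator (ball 0 1) z * ((U (x + \<rho> *\<^sub>R z) - U x)\<^sup>2 * (1 - z \<bullet> z) ^ 3)"
    proof (cases "norm z < 1")
      case True
      have "0 \<le> (1 - z \<bullet> z) ^ 3" using True by (intro zero_le_power one_minus_inner_nonneg) simp
      then show ?thesis by (intro mult_nonneg_nonneg) auto
    qed auto
  qed
  also have "(\<lambda>z. indicator (ball 0 1) z * ((U (x + \<rho> *\<^sub>R z) - U x)\<^sup>2 * (1 - z \<bullet> z) ^ 3)) =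
    (\<lambda>z. indicator (ball 0 1) z * ((U (x + \<rho> *\<^sub>R z))\<^sup>2 * (1 - z \<bullet> z) ^ 3)
       - (2 * U x) * (indicator (ball 0 1) z * (U (x + \<rho> *\<^sub>R z) * (1 - z \<bullet> z) ^ 3))
       + (U x)\<^sup>2 * (indicator (ball 0 1) z * (1 - z \<bullet> z) ^ 3))"
    by (simp add: fun_eq_iff power2_diff algebra_simps)
  also have "integral\<^sup>L lborel \<dots> = A - 2 * U x * (?c * U x) + (U x)\<^sup>2 * ?c"
    using i1 i2 i3 m by (simp add: A_def mv_const_def)
  finally have "?c * (U x)\<^sup>2 \<le> A" by (simp add: power2_eq_square algebra_simps)
  also have "A \<le> (\<integral>z. indicator (ball 0 1) z * (U (x + \<rho> *\<^sub>R z))\<^sup>2 \<partial>lborel)"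
    unfolding A_def
  proof (rule integral_mono[OF i1 i4])
    fix z :: 'a
    show "indicator (ball 0 1) z * ((U (x + \<rho> *\<^sub>R z))\<^sup>2 * (1 - z \<bullet> z) ^ 3) \<le> indicator (ball 0 1) z * (U (x + \<rho> *\<^sub>R z))\<^sup>2"
      using one_minus_inner_nonneg[of z] by (auto simp: indicator_def intro!: mult_left_le power_le_one)
  qed
  finally have *: "?c * (U x)\<^sup>2 \<le> (\<integral>z. indicator (ball 0 1) z * (U (x + \<rho> *\<^sub>R z))\<^sup>2 \<partial>lborel)" .
  define g where "g w = indicator (ball x \<rho>) w * (U w)\<^sup>2" for w
  have "integrable lborel g" unfolding g_def by (intro integrable_ball_continuous continuous_intros Uc)
  then have gm: "g \<in> borel_measurable borel" using borel_measurable_integrable by fastforce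
  have "x + \<rho> *\<^sub>R z \<in> ball x \<rho> \<longleftrightarrow> z \<in> ball 0 1" for z
    using \<rho> by (simp add: dist_norm)
  then have "g (x + \<rho> *\<^sub>R z) = indicator (ball 0 1) z * (U (x + \<rho> *\<^sub>R z))\<^sup>2" for z by (simp add: g_def indicator_def)
  then have "integral\<^sup>L lborel g = \<rho> ^ DIM('a) * (\<integral>z. indicator (ball 0 1) z * (U (x + \<rho> *\<^sub>R z))\<^sup>2 \<partial>lborel)"
    using integral_lborel_scale[OF gm \<rho>(1), of x] by simp
  moreover have "\<rho> ^ DIM('a) * (?c * (U x)\<^sup>2) \<le> \<rho> ^ DIM('a) * (\<integral>z. indicator (ball 0 1) z * (U (x + \<rho> *\<^sub>R z))\<^sup>2 \<partial>lborel)"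
    using \<rho> * by (intro mult_left_mono) auto
  ultimately show ?thesis unfolding g_def by (simp add: mult_ac)
qed

section \<open>Zeros and lower bounds in one variable\<close>

text \<open>The clause \<open>y < Max X\<close> serves the induction: the new zero lies between the
  two largest points of \<open>X\<close>, hence above all zeros found before.\<close>

lemma rolle_zeros:
  fixes f f' :: "real \<Rightarrow> real"
  assumes "finite X" "card X = Suc k" "\<And>x. x \<in> X \<Longrightarrow> f x = 0 \<and> a \<le> x \<and> x \<le> b"
    and "\<And>x. a \<le> x \<Longrightarrow> x \<le> b \<Longrightarrow> (f has_real_derivative f' x) (at x)"
  shows "\<exists>Y. finite Y \<and> card Y = k \<and> (\<forall>y\<in>Y. f' y = 0 \<and> a \<le> y \<and> y \<le> b) \<and> (\<forall>y\<in>Y. y < Max X)"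
  using assms(1-3)
proof (induction k arbitrary: X)
  case 0
  then show ?case by (intro exI[of _ "{}"]) auto
next
  case (Suc k)
  define M where "M = Max X"
  define X' where "X' = X - {M}"
  define M' where "M' = Max X'"
  have ne: "X \<noteq> {}" using Suc.prems by auto
  have MX: "M \<in> X" unfolding M_def using Suc.prems ne by simp
  have X': "finite X'" "card X' = Suc k" using Suc.prems MX by (auto simp: X'_def)
  have ne': "X' \<noteq> {}" using X' by auto
  have M'X: "M' \<in> X'" unfolding M'_def using X' ne' by simp
  have lt: "M' < M" using M'X Suc.prems(1) by (auto simp: X'_def M_def less_le)
  obtain Y where Y: "finite Y" "card Y = k" "\<forall>y\<in>Y. f' y = 0 \<and> a \<le> y \<and> y \<le> b" "\<forall>y\<in>Y. y < M'"
    using Suc.IH[OF X'] Suc.prems(3) unfolding M'_def X'_def by blast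
  have in1: "a \<le> M'" "M \<le> b" "f M' = 0" "f M = 0" using Suc.prems(3) M'X MX by (auto simp: X'_def)
  have "\<exists>z. M' < z \<and> z < M \<and> f' z = 0"
  proof (rule Rolle_deriv[OF lt, of f "\<lambda>x v. v * f' x", THEN exE])
    show "f M' = f M" using in1 by simp
    show "continuous_on {M'..M} f"
      using assms(4) in1 by (intro continuous_at_imp_continuous_on ballI) (auto intro!: DERIV_isCont[OF assms(4)])
    show "(f has_derivative (\<lambda>v. v * f' x)) (at x)" if "M' < x" "x < M" for x
      using assms(4)[of x] that in1 by (simp add: has_field_derivative_def mult.commute[of _ "f' x"])
    fix z assume z: "M' < z \<and> z < M \<and> (\<lambda>v. v * f' z) = (\<lambda>v. 0)"
    then have "(\<lambda>v. v * f' z) 1 = 0" by metis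
    then show "\<exists>z. M' < z \<and> z < M \<and> f' z = 0" using z by auto
  qed
  then obtain z where z: "M' < z" "z < M" "f' z = 0" by blast
  show ?case
  proof (intro exI[of _ "insert z Y"] conjI)
    show "card (insert z Y) = Suc k" using Y z by (subst card_insert_disjoint) auto
    show "\<forall>y\<in>insert z Y. y < Max X" using Y z lt by (auto simp: M_def[symmetric])
    show "\<forall>y\<in>insert z Y. f' y = 0 \<and> a \<le> y \<and> y \<le> b" using Y z in1 by auto
  qed (use Y in auto)
qed

lemma rolle_iterated:
  fixes D :: "nat \<Rightarrow> real \<Rightarrow> real"
  assumes "finite X" "card X = Suc k" "\<And>x. x \<in> X \<Longrightarrow> D j x = 0 \<and> a \<le> x \<and> x \<le> b"
    and D: "\<And>i x. a \<le> x \<Longrightarrow> x \<le> b \<Longrightarrow> (D i has_real_derivative D (Suc i) x) (at x)"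
  shows "\<exists>\<xi>. a \<le> \<xi> \<and> \<xi> \<le> b \<and> D (j + k) \<xi> = 0"
  using assms(1-3)
proof (induction k arbitrary: X j)
  case 0
  then obtain x where "x \<in> X" by (metis card.empty ex_in_conv nat.distinct(1))
  then show ?case using 0 by auto
next
  case (Suc k)
  obtain Y where "finite Y" "card Y = Suc k" "\<forall>y\<in>Y. D (Suc j) y = 0 \<and> a \<le> y \<and> y \<le> b"
    using rolle_zeros[OF Suc.prems D] by blast
  then have "\<exists>\<xi>. a \<le> \<xi> \<and> \<xi> \<le> b \<and> D (Suc j + k) \<xi> = 0" by (intro Suc.IH) auto
  then show ?case by simp
qed

text \<open>To \<open>p\<close> a multiple of the nodal polynomial is added that makes the
  difference vanish at \<open>x\<close> too; its \<open>k + 1\<close> zeros yield a zero of its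
  \<open>k\<close>-th derivative. The alternative \<open>p = 0\<close> admits an empty set of nodes,
  where no degree is below \<open>k\<close>.\<close>

lemma interpolation_error:
  fixes D :: "nat \<Rightarrow> real \<Rightarrow> real" and p :: "real poly"
  assumes D: "\<And>i x. a \<le> x \<Longrightarrow> x \<le> b \<Longrightarrow> (D i has_real_derivative D (Suc i) x) (at x)"
    and X: "finite X" "card X = k" "X \<subseteq> {a..b}" and p: "degree p < k \<or> p = 0" "\<And>x. x \<in> X \<Longrightarrow> poly p x = D 0 x"
    and x: "a \<le> x" "x \<le> b"
  shows "\<exists>\<xi>. a \<le> \<xi> \<and> \<xi> \<le> b \<and> D 0 x - poly p x = D k \<xi> / fact k * (\<Prod>y\<in>X. x - y)"
proof (cases "x \<in> X")
  case True
  then have "(\<Prod>y\<in>X. x - y) = 0" using X by simp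
  then show ?thesis using True p x by (intro exI[of _ x]) auto
next
  case False
  define q :: "real poly" where "q = (\<Prod>y\<in>X. [:- y, 1:])"
  have pq: "poly q z = (\<Prod>y\<in>X. z - y)" for z by (simp add: q_def poly_prod)
  have nz: "poly q x \<noteq> 0" using False X by (auto simp: pq)
  define c where "c = (D 0 x - poly p x) / poly q x"
  define r where "r = p + smult c q"
  define E where "E i z = D i z - poly ((pderiv ^^ i) r) z" for i z
  have dq1: "degree q = k" unfolding q_def using X by (auto simp: degree_prod_sum_eq)
  have "lead_coeff q = (\<Prod>y\<in>X. lead_coeff [:- y, 1:])" unfolding q_def by (rule lead_coeff_prod)
  then have dq: "degree q = k" "lead_coeff q = 1" using dq1 by auto
  have Ed: "(E i has_real_derivative E (Suc i) z) (at z)" if "a \<le> z" "z \<le> b" for i z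
    unfolding E_def by (auto intro!: derivative_eq_intros D that poly_DERIV)
  have "\<exists>\<xi>. a \<le> \<xi> \<and> \<xi> \<le> b \<and> E (0 + k) \<xi> = 0"
  proof (rule rolle_iterated[where X = "insert x X"])
    show "card (insert x X) = Suc k" using X False by simp
    show "E 0 z = 0 \<and> a \<le> z \<and> z \<le> b" if "z \<in> insert x X" for z
    proof -
      have "E 0 z = D 0 z - (poly p z + c * poly q z)" by (simp add: E_def r_def)
      moreover have "poly q z = 0" if "z \<in> X" using that X by (simp add: pq)
      ultimately show ?thesis using that p x X nz by (auto simp: c_def)
    qed
  qed (use X Ed in auto)
  then obtain \<xi> where \<xi>: "a \<le> \<xi>" "\<xi> \<le> b" "D k \<xi> = poly ((pderiv ^^ k) r) \<xi>" by (auto simp: E_def)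
  have "(pderiv ^^ k) r = [:c * fact k:]"
  proof -
    have 1: "coeff ((pderiv ^^ k) r) 0 = c * fact k"
    proof -
      have "coeff p k = 0" using p(1) by (auto intro: coeff_eq_0)
      moreover have "coeff q k = 1" using dq by simp
      ultimately have "coeff r k = c" by (simp add: r_def)
      then show ?thesis by (simp add: coeff_higher_pderiv pochhammer_fact)
    qed
    have "degree r \<le> k" unfolding r_def using p(1) dq by (auto intro!: degree_add_le order_trans[OF degree_smult_le])
    then have "degree ((pderiv ^^ k) r) = 0" by (simp add: degree_higher_pderiv)
    then show ?thesis using 1 by (metis degree_0_id)
  qed
  then have "D k \<xi> = c * fact k" using \<xi> by simp
  then have "D 0 x - poly p x = D k \<xi> / fact k * (\<Prod>y\<in>X. x - y)" using nz by (simp add: c_def pq)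
  then show ?thesis using \<xi> by blast
qed

lemma lagrange_interpolation:
  fixes f :: "real \<Rightarrow> real"
  assumes X: "finite X"
  shows "\<exists>p. (degree p < card X \<or> p = 0) \<and> (\<forall>x\<in>X. poly p x = f x) \<and>
    (\<forall>z. poly p z = (\<Sum>x\<in>X. f x * (\<Prod>y\<in>X - {x}. (z - y) / (x - y))))"
proof -
  define p where "p = (\<Sum>x\<in>X. smult (f x) (\<Prod>y\<in>X - {x}. smult (1 / (x - y)) [:- y, 1:]))"
  have val: "poly p z = (\<Sum>x\<in>X. f x * (\<Prod>y\<in>X - {x}. (z - y) / (x - y)))" for z
    by (simp add: p_def poly_sum poly_prod diff_divide_distrib)
  have "poly p x = f x" if "x \<in> X" for x
  proof -
    have "poly p x = (\<Sum>x'\<in>X. if x' = x then f x else 0)"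
      unfolding val
    proof (rule sum.cong[OF refl])
      fix x' assume x': "x' \<in> X"
      show "f x' * (\<Prod>y\<in>X - {x'}. (x - y) / (x' - y)) = (if x' = x then f x else 0)"
      proof (cases "x' = x")
        case True
        have "(\<Prod>y\<in>X - {x}. (x - y) / (x - y)) = 1" by (rule prod.neutral) auto
        then show ?thesis using True by simp
      next
        case False
        then have "(\<Prod>y\<in>X - {x'}. (x - y) / (x' - y)) = 0" using X that by auto
        then show ?thesis using False by simp
      qed
    qed
    then show ?thesis using X that by simp
  qed
  moreover have "degree p < card X \<or> p = 0"
  proof (cases "X = {}")
    case True
    then show ?thesis by (simp add: p_def)
  next
    case False
    have "degree p \<le> card X - 1"
      unfolding p_def
    proof (rule degree_sum_le[OF X])
      fix x assume "x \<in> X"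
      have "degree (\<Prod>y\<in>X - {x}. smult (1 / (x - y)) [:- y, 1:]) \<le> (\<Sum>y\<in>X - {x}. degree (smult (1 / (x - y)) [:- y, 1:]))"
        using X by (intro order_trans[OF degree_prod_sum_le]) (auto simp: o_def)
      also have "\<dots> \<le> (\<Sum>y\<in>X - {x}. 1)" by (intro sum_mono order_trans[OF degree_smult_le]) simp
      also have "\<dots> = card X - 1" using X \<open>x \<in> X\<close> by simp
      finally show "degree (smult (f x) (\<Prod>y\<in>X - {x}. smult (1 / (x - y)) [:- y, 1:])) \<le> card X - 1"
        by (intro order_trans[OF degree_smult_le])
    qed
    moreover have "card X > 0" using False X by (simp add: card_gt_0_iff)
    ultimately show ?thesis by linarith
  qed
  ultimately show ?thesis using val by blast
qed

text \<open>The zero polynomial interpolates at the zeros, so the value at 0 is a pure interpolation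
  error and at most \<open>S * (Q * T) ^ card X\<close>. The more zeros, the smaller this is,
  against the lower bound at 0: a real-variable substitute for Jensen's formula.\<close>

lemma zero_count_bound:
  fixes D :: "nat \<Rightarrow> real \<Rightarrow> real"
  assumes D: "\<And>i t. 0 \<le> t \<Longrightarrow> t \<le> T \<Longrightarrow> (D i has_real_derivative D (Suc i) t) (at t)"
    and bd: "\<And>i t. 0 \<le> t \<Longrightarrow> t \<le> T \<Longrightarrow> \<bar>D i t\<bar> \<le> S * fact i * Q ^ i"
    and Q: "0 \<le> Q" "Q * T \<le> 1 / 2" and X: "finite X" "X \<subseteq> {0<..T}" "\<And>x. x \<in> X \<Longrightarrow> D 0 x = 0"
    and T: "0 \<le> T" and S: "S > 0" and M: "S * exp (- M) \<le> \<bar>D 0 0\<bar>"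
  shows "card X * ln 2 \<le> M"
proof -
  have "\<exists>\<xi>. 0 \<le> \<xi> \<and> \<xi> \<le> T \<and> D 0 0 - poly 0 0 = D (card X) \<xi> / fact (card X) * (\<Prod>y\<in>X. 0 - y)"
    by (rule interpolation_error[where p = 0]) (use D X T in \<open>auto simp: subset_iff\<close>)
  then obtain \<xi> where \<xi>: "0 \<le> \<xi>" "\<xi> \<le> T" "D 0 0 = D (card X) \<xi> / fact (card X) * (\<Prod>y\<in>X. - y)" by auto
  have "S * exp (- M) \<le> \<bar>D (card X) \<xi>\<bar> / fact (card X) * (\<Prod>y\<in>X. \<bar>y\<bar>)"
    using M \<xi>(3) by (simp add: abs_mult abs_prod)
  also have "\<dots> \<le> (S * Q ^ card X) * T ^ card X"
  proof (intro mult_mono)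
    show "\<bar>D (card X) \<xi>\<bar> / fact (card X) \<le> S * Q ^ card X"
      using bd[OF \<xi>(1,2), of "card X"] by (simp add: divide_simps mult_ac)
    have "(\<Prod>y\<in>X. \<bar>y\<bar>) \<le> (\<Prod>y\<in>X. T)" by (rule prod_mono) (use X in \<open>auto simp: subset_iff\<close>)
    then show "(\<Prod>y\<in>X. \<bar>y\<bar>) \<le> T ^ card X" by simp
  qed (use S Q in \<open>auto intro: prod_nonneg\<close>)
  also have "\<dots> = S * (Q * T) ^ card X" by (simp add: power_mult_distrib)
  also have "\<dots> \<le> S * (1 / 2) ^ card X" using S Q T by (intro mult_left_mono power_mono) auto
  finally have "exp (- M) \<le> (1 / 2) ^ card X" using S by simp
  then have "ln (exp (- M)) \<le> ln ((1 / 2 :: real) ^ card X)" by (subst ln_le_cancel_iff) auto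
  then show ?thesis by (simp add: ln_realpow ln_div)
qed

lemma prod_abs_diff_nat:
  assumes "i < k"
  shows "(\<Prod>j\<in>{..<k} - {i}. \<bar>real i - real j\<bar>) = fact i * fact (k - 1 - i)"
proof -
  have s: "{..<k} - {i} = {..<i} \<union> {i<..<k}" using assms by auto
  have "(\<Prod>j\<in>{..<i}. \<bar>real i - real j\<bar>) = (\<Prod>j\<in>{1..i}. real j)"
    by (rule prod.reindex_bij_witness[of _ "\<lambda>j. i - j" "\<lambda>j. i - j"]) auto
  also have "\<dots> = fact i" by (simp add: fact_prod)
  finally have 1: "(\<Prod>j\<in>{..<i}. \<bar>real i - real j\<bar>) = fact i" .
  have "(\<Prod>j\<in>{i<..<k}. \<bar>real i - real j\<bar>) = (\<Prod>j\<in>{1..k-1-i}. real j)"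
    by (rule prod.reindex_bij_witness[of _ "\<lambda>j. i + j" "\<lambda>j. j - i"]) (use assms in auto)
  also have "\<dots> = fact (k - 1 - i)" by (simp add: fact_prod)
  finally have 2: "(\<Prod>j\<in>{i<..<k}. \<bar>real i - real j\<bar>) = fact (k - 1 - i)" .
  have "(\<Prod>j\<in>{..<i} \<union> {i<..<k}. \<bar>real i - real j\<bar>) =
      (\<Prod>j\<in>{..<i}. \<bar>real i - real j\<bar>) * (\<Prod>j\<in>{i<..<k}. \<bar>real i - real j\<bar>)"
    by (rule prod.union_disjoint) auto
  then show ?thesis unfolding s 1 2 .
qed

text \<open>If \<open>D 0\<close> stayed below the claimed bound on all of \<open>[t0, T]\<close>,
  the Lagrange polynomial with \<open>k\<close> equidistant nodes there would be small at 0, while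
  its error at 0 is at most \<open>S * (1 / 2) ^ k\<close>. With the right \<open>k\<close> the
  first is at most, and the second less than, half of \<open>S * exp (- B)\<close>, against the
  lower bound at 0.\<close>

lemma propagate_lower_bound:
  fixes D :: "nat \<Rightarrow> real \<Rightarrow> real"
  assumes D: "\<And>i t. 0 \<le> t \<Longrightarrow> t \<le> T \<Longrightarrow> (D i has_real_derivative D (Suc i) t) (at t)"
    and bd: "\<And>i t. 0 \<le> t \<Longrightarrow> t \<le> T \<Longrightarrow> \<bar>D i t\<bar> \<le> S * fact i * Q ^ i"
    and Q: "0 \<le> Q" "Q * T \<le> 1 / 2" and T: "T = t0 + l" "0 \<le> t0" "0 < l" and S: "S > 0"
    and B: "B \<ge> 0" "S * exp (- B) \<le> \<bar>D 0 0\<bar>"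
  shows "\<exists>t. t0 \<le> t \<and> t \<le> T \<and> S * exp (- ((B + 1) * (1 + 2 * ln (4 * exp 1 * T / l)))) \<le> \<bar>D 0 t\<bar>"
proof (rule ccontr)
  \<comment> \<open>The \<open>k\<close>-th power of \<open>2 * exp 1 * T / l\<close> bounds every
    Lagrange basis polynomial at 0; the further factor 2 absorbs the number of nodes through
    \<open>k \<le> 2 ^ k\<close>.\<close>
  define A where "A = 4 * exp 1 * T / l"
  define m where "m = S * exp (- ((B + 1) * (1 + 2 * ln A)))"
  assume "\<not> ?thesis"
  then have "\<forall>t. \<not> (t0 \<le> t \<and> t \<le> T \<and> m \<le> \<bar>D 0 t\<bar>)" unfolding m_def A_def by blast
  then have small: "\<bar>D 0 t\<bar> < m" if "t0 \<le> t" "t \<le> T" for t using that not_le by blast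
  have Tl: "T \<ge> l" "T > 0" using T by auto
  have e1: "exp 1 \<ge> (1::real)" by simp
  have "A \<ge> 4 * 1 * 1" unfolding A_def times_divide_eq_right[symmetric]
    using Tl T e1 by (intro mult_mono) auto
  then have A1: "A \<ge> 4" by simp
  \<comment> \<open>The summand 2 gives \<open>k > B / ln 2 + 1\<close>, hence
    \<open>(1 / 2) ^ k < exp (- B) / 2\<close>, while \<open>k \<le> 2 * B + 2\<close> still holds;
    the latter is the source of the coefficient 2 of the logarithm in the claim.\<close>
  define k where "k = nat \<lfloor>B / ln 2\<rfloor> + 2"
  have l2: "0 < ln (2::real)" "ln (2::real) \<le> 1" "1 / 2 \<le> ln (2::real)"
    using ln_2_less_1 ln2_ge_two_thirds by auto
  have "0 \<le> B / ln 2" using B l2 by simp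
  then have k: "real k > B / ln 2 + 1" "real k \<le> B / ln 2 + 2" unfolding k_def by linarith+
  have k2: "k \<ge> 2" by (simp add: k_def)
  define a where "a i = t0 + real (Suc i) * (l / real k)" for i
  define X where "X = a ` {..<k}"
  have inj: "inj_on a {..<k}" using T k2 by (auto simp: inj_on_def a_def)
  have cX: "card X = k" "finite X" using card_image[OF inj] by (auto simp: X_def)
  have aT: "t0 \<le> a i" "a i \<le> T" "0 < a i" if "i < k" for i
  proof -
    have "real (Suc i) / real k \<le> 1" using that by simp
    then have "l * (real (Suc i) / real k) \<le> l * 1" using T by (intro mult_left_mono) auto
    then show "a i \<le> T" using T by (simp add: a_def mult.commute)
    have "real (Suc i) * (l / real k) > 0" using T that by (intro mult_pos_pos) auto
    then show "t0 \<le> a i" "0 < a i" using T by (auto simp: a_def)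
  qed
  obtain p where p: "degree p < card X \<or> p = 0" "\<forall>x\<in>X. poly p x = D 0 x"
    "\<forall>z. poly p z = (\<Sum>x\<in>X. D 0 x * (\<Prod>y\<in>X - {x}. (z - y) / (x - y)))"
    using lagrange_interpolation[OF cX(2), of "D 0"] by blast
  have "\<exists>\<xi>. 0 \<le> \<xi> \<and> \<xi> \<le> T \<and> D 0 0 - poly p 0 = D k \<xi> / fact k * (\<Prod>y\<in>X. 0 - y)"
    by (rule interpolation_error) (use D p(1,2) cX aT Tl in \<open>auto simp: X_def less_imp_le\<close>)
  then obtain \<xi> where \<xi>: "0 \<le> \<xi>" "\<xi> \<le> T" "D 0 0 - poly p 0 = D k \<xi> / fact k * (\<Prod>y\<in>X. 0 - y)" by blast
  have err: "\<bar>D 0 0 - poly p 0\<bar> \<le> S * (1 / 2) ^ k"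
  proof -
    have "\<bar>D 0 0 - poly p 0\<bar> = \<bar>D k \<xi>\<bar> / fact k * (\<Prod>y\<in>X. \<bar>y\<bar>)"
      unfolding \<xi>(3) by (simp add: abs_mult abs_prod)
    also have "\<dots> \<le> (S * Q ^ k) * T ^ k"
    proof (intro mult_mono)
      show "\<bar>D k \<xi>\<bar> / fact k \<le> S * Q ^ k"
        using bd[OF \<xi>(1,2), of k] by (simp add: divide_simps mult_ac)
      have "(\<Prod>y\<in>X. \<bar>y\<bar>) \<le> (\<Prod>y\<in>X. T)" by (rule prod_mono) (use aT in \<open>force simp: X_def\<close>)
      then show "(\<Prod>y\<in>X. \<bar>y\<bar>) \<le> T ^ k" by (simp add: cX)
    qed (use S Q in \<open>auto intro: prod_nonneg\<close>)
    also have "\<dots> = S * (Q * T) ^ k" by (simp add: power_mult_distrib)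
    also have "\<dots> \<le> S * (1 / 2) ^ k" using S Q Tl by (intro mult_left_mono power_mono) auto
    finally show ?thesis .
  qed
  \<comment> \<open>For equidistant nodes the denominator is a power of \<open>l / k\<close> times a
    product of two factorials. Their binomial coefficient is at most \<open>2 ^ (k - 1)\<close>, and
    the remaining \<open>k ^ k / fact k\<close> is at most \<open>exp 1 ^ k\<close>.\<close>
  have basis: "(\<Prod>y\<in>X - {x}. \<bar>y\<bar> / \<bar>x - y\<bar>) \<le> (2 * exp 1 * T / l) ^ k" if "x \<in> X" for x
  proof -
    obtain i where i: "i < k" "x = a i" using \<open>x \<in> X\<close> unfolding X_def by blast
    have "X - {x} = a ` ({..<k} - {i})" using inj_on_image_set_diff[OF inj, of "{..<k}" "{i}"] i by (auto simp: X_def)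
    then have "(\<Prod>y\<in>X - {x}. \<bar>y\<bar> / \<bar>x - y\<bar>) = (\<Prod>j\<in>{..<k} - {i}. \<bar>a j\<bar> / \<bar>a i - a j\<bar>)"
      using inj by (simp add: i(2) prod.reindex inj_on_diff)
    also have "\<dots> \<le> (\<Prod>j\<in>{..<k} - {i}. (T * real k / l) * (1 / \<bar>real i - real j\<bar>))"
    proof (rule prod_mono, intro conjI)
      fix j assume j: "j \<in> {..<k} - {i}"
      have "a i - a j = (real i - real j) * (l / real k)" by (simp add: a_def algebra_simps add_divide_distrib diff_divide_distrib)
      then have "\<bar>a i - a j\<bar> = \<bar>real i - real j\<bar> * (l / real k)" using T by (simp add: abs_mult)
      then have "\<bar>a j\<bar> / \<bar>a i - a j\<bar> = \<bar>a j\<bar> * (real k / l * (1 / \<bar>real i - real j\<bar>))" by simp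
      also have "\<dots> \<le> T * (real k / l * (1 / \<bar>real i - real j\<bar>))" using aT[of j] j T by (intro mult_right_mono) auto
      finally show "\<bar>a j\<bar> / \<bar>a i - a j\<bar> \<le> (T * real k / l) * (1 / \<bar>real i - real j\<bar>)" by simp
    qed auto
    also have "\<dots> = (T * real k / l) ^ (k - 1) / (\<Prod>j\<in>{..<k} - {i}. \<bar>real i - real j\<bar>)"
      using i by (simp only: prod.distrib prod_dividef prod_constant) (simp add: power_mult_distrib power_divide)
    also have "\<dots> = (T * real k / l) ^ (k - 1) / (fact i * fact (k - 1 - i))"
      by (simp only: prod_abs_diff_nat[OF i(1)])
    also have "\<dots> = (T * real k / l) ^ (k - 1) * real ((k - 1) choose i) / fact (k - 1)"
      using i by (simp add: binomial_fact)
    also have "\<dots> \<le> (T * real k / l) ^ (k - 1) * 2 ^ (k - 1) / fact (k - 1)"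
    proof (intro divide_right_mono mult_left_mono)
      have "((k - 1) choose i) \<le> 2 ^ (k - 1)" by (rule binomial_le_pow2)
      then show "real ((k - 1) choose i) \<le> 2 ^ (k - 1)" by (metis of_nat_le_iff of_nat_numeral of_nat_power)
    qed (use T Tl in auto)
    also have "\<dots> = (2 * T / l) ^ (k - 1) * (real k ^ (k - 1) / fact (k - 1))" by (simp add: power_mult_distrib power_divide)
    also have "real k ^ (k - 1) / fact (k - 1) = real k ^ k / fact k"
    proof -
      obtain k' where "k = Suc k'" using k2 by (cases k) auto
      then show ?thesis by (simp add: fact_Suc del: of_nat_Suc)
    qed
    also have "(2 * T / l) ^ (k - 1) * (real k ^ k / fact k) \<le> (2 * T / l) ^ k * exp 1 ^ k"
    proof (intro mult_mono)
      show "(2 * T / l) ^ (k - 1) \<le> (2 * T / l) ^ k" using Tl T by (intro power_increasing) auto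
      show "real k ^ k / fact k \<le> exp 1 ^ k" using power_self_le_exp_fact[of k] by (simp add: divide_simps)
    qed (use Tl T in auto)
    also have "\<dots> = (2 * exp 1 * T / l) ^ k" by (simp add: power_mult_distrib power_divide)
    finally show ?thesis .
  qed
  have "\<bar>poly p 0\<bar> \<le> m * A ^ k"
  proof -
    have "\<bar>poly p 0\<bar> \<le> (\<Sum>x\<in>X. \<bar>D 0 x * (\<Prod>y\<in>X - {x}. (0 - y) / (x - y))\<bar>)"
      using p(3) by (simp only: sum_abs)
    also have "\<dots> = (\<Sum>x\<in>X. \<bar>D 0 x\<bar> * (\<Prod>y\<in>X - {x}. \<bar>y\<bar> / \<bar>x - y\<bar>))"
      by (simp add: abs_mult abs_prod)
    also have "\<dots> \<le> (\<Sum>x\<in>X. m * (2 * exp 1 * T / l) ^ k)"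
      by (intro sum_mono mult_mono basis) (use small aT S in \<open>auto simp: X_def m_def less_imp_le intro!: prod_nonneg\<close>)
    also have "\<dots> = m * (real k * (2 * exp 1 * T / l) ^ k)" using cX by simp
    also have "\<dots> \<le> m * (2 ^ k * (2 * exp 1 * T / l) ^ k)"
    proof (intro mult_left_mono mult_right_mono)
      show "real k \<le> 2 ^ k" using of_nat_less_two_power[of k] less_imp_le by blast
    qed (use S Tl T in \<open>auto simp: m_def\<close>)
    also have "2 ^ k * (2 * exp 1 * T / l) ^ k = A ^ k" by (simp add: A_def power_mult_distrib[symmetric] mult_ac)
    finally show ?thesis .
  qed
  \<comment> \<open>As \<open>k \<le> 2 * (B + 1)\<close>, the power of \<open>A\<close> is consumed
    by the logarithmic part of the exponent in \<open>m\<close>. What is left is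
    \<open>exp (- B - 1)\<close>, at most \<open>exp (- B) / 2\<close>.\<close>
  also have "m * A ^ k \<le> S * exp (- B) / 2"
  proof -
    have "ln A * real k \<le> ln A * (2 * B + 2)"
    proof (intro mult_left_mono)
      have "B / ln 2 \<le> B / (1/2)" using B l2 by (intro divide_left_mono) auto
      then show "real k \<le> 2 * B + 2" using k by simp
    qed (use A1 in auto)
    then have "- ((B + 1) * (1 + 2 * ln A)) + ln A * real k \<le> - B - ln 2" using l2 by (simp add: algebra_simps)
    then have le: "exp (- ((B + 1) * (1 + 2 * ln A)) + ln A * real k) \<le> exp (- B - ln 2)" by simp
    have "exp (ln A * real k) = A ^ k" using A1 by (simp add: mult.commute[of "ln A"] exp_of_nat_mult)
    then have "exp (- ((B + 1) * (1 + 2 * ln A))) * A ^ k = exp (- ((B + 1) * (1 + 2 * ln A)) + ln A * real k)"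
      by (simp only: exp_add)
    also note le
    also have "exp (- B - ln 2) = exp (- B) / 2" by (simp add: exp_diff)
    finally have "exp (- ((B + 1) * (1 + 2 * ln A))) * A ^ k \<le> exp (- B) / 2" .
    then have "S * (exp (- ((B + 1) * (1 + 2 * ln A))) * A ^ k) \<le> S * (exp (- B) / 2)" using S by (intro mult_left_mono) auto
    then show ?thesis by (simp add: m_def)
  qed
  finally have pp: "\<bar>poly p 0\<bar> \<le> S * exp (- B) / 2" .
  have "(1 / 2 :: real) ^ k < exp (- B) / 2"
  proof -
    have "(1/2::real) ^ k = exp (- (real k * ln 2))" by (simp add: exp_minus exp_of_nat_mult power_one_over inverse_eq_divide)
    also have "real k * ln 2 > (B / ln 2 + 1) * ln 2" using k l2 by (intro mult_strict_right_mono) auto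
    then have "exp (- (real k * ln 2)) < exp (- (B + ln 2))" using l2 by (simp add: distrib_right)
    also have "exp (- (B + ln 2)) = exp (- B) / 2" by (simp add: exp_diff)
    finally show ?thesis .
  qed
  then have "S * (1 / 2) ^ k < S * (exp (- B) / 2)" using S by (intro mult_strict_left_mono) auto
  then show False using err pp B(2) by (simp add: abs_if split: if_splits)
qed

section \<open>Hausdorff measure and cones\<close>

definition hcost :: "nat \<Rightarrow> 'a::metric_space set \<Rightarrow> ennreal" where
  "hcost s C = (if C = {} then 0 else ennreal (unit_ball_vol (real s) * (diameter C / 2) ^ s))"

definition hcover :: "real \<Rightarrow> 'a::metric_space set \<Rightarrow> (nat \<Rightarrow> 'a set) \<Rightarrow> bool" where
  "hcover \<delta> A C \<longleftrightarrow> A \<subseteq> (\<Union>i. C i) \<and> (\<forall>i. bounded (C i) \<and> diameter (C i) \<le> \<delta>)"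

lemma hausdorff_premeasure_eq: "hausdorff_premeasure s \<delta> A = (INF C \<in> {C. hcover \<delta> A C}. \<Sum>i. hcost s (C i))"
  by (simp add: hausdorff_premeasure_def hcover_def hcost_def)

lemma hausdorff_premeasure_le: "hcover \<delta> A C \<Longrightarrow> hausdorff_premeasure s \<delta> A \<le> (\<Sum>i. hcost s (C i))"
  unfolding hausdorff_premeasure_eq by (rule INF_lower) simp

lemma hausdorff_premeasure_mono: "A \<subseteq> B \<Longrightarrow> hausdorff_premeasure s \<delta> A \<le> hausdorff_premeasure s \<delta> B"
  unfolding hausdorff_premeasure_eq by (rule INF_superset_mono) (unfold hcover_def, blast, simp)

lemma hausdorff_premeasure_antimono: "\<delta> \<le> \<delta>' \<Longrightarrow> hausdorff_premeasure s \<delta>' A \<le> hausdorff_premeasure s \<delta> A"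
  unfolding hausdorff_premeasure_eq by (rule INF_superset_mono) (unfold hcover_def, blast intro: order_trans, simp)

lemma hausdorff_premeasure_le_outer: "\<delta> > 0 \<Longrightarrow> hausdorff_premeasure s \<delta> A \<le> hausdorff_outer s A"
  unfolding hausdorff_outer_def by (rule SUP_upper) simp

lemma hausdorff_outer_mono: "A \<subseteq> B \<Longrightarrow> hausdorff_outer s A \<le> hausdorff_outer s B"
  unfolding hausdorff_outer_def by (intro SUP_mono) (auto intro: hausdorff_premeasure_mono)

lemma hausdorff_outer_empty [simp]: "hausdorff_outer s {} = 0"
proof -
  have "hausdorff_premeasure s \<delta> ({} :: 'a set) = 0" if "\<delta> > 0" for \<delta>
  proof -
    have "hausdorff_premeasure s \<delta> ({} :: 'a set) \<le> (\<Sum>i::nat. hcost s ({} :: 'a set))"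
      by (rule hausdorff_premeasure_le) (use that in \<open>auto simp: hcover_def\<close>)
    then show ?thesis by (simp add: hcost_def)
  qed
  then have "hausdorff_outer s ({} :: 'a set) \<le> 0" unfolding hausdorff_outer_def by (intro SUP_least) auto
  then show ?thesis by simp
qed

lemma hausdorff_premeasure_UN:
  "hausdorff_premeasure s \<delta> (\<Union>i. A i) \<le> (\<Sum>n. hausdorff_premeasure s \<delta> (A n))"
proof (rule ennreal_le_epsilon)
  fix e :: real assume "0 < e" and fin: "(\<Sum>n. hausdorff_premeasure s \<delta> (A n)) < top"
  have "\<exists>C. hcover \<delta> (A n) C \<and> (\<Sum>i. hcost s (C i)) \<le> hausdorff_premeasure s \<delta> (A n) + e * (1/2)^Suc n" for n
  proof -
    have "hausdorff_premeasure s \<delta> (A n) < top" using fin by (auto dest!: ennreal_suminf_lessD)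
    then have "hausdorff_premeasure s \<delta> (A n) < hausdorff_premeasure s \<delta> (A n) + e * (1/2)^Suc n"
      using \<open>0 < e\<close> by (auto simp: less_top)
    then show ?thesis
      unfolding hausdorff_premeasure_eq[of s \<delta> "A n"] INF_less_iff using less_imp_le by blast
  qed
  then obtain B where B: "\<And>n. hcover \<delta> (A n) (B n)"
    "\<And>n. (\<Sum>i. hcost s (B n i)) \<le> hausdorff_premeasure s \<delta> (A n) + e * (1/2)^Suc n" by metis
  define C where "C = case_prod B o prod_decode"
  have "hcover \<delta> (\<Union>i. A i) C"
    unfolding hcover_def
  proof (intro conjI allI)
    show "(\<Union>i. A i) \<subseteq> (\<Union>i. C i)"
    proof
      fix x assume "x \<in> (\<Union>i. A i)"
      then obtain i where "x \<in> A i" by blast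
      then obtain j where "x \<in> B i j" using B(1)[of i] by (auto simp: hcover_def)
      then have "x \<in> C (prod_encode (i, j))" by (simp add: C_def)
      then show "x \<in> (\<Union>i. C i)" by blast
    qed
    show "bounded (C i)" "diameter (C i) \<le> \<delta>" for i
      using B(1) by (auto simp: hcover_def C_def split: prod.split)
  qed
  then have "hausdorff_premeasure s \<delta> (\<Union>i. A i) \<le> (\<Sum>i. hcost s (C i))" by (rule hausdorff_premeasure_le)
  also have "\<dots> = (\<Sum>n. \<Sum>i. hcost s (B n i))"
    unfolding C_def comp_def
    by (rule suminf_ennreal_2dimen[of _ "\<lambda>p. hcost s (case p of (n, i) \<Rightarrow> B n i)", symmetric, THEN sym]) simp
  also have "\<dots> \<le> (\<Sum>n. hausdorff_premeasure s \<delta> (A n) + e * (1/2) ^ Suc n)"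
    using B by (intro suminf_le) auto
  also have "... = (\<Sum>n. hausdorff_premeasure s \<delta> (A n)) + (\<Sum>n. ennreal e * ennreal ((1/2) ^ Suc n))"
    using \<open>0 < e\<close> by (subst suminf_add[symmetric]) (auto simp del: ennreal_suminf_cmult simp add: ennreal_mult[symmetric])
  also have "\<dots> = (\<Sum>n. hausdorff_premeasure s \<delta> (A n)) + e"
    unfolding ennreal_suminf_cmult by (subst suminf_ennreal_eq[OF zero_le_power power_half_series]) auto
  finally show "hausdorff_premeasure s \<delta> (\<Union>i. A i) \<le> (\<Sum>n. hausdorff_premeasure s \<delta> (A n)) + e" .
qed

lemma hausdorff_outer_UN: "hausdorff_outer s (\<Union>i::nat. A i) \<le> (\<Sum>n. hausdorff_outer s (A n))"
proof -
  have "hausdorff_premeasure s \<delta> (\<Union>i. A i) \<le> (\<Sum>n. hausdorff_outer s (A n))" if "\<delta> > 0" for \<delta>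
    by (rule order_trans[OF hausdorff_premeasure_UN suminf_le]) (use hausdorff_premeasure_le_outer[OF that] in auto)
  then show ?thesis unfolding hausdorff_outer_def[of s "\<Union>i. A i"] by (intro SUP_least) auto
qed

lemma hausdorff_outer_Un: "hausdorff_outer s (A \<union> B) \<le> hausdorff_outer s A + hausdorff_outer s B"
proof -
  define C where "C i = (if i = 0 then A else if i = 1 then B else {})" for i :: nat
  have "A \<union> B = (\<Union>i. C i)" by (auto simp: C_def split: if_splits)
  then have "hausdorff_outer s (A \<union> B) \<le> (\<Sum>i. hausdorff_outer s (C i))" using hausdorff_outer_UN by metis
  also have "\<dots> = (\<Sum>i\<in>{0, 1}. hausdorff_outer s (C i))" by (rule suminf_finite) (auto simp: C_def)
  finally show ?thesis by (simp add: C_def)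
qed

text \<open>A covering set of diameter below \<open>e\<close> cannot meet both sets, so every fine
  cover of the union splits into a cover of each.\<close>

lemma hausdorff_outer_separated:
  assumes e: "e > 0" and sep: "\<And>a b. a \<in> A \<Longrightarrow> b \<in> B \<Longrightarrow> e \<le> dist a b"
  shows "hausdorff_outer s A + hausdorff_outer s B \<le> hausdorff_outer s (A \<union> B)"
proof -
  have *: "hausdorff_premeasure s \<delta> A + hausdorff_premeasure s \<delta> B \<le> hausdorff_premeasure s \<delta> (A \<union> B)"
    if \<delta>: "0 < \<delta>" "\<delta> < e" for \<delta>
    unfolding hausdorff_premeasure_eq[of s \<delta> "A \<union> B"]
  proof (rule INF_greatest)
    fix C assume "C \<in> {C. hcover \<delta> (A \<union> B) C}"
    then have C: "hcover \<delta> (A \<union> B) C" by simp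
    define CA where "CA i = (if C i \<inter> A = {} then {} else C i)" for i
    define CB where "CB i = (if C i \<inter> B = {} then {} else C i)" for i
    have "hcover \<delta> A CA" "hcover \<delta> B CB"
      using C \<delta> by (fastforce simp: hcover_def CA_def CB_def)+
    then have "hausdorff_premeasure s \<delta> A + hausdorff_premeasure s \<delta> B \<le> (\<Sum>i. hcost s (CA i)) + (\<Sum>i. hcost s (CB i))"
      by (intro add_mono hausdorff_premeasure_le)
    also have "\<dots> = (\<Sum>i. hcost s (CA i) + hcost s (CB i))" by (rule suminf_add) auto
    also have "\<dots> \<le> (\<Sum>i. hcost s (C i))"
    proof (rule suminf_le)
      fix i
      have "C i \<inter> A = {} \<or> C i \<inter> B = {}"
      proof (rule ccontr)
        assume "\<not> ?thesis"
        then obtain a b where ab: "a \<in> C i" "a \<in> A" "b \<in> C i" "b \<in> B" by blast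
        then have "dist a b \<le> diameter (C i)" using C by (auto simp: hcover_def intro: diameter_bounded_bound)
        also have "\<dots> \<le> \<delta>" using C by (auto simp: hcover_def)
        finally show False using sep[OF ab(2,4)] \<delta> by linarith
      qed
      then show "hcost s (CA i) + hcost s (CB i) \<le> hcost s (C i)" by (auto simp: CA_def CB_def hcost_def)
    qed auto
    finally show "hausdorff_premeasure s \<delta> A + hausdorff_premeasure s \<delta> B \<le> (\<Sum>i. hcost s (C i))" .
  qed
  have "hausdorff_premeasure s \<delta> A + hausdorff_premeasure s \<delta>' B \<le> hausdorff_outer s (A \<union> B)"
    if "\<delta> > 0" "\<delta>' > 0" for \<delta> \<delta>'
  proof -
    define \<epsilon> where "\<epsilon> = min (min \<delta> \<delta>') (e / 2)"
    have \<epsilon>: "0 < \<epsilon>" "\<epsilon> < e" "\<epsilon> \<le> \<delta>" "\<epsilon> \<le> \<delta>'" using that e by (auto simp: \<epsilon>_def)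
    have "hausdorff_premeasure s \<delta> A + hausdorff_premeasure s \<delta>' B \<le> hausdorff_premeasure s \<epsilon> A + hausdorff_premeasure s \<epsilon> B"
      by (intro add_mono hausdorff_premeasure_antimono \<epsilon>)
    also have "\<dots> \<le> hausdorff_premeasure s \<epsilon> (A \<union> B)" by (rule *[OF \<epsilon>(1,2)])
    also have "\<dots> \<le> hausdorff_outer s (A \<union> B)" by (rule hausdorff_premeasure_le_outer[OF \<epsilon>(1)])
    finally show ?thesis .
  qed
  then have "hausdorff_premeasure s \<delta> A + hausdorff_outer s B \<le> hausdorff_outer s (A \<union> B)" if "\<delta> > 0" for \<delta>
    using that unfolding hausdorff_outer_def[of s B]
    by (subst ennreal_SUP_add_right) (auto intro!: SUP_least)
  then show ?thesis
    unfolding hausdorff_outer_def[of s A]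
    by (subst ennreal_SUP_add_left[symmetric]) (auto intro!: SUP_least)
qed

lemma hausdorff_outer_separated_sum:
  fixes n :: nat
  assumes e: "e > 0" and sep: "\<And>i j a b. i < n \<Longrightarrow> j < n \<Longrightarrow> i \<noteq> j \<Longrightarrow> a \<in> A i \<Longrightarrow> b \<in> A j \<Longrightarrow> e \<le> dist a b"
  shows "(\<Sum>i<n. hausdorff_outer s (A i)) \<le> hausdorff_outer s (\<Union>i<n. A i)"
  using sep
proof (induction n)
  case (Suc n)
  have "(\<Sum>i<Suc n. hausdorff_outer s (A i)) \<le> hausdorff_outer s (\<Union>i<n. A i) + hausdorff_outer s (A n)"
  proof -
    have "(\<Sum>i<n. hausdorff_outer s (A i)) \<le> hausdorff_outer s (\<Union>i<n. A i)"
      by (rule Suc.IH) (rule Suc.prems, auto)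
    then show ?thesis by (simp add: add_right_mono)
  qed
  also have "\<dots> \<le> hausdorff_outer s ((\<Union>i<n. A i) \<union> A n)"
    by (rule hausdorff_outer_separated[OF e]) (use Suc.prems less_SucI in \<open>auto simp: less_Suc_eq\<close>)
  also have "(\<Union>i<n. A i) \<union> A n = (\<Union>i<Suc n. A i)" by (auto simp: less_Suc_eq)
  finally show ?case .
qed simp

text \<open>The rings \<open>R j\<close> around \<open>C\<close> of the same parity are pairwise separated, so their measures are summable.\<close>

lemma hausdorff_outer_closed_split:
  fixes T :: "'a::metric_space set"
  assumes C: "closed C"
  shows "hausdorff_outer s (T \<inter> C) + hausdorff_outer s (T - C) \<le> hausdorff_outer s T"
proof (cases "C = {} \<or> hausdorff_outer s T = top")
  case True
  then show ?thesis by auto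
next
  case False
  then have ne: "C \<noteq> {}" and fin: "hausdorff_outer s T < top" by (auto simp: less_top)
  define H where "H A = hausdorff_outer s A" for A :: "'a set"
  define d where "d x = infdist x C" for x
  have lip: "\<bar>d x - d y\<bar> \<le> dist x y" for x y
    using infdist_triangle[of x C y] infdist_triangle[of y C x] by (auto simp: d_def dist_commute)
  define P where "P k = {x \<in> T. d x \<ge> 1 / real (Suc k)}" for k
  define R where "R k = {x \<in> T. 1 / real (Suc (Suc k)) \<le> d x \<and> d x < 1 / real (Suc k)}" for k
  have pos: "d x > 0" if "x \<notin> C" for x
    using that C ne by (simp add: d_def infdist_pos_not_in_closed)
  have PT: "H (T \<inter> C) + H (P k) \<le> H T" for k
  proof -
    have "H (T \<inter> C) + H (P k) \<le> H ((T \<inter> C) \<union> P k)"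
      unfolding H_def
    proof (rule hausdorff_outer_separated)
      show "0 < 1 / real (Suc k)" by simp
      fix a b assume "a \<in> T \<inter> C" "b \<in> P k"
      then show "1 / real (Suc k) \<le> dist a b" using lip[of b a] ne by (auto simp: P_def d_def dist_commute)
    qed
    also have "\<dots> \<le> H T" unfolding H_def by (rule hausdorff_outer_mono) (auto simp: P_def)
    finally show ?thesis .
  qed
  have parity: "(\<Sum>i<n. H (R (2 * i + p))) \<le> H T" for n p
  proof -
    \<comment> \<open>Between two rings of the same parity lies at least one whole ring, the one
      after the outer of the two. Widths of rings decrease with the index, so the width at the
      largest index in question separates all pairs.\<close>
    define e where "e = 1 / real (2 * n + p + 2) - 1 / real (2 * n + p + 3)"
    have ray: "e \<le> 1 / real (Suc (Suc j)) - 1 / real (Suc (Suc (Suc j)))" if "j \<le> 2 * n + p" for j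
    proof -
      have eq: "1 / (x + 1) - 1 / (x + 2) = 1 / ((x + 1) * (x + 2))" if "x \<ge> 0" for x :: real
        using that by (simp add: field_simps)
      have 1: "e = 1 / ((real (2 * n + p) + 1 + 1) * (real (2 * n + p) + 1 + 2))"
        unfolding e_def using eq[of "real (2 * n + p) + 1"] by (simp add: algebra_simps)
      have 2: "1 / real (Suc (Suc j)) - 1 / real (Suc (Suc (Suc j))) = 1 / ((real j + 1 + 1) * (real j + 1 + 2))"
        using eq[of "real j + 1"] by (simp add: algebra_simps)
      have "real j \<le> real (2 * n + p)" using that by (subst of_nat_le_iff)
      then show ?thesis unfolding 1 2 by (intro divide_left_mono mult_mono) auto
    qed
    have e0: "e > 0" by (auto simp: e_def intro!: divide_strict_left_mono)
    have sep': "e \<le> dist a b" if "i < j" "j < n" "a \<in> R (2 * i + p)" "b \<in> R (2 * j + p)" for i j a b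
    proof -
      have "1 / real (Suc (2 * j + p)) \<le> 1 / real (Suc (Suc (Suc (2 * i + p))))"
        using that by (intro divide_left_mono) auto
      moreover have "e \<le> 1 / real (Suc (Suc (2 * i + p))) - 1 / real (Suc (Suc (Suc (2 * i + p))))"
        using that by (intro ray) auto
      ultimately have "e \<le> d a - d b" using that(3,4) unfolding R_def by (smt (verit) mem_Collect_eq)
      then show ?thesis using lip[of a b] by linarith
    qed
    have "(\<Sum>i<n. H (R (2 * i + p))) \<le> H (\<Union>i<n. R (2 * i + p))"
      unfolding H_def
    proof (rule hausdorff_outer_separated_sum[OF e0])
      fix i j a b assume "i < n" "j < n" "i \<noteq> j" "a \<in> R (2 * i + p)" "b \<in> R (2 * j + p)"
      then show "e \<le> dist a b" using sep'[of i j a b] sep'[of j i b a] by (cases "i < j") (auto simp: dist_commute)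
    qed
    also have "\<dots> \<le> H T" unfolding H_def by (rule hausdorff_outer_mono) (auto simp: R_def)
    finally show ?thesis .
  qed
  have "(\<Sum>i<n. H (R i)) \<le> 2 * H T" for n
  proof -
    have "(\<Sum>i<n. H (R i)) \<le> (\<Sum>i<2 * n. H (R i))" by (rule sum_mono2) auto
    also have "\<dots> = (\<Sum>i<n. H (R (2 * i + 0))) + (\<Sum>i<n. H (R (2 * i + 1)))"
      by (induction n) (auto simp: algebra_simps)
    also have "\<dots> \<le> H T + H T" by (intro add_mono parity)
    finally show ?thesis by (simp add: mult_2)
  qed
  then have "(\<Sum>i. H (R i)) \<le> 2 * H T" by (intro suminf_le_const) auto
  also have "\<dots> < top" using fin by (simp add: H_def ennreal_mult_less_top)
  finally have sfin: "(\<Sum>i. H (R i)) < top" .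
  define r where "r i = enn2real (H (R i))" for i
  have "H (R i) < top" for i using sfin by (auto dest!: ennreal_suminf_lessD)
  then have Hr: "H (R i) = ennreal (r i)" for i by (simp add: r_def)
  have r0: "r i \<ge> 0" for i by (simp add: r_def)
  have sr: "summable r"
  proof (rule summable_suminf_not_top)
    show "(\<Sum>i. ennreal (r i)) \<noteq> top" using sfin by (simp add: Hr)
  qed (rule r0)
  have "H (T \<inter> C) + H (T - C) \<le> H T"
  proof (rule ennreal_le_epsilon)
    fix e :: real assume e: "0 < e"
    obtain N where N: "\<And>n. n \<ge> N \<Longrightarrow> norm (\<Sum>i. r (i + n)) < e" using suminf_exist_split[OF e sr] by blast
    \<comment> \<open>A point outside the closed set has positive distance from it: either at least
      \<open>1 / Suc N\<close>, or it lies in a ring of index at least \<open>N\<close>. These rings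
      form the tail of a convergent series.\<close>
    have "T - C \<subseteq> P N \<union> (\<Union>i. R (i + N))"
    proof
      fix x assume x: "x \<in> T - C"
      show "x \<in> P N \<union> (\<Union>i. R (i + N))"
      proof (cases "d x \<ge> 1 / real (Suc N)")
        case True
        then show ?thesis using x by (simp add: P_def)
      next
        case False
        obtain m where "inverse (real (Suc m)) < d x" using reals_Archimedean[of "d x"] pos[of x] x by auto
        then have ex: "\<exists>m. 1 / real (Suc m) \<le> d x" by (auto simp: inverse_eq_divide intro: less_imp_le)
        define m where "m = (LEAST m. 1 / real (Suc m) \<le> d x)"
        have m: "1 / real (Suc m) \<le> d x" unfolding m_def using ex by (rule LeastI_ex)
        have mN: "m > N"
        proof (rule ccontr)
          assume "\<not> m > N"
          then have "1 / real (Suc N) \<le> 1 / real (Suc m)" by (intro divide_left_mono) auto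
          then show False using m False by linarith
        qed
        then have "\<not> 1 / real (Suc (m - 1)) \<le> d x" unfolding m_def by (intro not_less_Least) auto
        then have "x \<in> R (m - 1)" using m mN x by (auto simp: R_def)
        then have "x \<in> R ((m - 1 - N) + N)" using mN by simp
        then show ?thesis by blast
      qed
    qed
    then have "H (T - C) \<le> H (P N \<union> (\<Union>i. R (i + N)))" unfolding H_def by (rule hausdorff_outer_mono)
    also have "\<dots> \<le> H (P N) + H (\<Union>i. R (i + N))" unfolding H_def by (rule hausdorff_outer_Un)
    also have "H (\<Union>i. R (i + N)) \<le> (\<Sum>i. H (R (i + N)))" unfolding H_def by (rule hausdorff_outer_UN)
    also have "\<dots> = ennreal (\<Sum>i. r (i + N))"
      unfolding Hr by (rule suminf_ennreal2) (use r0 sr in \<open>auto simp: summable_iff_shift\<close>)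
    also have "\<dots> \<le> ennreal e" using N[of N] by (intro ennreal_leI) auto
    finally have "H (T - C) \<le> H (P N) + ennreal e" by (simp add: add_left_mono)
    then have "H (T \<inter> C) + H (T - C) \<le> H (T \<inter> C) + H (P N) + ennreal e" by (simp add: add_left_mono add.assoc)
    also have "\<dots> \<le> H T + ennreal e" by (intro add_right_mono PT)
    finally show "H (T \<inter> C) + H (T - C) \<le> H T + ennreal e" .
  qed
  then show ?thesis by (simp add: H_def)
qed

lemma space_hausdorff_measure [simp]: "space (hausdorff_measure s) = UNIV"
  by (simp add: hausdorff_measure_def)

lemma sets_hausdorff_measure [simp, measurable_cong]: "sets (hausdorff_measure s) = sets borel"
  by (simp add: hausdorff_measure_def sets.sigma_sets_eq[of borel, simplified])

text \<open>Caratheodory's criterion: closed sets split every set additively, so all Borel sets do,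
  and the outer measure is countably additive on them. Without this \<open>hausdorff_measure\<close>
  cannot be evaluated, since \<open>measure_of\<close> yields the null measure for a set function
  that is not a measure.\<close>

lemma emeasure_hausdorff_measure:
  fixes A :: "'a::metric_space set"
  assumes "A \<in> sets borel"
  shows "emeasure (hausdorff_measure s) A = hausdorff_outer s A"
proof -
  have oms: "outer_measure_space (Pow UNIV) (hausdorff_outer s :: 'a set \<Rightarrow> ennreal)"
    unfolding outer_measure_space_def positive_def increasing_def countably_subadditive_def
    by (auto intro: hausdorff_outer_mono hausdorff_outer_UN)
  let ?L = "lambda_system UNIV (Pow UNIV) (hausdorff_outer s :: 'a set \<Rightarrow> ennreal)"
  interpret sigma_algebra "UNIV :: 'a set" "Pow UNIV" by (rule sigma_algebra_Pow)
  have ms: "measure_space UNIV ?L (hausdorff_outer s)" by (rule caratheodory_lemma[OF oms])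
  have "closed C \<Longrightarrow> C \<in> ?L" for C :: "'a set"
    unfolding lambda_system_def
  proof (simp, intro allI antisym)
    fix T :: "'a set" assume C: "closed C"
    have "hausdorff_outer s T \<le> hausdorff_outer s ((C \<inter> T) \<union> (- C \<inter> T))" by (rule hausdorff_outer_mono) auto
    also have "\<dots> \<le> hausdorff_outer s (C \<inter> T) + hausdorff_outer s (- C \<inter> T)" by (rule hausdorff_outer_Un)
    finally show "hausdorff_outer s T \<le> hausdorff_outer s (C \<inter> T) + hausdorff_outer s ((UNIV - C) \<inter> T)" by (simp add: Compl_eq_Diff_UNIV)
    show "hausdorff_outer s (C \<inter> T) + hausdorff_outer s ((UNIV - C) \<inter> T) \<le> hausdorff_outer s T"
      using hausdorff_outer_closed_split[OF C, of s T] by (simp add: Int_commute Diff_eq Compl_eq_Diff_UNIV[symmetric])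
  qed
  then have "sigma_sets UNIV {C :: 'a set. closed C} \<subseteq> ?L"
    using ms by (intro sigma_algebra.sigma_sets_subset) (auto simp: measure_space_def)
  then have sub: "sets (borel :: 'a measure) \<subseteq> ?L" by (simp add: borel_eq_closed)
  show ?thesis
  proof (rule emeasure_measure_of[OF hausdorff_measure_def])
    show "countably_additive (sets (hausdorff_measure s)) (hausdorff_outer s :: 'a set \<Rightarrow> ennreal)"
      using ms sub unfolding measure_space_def countably_additive_def by (auto simp: subset_iff)
  qed (use assms in \<open>auto simp: positive_def\<close>)
qed

text \<open>The images of the traces on \<open>A\<close> of a cover have diameters enlarged at most
  by \<open>L\<close>, and costs scale with \<open>L ^ s\<close>. The factor is divided out first,
  so that the infimum over covers of \<open>A\<close> can be treated cover by cover.\<close>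

lemma hausdorff_outer_lipschitz_image:
  fixes f :: "'a::real_normed_vector \<Rightarrow> 'b::real_normed_vector"
  assumes L: "L > 0" and lip: "\<And>x y. x \<in> A \<Longrightarrow> y \<in> A \<Longrightarrow> dist (f x) (f y) \<le> L * dist x y"
  shows "hausdorff_outer s (f ` A) \<le> ennreal (L ^ s) * hausdorff_outer s A"
proof -
  have c: "ennreal (L ^ s) \<noteq> 0" "ennreal (L ^ s) \<noteq> top" "ennreal (L ^ s) > 0" using L by auto
  have "hausdorff_premeasure s \<delta> (f ` A) \<le> ennreal (L ^ s) * hausdorff_outer s A" if \<delta>: "\<delta> > 0" for \<delta>
  proof -
    have "hausdorff_premeasure s \<delta> (f ` A) / ennreal (L ^ s) \<le> hausdorff_premeasure s (\<delta> / L) A"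
      unfolding hausdorff_premeasure_eq[of s "\<delta> / L" A]
    proof (rule INF_greatest)
      fix C assume "C \<in> {C. hcover (\<delta> / L) A C}"
      then have C: "A \<subseteq> (\<Union>i. C i)" "\<And>i. bounded (C i)" "\<And>i. diameter (C i) \<le> \<delta> / L" by (auto simp: hcover_def)
      define E where "E i = f ` (C i \<inter> A)" for i
      have d: "diameter (E i) \<le> L * diameter (C i)" for i
      proof (rule diameter_le)
        show "E i \<noteq> {} \<or> 0 \<le> L * diameter (C i)" using L diameter_ge_0[OF C(2)[of i]] by simp
        fix x y assume "x \<in> E i" "y \<in> E i"
        then obtain u v where uv: "x = f u" "y = f v" "u \<in> C i" "v \<in> C i" "u \<in> A" "v \<in> A" by (auto simp: E_def)
        have "dist x y \<le> L * dist u v" using lip uv by simp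
        also have "\<dots> \<le> L * diameter (C i)" using L uv diameter_bounded_bound[OF C(2)] by (intro mult_left_mono) auto
        finally show "norm (x - y) \<le> L * diameter (C i)" by (simp add: dist_norm)
      qed
      have b: "bounded (E i)" for i
      proof -
        have "dist (f u) (f v) \<le> L * diameter (C i)" if "u \<in> C i \<inter> A" "v \<in> C i \<inter> A" for u v
        proof -
          have "dist (f u) (f v) \<le> L * dist u v" using lip that by simp
          also have "\<dots> \<le> L * diameter (C i)" using L that diameter_bounded_bound[OF C(2)] by (intro mult_left_mono) auto
          finally show ?thesis .
        qed
        then show ?thesis unfolding E_def bounded_def by blast
      qed
      have "hcover \<delta> (f ` A) E"
        unfolding hcover_def
      proof (intro conjI allI)
        show "f ` A \<subseteq> (\<Union>i. E i)" using C(1) by (fastforce simp: E_def)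
        show "bounded (E i)" for i by (rule b)
        show "diameter (E i) \<le> \<delta>" for i
          using d[of i] mult_left_mono[OF C(3)[of i], of L] L by simp
      qed
      then have "hausdorff_premeasure s \<delta> (f ` A) \<le> (\<Sum>i. hcost s (E i))" by (rule hausdorff_premeasure_le)
      also have "\<dots> \<le> (\<Sum>i. ennreal (L ^ s) * hcost s (C i))"
      proof (rule suminf_le)
        fix i
        show "hcost s (E i) \<le> ennreal (L ^ s) * hcost s (C i)"
        proof (cases "E i = {}")
          case False
          then have ne: "C i \<noteq> {}" by (auto simp: E_def)
          have "unit_ball_vol (real s) * (diameter (E i) / 2) ^ s \<le> unit_ball_vol (real s) * (L * diameter (C i) / 2) ^ s"
            using d[of i] diameter_ge_0[OF b[of i]] by (intro mult_left_mono power_mono) auto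
          also have "\<dots> = L ^ s * (unit_ball_vol (real s) * (diameter (C i) / 2) ^ s)"
            by (simp add: power_mult_distrib power_divide)
          finally show ?thesis using False ne L diameter_ge_0[OF C(2)[of i]]
            by (simp add: hcost_def ennreal_mult'[symmetric] ennreal_leI)
        qed (simp add: hcost_def)
      qed auto
      also have "\<dots> = ennreal (L ^ s) * (\<Sum>i. hcost s (C i))" by simp
      finally show "hausdorff_premeasure s \<delta> (f ` A) / ennreal (L ^ s) \<le> (\<Sum>i. hcost s (C i))"
        by (rule divide_le_posI_ennreal[OF c(3)])
    qed
    also have "\<dots> \<le> hausdorff_outer s A" by (rule hausdorff_premeasure_le_outer) (use \<delta> L in auto)
    finally have le: "hausdorff_premeasure s \<delta> (f ` A) / ennreal (L ^ s) \<le> hausdorff_outer s A" .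
    have "hausdorff_premeasure s \<delta> (f ` A) = ennreal (L ^ s) * (hausdorff_premeasure s \<delta> (f ` A) / ennreal (L ^ s))"
      by (subst ennreal_times_divide, subst mult.commute, rule ennreal_mult_divide_eq[symmetric]) (use c in auto)
    also have "\<dots> \<le> ennreal (L ^ s) * hausdorff_outer s A" by (intro mult_left_mono le) simp
    finally show ?thesis .
  qed
  then show ?thesis unfolding hausdorff_outer_def[of s "f ` A"] by (intro SUP_least) auto
qed

section \<open>Tubes and cones\<close>

definition tube_const :: "'a::euclidean_space itself \<Rightarrow> real" where
  "tube_const _ = unit_ball_vol (real (DIM('a) - 1)) * 2 ^ DIM('a) / unit_ball_vol (real DIM('a))"

lemma tube_const_pos: "tube_const TYPE('a::euclidean_space) > 0"
  by (simp add: tube_const_def)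

text \<open>Take a maximal \<open>\<delta>\<close>-separated subset of \<open>A\<close>: the balls
  of radius \<open>\<delta>\<close> around it cover \<open>A\<close>, those of radius
  \<open>\<delta> / 2\<close> are disjoint and lie in the tube. The constant is the quotient of the
  cost charged for the former and the volume of the latter.\<close>

lemma hausdorff_premeasure_tube:
  fixes A :: "'a::euclidean_space set"
  assumes A: "bounded A" and \<delta>: "\<delta> > 0"
  shows "hausdorff_premeasure (DIM('a) - 1) (2 * \<delta>) A \<le> ennreal (tube_const TYPE('a) / \<delta>) * emeasure lborel (\<Union>a\<in>A. ball a \<delta>)"
proof -
  let ?V = "unit_ball_vol (real DIM('a))" and ?W = "unit_ball_vol (real (DIM('a) - 1))"
  define N where "N = (\<Union>a\<in>A. ball a \<delta>)"
  have No: "N \<in> sets lborel" by (auto simp: N_def intro!: borel_open)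
  have "bounded N"
  proof -
    obtain B where B: "\<And>a. a \<in> A \<Longrightarrow> norm a \<le> B" using A by (auto simp: bounded_iff)
    have "N \<subseteq> ball 0 (B + \<delta>)"
    proof
      fix x assume "x \<in> N"
      then obtain a where "a \<in> A" "dist a x < \<delta>" by (auto simp: N_def)
      then show "x \<in> ball 0 (B + \<delta>)" using B[of a] dist_triangle[of 0 x a] by (auto simp: dist_commute)
    qed
    then show ?thesis using bounded_ball bounded_subset by blast
  qed
  then have fin: "emeasure lborel N < \<infinity>" by (rule emeasure_bounded_finite)
  define sep where "sep T \<longleftrightarrow> finite T \<and> T \<subseteq> A \<and> (\<forall>x\<in>T. \<forall>y\<in>T. x \<noteq> y \<longrightarrow> \<delta> \<le> dist x y)" for T
  have bound: "ennreal (real (card T) * (?V * (\<delta> / 2) ^ DIM('a))) \<le> emeasure lborel N" if "sep T" for T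
  proof -
    have T: "finite T" "T \<subseteq> A" "\<And>x y. x \<in> T \<Longrightarrow> y \<in> T \<Longrightarrow> x \<noteq> y \<Longrightarrow> \<delta> \<le> dist x y" using that by (auto simp: sep_def)
    have dj: "disjoint_family_on (\<lambda>x. ball x (\<delta> / 2)) T"
      unfolding disjoint_family_on_def
    proof (intro ballI impI)
      fix x y assume xy: "x \<in> T" "y \<in> T" "x \<noteq> y"
      show "ball x (\<delta> / 2) \<inter> ball y (\<delta> / 2) = {}"
      proof (rule ccontr)
        assume "\<not> ?thesis"
        then obtain z where "dist x z < \<delta> / 2" "dist y z < \<delta> / 2" by auto
        then show False using T(3)[OF xy] dist_triangle[of x y z] by (auto simp: dist_commute)
      qed
    qed
    have "ennreal (real (card T) * (?V * (\<delta> / 2) ^ DIM('a))) = (\<Sum>x\<in>T. emeasure lborel (ball x (\<delta> / 2)))"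
      using \<delta> by (simp add: emeasure_ball ennreal_mult ennreal_of_nat_eq_real_of_nat)
    also have "\<dots> = emeasure lborel (\<Union>x\<in>T. ball x (\<delta> / 2))"
      by (rule sum_emeasure[OF _ dj T(1)]) auto
    also have "\<dots> \<le> emeasure lborel N"
      using T(2) \<delta> by (intro emeasure_mono No) (force simp: N_def)
    finally show ?thesis .
  qed
  have v: "?V * (\<delta> / 2) ^ DIM('a) > 0" using \<delta> by simp
  obtain b where b: "emeasure lborel N = ennreal b" "b \<ge> 0" using fin by (cases "emeasure lborel N") auto
  have "card T \<le> nat \<lceil>b / (?V * (\<delta> / 2) ^ DIM('a))\<rceil>" if "sep T" for T
  proof -
    have "real (card T) * (?V * (\<delta> / 2) ^ DIM('a)) \<le> b" using bound[OF that] b by simp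
    then have "real (card T) \<le> b / (?V * (\<delta> / 2) ^ DIM('a))" using v by (simp add: pos_le_divide_eq)
    then show ?thesis by linarith
  qed
  moreover have "sep {}" by (simp add: sep_def)
  \<comment> \<open>Disjoint balls in a tube of finite volume bound the cardinality of separated
    sets, so a largest one exists.\<close>
  ultimately obtain T where T: "sep T" "\<And>T'. sep T' \<Longrightarrow> card T' \<le> card T"
    using ex_has_greatest_nat[of sep "{}" card "Suc (nat \<lceil>b / (?V * (\<delta> / 2) ^ DIM('a))\<rceil>)"]
    unfolding less_Suc_eq_le by blast
  have fT: "finite T" using T by (simp add: sep_def)
  have cov: "A \<subseteq> (\<Union>t\<in>T. ball t \<delta>)"
  proof (rule ccontr)
    assume "\<not> ?thesis"
    then obtain a where a: "a \<in> A" "\<And>t. t \<in> T \<Longrightarrow> \<delta> \<le> dist t a" by (force simp: not_less)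
    then have "a \<notin> T" using \<delta> by fastforce
    moreover have "sep (insert a T)" using T(1) a by (auto simp: sep_def dist_commute)
    ultimately show False using T(2)[of "insert a T"] fT by simp
  qed
  obtain h where h: "bij_betw h {0..<card T} T" using ex_bij_betw_nat_finite[OF fT] by blast
  define C where "C i = (if i < card T then ball (h i) \<delta> else {})" for i
  have dC: "diameter (C i) \<le> 2 * \<delta>" for i
  proof (rule diameter_le)
    fix x y assume "x \<in> C i" "y \<in> C i"
    then have "dist (h i) x < \<delta>" "dist (h i) y < \<delta>" by (auto simp: C_def split: if_splits)
    then show "norm (x - y) \<le> 2 * \<delta>" using dist_triangle[of x y "h i"] by (auto simp: dist_commute dist_norm[symmetric])
  qed (use \<delta> in auto)
  have bC: "bounded (C i)" for i by (simp add: C_def)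
  have "hcover (2 * \<delta>) A C"
    unfolding hcover_def
  proof (intro conjI allI dC bC)
    show "A \<subseteq> (\<Union>i. C i)"
    proof
      fix x assume "x \<in> A"
      then obtain t where t: "t \<in> T" "x \<in> ball t \<delta>" using cov by blast
      then have "t \<in> h ` {0..<card T}" using h by (simp add: bij_betw_def)
      then obtain i where "i < card T" "t = h i" by auto
      then have "x \<in> C i" using t by (simp add: C_def)
      then show "x \<in> (\<Union>i. C i)" by blast
    qed
  qed
  then have "hausdorff_premeasure (DIM('a) - 1) (2 * \<delta>) A \<le> (\<Sum>i. hcost (DIM('a) - 1) (C i))" by (rule hausdorff_premeasure_le)
  also have "\<dots> = (\<Sum>i<card T. hcost (DIM('a) - 1) (C i))" by (rule suminf_finite) (auto simp: C_def hcost_def)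
  also have "\<dots> \<le> (\<Sum>i<card T. ennreal (?W * \<delta> ^ (DIM('a) - 1)))"
  proof (rule sum_mono)
    fix i
    have "(diameter (C i) / 2) ^ (DIM('a) - 1) \<le> \<delta> ^ (DIM('a) - 1)"
      using dC[of i] diameter_ge_0[OF bC[of i]] by (intro power_mono) auto
    then show "hcost (DIM('a) - 1) (C i) \<le> ennreal (?W * \<delta> ^ (DIM('a) - 1))"
      by (auto simp: hcost_def intro!: ennreal_leI mult_left_mono)
  qed
  also have "\<dots> = ennreal (real (card T) * (?W * \<delta> ^ (DIM('a) - 1)))"
    using \<delta> by (simp add: ennreal_mult ennreal_of_nat_eq_real_of_nat)
  also have "real (card T) * (?W * \<delta> ^ (DIM('a) - 1)) = tube_const TYPE('a) / \<delta> * (real (card T) * (?V * (\<delta> / 2) ^ DIM('a)))"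
  proof -
    obtain k where "DIM('a) = Suc k" using DIM_positive[where 'a='a] by (metis gr0_implies_Suc)
    moreover have "unit_ball_vol (1 + real k) \<noteq> 0" for k using unit_ball_vol_pos[of "1 + real k"] by linarith
    ultimately show ?thesis using \<delta> by (simp add: tube_const_def power_divide)
  qed
  also have "ennreal \<dots> = ennreal (tube_const TYPE('a) / \<delta>) * ennreal (real (card T) * (?V * (\<delta> / 2) ^ DIM('a)))"
    using \<delta> tube_const_pos[where 'a='a] by (intro ennreal_mult) auto
  also have "\<dots> \<le> ennreal (tube_const TYPE('a) / \<delta>) * emeasure lborel N"
    by (intro mult_left_mono bound T) auto
  finally show ?thesis by (simp add: N_def)
qed

definition dcone :: "real \<Rightarrow> 'a::euclidean_space set \<Rightarrow> 'a set" where
  "dcone r B = {y. y \<noteq> 0 \<and> norm y < r \<and> sgn y \<in> B}"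

lemma dcone_borel: "B \<in> sets borel \<Longrightarrow> dcone r B \<in> sets borel"
proof -
  assume B: "B \<in> sets borel"
  have "continuous_on (- {0}) (sgn :: 'a \<Rightarrow> 'a)" unfolding sgn_div_norm by (intro continuous_intros) auto
  then have "(\<lambda>x. indicator (- {0}) x *\<^sub>R sgn x :: 'a) \<in> borel_measurable borel"
    by (intro borel_measurable_continuous_on_indicator) auto
  also have "(\<lambda>x. indicator (- {0}) x *\<^sub>R sgn x :: 'a) = sgn" by (auto simp: fun_eq_iff indicator_def)
  finally have [measurable]: "sgn \<in> borel_measurable (borel :: 'a measure)" .
  have "dcone r B = (- {0}) \<inter> ball 0 r \<inter> (sgn -` B \<inter> space borel)" by (auto simp: dcone_def)
  also have "\<dots> \<in> sets borel" using B by (intro sets.Int measurable_sets[of sgn borel borel]) auto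
  finally show ?thesis .
qed

lemma sgn_scaleR_pos: "c > 0 \<Longrightarrow> sgn (c *\<^sub>R y :: 'a::real_normed_vector) = sgn y"
  by (simp add: sgn_scaleR)

lemma emeasure_dcone_scale:
  fixes B :: "'a::euclidean_space set"
  assumes "B \<in> sets borel" "r > 0"
  shows "emeasure lborel (dcone r B) = ennreal (r ^ DIM('a)) * emeasure lborel (dcone 1 B)"
proof -
  have "{x. 0 + r *\<^sub>R x \<in> dcone r B} = dcone 1 B"
    using assms by (auto simp: dcone_def sgn_scaleR_pos)
  then have "emeasure lborel (dcone 1 B) = emeasure lborel (dcone r B) / ennreal (r ^ DIM('a))"
    using emeasure_lborel_scale[OF dcone_borel[OF assms(1)] assms(2), of 0 r] by simp
  moreover have "ennreal (r ^ DIM('a)) \<noteq> 0" "ennreal (r ^ DIM('a)) \<noteq> top" using assms by auto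
  ultimately show ?thesis by (metis ennreal_times_divide mult.commute ennreal_mult_divide_eq)
qed

lemma emeasure_dcone_finite: "emeasure lborel (dcone r (B :: 'a::euclidean_space set)) < top"
proof -
  have "dcone r B \<subseteq> ball 0 r" by (auto simp: dcone_def)
  then have "bounded (dcone r B)" using bounded_ball bounded_subset by blast
  then show ?thesis using emeasure_bounded_finite by (metis infinity_ennreal_def)
qed

text \<open>The right side is the chord over \<open>[0, 1]\<close> of the convex left side.\<close>

lemma one_plus_power_le: "0 \<le> \<delta> \<Longrightarrow> \<delta> \<le> 1 \<Longrightarrow> (1 + \<delta>) ^ k \<le> 1 + (2 ^ k - 1) * (\<delta>::real)"
proof (induction k)
  case (Suc k)
  have "(1 + \<delta>) ^ Suc k \<le> (1 + \<delta>) * (1 + (2 ^ k - 1) * \<delta>)" using Suc by (auto intro!: mult_left_mono)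
  also have "\<dots> = 1 + (2 ^ k) * \<delta> + (2 ^ k - 1) * (\<delta> * \<delta>)" by (simp add: algebra_simps)
  also have "\<dots> \<le> 1 + (2 ^ k) * \<delta> + (2 ^ k - 1) * (\<delta> * 1)"
    using Suc.prems by (intro add_left_mono mult_left_mono) auto
  finally show ?case by (simp add: algebra_simps)
qed simp

lemma shell_power_le:
  assumes "0 \<le> \<delta>" "\<delta> \<le> 1"
  shows "(1 + \<delta>) ^ k - (1 - \<delta>) ^ k \<le> (2 ^ k + real k) * (\<delta>::real)"
proof -
  have "1 + real k * (- \<delta>) \<le> (1 + (- \<delta>)) ^ k" by (rule Bernoulli_inequality) (use assms in auto)
  moreover have "(1 + \<delta>) ^ k \<le> 1 + (2 ^ k - 1) * \<delta>" by (rule one_plus_power_le[OF assms])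
  ultimately show ?thesis using assms by (simp add: algebra_simps)
qed

definition cone_const :: "'a::euclidean_space itself \<Rightarrow> real" where
  "cone_const _ = tube_const TYPE('a) * (2 ^ DIM('a) + real DIM('a))"

lemma cone_const_pos: "cone_const TYPE('a::euclidean_space) > 0"
  unfolding cone_const_def using tube_const_pos[where 'a='a] by (intro mult_pos_pos add_pos_nonneg) auto

text \<open>The \<open>\<delta>\<close>-tube around \<open>K\<close> lies in the shell between the
  radii \<open>1 - \<delta>\<close> and \<open>1 + \<delta>\<close> over the
  \<open>2 * \<delta>\<close>-neighbourhood of \<open>K\<close>. By homogeneity the shell has at
  most a multiple of \<open>\<delta>\<close> times the volume of the unit cone over that
  neighbourhood. The tube bound divides by \<open>\<delta>\<close>, and as \<open>\<delta>\<close>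
  tends to 0 the cones decrease to the cone over the closed set \<open>K\<close>.\<close>

lemma hausdorff_outer_sphere_le_cone:
  fixes K :: "'a::euclidean_space set"
  assumes K: "compact K" "K \<subseteq> sphere 0 1"
  shows "hausdorff_outer (DIM('a) - 1) K \<le> ennreal (cone_const TYPE('a)) * emeasure lborel (dcone 1 K)"
proof (cases "K = {}")
  case False
  define Kd where "Kd \<delta> = {x. infdist x K \<le> \<delta>}" for \<delta>
  have clK: "closed K" using K compact_imp_closed by blast
  have cl: "closed (Kd \<delta>)" for \<delta> unfolding Kd_def by (intro closed_Collect_le continuous_intros)
  have bor: "Kd \<delta> \<in> sets borel" for \<delta> using cl by (rule borel_closed)
  have tube: "hausdorff_premeasure (DIM('a) - 1) (2 * \<delta>) K \<le> ennreal (cone_const TYPE('a)) * emeasure lborel (dcone 1 (Kd (2 * \<delta>)))"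
    if \<delta>: "0 < \<delta>" "\<delta> < 1" for \<delta>
  proof -
    let ?B = "Kd (2 * \<delta>)" and ?e = "emeasure lborel (dcone 1 (Kd (2 * \<delta>)))"
    have "(\<Union>a\<in>K. ball a \<delta>) \<subseteq> dcone (1 + \<delta>) ?B - dcone (1 - \<delta>) ?B"
    proof
      fix y assume "y \<in> (\<Union>a\<in>K. ball a \<delta>)"
      then obtain a where a: "a \<in> K" "dist a y < \<delta>" by auto
      have na: "norm a = 1" using a K by auto
      have ny: "1 - \<delta> < norm y" "norm y < 1 + \<delta>"
        using norm_triangle_ineq2[of a y] norm_triangle_ineq2[of y a] a na by (auto simp: dist_norm norm_minus_commute)
      then have y0: "y \<noteq> 0" using \<delta> by auto
      have "y - sgn y = (norm y - 1) *\<^sub>R sgn y" using y0 by (simp add: sgn_div_norm algebra_simps)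
      then have "norm (y - sgn y) = \<bar>norm y - 1\<bar>" using y0 by (simp add: norm_sgn)
      then have "dist a (sgn y) \<le> 2 * \<delta>"
        using dist_triangle[of a "sgn y" y] a ny by (auto simp: dist_norm)
      then have "sgn y \<in> ?B" using infdist_le2[OF a(1), of "sgn y" "2 * \<delta>"] by (simp add: Kd_def dist_commute)
      then show "y \<in> dcone (1 + \<delta>) ?B - dcone (1 - \<delta>) ?B" using ny y0 by (auto simp: dcone_def)
    qed
    then have "emeasure lborel (\<Union>a\<in>K. ball a \<delta>) \<le> emeasure lborel (dcone (1 + \<delta>) ?B - dcone (1 - \<delta>) ?B)"
      by (intro emeasure_mono) (auto intro!: dcone_borel bor)
    also have "\<dots> = emeasure lborel (dcone (1 + \<delta>) ?B) - emeasure lborel (dcone (1 - \<delta>) ?B)"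
      using emeasure_dcone_finite[of "1 - \<delta>" ?B] \<delta>
      by (intro emeasure_Diff) (auto simp: dcone_borel bor, auto simp: dcone_def)
    also have "\<dots> = ennreal ((1 + \<delta>) ^ DIM('a) - (1 - \<delta>) ^ DIM('a)) * ?e"
    proof -
      obtain e where e: "?e = ennreal e" "e \<ge> 0"
        using emeasure_dcone_finite[of 1 ?B] by (cases ?e) auto
      have p: "0 \<le> (1 - \<delta>) ^ DIM('a)" "0 \<le> (1 + \<delta>) ^ DIM('a)" using \<delta> by auto
      have 1: "emeasure lborel (dcone (1 + \<delta>) ?B) = ennreal ((1 + \<delta>) ^ DIM('a) * e)"
        using \<delta> p e by (subst emeasure_dcone_scale[OF bor]) (auto simp: ennreal_mult)
      have 2: "emeasure lborel (dcone (1 - \<delta>) ?B) = ennreal ((1 - \<delta>) ^ DIM('a) * e)"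
        using \<delta> p e by (subst emeasure_dcone_scale[OF bor]) (auto simp: ennreal_mult)
      have "ennreal ((1 + \<delta>) ^ DIM('a) * e) - ennreal ((1 - \<delta>) ^ DIM('a) * e)
          = ennreal (((1 + \<delta>) ^ DIM('a) - (1 - \<delta>) ^ DIM('a)) * e)"
        unfolding left_diff_distrib using p e by (intro ennreal_minus) auto
      then show ?thesis unfolding 1 2 using e by (simp only: ennreal_mult'')
    qed
    also have "\<dots> \<le> ennreal ((2 ^ DIM('a) + real DIM('a)) * \<delta>) * ?e"
      using shell_power_le[of \<delta> "DIM('a)"] \<delta> by (intro mult_right_mono ennreal_leI) auto
    finally have "emeasure lborel (\<Union>a\<in>K. ball a \<delta>) \<le> ennreal ((2 ^ DIM('a) + real DIM('a)) * \<delta>) * ?e" .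
    then have "ennreal (tube_const TYPE('a) / \<delta>) * emeasure lborel (\<Union>a\<in>K. ball a \<delta>) \<le>
       ennreal (tube_const TYPE('a) / \<delta>) * (ennreal ((2 ^ DIM('a) + real DIM('a)) * \<delta>) * ?e)"
      by (rule mult_left_mono) simp
    also have "\<dots> = ennreal (tube_const TYPE('a) / \<delta> * ((2 ^ DIM('a) + real DIM('a)) * \<delta>)) * ?e"
      using \<delta> tube_const_pos[where 'a='a] by (subst ennreal_mult) (auto simp: mult.assoc)
    also have "tube_const TYPE('a) / \<delta> * ((2 ^ DIM('a) + real DIM('a)) * \<delta>) = cone_const TYPE('a)"
      using \<delta> by (simp add: cone_const_def)
    finally show ?thesis
      using hausdorff_premeasure_tube[OF compact_imp_bounded[OF K(1)] \<delta>(1)] by (rule order_trans[rotated])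
  qed
  define \<delta> where "\<delta> k = inverse (real (Suc (Suc k)))" for k
  have \<delta>: "0 < \<delta> k" "\<delta> k < 1" for k by (auto simp: \<delta>_def inverse_eq_divide)
  have dec: "decseq (\<lambda>k. dcone 1 (Kd (2 * \<delta> k)))"
  proof (rule decseq_SucI)
    fix k
    have "\<delta> (Suc k) \<le> \<delta> k" by (simp add: \<delta>_def)
    then show "dcone 1 (Kd (2 * \<delta> (Suc k))) \<subseteq> dcone 1 (Kd (2 * \<delta> k))" by (auto simp: dcone_def Kd_def)
  qed
  have lim0: "\<delta> \<longlonglongrightarrow> 0"
    unfolding \<delta>_def by (rule LIMSEQ_Suc[OF LIMSEQ_inverse_real_of_nat])
  have int: "(\<Inter>k. dcone 1 (Kd (2 * \<delta> k))) = dcone 1 K"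
  proof (intro equalityI subsetI)
    fix y assume y: "y \<in> (\<Inter>k. dcone 1 (Kd (2 * \<delta> k)))"
    then have "infdist (sgn y) K \<le> 2 * \<delta> k" for k by (auto simp: dcone_def Kd_def)
    moreover have "(\<lambda>k. 2 * \<delta> k) \<longlonglongrightarrow> 2 * 0" by (intro tendsto_intros lim0)
    ultimately have "infdist (sgn y) K \<le> 0" using LIMSEQ_le_const[of "\<lambda>k. 2 * \<delta> k" 0] by auto
    then have "infdist (sgn y) K = 0" using infdist_nonneg by (metis antisym)
    then have "sgn y \<in> K" using in_closed_iff_infdist_zero[OF clK False] by blast
    then show "y \<in> dcone 1 K" using y by (auto simp: dcone_def)
  next
    fix y assume "y \<in> dcone 1 K"
    then show "y \<in> (\<Inter>k. dcone 1 (Kd (2 * \<delta> k)))" using \<delta>(1) less_imp_le by (force simp: dcone_def Kd_def)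
  qed
  have "(\<lambda>k. emeasure lborel (dcone 1 (Kd (2 * \<delta> k)))) \<longlonglongrightarrow> emeasure lborel (\<Inter>k. dcone 1 (Kd (2 * \<delta> k)))"
    by (rule Lim_emeasure_decseq[OF _ dec]) (auto intro!: dcone_borel bor simp: less_imp_neq[OF emeasure_dcone_finite])
  then have lim: "(\<lambda>k. ennreal (cone_const TYPE('a)) * emeasure lborel (dcone 1 (Kd (2 * \<delta> k)))) \<longlonglongrightarrow>
      ennreal (cone_const TYPE('a)) * emeasure lborel (dcone 1 K)"
    unfolding int by (intro ennreal_tendsto_cmult) auto
  have "hausdorff_premeasure (DIM('a) - 1) \<epsilon> K \<le> ennreal (cone_const TYPE('a)) * emeasure lborel (dcone 1 K)" if "\<epsilon> > 0" for \<epsilon>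
  proof (rule LIMSEQ_le_const[OF lim])
    have "\<forall>\<^sub>F k in sequentially. \<delta> k < \<epsilon> / 2" using lim0 that by (intro order_tendstoD) auto
    then obtain N where N: "\<And>k. k \<ge> N \<Longrightarrow> \<delta> k < \<epsilon> / 2" by (auto simp: eventually_sequentially)
    have "hausdorff_premeasure (DIM('a) - 1) \<epsilon> K \<le> ennreal (cone_const TYPE('a)) * emeasure lborel (dcone 1 (Kd (2 * \<delta> k)))" if "k \<ge> N" for k
      by (rule order_trans[OF hausdorff_premeasure_antimono tube[OF \<delta>]]) (use N[OF that] in auto)
    then show "\<exists>N. \<forall>k\<ge>N. hausdorff_premeasure (DIM('a) - 1) \<epsilon> K \<le> ennreal (cone_const TYPE('a)) * emeasure lborel (dcone 1 (Kd (2 * \<delta> k)))"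
      by blast
  qed
  then show ?thesis unfolding hausdorff_outer_def by (intro SUP_least) auto
qed simp

section \<open>Integrals over spheres\<close>

lemma nn_integral_mono_measure_eq_sets:
  assumes s: "sets M = sets N" and le: "\<And>A. A \<in> sets M \<Longrightarrow> emeasure M A \<le> emeasure N A"
  shows "integral\<^sup>N M f \<le> integral\<^sup>N N f"
proof -
  have sp: "space M = space N" using s by (rule sets_eq_imp_space_eq)
  have sf: "simple_function M g \<longleftrightarrow> simple_function N g" for g :: "'a \<Rightarrow> ennreal"
    using s sp by (simp add: simple_function_def)
  have "integral\<^sup>S M g \<le> integral\<^sup>S N g" if "simple_function M g" for g
    unfolding simple_integral_def using that le sp
    by (auto intro!: sum_mono mult_left_mono simp: simple_function_def)
  then show ?thesis unfolding nn_integral_def sf[symmetric] by (intro SUP_mono) auto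
qed

text \<open>One inequality is the Lipschitz bound for the dilation, the other the same bound for its
  inverse.\<close>

lemma hausdorff_outer_scale:
  fixes A :: "'a::real_normed_vector set"
  assumes c: "c > 0"
  shows "hausdorff_outer s ((\<lambda>x. c *\<^sub>R x) ` A) = ennreal (c ^ s) * hausdorff_outer s A"
proof (rule antisym)
  have lip: "hausdorff_outer s ((\<lambda>x. c *\<^sub>R x) ` A) \<le> ennreal (c ^ s) * hausdorff_outer s A"
    if "c > 0" for c and A :: "'a set"
    by (rule hausdorff_outer_lipschitz_image[OF that]) (use that in \<open>auto simp: dist_norm simp flip: scaleR_diff_right\<close>)
  show "hausdorff_outer s ((\<lambda>x. c *\<^sub>R x) ` A) \<le> ennreal (c ^ s) * hausdorff_outer s A" by (rule lip[OF c])
  have "A = (\<lambda>x. (1/c) *\<^sub>R x) ` (\<lambda>x. c *\<^sub>R x) ` A" using c by (simp add: image_image)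
  then have "hausdorff_outer s A \<le> ennreal ((1/c) ^ s) * hausdorff_outer s ((\<lambda>x. c *\<^sub>R x) ` A)"
    using lip[of "1/c" "(\<lambda>x. c *\<^sub>R x) ` A"] c by simp
  then have "ennreal (c ^ s) * hausdorff_outer s A \<le> ennreal (c ^ s) * (ennreal ((1/c) ^ s) * hausdorff_outer s ((\<lambda>x. c *\<^sub>R x) ` A))"
    by (rule mult_left_mono) simp
  also have "\<dots> = ennreal (c ^ s * (1/c) ^ s) * hausdorff_outer s ((\<lambda>x. c *\<^sub>R x) ` A)"
    using c by (simp add: ennreal_mult mult.assoc)
  also have "c ^ s * (1/c) ^ s = 1" using c by (simp add: power_one_over)
  finally show "ennreal (c ^ s) * hausdorff_outer s A \<le> hausdorff_outer s ((\<lambda>x. c *\<^sub>R x) ` A)" by simp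
qed

lemma hausdorff_measure_scale:
  assumes c: "c > 0"
  shows "(hausdorff_measure s :: 'a::euclidean_space measure) =
    scale_measure (ennreal (c ^ s)) (distr (hausdorff_measure s) borel (\<lambda>x. c *\<^sub>R x))"
proof (rule measure_eqI)
  fix A :: "'a set" assume "A \<in> sets (hausdorff_measure s)"
  then have A: "A \<in> sets borel" by simp
  have m: "(\<lambda>x. c *\<^sub>R x) \<in> borel_measurable (borel :: 'a measure)" by measurable
  have vb: "(\<lambda>x. c *\<^sub>R x) -` A \<in> sets borel" using measurable_sets[OF m A] by simp
  have "A = (\<lambda>x. c *\<^sub>R x) ` ((\<lambda>x. c *\<^sub>R x) -` A)"
  proof -
    have "x \<in> (\<lambda>x. c *\<^sub>R x) ` ((\<lambda>x. c *\<^sub>R x) -` A)" if "x \<in> A" for x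
      using that c by (intro image_eqI[of _ _ "(1/c) *\<^sub>R x"]) auto
    then show ?thesis by auto
  qed
  then have "hausdorff_outer s A = ennreal (c ^ s) * hausdorff_outer s ((\<lambda>x. c *\<^sub>R x) -` A)"
    using hausdorff_outer_scale[OF c] by metis
  then show "emeasure (hausdorff_measure s) A = emeasure (scale_measure (ennreal (c ^ s)) (distr (hausdorff_measure s) borel (\<lambda>x. c *\<^sub>R x))) A"
    using A vb by (simp add: emeasure_hausdorff_measure emeasure_distr)
qed simp

lemma measurable_indicator_mult:
  fixes f :: "'a::euclidean_space \<Rightarrow> real"
  assumes "continuous_on S f" "S \<in> sets borel"
  shows "(\<lambda>x. indicator S x * f x) \<in> borel_measurable borel"
  using borel_measurable_continuous_on_indicator[OF assms(2,1)] by simp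

lemma hausdorff_sphere_integral_scale:
  fixes f :: "'a::euclidean_space \<Rightarrow> real"
  assumes t: "t > 0" and f: "continuous_on (sphere 0 t) f" "\<And>x. norm x = t \<Longrightarrow> 0 \<le> f x"
  shows "(LINT y:sphere 0 t|hausdorff_measure s. f y) = t ^ s * (\<integral>w. indicator (sphere 0 1) w * f (t *\<^sub>R w) \<partial>hausdorff_measure s)"
proof -
  let ?H = "hausdorff_measure s :: 'a measure"
  let ?g = "\<lambda>y. indicator (sphere 0 t) y * f y"
  have gm: "?g \<in> borel_measurable borel" by (rule measurable_indicator_mult[OF f(1)]) (auto intro: borel_closed)
  have g0: "0 \<le> ?g y" for y using f(2) by (auto simp: indicator_def)
  have eq: "?g (t *\<^sub>R w) = indicator (sphere 0 1) w * f (t *\<^sub>R w)" for w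
    using t by (auto simp: indicator_def)
  have m: "(\<lambda>x. t *\<^sub>R x) \<in> measurable ?H borel" by measurable
  have gm2: "(\<lambda>w. ?g (t *\<^sub>R w)) \<in> borel_measurable ?H" using measurable_compose[OF m gm] .
  have "(LINT y:sphere 0 t|?H. f y) = (\<integral>y. ?g y \<partial>?H)" by (simp add: set_lebesgue_integral_def)
  also have "\<dots> = enn2real (\<integral>\<^sup>+y. ennreal (?g y) \<partial>?H)"
    by (rule integral_eq_nn_integral) (use gm g0 in auto)
  also have "(\<integral>\<^sup>+y. ennreal (?g y) \<partial>?H) = (\<integral>\<^sup>+y. ennreal (?g y) \<partial>scale_measure (ennreal (t ^ s)) (distr ?H borel (\<lambda>x. t *\<^sub>R x)))"
    using hausdorff_measure_scale[OF t, of s] by metis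
  also have "\<dots> = ennreal (t ^ s) * (\<integral>\<^sup>+y. ennreal (?g y) \<partial>distr ?H borel (\<lambda>x. t *\<^sub>R x))"
    by (rule nn_integral_scale_measure) (use gm in auto)
  also have "(\<integral>\<^sup>+y. ennreal (?g y) \<partial>distr ?H borel (\<lambda>x. t *\<^sub>R x)) = (\<integral>\<^sup>+w. ennreal (?g (t *\<^sub>R w)) \<partial>?H)"
    by (rule nn_integral_distr[OF m]) (use gm in auto)
  also have "enn2real (ennreal (t ^ s) * (\<integral>\<^sup>+w. ennreal (?g (t *\<^sub>R w)) \<partial>?H)) = t ^ s * enn2real (\<integral>\<^sup>+w. ennreal (?g (t *\<^sub>R w)) \<partial>?H)"
    using t by (simp add: enn2real_mult)
  also have "enn2real (\<integral>\<^sup>+w. ennreal (?g (t *\<^sub>R w)) \<partial>?H) = (\<integral>w. ?g (t *\<^sub>R w) \<partial>?H)"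
    by (rule integral_eq_nn_integral[symmetric]) (use gm2 g0 in auto)
  finally show ?thesis unfolding eq .
qed

lemma hausdorff_outer_sphere_subset_finite:
  "hausdorff_outer (DIM('a) - 1) (sphere 0 1 :: 'a::euclidean_space set) < top"
proof -
  have "hausdorff_outer (DIM('a) - 1) (sphere 0 1 :: 'a set) \<le> ennreal (cone_const TYPE('a)) * emeasure lborel (dcone 1 (sphere 0 1 :: 'a set))"
    by (rule hausdorff_outer_sphere_le_cone) auto
  also have "\<dots> < top" using emeasure_dcone_finite[of 1 "sphere 0 1 :: 'a set"] by (simp add: ennreal_mult_less_top)
  finally show ?thesis .
qed

lemma borel_measurable_sgn_euclidean: "(sgn :: 'a::euclidean_space \<Rightarrow> 'a) \<in> borel_measurable borel"
proof -
  have "continuous_on (- {0}) (sgn :: 'a \<Rightarrow> 'a)" unfolding sgn_div_norm by (intro continuous_intros) auto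
  then have "(\<lambda>x. indicator (- {0}) x *\<^sub>R sgn x :: 'a) \<in> borel_measurable borel"
    by (intro borel_measurable_continuous_on_indicator) auto
  also have "(\<lambda>x. indicator (- {0}) x *\<^sub>R sgn x :: 'a) = sgn" by (auto simp: fun_eq_iff indicator_def)
  finally show ?thesis .
qed

text \<open>A one-sided form of polar coordinates. On compact sets it is the cone bound. The
  Hausdorff measure restricted to the sphere is finite, so inner regularity carries the bound to
  Borel sets and then to integrals; the right side integrates against the image under
  \<open>sgn\<close> of Lebesgue measure on the punctured ball.\<close>

lemma hausdorff_sphere_nn_integral_le_cone:
  fixes g :: "'a::euclidean_space \<Rightarrow> ennreal"
  assumes g: "g \<in> borel_measurable borel"
  shows "(\<integral>\<^sup>+w. indicator (sphere 0 1) w * g w \<partial>hausdorff_measure (DIM('a) - 1)) \<le>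
    ennreal (cone_const TYPE('a)) * (\<integral>\<^sup>+y. indicator (ball 0 1 - {0}) y * g (sgn y) \<partial>lborel)"
proof -
  let ?H = "hausdorff_measure (DIM('a) - 1) :: 'a measure"
  have S: "sphere 0 1 \<in> sets (borel :: 'a measure)" "ball 0 1 - {0} \<in> sets (borel :: 'a measure)" by (auto intro: borel_closed)
  have im: "(indicator (sphere 0 1) :: 'a \<Rightarrow> ennreal) \<in> borel_measurable ?H"
    using S by (simp add: borel_measurable_indicator_iff)
  define M where "M = density ?H (indicator (sphere 0 1))"
  have im2: "(indicator (ball 0 1 - {0}) :: 'a \<Rightarrow> ennreal) \<in> borel_measurable lborel"
    using S by (simp add: borel_measurable_indicator_iff)
  define D where "D = density lborel (indicator (ball (0::'a) 1 - {0}))"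
  define N where "N = scale_measure (ennreal (cone_const TYPE('a))) (distr D borel sgn)"
  have sM: "sets M = sets borel" by (simp add: M_def)
  have sg: "sgn \<in> measurable D borel" using borel_measurable_sgn_euclidean by (simp add: D_def)
  have M: "emeasure M B = hausdorff_outer (DIM('a) - 1) (B \<inter> sphere 0 1)" if "B \<in> sets borel" for B
    using that S im unfolding M_def by (subst emeasure_density)
      (auto simp: emeasure_hausdorff_measure Int_commute simp flip: indicator_inter_arith)
  have N: "emeasure N B = ennreal (cone_const TYPE('a)) * emeasure lborel (dcone 1 B)" if B: "B \<in> sets borel" for B
  proof -
    have sB: "sgn -` B \<in> sets (borel :: 'a measure)" using measurable_sets[OF borel_measurable_sgn_euclidean B] by simp
    have "emeasure (distr D borel sgn) B = emeasure D (sgn -` B)" using emeasure_distr[OF sg B] by (simp add: D_def)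
    also have "\<dots> = emeasure lborel ((ball 0 1 - {0}) \<inter> sgn -` B)"
      unfolding D_def using sB S im2 by (subst emeasure_density) (auto simp flip: indicator_inter_arith)
    also have "(ball 0 1 - {0}) \<inter> sgn -` B = dcone 1 B" by (auto simp: dcone_def)
    finally show ?thesis by (simp add: N_def)
  qed
  have le: "emeasure M B \<le> emeasure N B" if "B \<in> sets M" for B
  proof -
    have B: "B \<in> sets borel" using that sM by simp
    have fin: "emeasure M (space M) \<noteq> \<infinity>"
      using M[of UNIV] hausdorff_outer_sphere_subset_finite[where 'a='a] by (simp add: M_def)
    have "emeasure M B = (SUP K \<in> {K. K \<subseteq> B \<and> compact K}. emeasure M K)"
      by (rule inner_regular[OF sM fin B])
    also have "\<dots> \<le> emeasure N B"
    proof (rule SUP_least, clarify)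
      fix K assume K: "K \<subseteq> B" "compact K"
      then have Kb: "K \<in> sets borel" by (intro borel_closed compact_imp_closed)
      have "emeasure M K = hausdorff_outer (DIM('a) - 1) (K \<inter> sphere 0 1)" by (rule M[OF Kb])
      also have "\<dots> \<le> ennreal (cone_const TYPE('a)) * emeasure lborel (dcone 1 (K \<inter> sphere 0 1))"
        by (rule hausdorff_outer_sphere_le_cone) (use K in auto)
      also have "\<dots> \<le> ennreal (cone_const TYPE('a)) * emeasure lborel (dcone 1 B)"
        by (intro mult_left_mono emeasure_mono) (use K B in \<open>auto simp: dcone_def intro!: dcone_borel[unfolded dcone_def]\<close>)
      finally show "emeasure M K \<le> emeasure N B" by (simp add: N[OF B])
    qed
    finally show ?thesis .
  qed
  have "(\<integral>\<^sup>+w. indicator (sphere 0 1) w * g w \<partial>?H) = integral\<^sup>N M g"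
    unfolding M_def by (rule nn_integral_density[symmetric]) (use g im in auto)
  also have "\<dots> \<le> integral\<^sup>N N g"
    by (rule nn_integral_mono_measure_eq_sets) (use le sM in \<open>auto simp: N_def\<close>)
  also have "\<dots> = ennreal (cone_const TYPE('a)) * integral\<^sup>N (distr D borel sgn) g"
    unfolding N_def by (rule nn_integral_scale_measure) (use g in auto)
  also have "integral\<^sup>N (distr D borel sgn) g = (\<integral>\<^sup>+y. g (sgn y) \<partial>D)"
    by (rule nn_integral_distr[OF sg]) (use g in simp)
  also have "\<dots> = (\<integral>\<^sup>+y. indicator (ball 0 1 - {0}) y * g (sgn y) \<partial>lborel)"
    unfolding D_def by (rule nn_integral_density) (use measurable_compose[OF borel_measurable_sgn_euclidean g] im2 in auto)
  finally show ?thesis .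
qed

lemma hausdorff_sphere_integral_le_cone:
  fixes f :: "'a::euclidean_space \<Rightarrow> real"
  assumes f: "continuous_on (sphere 0 1) f" "\<And>x. norm x = 1 \<Longrightarrow> 0 \<le> f x"
  shows "(\<integral>w. indicator (sphere 0 1) w * f w \<partial>hausdorff_measure (DIM('a) - 1)) \<le>
    cone_const TYPE('a) * (\<integral>y. indicator (ball 0 1 - {0}) y * f (sgn y) \<partial>lborel)"
    and "integrable lborel (\<lambda>y. indicator (ball 0 1 - {0}) y * f (sgn y))"
    and "integrable (hausdorff_measure (DIM('a) - 1)) (\<lambda>w. indicator (sphere 0 1) w * f w)"
proof -
  let ?H = "hausdorff_measure (DIM('a) - 1) :: 'a measure"
  let ?g = "\<lambda>y. indicator (sphere 0 1) y * f y"
  have gm: "?g \<in> borel_measurable borel" by (rule measurable_indicator_mult[OF f(1)]) (auto intro: borel_closed)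
  have g0: "0 \<le> ?g y" for y using f(2) by (auto simp: indicator_def)
  have "bounded (f ` sphere 0 1)" by (intro compact_imp_bounded compact_continuous_image f) auto
  then obtain K where "\<forall>x\<in>f ` sphere 0 1. norm x \<le> K" unfolding bounded_iff by blast
  then have "norm y = 1 \<Longrightarrow> \<bar>f y\<bar> \<le> K" for y by auto
  then have K: "norm (?g y) \<le> \<bar>K\<bar> * indicator (sphere 0 1) y" for y
    by (cases "norm y = 1") (fastforce simp: indicator_def)+
  have H1: "emeasure ?H (sphere 0 1) < \<infinity>"
    using hausdorff_outer_sphere_subset_finite[where 'a='a] by (subst emeasure_hausdorff_measure) (auto intro: borel_closed)
  show int: "integrable ?H ?g"
    by (rule Bochner_Integration.integrable_bound[of _ "\<lambda>y. \<bar>K\<bar> * indicator (sphere 0 1) y"])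
      (use H1 gm K in \<open>auto intro!: integrable_mult_right integrable_real_indicator borel_closed\<close>)
  have eq: "indicator (ball 0 1 - {0}) y * f (sgn y) = indicator (ball 0 1 - {0}) y * ?g (sgn y)" for y
    by (auto simp: indicator_def norm_sgn)
  have gm2: "(\<lambda>y. indicator (ball 0 1 - {0}) y * ?g (sgn y)) \<in> borel_measurable lborel"
  proof -
    have "(indicator (ball 0 1 - {0}) :: 'a \<Rightarrow> real) \<in> borel_measurable borel" by (rule borel_measurable_indicator) simp
    then show ?thesis
      unfolding measurable_lborel2
      by (rule borel_measurable_times[OF _ measurable_compose[OF borel_measurable_sgn_euclidean gm]])
  qed
  show int2: "integrable lborel (\<lambda>y. indicator (ball 0 1 - {0}) y * f (sgn y))"
    unfolding eq
  proof (rule Bochner_Integration.integrable_bound[OF _ gm2])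
    show "integrable lborel (\<lambda>y::'a. indicator (ball 0 1) y * \<bar>K\<bar>)"
      by (intro integrable_ball_continuous continuous_intros)
    show "AE y in lborel. norm (indicator (ball 0 1 - {0}) y * ?g (sgn y)) \<le> norm (indicator (ball 0 1) y * \<bar>K\<bar>)"
    proof (rule AE_I2)
      fix y :: 'a
      have "indicator (sphere 0 1) (sgn y) \<le> (1::real)" by (simp add: indicator_def)
      then have "norm (?g (sgn y)) \<le> \<bar>K\<bar>" using K[of "sgn y"] mult_left_le[of "indicator (sphere 0 1) (sgn y)" "\<bar>K\<bar>"] by linarith
      then show "norm (indicator (ball 0 1 - {0}) y * ?g (sgn y)) \<le> norm (indicator (ball 0 1) y * \<bar>K\<bar>)"
        by (simp only: indicator_def split: if_split) auto
    qed
  qed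
  have "ennreal (\<integral>w. ?g w \<partial>?H) = (\<integral>\<^sup>+w. ennreal (?g w) \<partial>?H)"
    by (rule nn_integral_eq_integral[symmetric, OF int]) (use g0 in auto)
  also have "\<dots> = (\<integral>\<^sup>+w. indicator (sphere 0 1) w * ennreal (?g w) \<partial>?H)"
    by (intro nn_integral_cong) (auto simp: indicator_def)
  also have "\<dots> \<le> ennreal (cone_const TYPE('a)) * (\<integral>\<^sup>+y. indicator (ball 0 1 - {0}) y * ennreal (?g (sgn y)) \<partial>lborel)"
    by (rule hausdorff_sphere_nn_integral_le_cone) (use gm in auto)
  also have "(\<integral>\<^sup>+y. indicator (ball 0 1 - {0}) y * ennreal (?g (sgn y)) \<partial>lborel) = (\<integral>\<^sup>+y. ennreal (indicator (ball 0 1 - {0}) y * f (sgn y)) \<partial>lborel)"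
    by (intro nn_integral_cong) (auto simp: indicator_def norm_sgn)
  also have "\<dots> = ennreal (\<integral>y. indicator (ball 0 1 - {0}) y * f (sgn y) \<partial>lborel)"
    by (rule nn_integral_eq_integral[OF int2]) (use f(2) in \<open>auto simp: indicator_def norm_sgn\<close>)
  also have "ennreal (cone_const TYPE('a)) * \<dots> = ennreal (cone_const TYPE('a) * (\<integral>y. indicator (ball 0 1 - {0}) y * f (sgn y) \<partial>lborel))"
    using cone_const_pos[where 'a='a] by (intro ennreal_mult[symmetric] Bochner_Integration.integral_nonneg)
      (use f(2) in \<open>auto simp: indicator_def norm_sgn\<close>)
  finally show "(\<integral>w. ?g w \<partial>?H) \<le> cone_const TYPE('a) * (\<integral>y. indicator (ball 0 1 - {0}) y * f (sgn y) \<partial>lborel)"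
    using cone_const_pos[where 'a='a] f(2)
    by (subst (asm) ennreal_le_iff) (auto intro!: mult_nonneg_nonneg Bochner_Integration.integral_nonneg simp: indicator_def norm_sgn)
qed

text \<open>On a thin shell \<open>f\<close> is within \<open>\<eta>\<close> of the function that is
  constant along rays and agrees with \<open>f\<close> on the sphere of radius \<open>t\<close>. The
  integral of the latter over a ball is homogeneous of degree \<open>DIM('a)\<close> in the radius,
  which yields the factor in front; then \<open>\<eta>\<close> tends to 0.\<close>

lemma shell_derivative_ge:
  fixes f :: "'a::euclidean_space \<Rightarrow> real"
  assumes t: "0 < t" "t < R" and f: "continuous_on (cball 0 R) f" "\<And>x. x \<in> cball 0 R \<Longrightarrow> 0 \<le> f x"
    and F: "((\<lambda>t. \<integral>y. indicator (ball 0 t) y * f y \<partial>lborel) has_real_derivative F') (at t)"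
  shows "real DIM('a) * t ^ (DIM('a) - 1) * (\<integral>y. indicator (ball 0 1 - {0}) y * f (t *\<^sub>R sgn y) \<partial>lborel) \<le> F'"
proof -
  define \<Phi> where "\<Phi> = (\<integral>y. indicator (ball 0 1 - {0}) y * f (t *\<^sub>R sgn y) \<partial>(lborel :: 'a measure))"
  define V where "V = unit_ball_vol (real DIM('a))"
  define F where "F \<tau> = (\<integral>y. indicator (ball 0 \<tau>) y * f y \<partial>lborel)" for \<tau>
  let ?m = "DIM('a)"
  have fc: "continuous_on (sphere 0 1) (\<lambda>w. f (t *\<^sub>R w))"
    by (rule continuous_on_compose2[OF f(1)]) (use t in \<open>auto intro!: continuous_intros\<close>)
  have f0: "0 \<le> f (t *\<^sub>R w)" if "norm w = 1" for w using f(2)[of "t *\<^sub>R w"] that t by simp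
  have hom: "(\<integral>y. indicator (ball 0 a - {0}) y * f (t *\<^sub>R sgn y) \<partial>lborel) = a ^ ?m * \<Phi>"
    "integrable lborel (\<lambda>y. indicator (ball 0 a - {0}) y * f (t *\<^sub>R sgn y))" if a: "a > 0" for a
  proof -
    have i1: "integrable lborel (\<lambda>y. indicator (ball 0 1 - {0}) y * f (t *\<^sub>R sgn y))"
      by (rule hausdorff_sphere_integral_le_cone(2)[OF fc f0])
    let ?g = "\<lambda>y. indicator (ball 0 a - {0}) y * f (t *\<^sub>R sgn y)"
    have e1: "?g (0 + a *\<^sub>R z) = indicator (ball 0 1 - {0}) z * f (t *\<^sub>R sgn z)" for z
      using a by (auto simp: indicator_def sgn_scaleR_pos)
    have e2: "?g y = (\<lambda>z. indicator (ball 0 1 - {0}) z * f (t *\<^sub>R sgn z)) ((1/a) *\<^sub>R y)" for y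
      using a by (auto simp: indicator_def sgn_scaleR_pos)
    have m1: "(\<lambda>z. indicator (ball 0 1 - {0}) z * f (t *\<^sub>R sgn z)) \<in> borel_measurable borel"
      using borel_measurable_integrable[OF i1] by simp
    have gm: "?g \<in> borel_measurable borel"
      unfolding e2 by (rule measurable_compose[OF _ m1]) simp
    show "(\<integral>y. ?g y \<partial>lborel) = a ^ ?m * \<Phi>"
      using integral_lborel_scale[OF gm a, of 0] unfolding e1 \<Phi>_def .
    obtain K where K: "\<And>x. x \<in> cball 0 R \<Longrightarrow> norm (f x) \<le> K"
      using continuous_on_cball_norm_bound[OF f(1)] by blast
    show "integrable lborel ?g"
    proof (rule Bochner_Integration.integrable_bound[of _ "\<lambda>y. indicator (ball 0 a) y * K"])
      show "integrable lborel (\<lambda>y::'a. indicator (ball 0 a) y * K)" by (intro integrable_ball_continuous continuous_intros)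
      show "AE x in lborel. norm (?g x) \<le> norm (indicator (ball 0 a) x * K)"
      proof (rule AE_I2)
        fix x :: 'a
        have "norm (f (t *\<^sub>R sgn x)) \<le> K" using t by (intro K) (auto simp: norm_sgn)
        then show "norm (?g x) \<le> norm (indicator (ball 0 a) x * K)" by (auto simp: indicator_def)
      qed
    qed (use gm in simp)
  qed
  have main: "real ?m * t ^ (?m - 1) * (\<Phi> - \<eta> * V) \<le> F'" if \<eta>: "\<eta> > 0" for \<eta>
  proof -
    have "uniformly_continuous_on (cball 0 R) f" by (intro compact_uniformly_continuous f) auto
    then obtain d where d: "d > 0" "\<And>x y. x \<in> cball 0 R \<Longrightarrow> y \<in> cball 0 R \<Longrightarrow> dist y x < d \<Longrightarrow> dist (f y) (f x) < \<eta>"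
      using \<eta> unfolding uniformly_continuous_on_def by metis
    define e where "e = min d (R - t)"
    have e: "e > 0" "e \<le> d" "t + e \<le> R" using d t by (auto simp: e_def)
    have ineq: "((t + h) ^ ?m - t ^ ?m) / h * (\<Phi> - \<eta> * V) \<le> (F (t + h) - F t) / h" if h: "0 < h" "h < e" for h
    proof -
      have Fi: "integrable lborel (\<lambda>y. indicator (ball 0 \<tau>) y * f y)" if "\<tau> \<le> R" for \<tau>
        by (rule integrable_ball_continuous) (rule continuous_on_subset[OF f(1)], use that in auto)
      have Vi: "integrable lborel (\<lambda>y::'a. indicator (ball 0 \<tau>) y * \<eta>)" for \<tau>
        by (intro integrable_ball_continuous continuous_intros)
      have Vv: "(\<integral>y. indicator (ball (0::'a) \<tau>) y * \<eta> \<partial>lborel) = \<tau> ^ ?m * (\<eta> * V)" if "\<tau> > 0" for \<tau>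
        using that by (simp add: content_ball V_def)
      have "((t + h) ^ ?m - t ^ ?m) * (\<Phi> - \<eta> * V) =
        ((t + h) ^ ?m * \<Phi> - (t + h) ^ ?m * (\<eta> * V)) - (t ^ ?m * \<Phi> - t ^ ?m * (\<eta> * V))" by (simp add: algebra_simps)
      also have "\<dots> = (\<integral>y. (indicator (ball 0 (t + h) - {0}) y * f (t *\<^sub>R sgn y) - indicator (ball 0 (t + h)) y * \<eta>)
          - (indicator (ball 0 t - {0}) y * f (t *\<^sub>R sgn y) - indicator (ball 0 t) y * \<eta>) \<partial>(lborel :: 'a measure))"
        using t h \<eta> hom[of "t + h"] hom[of t] Vi by (simp add: content_ball V_def algebra_simps)
      also have "\<dots> \<le> (\<integral>y. indicator (ball 0 (t + h)) y * f y - indicator (ball 0 t) y * f y \<partial>lborel)"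
      proof (rule integral_mono)
        show "integrable lborel (\<lambda>y. indicator (ball 0 (t + h)) y * f y - indicator (ball 0 t) y * f y)"
          using h e t by (intro Bochner_Integration.integrable_diff Fi) auto
        show "integrable lborel (\<lambda>y. (indicator (ball 0 (t + h) - {0}) y * f (t *\<^sub>R sgn y) - indicator (ball 0 (t + h)) y * \<eta>)
          - (indicator (ball 0 t - {0}) y * f (t *\<^sub>R sgn y) - indicator (ball 0 t) y * \<eta>))"
          using t h hom(2)[of "t + h"] hom(2)[of t] Vi by (intro Bochner_Integration.integrable_diff) auto
        fix y :: 'a
        show "(indicator (ball 0 (t + h) - {0}) y * f (t *\<^sub>R sgn y) - indicator (ball 0 (t + h)) y * \<eta>)
          - (indicator (ball 0 t - {0}) y * f (t *\<^sub>R sgn y) - indicator (ball 0 t) y * \<eta>)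
          \<le> indicator (ball 0 (t + h)) y * f y - indicator (ball 0 t) y * f y"
        proof (cases "t \<le> norm y \<and> norm y < t + h")
          case True
          then have y0: "y \<noteq> 0" using t by auto
          have "y - t *\<^sub>R sgn y = (norm y - t) *\<^sub>R sgn y" using y0 by (simp add: sgn_div_norm algebra_simps)
          then have "norm (y - t *\<^sub>R sgn y) = norm y - t" using y0 True by (simp add: norm_sgn)
          then have "dist (f y) (f (t *\<^sub>R sgn y)) < \<eta>"
            using True h e t y0 by (intro d) (auto simp: dist_norm norm_sgn)
          then show ?thesis using True y0 h by (auto simp: dist_real_def indicator_def)
        next
          case False
          then show ?thesis using h by (auto simp: indicator_def)
        qed
      qed
      also have "\<dots> = F (t + h) - F t"
        unfolding F_def using h e t by (intro Bochner_Integration.integral_diff Fi) auto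
      finally show ?thesis using h by (simp add: divide_right_mono)
    qed
    have F1: "((\<lambda>h. (F (t + h) - F t) / h) \<longlongrightarrow> F') (at_right 0)"
      using F unfolding DERIV_def F_def by (rule tendsto_within_subset) auto
    have "((\<lambda>x. x ^ ?m) has_real_derivative real ?m * t ^ (?m - 1)) (at t)"
      using DERIV_power[OF DERIV_ident, of ?m t] by simp
    then have "((\<lambda>h. ((t + h) ^ ?m - t ^ ?m) / h) \<longlongrightarrow> real ?m * t ^ (?m - 1)) (at_right 0)"
      unfolding DERIV_def by (rule tendsto_within_subset) auto
    then have F2: "((\<lambda>h. ((t + h) ^ ?m - t ^ ?m) / h * (\<Phi> - \<eta> * V)) \<longlongrightarrow> real ?m * t ^ (?m - 1) * (\<Phi> - \<eta> * V)) (at_right 0)"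
      by (intro tendsto_intros)
    show ?thesis
    proof (rule tendsto_le[OF _ F1 F2])
      show "\<forall>\<^sub>F h in at_right 0. ((t + h) ^ ?m - t ^ ?m) / h * (\<Phi> - \<eta> * V) \<le> (F (t + h) - F t) / h"
        using eventually_at_right_real[OF e(1)] by eventually_elim (use ineq in auto)
    qed simp
  qed
  have "((\<lambda>\<eta>. real ?m * t ^ (?m - 1) * (\<Phi> - \<eta> * V)) \<longlongrightarrow> real ?m * t ^ (?m - 1) * (\<Phi> - 0 * V)) (at_right 0)"
    by (intro tendsto_intros)
  then have "real ?m * t ^ (?m - 1) * (\<Phi> - 0 * V) \<le> F'"
    by (rule tendsto_upperbound) (rule eventually_mono[OF eventually_at_right_less main], simp_all)
  then show ?thesis by (simp add: \<Phi>_def)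
qed

text \<open>This is how the denominator of the frequency gets bounded by the derivative of the ball
  integral.\<close>

lemma hausdorff_sphere_integral_le_derivative:
  fixes f :: "'a::euclidean_space \<Rightarrow> real"
  assumes t: "0 < t" "t < R" and f: "continuous_on (cball 0 R) f" "\<And>x. x \<in> cball 0 R \<Longrightarrow> 0 \<le> f x"
    and F: "((\<lambda>t. \<integral>y. indicator (ball 0 t) y * f y \<partial>lborel) has_real_derivative F') (at t)"
  shows "(LINT y:sphere 0 t|hausdorff_measure (DIM('a) - 1). f y) \<le> cone_const TYPE('a) / DIM('a) * F'"
proof -
  have ft: "continuous_on (sphere 0 t) f" by (rule continuous_on_subset[OF f(1)]) (use t in auto)
  have f0: "0 \<le> f x" if "norm x = t" for x using f(2)[of x] that t by simp
  have fc: "continuous_on (sphere 0 1) (\<lambda>w. f (t *\<^sub>R w))"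
    by (rule continuous_on_compose2[OF f(1)]) (use t in \<open>auto intro!: continuous_intros\<close>)
  let ?\<Phi> = "\<integral>y. indicator (ball 0 1 - {0}) y * f (t *\<^sub>R sgn y) \<partial>lborel"
  have "(LINT y:sphere 0 t|hausdorff_measure (DIM('a) - 1). f y) =
      t ^ (DIM('a) - 1) * (\<integral>w. indicator (sphere 0 1) w * f (t *\<^sub>R w) \<partial>hausdorff_measure (DIM('a) - 1))"
    by (rule hausdorff_sphere_integral_scale[OF t(1) ft f0])
  also have "\<dots> \<le> t ^ (DIM('a) - 1) * (cone_const TYPE('a) * ?\<Phi>)"
    using t f0 by (intro mult_left_mono hausdorff_sphere_integral_le_cone(1)[OF fc]) auto
  also have "\<dots> = cone_const TYPE('a) / DIM('a) * (real DIM('a) * t ^ (DIM('a) - 1) * ?\<Phi>)" by simp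
  also have "\<dots> \<le> cone_const TYPE('a) / DIM('a) * F'"
    using cone_const_pos[where 'a='a] by (intro mult_left_mono shell_derivative_ge[OF t f F]) auto
  finally show ?thesis .
qed

text \<open>After dilation to the unit sphere this is dominated convergence. Continuity in the
  radius is wanted for the frequency, to locate the first radius at which it falls to the
  threshold.\<close>

lemma continuous_on_hausdorff_sphere_integral:
  fixes f :: "'a::euclidean_space \<Rightarrow> real"
  assumes f: "continuous_on (cball 0 R) f" "\<And>x. x \<in> cball 0 R \<Longrightarrow> 0 \<le> f x"
  shows "continuous_on {0<..R} (\<lambda>t. LINT y:sphere 0 t|hausdorff_measure (DIM('a) - 1). f y)"
proof -
  let ?H = "hausdorff_measure (DIM('a) - 1) :: 'a measure"
  have H1: "emeasure ?H (sphere 0 1) < \<infinity>"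
    using hausdorff_outer_sphere_subset_finite[where 'a='a] by (subst emeasure_hausdorff_measure) (auto intro: borel_closed)
  obtain K where K: "\<And>x. x \<in> cball 0 R \<Longrightarrow> norm (f x) \<le> K"
    using continuous_on_cball_norm_bound[OF f(1)] by blast
  have fc: "continuous_on (sphere 0 1) (\<lambda>w. f (t *\<^sub>R w))" if "t \<in> {0..R}" for t
    by (rule continuous_on_compose2[OF f(1)]) (use that in \<open>auto intro!: continuous_intros\<close>)
  have "continuous_on {0<..R} (\<lambda>t. \<integral>w. indicator (sphere 0 1) w * f (t *\<^sub>R w) \<partial>?H)"
    unfolding continuous_on_sequentially o_def
  proof (intro allI ballI impI, elim conjE)
    fix X t assume t: "t \<in> {0<..R}" and X: "\<forall>n. X n \<in> {0<..R}" "X \<longlonglongrightarrow> t"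
    show "(\<lambda>n. \<integral>w. indicator (sphere 0 1) w * f (X n *\<^sub>R w) \<partial>?H) \<longlonglongrightarrow> (\<integral>w. indicator (sphere 0 1) w * f (t *\<^sub>R w) \<partial>?H)"
    proof (rule integral_dominated_convergence[where w = "\<lambda>w. indicator (sphere 0 1) w * K"])
      have m: "(\<lambda>w. indicator (sphere 0 1) w * f (\<tau> *\<^sub>R w)) \<in> borel_measurable ?H" if "\<tau> \<in> {0<..R}" for \<tau>
        using measurable_indicator_mult[OF fc[of \<tau>]] that by (simp add: borel_closed)
      show "(\<lambda>w. indicator (sphere 0 1) w * f (t *\<^sub>R w)) \<in> borel_measurable ?H" by (rule m[OF t])
      show "(\<lambda>w. indicator (sphere 0 1) w * f (X n *\<^sub>R w)) \<in> borel_measurable ?H" for n by (rule m) (use X in auto)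
      show "integrable ?H (\<lambda>w. indicator (sphere 0 1) w * K)"
        using H1 by (intro integrable_mult_left integrable_real_indicator) (auto intro: borel_closed)
      show "AE w in ?H. (\<lambda>n. indicator (sphere 0 1) w * f (X n *\<^sub>R w)) \<longlonglongrightarrow> indicator (sphere 0 1) w * f (t *\<^sub>R w)"
      proof (rule AE_I2)
        fix w :: 'a
        show "(\<lambda>n. indicator (sphere 0 1) w * f (X n *\<^sub>R w)) \<longlonglongrightarrow> indicator (sphere 0 1) w * f (t *\<^sub>R w)"
        proof (cases "norm w = 1")
          case True
          have "(\<lambda>n. f (X n *\<^sub>R w)) \<longlonglongrightarrow> f (t *\<^sub>R w)"
          proof (rule continuous_on_tendsto_compose[OF f(1)])
            show "(\<lambda>n. X n *\<^sub>R w) \<longlonglongrightarrow> t *\<^sub>R w" by (intro tendsto_intros X)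
            show "t *\<^sub>R w \<in> cball 0 R" using t True by auto
            show "\<forall>\<^sub>F n in sequentially. X n *\<^sub>R w \<in> cball 0 R" using X(1) True by (auto intro!: always_eventually simp: abs_of_pos)
          qed
          then show ?thesis by (intro tendsto_mult tendsto_const)
        qed auto
      qed
      show "AE w in ?H. norm (indicator (sphere 0 1) w * f (X n *\<^sub>R w)) \<le> indicator (sphere 0 1) w * K" for n
      proof (rule AE_I2)
        fix w :: 'a
        show "norm (indicator (sphere 0 1) w * f (X n *\<^sub>R w)) \<le> indicator (sphere 0 1) w * K"
          using K[of "X n *\<^sub>R w"] spec[OF X(1), of n] by (cases "norm w = 1") auto
      qed
    qed
  qed
  then have "continuous_on {0<..R} (\<lambda>t. t ^ (DIM('a) - 1) * (\<integral>w. indicator (sphere 0 1) w * f (t *\<^sub>R w) \<partial>?H))"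
    by (intro continuous_intros)
  moreover have "t ^ (DIM('a) - 1) * (\<integral>w. indicator (sphere 0 1) w * f (t *\<^sub>R w) \<partial>?H) = (LINT y:sphere 0 t|?H. f y)"
    if "t \<in> {0<..R}" for t
    by (rule hausdorff_sphere_integral_scale[symmetric]) (use that in \<open>auto intro: f(2) continuous_on_subset[OF f(1)]\<close>)
  ultimately show ?thesis by (rule continuous_on_eq)
qed

text \<open>Below, the cone over a set of diameter at most \<open>1 / q\<close> is covered by \<open>q + 1\<close> balls
  centred on one segment; \<open>\<eta>\<close> makes up for sets of diameter zero.\<close>

lemma segment_grid_size:
  assumes d: "0 \<le> d" "d \<le> 1" and \<eta>: "0 < \<eta>" and s: "s \<ge> (1::nat)"
  shows "\<exists>q\<ge>(1::nat). d \<le> 1 / real q \<and> (1 / real q) ^ s \<le> (2 * d) ^ s + \<eta>"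
proof (cases "d = 0")
  case True
  obtain n where n: "inverse (real (Suc n)) < \<eta>" using reals_Archimedean[OF \<eta>] by blast
  have "(1 / real (Suc n)) ^ s \<le> (1 / real (Suc n)) ^ 1" by (rule power_decreasing) (use s in auto)
  also have "\<dots> \<le> \<eta>" using n by (simp add: inverse_eq_divide)
  finally show ?thesis using True \<eta> by (intro exI[of _ "Suc n"]) (auto simp: power_0_left)
next
  case False
  then have d0: "d > 0" using d by simp
  define q where "q = nat \<lfloor>1 / d\<rfloor>"
  have d1: "1 / d \<ge> 1" using d d0 by simp
  then have q1: "q \<ge> 1" unfolding q_def by linarith
  have q2: "real q \<le> 1 / d" "1 / d < real q + 1" using d1 unfolding q_def by linarith+
  have "d \<le> 1 / real q" using q2(1) q1 d0 by (simp add: field_simps)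
  moreover have "1 / real q \<le> 2 * d"
  proof -
    have "1 < (real q + 1) * d" using q2(2) d0 by (simp add: field_simps)
    also have "\<dots> \<le> (2 * real q) * d" using q1 d0 by (intro mult_right_mono) auto
    finally show ?thesis using q1 by (simp add: field_simps)
  qed
  then have "(1 / real q) ^ s \<le> (2 * d) ^ s" by (intro power_mono) auto
  ultimately show ?thesis using q1 \<eta> by (intro exI[of _ q]) auto
qed

text \<open>The converse comparison, for null sets, from which nonempty relatively open subsets of
  the sphere have positive measure. The cone over a covering set of diameter \<open>d\<close> lies
  in about \<open>1 / d\<close> balls of radius comparable to \<open>d\<close>; their total volume
  is of order \<open>d ^ (DIM('a) - 1)\<close>, like the cost of the set.\<close>

lemma emeasure_dcone_le_hausdorff:
  fixes A :: "'a::euclidean_space set"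
  assumes A: "A \<subseteq> sphere 0 1" and dim: "DIM('a) \<ge> 2" and z: "hausdorff_outer (DIM('a) - 1) A = 0"
    and m: "dcone 1 A \<in> sets borel"
  shows "emeasure lborel (dcone 1 A) = 0"
proof -
  let ?m = "DIM('a)" and ?s = "DIM('a) - 1"
  let ?V = "unit_ball_vol (real DIM('a))"
  define w where "w = unit_ball_vol (real (DIM('a) - 1))"
  \<comment> \<open>There are \<open>q + 1\<close>, so at most \<open>2 * q\<close>, balls, each of
    volume \<open>?V * (2 / q) ^ ?m\<close>.\<close>
  define c where "c = 2 * 2 ^ ?m * ?V"
  have W: "w > 0" and V: "?V > 0" by (simp_all add: w_def)
  have c: "c > 0" using V by (simp add: c_def)
  have s1: "?s \<ge> 1" using dim by simp
  have ms: "?m = Suc ?s" using dim by simp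
  have piece: "\<exists>E\<in>sets borel. dcone 1 (B \<inter> A) \<subseteq> E \<and> emeasure lborel E \<le> ennreal (c * 4 ^ ?s / w) * hcost ?s B + ennreal (c * \<eta>)"
    if B: "bounded B" "diameter B \<le> 1" and \<eta>: "\<eta> > 0" for B and \<eta> :: real
  proof (cases "B \<inter> A = {}")
    case True
    then show ?thesis by (intro bexI[of _ "{}"]) (auto simp: dcone_def)
  next
    case False
    then obtain p where p: "p \<in> B" "p \<in> A" by auto
    have np: "norm p = 1" using p A by auto
    have d: "0 \<le> diameter B" using diameter_ge_0[OF B(1)] .
    obtain q :: nat where q: "q \<ge> 1" "diameter B \<le> 1 / real q" "(1 / real q) ^ ?s \<le> (2 * diameter B) ^ ?s + \<eta>"
      using segment_grid_size[OF d B(2) \<eta> s1] by blast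
    define E where "E = (\<Union>l\<in>{0..q}. cball ((real l / real q) *\<^sub>R p) (2 / real q))"
    have Eb: "E \<in> sets borel" unfolding E_def by (intro sets.finite_UN) (auto intro: borel_closed)
    have "dcone 1 (B \<inter> A) \<subseteq> E"
    proof
      fix y assume y: "y \<in> dcone 1 (B \<inter> A)"
      define l where "l = nat \<lfloor>norm y * real q\<rfloor>"
      have ny: "norm y < 1" "sgn y \<in> B" "y \<noteq> 0" using y by (auto simp: dcone_def)
      have l: "real l \<le> norm y * real q" "norm y * real q \<le> real l + 1" 
      proof -
        have "0 \<le> norm y * real q" by simp
        then show "real l \<le> norm y * real q" "norm y * real q \<le> real l + 1" unfolding l_def by linarith+
      qed
      have "norm y * real q \<le> 1 * real q" using ny by (intro mult_right_mono) auto
      then have lq: "l \<le> q" using l by linarith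
      have "norm y - real l / real q = (norm y * real q - real l) / real q" using q by (simp add: field_simps)
      then have "\<bar>norm y - real l / real q\<bar> \<le> 1 / real q" using l q by (simp add: divide_right_mono)
      moreover have "norm (sgn y - p) \<le> 1 / real q"
        using diameter_bounded_bound[OF B(1) ny(2) p(1)] q by (simp add: dist_norm)
      moreover have "y - (real l / real q) *\<^sub>R p = norm y *\<^sub>R (sgn y - p) + (norm y - real l / real q) *\<^sub>R p"
        using ny by (simp add: sgn_div_norm algebra_simps)
      then have "norm (y - (real l / real q) *\<^sub>R p) \<le> norm y * norm (sgn y - p) + \<bar>norm y - real l / real q\<bar> * norm p"
        using norm_triangle_ineq[of "norm y *\<^sub>R (sgn y - p)" "(norm y - real l / real q) *\<^sub>R p"] by simp
      moreover have "norm y * norm (sgn y - p) \<le> 1 * norm (sgn y - p)" using ny by (intro mult_right_mono) auto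
      ultimately have "norm (y - (real l / real q) *\<^sub>R p) \<le> 2 / real q" using np by simp
      then show "y \<in> E" unfolding E_def using lq by (auto simp: dist_norm norm_minus_commute intro!: bexI[of _ l])
    qed
    moreover have "emeasure lborel E \<le> ennreal (c * 4 ^ ?s / w) * hcost ?s B + ennreal (c * \<eta>)"
    proof -
      have "emeasure lborel E \<le> (\<Sum>l\<in>{0..q}. emeasure lborel (cball ((real l / real q) *\<^sub>R p) (2 / real q)))"
        unfolding E_def by (intro emeasure_subadditive_finite) (auto intro: borel_closed)
      also have "\<dots> = ennreal ((real q + 1) * (?V * (2 / real q) ^ ?m))"
      proof -
        have "(\<Sum>l\<in>{0..q}. emeasure lborel (cball ((real l / real q) *\<^sub>R p) (2 / real q))) = (\<Sum>l\<in>{0..q}. ennreal (?V * (2 / real q) ^ ?m))"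
          by (simp add: emeasure_cball)
        also have "\<dots> = ennreal (\<Sum>l\<in>{0..q}. ?V * (2 / real q) ^ ?m)" using V by (intro sum_ennreal) auto
        also have "(\<Sum>l\<in>{0..q}. ?V * (2 / real q) ^ ?m) = (real q + 1) * (?V * (2 / real q) ^ ?m)"
          by (simp add: distrib_right)
        finally show ?thesis .
      qed
      also have "\<dots> \<le> ennreal (c * ((2 * diameter B) ^ ?s + \<eta>))"
      proof (rule ennreal_leI)
        have "(real q + 1) * (?V * (2 / real q) ^ ?m) \<le> (2 * real q) * (?V * (2 / real q) ^ ?m)"
          using q V by (intro mult_right_mono) auto
        also have "\<dots> = c * (1 / real q) ^ ?s"
        proof -
          have "(2 / real q) ^ ?m = (2 * (1 / real q)) ^ ?m" by simp
          also have "\<dots> = 2 ^ ?m * (1 / real q) ^ ?m" by (rule power_mult_distrib)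
          also have "(1 / real q) ^ ?m = (1 / real q) ^ Suc ?s" using ms by metis
          also have "\<dots> = (1 / real q) ^ ?s / real q" by (simp only: power_Suc) simp
          finally show ?thesis using q by (simp only: c_def) (simp add: field_simps)
        qed
        also have "\<dots> \<le> c * ((2 * diameter B) ^ ?s + \<eta>)" using q c by (intro mult_left_mono) auto
        finally show "(real q + 1) * (?V * (2 / real q) ^ ?m) \<le> c * ((2 * diameter B) ^ ?s + \<eta>)" .
      qed
      also have "c * ((2 * diameter B) ^ ?s + \<eta>) = c * 4 ^ ?s / w * (w * (diameter B / 2) ^ ?s) + c * \<eta>"
      proof -
        have "(2 * diameter B) ^ ?s = (4 * (diameter B / 2)) ^ ?s" by simp
        also have "\<dots> = 4 ^ ?s * (diameter B / 2) ^ ?s" by (rule power_mult_distrib)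
        finally have e: "(2 * diameter B) ^ ?s = 4 ^ ?s * (diameter B / 2) ^ ?s" .
        show ?thesis unfolding e using W by (simp add: distrib_left)
      qed
      also have "ennreal \<dots> = ennreal (c * 4 ^ ?s / w) * hcost ?s B + ennreal (c * \<eta>)"
      proof -
        have hc: "hcost ?s B = ennreal (w * (diameter B / 2) ^ ?s)" using p by (auto simp: hcost_def w_def)
        have n: "0 \<le> c * 4 ^ ?s / w" "0 \<le> w * (diameter B / 2) ^ ?s" "0 \<le> c * \<eta>" using c W d \<eta> by auto
        show ?thesis unfolding hc ennreal_mult[OF n(1,2), symmetric]
          by (rule ennreal_plus[OF mult_nonneg_nonneg[OF n(1,2)] n(3)])
      qed
      finally show ?thesis .
    qed
    ultimately show ?thesis using Eb by blast
  qed
  have bound: "emeasure lborel (dcone 1 A) \<le> ennreal ((c * 4 ^ ?s / w + c) * \<epsilon>)" if \<epsilon>: "\<epsilon> > 0" for \<epsilon> :: real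
  proof -
    have "hausdorff_premeasure ?s 1 A \<le> 0" using hausdorff_premeasure_le_outer[of 1 ?s A] z by simp
    then have "hausdorff_premeasure ?s 1 A < ennreal \<epsilon>" using \<epsilon> by simp
    then obtain C where C: "hcover 1 A C" "(\<Sum>i. hcost ?s (C i)) < ennreal \<epsilon>"
      unfolding hausdorff_premeasure_eq INF_less_iff by auto
    have "\<exists>E\<in>sets borel. dcone 1 (C i \<inter> A) \<subseteq> E \<and> emeasure lborel E \<le> ennreal (c * 4 ^ ?s / w) * hcost ?s (C i) + ennreal (c * (\<epsilon> * (1/2) ^ Suc i))" for i
      by (rule piece) (use C(1) \<epsilon> in \<open>auto simp: hcover_def\<close>)
    then obtain E where E: "\<And>i. E i \<in> sets borel" "\<And>i. dcone 1 (C i \<inter> A) \<subseteq> E i"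
      "\<And>i. emeasure lborel (E i) \<le> ennreal (c * 4 ^ ?s / w) * hcost ?s (C i) + ennreal (c * (\<epsilon> * (1/2) ^ Suc i))" by metis
    have "dcone 1 A \<subseteq> (\<Union>i. E i)"
    proof
      fix y assume y: "y \<in> dcone 1 A"
      then obtain i where "sgn y \<in> C i" using C(1) by (auto simp: dcone_def hcover_def)
      then have "y \<in> dcone 1 (C i \<inter> A)" using y by (auto simp: dcone_def)
      then show "y \<in> (\<Union>i. E i)" using E(2) by blast
    qed
    then have "emeasure lborel (dcone 1 A) \<le> emeasure lborel (\<Union>i. E i)" using E(1) by (intro emeasure_mono) auto
    also have "\<dots> \<le> (\<Sum>i. emeasure lborel (E i))" using E(1) by (intro emeasure_subadditive_countably) auto
    also have "\<dots> \<le> (\<Sum>i. ennreal (c * 4 ^ ?s / w) * hcost ?s (C i) + ennreal (c * \<epsilon>) * ennreal ((1/2) ^ Suc i))"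
    proof (rule suminf_le)
      fix i
      have "ennreal (c * (\<epsilon> * (1/2) ^ Suc i)) = ennreal (c * \<epsilon>) * ennreal ((1/2) ^ Suc i)"
        using c \<epsilon> by (subst ennreal_mult[symmetric]) (auto simp: mult.assoc)
      then show "emeasure lborel (E i) \<le> ennreal (c * 4 ^ ?s / w) * hcost ?s (C i) + ennreal (c * \<epsilon>) * ennreal ((1/2) ^ Suc i)"
        using E(3)[of i] by simp
    qed auto
    also have "\<dots> = ennreal (c * 4 ^ ?s / w) * (\<Sum>i. hcost ?s (C i)) + ennreal (c * \<epsilon>) * (\<Sum>i. ennreal ((1/2) ^ Suc i))"
      by (subst suminf_add[symmetric]) (auto simp only: ennreal_suminf_cmult summableI)
    also have "(\<Sum>i. ennreal ((1/2) ^ Suc i)) = ennreal 1"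
      by (rule suminf_ennreal_eq[OF _ power_half_series]) simp
    also have "ennreal (c * 4 ^ ?s / w) * (\<Sum>i. hcost ?s (C i)) + ennreal (c * \<epsilon>) * ennreal 1
       \<le> ennreal (c * 4 ^ ?s / w) * ennreal \<epsilon> + ennreal (c * \<epsilon>) * ennreal 1"
      using C(2) by (intro add_mono mult_left_mono) auto
    also have "\<dots> = ennreal ((c * 4 ^ ?s / w + c) * \<epsilon>)"
      using c \<epsilon> W by (simp add: ennreal_mult[symmetric] ennreal_plus[symmetric] distrib_right del: ennreal_plus)
    finally show ?thesis .
  qed
  define k where "k = c * 4 ^ ?s / w + c"
  have k: "k > 0" using c W by (simp add: k_def add_pos_pos)
  have le: "emeasure lborel (dcone 1 A) \<le> 0 + ennreal e" if "e > 0" for e :: real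
  proof -
    have "e / k > 0" using k that by simp
    from bound[OF this, folded k_def] show ?thesis using k by simp
  qed
  have "emeasure lborel (dcone 1 A) \<le> 0" by (rule ennreal_le_epsilon) (rule le)
  then show ?thesis by simp
qed

text \<open>If the integral vanished, the relatively open part of the sphere where \<open>f\<close>
  is positive would be null, and the cone over it would be a nonempty open set of Lebesgue measure
  zero.\<close>

lemma hausdorff_sphere_integral_pos:
  fixes f :: "'a::euclidean_space \<Rightarrow> real"
  assumes t: "t > 0" and dim: "DIM('a) \<ge> 2" and f: "continuous_on (sphere 0 t) f" "\<And>x. norm x = t \<Longrightarrow> 0 \<le> f x"
    and p: "norm p = t" "f p > 0"
  shows "(LINT y:sphere 0 t|hausdorff_measure (DIM('a) - 1). f y) > 0"
proof -
  let ?H = "hausdorff_measure (DIM('a) - 1) :: 'a measure"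
  have fc: "continuous_on (sphere 0 1) (\<lambda>w. f (t *\<^sub>R w))"
    by (rule continuous_on_compose2[OF f(1)]) (use t in \<open>auto intro!: continuous_intros\<close>)
  have f0: "0 \<le> f (t *\<^sub>R w)" if "norm w = 1" for w using f(2)[of "t *\<^sub>R w"] that t by simp
  define I where "I = (\<integral>w. indicator (sphere 0 1) w * f (t *\<^sub>R w) \<partial>?H)"
  have int: "integrable ?H (\<lambda>w. indicator (sphere 0 1) w * f (t *\<^sub>R w))"
    by (rule hausdorff_sphere_integral_le_cone(3)[OF fc f0])
  have nn: "0 \<le> indicator (sphere 0 1) w * f (t *\<^sub>R w)" for w using f0 by (auto simp: indicator_def)
  have "I \<noteq> 0"
  proof
    assume "I = 0"
    then have ae: "AE w in ?H. indicator (sphere 0 1) w * f (t *\<^sub>R w) = 0"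
      unfolding I_def using integral_nonneg_eq_0_iff_AE[OF int] nn by simp
    obtain U where U: "open U" "{w \<in> sphere 0 1. f (t *\<^sub>R w) > 0} = sphere 0 1 \<inter> U"
    proof -
      have "openin (top_of_set (sphere 0 1)) (sphere 0 1 \<inter> (\<lambda>w. f (t *\<^sub>R w)) -` {0<..})"
        by (rule continuous_openin_preimage_gen[OF fc]) simp
      then obtain U where U: "open U" "sphere 0 1 \<inter> (\<lambda>w. f (t *\<^sub>R w)) -` {0<..} = sphere 0 1 \<inter> U"
        unfolding openin_open by (elim exE conjE)
      have "{w \<in> sphere 0 1. f (t *\<^sub>R w) > 0} = sphere 0 1 \<inter> (\<lambda>w. f (t *\<^sub>R w)) -` {0<..}"
        unfolding vimage_def by (simp only: Int_def mem_Collect_eq greaterThan_iff)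
      then show thesis using that[of U] U by simp
    qed
    define A where "A = sphere 0 1 \<inter> U"
    have Ab: "A \<in> sets borel" unfolding A_def using U(1) by (auto intro: borel_closed borel_open)
    have "emeasure ?H A = 0"
    proof -
      have "AE w in ?H. w \<notin> A"
        using ae
      proof eventually_elim
        case (elim w)
        show "w \<notin> A"
        proof
          assume "w \<in> A"
          then have "w \<in> {w \<in> sphere 0 1. f (t *\<^sub>R w) > 0}" unfolding U(2) A_def .
          then show False using elim by simp
        qed
      qed
      then show ?thesis using Ab by (subst (asm) AE_iff_measurable[of A]) auto
    qed
    then have h0: "hausdorff_outer (DIM('a) - 1) A = 0" unfolding emeasure_hausdorff_measure[OF Ab] .
    have As: "A \<subseteq> sphere 0 1" by (auto simp: A_def)
    have z: "emeasure lborel (dcone 1 A) = 0"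
      by (rule emeasure_dcone_le_hausdorff[OF As dim h0 dcone_borel[OF Ab]])
    have op: "open (dcone 1 A)"
    proof -
      have c: "continuous_on (ball 0 1 - {0}) (sgn :: 'a \<Rightarrow> 'a)" unfolding sgn_div_norm by (intro continuous_intros) auto
      have "open ((ball 0 1 - {0}) \<inter> sgn -` U)" by (rule continuous_open_preimage[OF c]) (use U in auto)
      also have "(ball 0 1 - {0}) \<inter> sgn -` U = dcone 1 A" by (auto simp: dcone_def A_def norm_sgn)
      finally show ?thesis .
    qed
    have "(1/(2*t)) *\<^sub>R p \<in> dcone 1 A"
    proof -
      have "(1/t) *\<^sub>R p \<in> {w \<in> sphere 0 1. f (t *\<^sub>R w) > 0}" using p t by simp
      then have 1: "(1/t) *\<^sub>R p \<in> A" unfolding U(2) A_def .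
      have "sgn ((1/(2*t)) *\<^sub>R p) = sgn p" by (rule sgn_scaleR_pos) (use t in simp)
      also have "sgn p = (1/t) *\<^sub>R p" using p by (simp add: sgn_div_norm inverse_eq_divide)
      finally have 2: "sgn ((1/(2*t)) *\<^sub>R p) = (1/t) *\<^sub>R p" .
      have 3: "(1/(2*t)) *\<^sub>R p \<noteq> 0" "norm ((1/(2*t)) *\<^sub>R p) < 1" using p t by auto
      show ?thesis unfolding dcone_def mem_Collect_eq 2 using 1 3 by blast
    qed
    then have "\<not> negligible (dcone 1 A)" using op open_not_negligible by blast
    moreover have "negligible (dcone 1 A)" using z op by (simp add: negligible_iff_emeasure0 borel_open)
    ultimately show False by blast
  qed
  moreover have "I \<ge> 0" unfolding I_def by (rule Bochner_Integration.integral_nonneg) (rule nn)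
  ultimately have "I > 0" by simp
  then show ?thesis using hausdorff_sphere_integral_scale[OF t f] t by (simp add: I_def)
qed

section \<open>Frequency and growth\<close>

lemma partial_deriv_add:
  assumes "f differentiable (at x)" "g differentiable (at x)"
  shows "partial_deriv b (\<lambda>x. f x + g x) x = partial_deriv b f x + partial_deriv b g x"
    "(\<lambda>x. f x + g x) differentiable (at x)"
proof -
  have "((\<lambda>x. f x + g x) has_derivative (\<lambda>v. (grad f x + grad g x) \<bullet> v)) (at x)"
    using has_derivative_add[OF has_derivative_grad[OF assms(1)] has_derivative_grad[OF assms(2)]]
    by (simp add: inner_add_left)
  then have "partial_deriv b (\<lambda>x. f x + g x) x = (grad f x + grad g x) \<bullet> b" by (rule partial_deriv_eq)
  then show "partial_deriv b (\<lambda>x. f x + g x) x = partial_deriv b f x + partial_deriv b g x"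
    using partial_deriv_eq[OF has_derivative_grad[OF assms(1)]] partial_deriv_eq[OF has_derivative_grad[OF assms(2)]]
    by (simp add: inner_add_left)
  show "(\<lambda>x. f x + g x) differentiable (at x)" using assms by (rule differentiable_add)
qed

lemma partial_deriv_mult:
  fixes f g :: "'a::euclidean_space \<Rightarrow> real"
  assumes "f differentiable (at x)" "g differentiable (at x)"
  shows "partial_deriv b (\<lambda>x. f x * g x) x = f x * partial_deriv b g x + g x * partial_deriv b f x"
    "(\<lambda>x. f x * g x) differentiable (at x)"
proof -
  have "((\<lambda>x. f x * g x) has_derivative (\<lambda>v. (f x *\<^sub>R grad g x + g x *\<^sub>R grad f x) \<bullet> v)) (at x)"
    by (rule has_derivative_eq_rhs[OF has_derivative_mult[OF has_derivative_grad[OF assms(1)] has_derivative_grad[OF assms(2)]]])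
      (simp add: fun_eq_iff inner_add_left mult.commute)
  then have "partial_deriv b (\<lambda>x. f x * g x) x = (f x *\<^sub>R grad g x + g x *\<^sub>R grad f x) \<bullet> b" by (rule partial_deriv_eq)
  also have "\<dots> = f x * partial_deriv b g x + g x * partial_deriv b f x"
    using partial_deriv_eq[OF has_derivative_grad[OF assms(1)]] partial_deriv_eq[OF has_derivative_grad[OF assms(2)]]
    by (simp add: inner_add_left)
  finally show "partial_deriv b (\<lambda>x. f x * g x) x = f x * partial_deriv b g x + g x * partial_deriv b f x" .
  show "(\<lambda>x. f x * g x) differentiable (at x)" using assms by (rule differentiable_mult)
qed

lemma partial_deriv_const: "partial_deriv b (\<lambda>x. c) x = 0" "(\<lambda>x. c :: real) differentiable (at x)"
  using partial_deriv_eq[of "\<lambda>x. c" 0 x b] by auto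

lemma C_k_on_const: "C_k_on k W (\<lambda>x. c)"
proof (induction k arbitrary: c)
  case (Suc k)
  have "partial_deriv b (\<lambda>x. c) = (\<lambda>x. 0)" for b :: 'a using partial_deriv_const by (intro ext)
  then show ?case using Suc by (simp add: partial_deriv_const)
qed simp

lemma C_k_on_Suc_differentiable: "C_k_on (Suc k) W f \<Longrightarrow> x \<in> W \<Longrightarrow> f differentiable (at x)"
  by simp

lemma C_k_on_add:
  assumes W: "open W"
  shows "C_k_on k W f \<Longrightarrow> C_k_on k W g \<Longrightarrow> C_k_on k W (\<lambda>x. f x + g x)"
proof (induction k arbitrary: f g)
  case (Suc k)
  note d = C_k_on_Suc_differentiable[OF Suc.prems(1)] C_k_on_Suc_differentiable[OF Suc.prems(2)]
  have "C_k_on k W (partial_deriv b (\<lambda>x. f x + g x))" if b: "b \<in> Basis" for b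
    by (rule C_k_on_cong[OF W _ Suc.IH[OF C_k_on_Suc_partial[OF Suc.prems(1) b] C_k_on_Suc_partial[OF Suc.prems(2) b]]])
      (use partial_deriv_add(1)[OF d] in simp)
  then show ?case using partial_deriv_add(2)[OF d] by simp
qed (auto intro: continuous_intros)

lemma C_k_on_mult:
  assumes W: "open W"
  shows "C_k_on k W f \<Longrightarrow> C_k_on k W g \<Longrightarrow> C_k_on k W (\<lambda>x. f x * g x)"
proof (induction k arbitrary: f g)
  case (Suc k)
  note d = C_k_on_Suc_differentiable[OF Suc.prems(1)] C_k_on_Suc_differentiable[OF Suc.prems(2)]
  have "C_k_on k W (partial_deriv b (\<lambda>x. f x * g x))" if b: "b \<in> Basis" for b
    by (rule C_k_on_cong[OF W _ C_k_on_add[OF W Suc.IH[OF C_k_on_lower[OF Suc.prems(1)] C_k_on_Suc_partial[OF Suc.prems(2) b]]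
            Suc.IH[OF C_k_on_lower[OF Suc.prems(2)] C_k_on_Suc_partial[OF Suc.prems(1) b]]]])
      (use partial_deriv_mult(1)[OF d] in simp)
  then show ?case using partial_deriv_mult(2)[OF d] by simp
qed (auto intro: continuous_intros)

lemma C_k_on_sum:
  assumes W: "open W"
  shows "(\<And>i. i \<in> I \<Longrightarrow> C_k_on k W (f i)) \<Longrightarrow> C_k_on k W (\<lambda>x. \<Sum>i\<in>I. f i x)"
proof (induction I rule: infinite_finite_induct)
  case (insert i I)
  then have "C_k_on k W (\<lambda>x. f i x + (\<Sum>i\<in>I. f i x))" by (intro C_k_on_add[OF W]) auto
  then show ?case using insert by simp
qed (auto intro: C_k_on_const)

lemma C_k_on_laplacian:
  assumes W: "open W" and f: "C_k_on (Suc (Suc k)) W f"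
  shows "C_k_on k W (laplacian f)"
proof -
  have "C_k_on k W (\<lambda>x. \<Sum>b\<in>Basis. partial_deriv b (partial_deriv b f) x)"
    by (intro C_k_on_sum[OF W] C_k_on_Suc_partial[OF C_k_on_Suc_partial[OF f]])
  then show ?thesis unfolding laplacian_def .
qed

lemma laplacian_lincomb:
  fixes f g :: "'a::euclidean_space \<Rightarrow> real"
  assumes W: "open W" and f: "C_k_on 2 W f" and g: "C_k_on 2 W g" and x: "x \<in> W"
  shows "laplacian (\<lambda>x. a * f x + c * g x) x = a * laplacian f x + c * laplacian g x"
proof -
  have f': "C_k_on (Suc (Suc 0)) W f" and g': "C_k_on (Suc (Suc 0)) W g" using f g by (simp_all add: numeral_2_eq_2)
  have lin: "partial_deriv b (\<lambda>x. a * p x + c * q x) y = a * partial_deriv b p y + c * partial_deriv b q y"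
    if "C_k_on (Suc j) W p" "C_k_on (Suc j) W q" "y \<in> W" for b p q y j
  proof -
    note d = C_k_on_Suc_differentiable[OF that(1,3)] C_k_on_Suc_differentiable[OF that(2,3)]
    note cd = partial_deriv_const(2)[of a y] partial_deriv_const(2)[of c y]
    show ?thesis
      using partial_deriv_add(1)[OF partial_deriv_mult(2)[OF cd(1) d(1)] partial_deriv_mult(2)[OF cd(2) d(2)], of b]
        partial_deriv_mult(1)[OF cd(1) d(1), of b] partial_deriv_mult(1)[OF cd(2) d(2), of b]
      by (simp add: partial_deriv_const)
  qed
  have "partial_deriv b (partial_deriv b (\<lambda>x. a * f x + c * g x)) x =
      a * partial_deriv b (partial_deriv b f) x + c * partial_deriv b (partial_deriv b g) x" if b: "b \<in> Basis" for b
  proof -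
    have "partial_deriv b (partial_deriv b (\<lambda>x. a * f x + c * g x)) x = partial_deriv b (\<lambda>x. a * partial_deriv b f x + c * partial_deriv b g x) x"
      by (rule partial_deriv_cong_open[OF W x]) (rule lin[OF f' g'])
    also have "\<dots> = a * partial_deriv b (partial_deriv b f) x + c * partial_deriv b (partial_deriv b g) x"
      by (rule lin[OF C_k_on_Suc_partial[OF f' b] C_k_on_Suc_partial[OF g' b] x])
    finally show ?thesis .
  qed
  then show ?thesis by (simp add: laplacian_def sum.distrib sum_distrib_left)
qed

lemma laplacian_square:
  fixes f :: "'a::euclidean_space \<Rightarrow> real"
  assumes W: "open W" and f: "C_k_on 2 W f" and x: "x \<in> W"
  shows "laplacian (\<lambda>x. (f x)\<^sup>2) x = 2 * (norm (grad f x))\<^sup>2 + 2 * f x * laplacian f x"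
proof -
  have f': "C_k_on (Suc (Suc 0)) W f" using f by (simp add: numeral_2_eq_2)
  have "partial_deriv b (partial_deriv b (\<lambda>x. (f x)\<^sup>2)) x = 2 * (partial_deriv b f x)\<^sup>2 + 2 * f x * partial_deriv b (partial_deriv b f) x"
    if b: "b \<in> Basis" for b
  proof -
    have "partial_deriv b (partial_deriv b (\<lambda>x. (f x)\<^sup>2)) x = partial_deriv b (\<lambda>x. 2 * (f x * partial_deriv b f x)) x"
      by (rule partial_deriv_cong_open[OF W x])
        (use partial_deriv_mult(1)[OF C_k_on_Suc_differentiable[OF f'] C_k_on_Suc_differentiable[OF f']] in \<open>simp add: power2_eq_square\<close>)
    also have "\<dots> = 2 * partial_deriv b (\<lambda>x. f x * partial_deriv b f x) x"
      using partial_deriv_mult(1)[OF partial_deriv_const(2) partial_deriv_mult(2)[OF C_k_on_Suc_differentiable[OF f' x] C_k_on_Suc_differentiable[OF C_k_on_Suc_partial[OF f' b] x]], of b 2]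
      by (simp add: partial_deriv_const)
    also have "partial_deriv b (\<lambda>x. f x * partial_deriv b f x) x = f x * partial_deriv b (partial_deriv b f) x + partial_deriv b f x * partial_deriv b f x"
      by (rule partial_deriv_mult(1)[OF C_k_on_Suc_differentiable[OF f' x] C_k_on_Suc_differentiable[OF C_k_on_Suc_partial[OF f' b] x]])
    finally show ?thesis by (simp add: power2_eq_square)
  qed
  moreover have "(norm (grad f x))\<^sup>2 = (\<Sum>b\<in>Basis. (partial_deriv b f x)\<^sup>2)"
    unfolding power2_norm_eq_inner by (subst euclidean_inner) (simp add: grad_inner_Basis power2_eq_square)
  ultimately show ?thesis by (simp add: laplacian_def sum.distrib sum_distrib_left mult.assoc)
qed

lemma separated_product_has_derivative:
  fixes a :: "'a::euclidean_space \<Rightarrow> real"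
  assumes a: "a differentiable (at x)" and b: "(b has_real_derivative b') (at t)"
  shows "((\<lambda>y. a (fst y) * b (snd y)) has_derivative (\<lambda>v. (b t *\<^sub>R grad a x, a x * b') \<bullet> v)) (at (x, t))"
proof -
  have 1: "((\<lambda>y. a (fst y)) has_derivative (\<lambda>v. grad a x \<bullet> fst v)) (at (x, t))"
    by (rule has_derivative_compose[OF has_derivative_fst[OF has_derivative_ident]]) (use has_derivative_grad[OF a] in simp)
  have 2: "((\<lambda>y. b (snd y)) has_derivative (\<lambda>v. b' * snd v)) (at (x, t))"
    by (rule has_derivative_compose[OF has_derivative_snd[OF has_derivative_ident]]) (use b in \<open>simp add: has_field_derivative_def\<close>)
  show ?thesis
    by (rule has_derivative_eq_rhs[OF has_derivative_mult[OF 1 2]]) (simp add: fun_eq_iff inner_prod_def mult_ac)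
qed

lemma separated_product_partials:
  fixes a :: "'a::euclidean_space \<Rightarrow> real"
  assumes a: "a differentiable (at x)" and b: "(b has_real_derivative b') (at t)"
  shows "partial_deriv (i, 0) (\<lambda>y. a (fst y) * b (snd y)) (x, t) = partial_deriv i a x * b t"
    "partial_deriv (0, 1) (\<lambda>y. a (fst y) * b (snd y)) (x, t) = a x * b'"
  unfolding partial_deriv_eq[OF separated_product_has_derivative[OF assms]]
  using partial_deriv_eq[OF has_derivative_grad[OF a]] by (simp_all add: inner_prod_def)

text \<open>The functions \<open>b j\<close> are the successive derivatives of one function. With
  \<open>j\<close> kept general, the induction stays within products of this form for both kinds of
  partial derivatives.\<close>

lemma C_k_on_separated_product:
  fixes a :: "'a::euclidean_space \<Rightarrow> real" and b :: "nat \<Rightarrow> real \<Rightarrow> real"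
  assumes W: "open W" and b: "\<And>j t. (b j has_real_derivative b (Suc j) t) (at t)"
  shows "C_k_on k W a \<Longrightarrow> C_k_on k (W \<times> UNIV) (\<lambda>y. a (fst y) * b j (snd y))"
proof (induction k arbitrary: a j)
  case 0
  have "continuous_on UNIV (b j)" using b by (intro continuous_at_imp_continuous_on) (auto intro: DERIV_isCont)
  then have "continuous_on (W \<times> UNIV) (\<lambda>y. b j (snd y))"
    by (rule continuous_on_compose2) (simp_all add: continuous_on_snd)
  moreover have "continuous_on (W \<times> (UNIV :: real set)) (\<lambda>y. a (fst y))"
    by (rule continuous_on_compose2[of W a]) (use 0 in \<open>auto simp: continuous_on_fst\<close>)
  ultimately show ?case by (simp add: continuous_on_mult)
next
  case (Suc k)
  have op: "open (W \<times> (UNIV :: real set))" using W by (intro open_Times) auto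
  note d = C_k_on_Suc_differentiable[OF Suc.prems]
  show ?case
  proof (rule C_k_on_SucI[OF op])
    fix y :: "'a \<times> real" assume "y \<in> W \<times> UNIV"
    then show "((\<lambda>y. a (fst y) * b j (snd y)) has_derivative (\<lambda>v. (b j (snd y) *\<^sub>R grad a (fst y), a (fst y) * b (Suc j) (snd y)) \<bullet> v)) (at y)"
      using separated_product_has_derivative[OF d b, of "fst y" j "snd y"] by auto
  next
    fix c :: "'a \<times> real" assume c: "c \<in> Basis"
    then consider i where "c = (i, 0)" "i \<in> Basis" | "c = (0, 1)" by (auto simp: Basis_prod_def)
    then show "C_k_on k (W \<times> UNIV) (\<lambda>y. (b j (snd y) *\<^sub>R grad a (fst y), a (fst y) * b (Suc j) (snd y)) \<bullet> c)"
    proof cases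
      case 1
      have "C_k_on k (W \<times> UNIV) (\<lambda>y. partial_deriv i a (fst y) * b j (snd y))"
        by (rule Suc.IH[OF C_k_on_Suc_partial[OF Suc.prems 1(2)]])
      then show ?thesis using 1 by (simp add: inner_prod_def grad_inner_Basis mult.commute)
    next
      case 2
      have "C_k_on k (W \<times> UNIV) (\<lambda>y. a (fst y) * b (Suc j) (snd y))"
        by (rule Suc.IH[OF C_k_on_lower[OF Suc.prems]])
      then show ?thesis using 2 by (simp add: inner_prod_def)
    qed
  qed
qed

lemma laplacian_separated_product:
  fixes a :: "'a::euclidean_space \<Rightarrow> real" and b :: "nat \<Rightarrow> real \<Rightarrow> real"
  assumes W: "open W" and b: "\<And>j t. (b j has_real_derivative b (Suc j) t) (at t)" and a: "C_k_on 2 W a" and y: "y \<in> W \<times> UNIV"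
  shows "laplacian (\<lambda>y. a (fst y) * b j (snd y)) y = laplacian a (fst y) * b j (snd y) + a (fst y) * b (Suc (Suc j)) (snd y)"
proof -
  obtain x t where xt: "y = (x, t)" "x \<in> W" using y by auto
  have op: "open (W \<times> (UNIV :: real set))" using W by (intro open_Times) auto
  have a': "C_k_on (Suc (Suc 0)) W a" using a by (simp add: numeral_2_eq_2)
  have 1: "partial_deriv (i, 0) (partial_deriv (i, 0) (\<lambda>y. a (fst y) * b j (snd y))) y = partial_deriv i (partial_deriv i a) x * b j t"
    if i: "i \<in> Basis" for i
  proof -
    have "partial_deriv (i, 0) (partial_deriv (i, 0) (\<lambda>y. a (fst y) * b j (snd y))) y = partial_deriv (i, 0) (\<lambda>y. partial_deriv i a (fst y) * b j (snd y)) y"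
      by (rule partial_deriv_cong_open[OF op y])
        (use separated_product_partials(1)[OF C_k_on_Suc_differentiable[OF a'] b] in auto)
    also have "\<dots> = partial_deriv i (partial_deriv i a) x * b j t"
      unfolding xt by (rule separated_product_partials(1)[OF C_k_on_Suc_differentiable[OF C_k_on_Suc_partial[OF a' i] xt(2)] b])
    finally show ?thesis .
  qed
  have 2: "partial_deriv (0, 1) (partial_deriv (0, 1) (\<lambda>y. a (fst y) * b j (snd y))) y = a x * b (Suc (Suc j)) t"
  proof -
    have "partial_deriv (0, 1) (partial_deriv (0, 1) (\<lambda>y. a (fst y) * b j (snd y))) y = partial_deriv (0, 1) (\<lambda>y. a (fst y) * b (Suc j) (snd y)) y"
      by (rule partial_deriv_cong_open[OF op y])
        (use separated_product_partials(2)[OF C_k_on_Suc_differentiable[OF a'] b] in auto)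
    also have "\<dots> = a x * b (Suc (Suc j)) t"
      unfolding xt by (rule separated_product_partials(2)[OF C_k_on_Suc_differentiable[OF a' xt(2)] b])
    finally show ?thesis .
  qed
  have s: "(\<Sum>c\<in>Basis. F c) = (\<Sum>i\<in>Basis. F (i, 0)) + F (0, 1)" for F :: "'a \<times> real \<Rightarrow> real"
    unfolding Basis_prod_def by (subst sum.union_disjoint) (auto simp: sum.reindex inj_on_def)
  show ?thesis
    unfolding laplacian_def s using 1 2 xt by (simp add: sum_distrib_right)
qed

section \<open>Growth of ball integrals under a frequency bound\<close>

definition ball_integral :: "('a::euclidean_space \<Rightarrow> real) \<Rightarrow> real \<Rightarrow> real" where
  "ball_integral f t = (\<integral>y. indicator (ball 0 t) y * f y \<partial>lborel)"

lemma ball_integral_scale: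
  fixes f :: "'a::euclidean_space \<Rightarrow> real"
  assumes t: "t \<ge> 0" and f: "continuous_on (cball 0 t) f"
  shows "ball_integral f t = t ^ DIM('a) * (\<integral>z. indicator (ball 0 1) z * f (t *\<^sub>R z) \<partial>lborel)"
proof (cases "t = 0")
  case False
  then have t0: "t > 0" using t by simp
  have m: "(\<lambda>y. indicator (ball 0 t) y * f y) \<in> borel_measurable borel"
    by (rule measurable_indicator_mult) (auto intro: continuous_on_subset[OF f])
  have e: "indicator (ball 0 t) (0 + t *\<^sub>R z) * f (0 + t *\<^sub>R z) = indicator (ball 0 1) z * f (t *\<^sub>R z)" for z
    using t0 by (auto simp: indicator_def)
  show ?thesis unfolding ball_integral_def integral_lborel_scale[OF m t0, of 0] e ..
qed (simp add: ball_integral_def)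

lemma abs_pos_part_diff_le: "\<bar>max 0 a - max 0 b\<bar> \<le> \<bar>a - b :: real\<bar>"
  by (auto simp: max_def abs_if)

text \<open>The functional \<open>J t = \<integral>\<^bsub>B\<^sub>t\<^esub> (t\<^sup>2 - |y|\<^sup>2) L\<close>; integrating by parts against this weight
  avoids integration over spheres.\<close>

lemma paraboloid_integral_has_derivative:
  fixes L :: "'a::euclidean_space \<Rightarrow> real"
  assumes L: "continuous_on (cball 0 R) L" and t: "0 \<le> t" "t \<le> R"
  shows "((\<lambda>t. \<integral>y. max 0 (t\<^sup>2 - y \<bullet> y) * (indicator (ball 0 R) y * L y) \<partial>lborel) has_real_derivative
    2 * t * ball_integral L t) (at t)"
proof -
  obtain K where K0: "K \<ge> 0" and K: "\<And>x. x \<in> cball 0 R \<Longrightarrow> norm (L x) \<le> K"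
    using continuous_on_cball_norm_bound[OF L] by blast
  have iL: "integrable lborel (\<lambda>y. indicator (ball 0 R) y * L y)" by (rule integrable_ball_continuous[OF L])
  have R0: "R \<ge> 0" using t by simp
  have sq: "\<bar>max 0 (s\<^sup>2 - y \<bullet> y) - max 0 (t\<^sup>2 - y \<bullet> y)\<bar> \<le> (2 * R + 1) * \<bar>s - t\<bar>" if "s \<in> {t - 1<..<t + 1}" for s and y :: 'a
  proof -
    have "\<bar>max 0 (s\<^sup>2 - y \<bullet> y) - max 0 (t\<^sup>2 - y \<bullet> y)\<bar> \<le> \<bar>s\<^sup>2 - t\<^sup>2\<bar>"
      using abs_pos_part_diff_le[of "s\<^sup>2 - y \<bullet> y" "t\<^sup>2 - y \<bullet> y"] by simp
    also have "\<dots> = \<bar>s + t\<bar> * \<bar>s - t\<bar>" by (simp add: abs_mult[symmetric] power2_eq_square algebra_simps)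
    also have "\<dots> \<le> (2 * R + 1) * \<bar>s - t\<bar>" using that t by (intro mult_right_mono) auto
    finally show ?thesis .
  qed
  let ?G = "\<lambda>y. (if y \<bullet> y < t\<^sup>2 then 2 * t else 0) * (indicator (ball 0 R) y * L y)"
  have "((\<lambda>t. \<integral>y. max 0 (t\<^sup>2 - y \<bullet> y) * (indicator (ball 0 R) y * L y) \<partial>lborel) has_derivative
    (\<lambda>v. integral\<^sup>L lborel ?G \<bullet> v)) (at t)"
  proof (rule has_derivative_integral_parameter(2)[of "{t - 1<..<t + 1}" _ _ _ _ "\<lambda>y. (2 * R + 1) * (indicator (ball 0 R) y * K)"])
    show "integrable lborel (\<lambda>y. max 0 (s\<^sup>2 - y \<bullet> y) * (indicator (ball 0 R) y * L y))" for s
    proof -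
      have "integrable lborel (\<lambda>y. indicator (ball 0 R) y * (max 0 (s\<^sup>2 - y \<bullet> y) * L y))"
        by (intro integrable_ball_continuous continuous_intros L)
      then show ?thesis by (simp add: mult_ac)
    qed
    show "?G \<in> borel_measurable lborel"
      using iL by (intro borel_measurable_times borel_measurable_integrable[OF iL] measurable_If) auto
    show "integrable lborel (\<lambda>y::'a. (2 * R + 1) * (indicator (ball 0 R) y * K))"
      by (intro integrable_mult_right integrable_ball_continuous continuous_intros)
    show "AE y in lborel. ((\<lambda>t. max 0 (t\<^sup>2 - y \<bullet> y) * (indicator (ball 0 R) y * L y)) has_derivative (\<bullet>) (?G y)) (at t)"
      using AE_not_on_sphere[of 0 t]
    proof eventually_elim
      case (elim y)
      have ne: "y \<bullet> y \<noteq> t\<^sup>2"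
        using elim t by (auto simp: dot_square_norm power2_eq_iff_nonneg)
      have "((\<lambda>t. max 0 (t\<^sup>2 - y \<bullet> y)) has_real_derivative (if y \<bullet> y < t\<^sup>2 then 2 * t else 0)) (at t)"
      proof (cases "y \<bullet> y < t\<^sup>2")
        case True
        have "((\<lambda>t. t\<^sup>2 - y \<bullet> y) has_real_derivative 2 * t) (at t)" by (auto intro!: derivative_eq_intros)
        moreover have "open {t :: real. y \<bullet> y < t\<^sup>2}" by (intro open_Collect_less continuous_intros)
        ultimately have "((\<lambda>t. max 0 (t\<^sup>2 - y \<bullet> y)) has_real_derivative 2 * t) (at t)"
          by (rule has_field_derivative_transform_within_open) (use True in auto)
        then show ?thesis using True by simp
      next
        case False
        have "((\<lambda>t. 0 :: real) has_real_derivative 0) (at t)" by simp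
        moreover have "open {t :: real. t\<^sup>2 < y \<bullet> y}" by (intro open_Collect_less continuous_intros)
        ultimately have "((\<lambda>t. max 0 (t\<^sup>2 - y \<bullet> y)) has_real_derivative 0) (at t)"
          by (rule has_field_derivative_transform_within_open) (use False ne in auto)
        then show ?thesis using False by simp
      qed
      from DERIV_cmult_right[OF this, of "indicator (ball 0 R) y * L y"]
      show ?case by (simp add: has_field_derivative_def inner_real_def[abs_def])
    qed
    show "AE y in lborel. \<bar>max 0 (s\<^sup>2 - y \<bullet> y) * (indicator (ball 0 R) y * L y) - max 0 (t\<^sup>2 - y \<bullet> y) * (indicator (ball 0 R) y * L y)\<bar>
      \<le> (2 * R + 1) * (indicator (ball 0 R) y * K) * norm (s - t)" if s: "s \<in> {t - 1<..<t + 1}" for s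
    proof (rule AE_I2)
      fix y :: 'a
      have "\<bar>indicator (ball 0 R) y * L y\<bar> \<le> indicator (ball 0 R) y * K" using K[of y] by (auto simp: indicator_def)
      then have "\<bar>max 0 (s\<^sup>2 - y \<bullet> y) - max 0 (t\<^sup>2 - y \<bullet> y)\<bar> * \<bar>indicator (ball 0 R) y * L y\<bar>
        \<le> ((2 * R + 1) * \<bar>s - t\<bar>) * (indicator (ball 0 R) y * K)"
        using sq[OF s, of y] R0 by (intro mult_mono) auto
      then show "\<bar>max 0 (s\<^sup>2 - y \<bullet> y) * (indicator (ball 0 R) y * L y) - max 0 (t\<^sup>2 - y \<bullet> y) * (indicator (ball 0 R) y * L y)\<bar>
      \<le> (2 * R + 1) * (indicator (ball 0 R) y * K) * norm (s - t)"
        unfolding left_diff_distrib[symmetric] abs_mult[of "max 0 (s\<^sup>2 - y \<bullet> y) - max 0 (t\<^sup>2 - y \<bullet> y)"] real_norm_def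
        by (simp only: mult_ac)
    qed
    show "AE y in lborel. norm (?G y) \<le> (2 * R + 1) * (indicator (ball 0 R) y * K)"
    proof (rule AE_I2)
      fix y :: 'a
      have "\<bar>indicator (ball 0 R) y * L y\<bar> \<le> indicator (ball 0 R) y * K" using K[of y] by (auto simp: indicator_def)
      moreover have "\<bar>if y \<bullet> y < t\<^sup>2 then 2 * t else 0\<bar> \<le> 2 * R + 1" using t by auto
      ultimately have "\<bar>if y \<bullet> y < t\<^sup>2 then 2 * t else 0\<bar> * \<bar>indicator (ball 0 R) y * L y\<bar> \<le> (2 * R + 1) * (indicator (ball 0 R) y * K)"
        using R0 by (intro mult_mono) auto
      then show "norm (?G y) \<le> (2 * R + 1) * (indicator (ball 0 R) y * K)" by (simp only: real_norm_def abs_mult)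
    qed
  qed auto
  moreover have "integral\<^sup>L lborel ?G = 2 * t * ball_integral L t"
  proof -
    have e: "?G y = 2 * t * (indicator (ball 0 t) y * L y)" for y
    proof -
      have "y \<bullet> y < t\<^sup>2 \<longleftrightarrow> norm y < t" 
        unfolding dot_square_norm using t power2_less_imp_less[of "norm y" t] power_strict_mono[of "norm y" t 2] by auto
      then show ?thesis using t by (auto simp: indicator_def)
    qed
    show ?thesis unfolding e ball_integral_def by simp
  qed
  ultimately show ?thesis unfolding has_field_derivative_def inner_real_def by simp
qed

text \<open>With \<open>F\<close> the ball integral, integration by parts gives
  \<open>t * F' t = ?m * F t + J t / 2\<close>. The hypothesis bounds the derivative of
  \<open>J\<close>, which is \<open>2 * t * ball_integral (laplacian f) t\<close>, by
  \<open>4 * K * F' t\<close>; both \<open>J\<close> and \<open>F\<close> vanish at 0, so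
  \<open>J t \<le> 4 * K * F t\<close>. Therefore \<open>F t * t powr (- \<kappa>)\<close> does not
  increase.\<close>

lemma ball_integral_growth:
  fixes f :: "'a::euclidean_space \<Rightarrow> real"
  assumes W: "open W" "C_k_on 2 W f" and R: "0 < R" "cball 0 R \<subseteq> W" and K: "K \<ge> 0" and f0: "\<And>x. x \<in> W \<Longrightarrow> 0 \<le> f x"
    and freq: "\<And>t F'. 0 < t \<Longrightarrow> t < R \<Longrightarrow> (ball_integral f has_real_derivative F') (at t) \<Longrightarrow>
        t * ball_integral (laplacian f) t \<le> 2 * K * F'"
    and ab: "0 < a" "a \<le> b" "b < R"
  shows "ball_integral f b \<le> (b / a) powr (real DIM('a) + 2 * K) * ball_integral f a"
proof -
  let ?m = "real DIM('a)"
  have C1: "C_k_on 1 W f" using W(2) C_k_on_lower[of 1 W f] by (simp add: numeral_2_eq_2)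
  have fc: "continuous_on (cball 0 R) f" using C_k_on_imp_continuous_on[OF C1] R(2) continuous_on_subset by blast
  have Lc: "continuous_on (cball 0 R) (laplacian f)"
    using C_k_on_laplacian[of W 0 f] W R(2) continuous_on_subset by (auto simp: numeral_2_eq_2)
  define \<phi> where "\<phi> t = (\<integral>z. indicator (ball 0 1) z * (f (0 + t *\<^sub>R z) * 1) \<partial>lborel)" for t
  define \<phi>' where "\<phi>' t = (\<integral>z. indicator (ball 0 1) z * ((grad f (0 + t *\<^sub>R z) \<bullet> z) * 1) \<partial>lborel)" for t
  define J where "J t = (\<integral>y. max 0 (t\<^sup>2 - y \<bullet> y) * (indicator (ball 0 R) y * laplacian f y) \<partial>lborel)" for t
  have d\<phi>: "(\<phi> has_real_derivative \<phi>' t) (at t)" if "\<bar>t\<bar> < R" for t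
    unfolding \<phi>_def \<phi>'_def by (rule radial_integral_has_derivative[OF W(1) C1 R(2) that]) (intro continuous_intros)
  have F\<phi>: "ball_integral f t = t ^ DIM('a) * \<phi> t" if "0 \<le> t" "t \<le> R" for t
  proof -
    have "cball 0 t \<subseteq> cball (0::'a) R" using that by auto
    from ball_integral_scale[OF that(1) continuous_on_subset[OF fc this]] show ?thesis by (simp add: \<phi>_def)
  qed
  have J\<phi>: "J t = 2 * t ^ Suc DIM('a) * \<phi>' t" if t: "0 < t" "t < R" for t
  proof -
    have sub: "cball 0 \<bar>t\<bar> \<subseteq> W" using t R(2) by (auto simp: subset_iff)
    have "J t = (\<integral>y. indicator (ball 0 t) y * ((t\<^sup>2 - y \<bullet> y) * laplacian f y) \<partial>lborel)"
      unfolding J_def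
    proof (rule Bochner_Integration.integral_cong[OF refl])
      fix y :: 'a
      show "max 0 (t\<^sup>2 - y \<bullet> y) * (indicator (ball 0 R) y * laplacian f y) = indicator (ball 0 t) y * ((t\<^sup>2 - y \<bullet> y) * laplacian f y)"
      proof (cases "norm y < t")
        case True
        then have "y \<bullet> y \<le> t\<^sup>2" unfolding dot_square_norm by (intro power_mono) auto
        then show ?thesis using True t by (simp add: max_absorb2)
      next
        case False
        then have "t\<^sup>2 \<le> y \<bullet> y" unfolding dot_square_norm using t by (intro power_mono) auto
        then show ?thesis using False by (simp add: max_absorb1)
      qed
    qed
    also have "\<dots> = ball_integral (\<lambda>y. (t\<^sup>2 - y \<bullet> y) * laplacian f y) t" by (simp add: ball_integral_def)
    also have "\<dots> = t ^ DIM('a) * (\<integral>z. indicator (ball 0 1) z * ((t\<^sup>2 - (t *\<^sub>R z) \<bullet> (t *\<^sub>R z)) * laplacian f (t *\<^sub>R z)) \<partial>lborel)"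
      by (rule ball_integral_scale) (use t in \<open>auto intro!: continuous_intros continuous_on_subset[OF Lc]\<close>)
    also have "(\<lambda>z. indicator (ball 0 1) z * ((t\<^sup>2 - (t *\<^sub>R z) \<bullet> (t *\<^sub>R z)) * laplacian f (t *\<^sub>R z))) =
        (\<lambda>z. t\<^sup>2 * (indicator (ball 0 1) z * (laplacian f (0 + t *\<^sub>R z) * (1 - z \<bullet> z) ^ Suc 0)))"
      by (auto simp: fun_eq_iff power2_eq_square algebra_simps)
    also have "integral\<^sup>L lborel \<dots> = t * (t * (\<integral>z. indicator (ball 0 1) z * (laplacian f (0 + t *\<^sub>R z) * (1 - z \<bullet> z) ^ Suc 0) \<partial>lborel))"
      by (simp add: power2_eq_square)
    also have "t * (\<integral>z. indicator (ball 0 1) z * (laplacian f (0 + t *\<^sub>R z) * (1 - z \<bullet> z) ^ Suc 0) \<partial>lborel) = 2 * \<phi>' t"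
      using laplacian_weight_by_parts[OF W sub, of 0] by (simp add: \<phi>'_def)
    finally show ?thesis by simp
  qed
  define F' where "F' t = ?m * t ^ (DIM('a) - 1) * \<phi> t + t ^ DIM('a) * \<phi>' t" for t
  have dF: "(ball_integral f has_real_derivative F' t) (at t)" if t: "0 < t" "t < R" for t
  proof -
    have "((\<lambda>t. t ^ DIM('a) * \<phi> t) has_real_derivative F' t) (at t)"
      unfolding F'_def by (rule DERIV_cong[OF DERIV_mult[OF DERIV_power[OF DERIV_ident] d\<phi>]]) (use t in auto)
    then show ?thesis
      by (rule has_field_derivative_transform_within_open[of _ _ _ "{0<..<R}"]) (use t F\<phi> in auto)
  qed
  have tF: "t * F' t = ?m * ball_integral f t + J t / 2" if t: "0 < t" "t < R" for t
  proof -
    have "t * t ^ (DIM('a) - 1) = t ^ DIM('a)" by (metis DIM_positive power_minus_mult mult.commute)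
    then have "t * F' t = ?m * (t ^ DIM('a) * \<phi> t) + t ^ Suc DIM('a) * \<phi>' t" by (simp add: F'_def distrib_left)
    then show ?thesis using F\<phi>[of t] J\<phi>[OF t] t by simp
  qed
  have dJ: "(J has_real_derivative 2 * t * ball_integral (laplacian f) t) (at t)" if "0 \<le> t" "t \<le> R" for t
    unfolding J_def by (rule paraboloid_integral_has_derivative[OF Lc that])
  have JF: "J t \<le> 4 * K * ball_integral f t" if t: "0 < t" "t < R" for t
  proof -
    \<comment> \<open>The ball integral is written as \<open>t ^ DIM('a) * \<phi> t\<close>, which
      is continuous at 0 because \<open>\<phi>\<close> is differentiable there.\<close>
    define Q where "Q t = J t - 4 * K * (t ^ DIM('a) * \<phi> t)" for t
    have "Q t \<le> Q 0"
    proof (rule DERIV_nonpos_imp_decreasing_open[where f = Q])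
      show "continuous_on {0..t} Q"
      proof (rule continuous_at_imp_continuous_on, rule ballI)
        fix s assume "s \<in> {0..t}"
        then have "isCont J s" "isCont \<phi> s" using t by (auto intro: DERIV_isCont[OF dJ] DERIV_isCont[OF d\<phi>])
        then show "isCont Q s" unfolding Q_def by (intro continuous_intros)
      qed
      fix s assume s: "0 < s" "s < t"
      have "(Q has_real_derivative 2 * s * ball_integral (laplacian f) s - 4 * K * F' s) (at s)"
      proof -
        have "((\<lambda>t. t ^ DIM('a) * \<phi> t) has_real_derivative F' s) (at s)"
          unfolding F'_def by (rule DERIV_cong[OF DERIV_mult[OF DERIV_power[OF DERIV_ident] d\<phi>]]) (use s t in auto)
        then show ?thesis unfolding Q_def
          by (intro DERIV_diff dJ DERIV_cmult) (use s t in auto)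
      qed
      moreover have "2 * s * ball_integral (laplacian f) s - 4 * K * F' s \<le> 0"
        using freq[OF s(1) _ dF[OF s(1)]] s t by simp
      ultimately show "\<exists>y. (Q has_real_derivative y) (at s) \<and> y \<le> 0" by blast
    qed (use t in auto)
    moreover have "Q 0 = 0" by (simp add: Q_def J_def max_absorb1)
    ultimately show ?thesis using F\<phi>[of t] t by (simp add: Q_def)
  qed
  define \<kappa> where "\<kappa> = ?m + 2 * K"
  define P where "P t = ball_integral f t * t powr (- \<kappa>)" for t
  have "P b \<le> P a"
  proof (rule DERIV_nonpos_imp_nonincreasing[OF ab(2), where f = P])
    fix t assume t: "a \<le> t" "t \<le> b"
    then have t': "0 < t" "t < R" using ab by auto
    have "(P has_real_derivative F' t * t powr (- \<kappa>) + (- \<kappa> * t powr (- \<kappa> - 1)) * ball_integral f t) (at t)"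
      unfolding P_def by (rule DERIV_mult[OF dF[OF t'] has_real_derivative_powr]) (use t' in auto)
    moreover have "F' t * t powr (- \<kappa>) + (- \<kappa> * t powr (- \<kappa> - 1)) * ball_integral f t = (t * F' t - \<kappa> * ball_integral f t) * t powr (- \<kappa> - 1)"
    proof -
      have "t powr (- \<kappa>) = t * t powr (- \<kappa> - 1)" using t' powr_mult_base[of t "- \<kappa> - 1"] by simp
      then show ?thesis by (simp add: algebra_simps)
    qed
    moreover have "t * F' t - \<kappa> * ball_integral f t \<le> 0" using tF[OF t'] JF[OF t'] by (simp add: \<kappa>_def algebra_simps)
    then have "(t * F' t - \<kappa> * ball_integral f t) * t powr (- \<kappa> - 1) \<le> 0" by (intro mult_nonpos_nonneg) auto
    ultimately show "\<exists>y. (P has_real_derivative y) (at t) \<and> y \<le> 0" by auto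
  qed
  then have "b powr \<kappa> * P b \<le> b powr \<kappa> * P a" by (intro mult_left_mono) auto
  moreover have "b powr \<kappa> * P b = ball_integral f b" using ab by (simp add: P_def powr_minus field_simps)
  moreover have "b powr \<kappa> * P a = (b / a) powr \<kappa> * ball_integral f a"
    using ab by (simp add: P_def powr_minus powr_divide field_simps)
  ultimately show ?thesis by (simp add: \<kappa>_def)
qed

lemma continuous_on_ball_integral:
  fixes L :: "'a::euclidean_space \<Rightarrow> real"
  assumes L: "continuous_on (cball 0 R) L"
  shows "continuous_on {0..R} (ball_integral L)"
proof -
  obtain K where K: "\<And>x. x \<in> cball 0 R \<Longrightarrow> norm (L x) \<le> K"
    using continuous_on_cball_norm_bound[OF L] by blast
  have Lc: "continuous_on (cball 0 1) (\<lambda>z. L (t *\<^sub>R z))" if "t \<in> {0..R}" for t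
  proof (rule continuous_on_compose2[OF L])
    show "(\<lambda>z. t *\<^sub>R z) ` cball 0 1 \<subseteq> cball (0::'a) R"
    proof (rule image_subsetI)
      fix z :: 'a assume "z \<in> cball 0 1"
      then show "t *\<^sub>R z \<in> cball 0 R" using affine_mem_cball[of z t R 0] that by simp
    qed
  qed (intro continuous_intros)
  have "continuous_on {0..R} (\<lambda>t. \<integral>z. indicator (ball 0 1) z * L (t *\<^sub>R z) \<partial>lborel)"
    unfolding continuous_on_sequentially o_def
  proof (intro allI ballI impI, elim conjE)
    fix X t assume t: "t \<in> {0..R}" and X: "\<forall>n. X n \<in> {0..R}" "X \<longlonglongrightarrow> t"
    have mem: "X n *\<^sub>R z \<in> cball 0 R" if "norm z \<le> 1" for z :: 'a and n
      using affine_mem_cball[OF that, of "X n" R 0] spec[OF X(1), of n] by simp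
    show "(\<lambda>n. \<integral>z. indicator (ball 0 1) z * L (X n *\<^sub>R z) \<partial>lborel) \<longlonglongrightarrow> (\<integral>z. indicator (ball 0 1) z * L (t *\<^sub>R z) \<partial>lborel)"
    proof (rule integral_dominated_convergence[where w = "\<lambda>z. indicator (ball 0 1) z * K"])
      show "(\<lambda>z. indicator (ball 0 1) z * L (t *\<^sub>R z)) \<in> borel_measurable lborel"
        by (rule borel_measurable_integrable[OF integrable_ball_continuous[OF Lc[OF t]]])
      show "(\<lambda>z. indicator (ball 0 1) z * L (X n *\<^sub>R z)) \<in> borel_measurable lborel" for n
        by (rule borel_measurable_integrable[OF integrable_ball_continuous[OF Lc]]) (use X(1) in blast)
      show "integrable lborel (\<lambda>z::'a. indicator (ball 0 1) z * K)"
        by (intro integrable_ball_continuous continuous_intros)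
      show "AE z in lborel. (\<lambda>n. indicator (ball 0 1) z * L (X n *\<^sub>R z)) \<longlonglongrightarrow> indicator (ball 0 1) z * L (t *\<^sub>R z)"
      proof (rule AE_I2)
        fix z :: 'a
        show "(\<lambda>n. indicator (ball 0 1) z * L (X n *\<^sub>R z)) \<longlonglongrightarrow> indicator (ball 0 1) z * L (t *\<^sub>R z)"
        proof (cases "norm z < 1")
          case True
          have "(\<lambda>n. L (X n *\<^sub>R z)) \<longlonglongrightarrow> L (t *\<^sub>R z)"
          proof (rule continuous_on_tendsto_compose[OF L])
            show "(\<lambda>n. X n *\<^sub>R z) \<longlonglongrightarrow> t *\<^sub>R z" by (intro tendsto_intros X)
            show "t *\<^sub>R z \<in> cball 0 R" using affine_mem_cball[of z t R 0] t True by simp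
            show "\<forall>\<^sub>F n in sequentially. X n *\<^sub>R z \<in> cball 0 R" using mem[of z] True by (intro always_eventually) auto
          qed
          then show ?thesis by (intro tendsto_mult tendsto_const)
        qed auto
      qed
      show "AE z in lborel. norm (indicator (ball 0 1) z * L (X n *\<^sub>R z)) \<le> indicator (ball 0 1) z * K" for n
      proof (rule AE_I2)
        fix z :: 'a
        show "norm (indicator (ball 0 1) z * L (X n *\<^sub>R z)) \<le> indicator (ball 0 1) z * K"
          using K[OF mem[of z n]] by (cases "norm z < 1") auto
      qed
    qed
  qed
  then have c: "continuous_on {0..R} (\<lambda>t. t ^ DIM('a) * (\<integral>z. indicator (ball 0 1) z * L (t *\<^sub>R z) \<partial>lborel))"
    by (intro continuous_intros)
  show ?thesis
  proof (rule continuous_on_eq[OF c])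
    fix t assume "t \<in> {0..R}"
    then have "0 \<le> t" "cball 0 t \<subseteq> cball (0::'a) R" by auto
    then show "t ^ DIM('a) * (\<integral>z. indicator (ball 0 1) z * L (t *\<^sub>R z) \<partial>lborel) = ball_integral L t"
      using ball_integral_scale[OF _ continuous_on_subset[OF L]] by metis
  qed
qed

text \<open>The bound on the logarithmic derivative holds only where \<open>N\<close> is at least
  \<open>C0\<close>. It is integrated from \<open>a\<close> to the first point at which
  \<open>N\<close> falls to \<open>C0\<close>, or to \<open>b\<close> if there is none; in both
  cases the value reached is at most \<open>max (N b) C0\<close>. The interval is no longer than 1,
  whence the factor \<open>exp C\<close>.\<close>

lemma almost_monotone_bound:
  fixes N :: "real \<Rightarrow> real"
  assumes ab: "a \<le> b" "b \<le> a + 1" and c: "continuous_on {a..b} N" and C0: "C0 > 0" and C: "C \<ge> 0"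
    and d: "\<And>t. a \<le> t \<Longrightarrow> t \<le> b \<Longrightarrow> N t \<ge> C0 \<Longrightarrow> \<exists>D. ((\<lambda>s. ln (N s)) has_real_derivative D) (at t) \<and> D \<ge> - C"
  shows "N a \<le> exp C * max (N b) C0"
proof (rule ccontr)
  assume "\<not> ?thesis"
  then have big: "exp C * max (N b) C0 < N a" by simp
  have "1 * max (N b) C0 \<le> exp C * max (N b) C0" using C C0 by (intro mult_right_mono) auto
  then have Na: "N a > C0" using big by linarith
  have *: False if T: "a \<le> T" "T \<le> b" "N T \<le> max (N b) C0" "\<And>t. a \<le> t \<Longrightarrow> t \<le> T \<Longrightarrow> N t \<ge> C0" for T
  proof -
    have "ln (N a) + C * a \<le> ln (N T) + C * T"
    proof (rule DERIV_nonneg_imp_nondecreasing[OF T(1), where f = "\<lambda>t. ln (N t) + C * t"])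
      fix t assume t: "a \<le> t" "t \<le> T"
      then obtain D where D: "((\<lambda>s. ln (N s)) has_real_derivative D) (at t)" "D \<ge> - C" using d[of t] T by auto
      have "((\<lambda>t. ln (N t) + C * t) has_real_derivative D + C * 1) (at t)"
        by (intro DERIV_add D DERIV_cmult DERIV_ident)
      then show "\<exists>y. ((\<lambda>t. ln (N t) + C * t) has_real_derivative y) (at t) \<and> 0 \<le> y" using D(2) by (intro exI[of _ "D + C * 1"]) auto
    qed
    moreover have "C * T \<le> C * (a + 1)" using T ab C by (intro mult_left_mono) auto
    ultimately have "ln (N a) \<le> ln (N T) + C" by (simp add: algebra_simps)
    then have "exp (ln (N a)) \<le> exp (ln (N T) + C)" by simp
    moreover have "N T > 0" "N a > 0" using T(4)[of T] T(1) Na C0 by auto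
    ultimately have "N a \<le> exp C * N T" by (simp add: exp_add mult.commute)
    also have "\<dots> \<le> exp C * max (N b) C0" using T(3) by (intro mult_left_mono) auto
    finally show False using big by simp
  qed
  define Z where "Z = {t \<in> {a..b}. N t \<le> C0}"
  show False
  proof (cases "Z = {}")
    case True
    then have "\<not> N t \<le> C0" if "a \<le> t" "t \<le> b" for t using that unfolding Z_def by auto
    then show False using ab by (intro *[of b]) (auto simp: not_le intro: less_imp_le)
  next
    case False
    have "closed Z" unfolding Z_def by (rule continuous_on_closed_Collect_le[OF c]) auto
    moreover have "bounded Z" by (rule bounded_subset[of "{a..b}"]) (auto simp: Z_def)
    ultimately have "compact Z" by (simp add: compact_eq_bounded_closed)
    then obtain T where T: "T \<in> Z" "\<And>t. t \<in> Z \<Longrightarrow> T \<le> t" using compact_attains_inf[OF _ False] by blast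
    have Tab: "a \<le> T" "T \<le> b" "N T \<le> C0" using T(1) by (auto simp: Z_def)
    have min: "N t > C0" if "a \<le> t" "t < T" for t
      using T(2)[of t] that Tab by (force simp: Z_def)
    have "N T = C0"
    proof (rule ccontr)
      assume "N T \<noteq> C0"
      then have lt: "N T < C0" using Tab by simp
      have "\<exists>t\<ge>a. t \<le> T \<and> N t = C0"
        by (rule IVT2') (use lt Na Tab continuous_on_subset[OF c] in auto)
      then obtain t where "a \<le> t" "t \<le> T" "N t = C0" by blast
      then show False using min[of t] lt by (cases "t = T") auto
    qed
    then show False using Tab min by (intro *[of T]) (auto simp: less_imp_le order.order_iff_strict)
  qed
qed

lemma cball_zero_subset_Times:
  fixes A :: "'a::euclidean_space set"
  assumes "cball 0 t \<subseteq> A"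
  shows "cball 0 t \<subseteq> A \<times> (UNIV :: 'b::euclidean_space set)"
proof
  fix y :: "'a \<times> 'b" assume "y \<in> cball 0 t"
  then have "norm (fst y) \<le> t" using norm_fst_le[of "fst y" "snd y"] by simp
  then show "y \<in> A \<times> UNIV" using assms by (cases y) auto
qed

section \<open>The squares of g and h, and the frequency function\<close>

definition phi_lift :: "real \<Rightarrow> (real^'n \<Rightarrow> real) \<Rightarrow> (real^'n) \<times> real \<Rightarrow> real" where
  "phi_lift lam u y = (lift_g lam u y)\<^sup>2 + (lift_h lam u y)\<^sup>2"

lemma exp_derivs: "((\<lambda>t. c ^ j * exp (c * t)) has_real_derivative c ^ Suc j * exp (c * t)) (at t)"
  by (auto intro!: derivative_eq_intros)

lemma lift_g_C_k_on:
  assumes "open \<Omega>" "C_k_on k \<Omega> a"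
  shows "C_k_on k (\<Omega> \<times> UNIV) (lift_g lam a)"
  using C_k_on_separated_product[where b = "\<lambda>j t. sqrt lam ^ j * exp (sqrt lam * t)" and j = 0, OF assms(1) exp_derivs assms(2)]
  by (simp add: lift_g_def[abs_def])

lemma lift_g_laplacian:
  assumes "open \<Omega>" "C_k_on 2 \<Omega> a" "y \<in> \<Omega> \<times> UNIV" "lam \<ge> 0"
  shows "laplacian (lift_g lam a) y = lift_g lam (\<lambda>x. laplacian a x + lam * a x) y"
proof -
  have "sqrt lam * sqrt lam = lam" using assms(4) by simp
  then show ?thesis
    using laplacian_separated_product[where b = "\<lambda>j t. sqrt lam ^ j * exp (sqrt lam * t)" and j = 0, OF assms(1) exp_derivs assms(2,3)]
    by (simp add: lift_g_def[abs_def] algebra_simps)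
qed

context
  fixes \<Omega> :: "(real^'n) set" and lam :: real and u :: "real^'n \<Rightarrow> real"
  assumes \<Omega>: "open \<Omega>" and lam: "lam > 1" and u4: "C_k_on 4 \<Omega> u"
    and eq: "\<And>x. x \<in> \<Omega> \<Longrightarrow> laplacian (laplacian u) x = lam\<^sup>2 * u x"
begin

lemma eigenfunction_C_k_on_2: "C_k_on 2 \<Omega> u"
proof -
  have "C_k_on (Suc (Suc 2)) \<Omega> u" using u4 by (simp add: eval_nat_numeral)
  then show ?thesis by (rule C_k_on_lower[OF C_k_on_lower])
qed

lemma laplacian_C_k_on_2: "C_k_on 2 \<Omega> (laplacian u)"
proof -
  have "C_k_on (Suc (Suc 2)) \<Omega> u" using u4 by (simp add: eval_nat_numeral)
  then show ?thesis by (rule C_k_on_laplacian[OF \<Omega>])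
qed

text \<open>The operator \<triangle>^2 - lam^2 factors into \<triangle> - lam and \<triangle> + lam.
  The choices \<open>c = lam\<close> and \<open>c = - lam\<close> give the two second order
  eigenfunctions that \<open>u\<close> is built from.\<close>

lemma shifted_laplacian:
  "C_k_on 2 \<Omega> (\<lambda>x. laplacian u x + c * u x)"
  "x \<in> \<Omega> \<Longrightarrow> c\<^sup>2 = lam\<^sup>2 \<Longrightarrow> laplacian (\<lambda>x. laplacian u x + c * u x) x = c * (laplacian u x + c * u x)"
proof -
  show "C_k_on 2 \<Omega> (\<lambda>x. laplacian u x + c * u x)"
    by (intro C_k_on_add[OF \<Omega>] C_k_on_mult[OF \<Omega>] laplacian_C_k_on_2 eigenfunction_C_k_on_2 C_k_on_const)
  show "laplacian (\<lambda>x. laplacian u x + c * u x) x = c * (laplacian u x + c * u x)" if "x \<in> \<Omega>" "c\<^sup>2 = lam\<^sup>2"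
    using laplacian_lincomb[OF \<Omega> laplacian_C_k_on_2 eigenfunction_C_k_on_2 that(1), of 1 c] eq[OF that(1)] that(2)
    by (simp add: algebra_simps power2_eq_square)
qed

text \<open>In the extra variable the exponential contributes \<open>lam\<close>, which cancels the
  eigenvalue \<open>- lam\<close> of \<open>\<lambda>x. laplacian u x - lam * u x\<close>.\<close>

lemma lift_h_harmonic:
  "C_k_on 2 (\<Omega> \<times> UNIV) (lift_h lam u)" "y \<in> \<Omega> \<times> UNIV \<Longrightarrow> laplacian (lift_h lam u) y = 0"
proof -
  have h: "lift_h lam u = lift_g lam (\<lambda>x. laplacian u x + (- lam) * u x)" by (simp add: lift_h_def)
  show "C_k_on 2 (\<Omega> \<times> UNIV) (lift_h lam u)" unfolding h by (intro lift_g_C_k_on \<Omega> shifted_laplacian(1))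
  show "laplacian (lift_h lam u) y = 0" if y: "y \<in> \<Omega> \<times> UNIV"
    unfolding h using lift_g_laplacian[OF \<Omega> shifted_laplacian(1) y, of lam "- lam"] shifted_laplacian(2)[of "fst y" "- lam"] y lam
    by (auto simp: lift_g_def)
qed

text \<open>Since h is harmonic and the Laplacian of g is h + 2 lam g, the Laplacian of g^2 + h^2
  consists of the squared gradients and of g times its Laplacian. This explains the terms g h and 2
  lam g^2 in the numerator of the frequency.\<close>

lemma phi_lift_laplacian:
  "C_k_on 2 (\<Omega> \<times> UNIV) (phi_lift lam u)"
  "y \<in> \<Omega> \<times> UNIV \<Longrightarrow> laplacian (phi_lift lam u) y = 2 * ((norm (grad (lift_g lam u) y))\<^sup>2 +
     (norm (grad (lift_h lam u) y))\<^sup>2 + lift_g lam u y * lift_h lam u y + 2 * lam * (lift_g lam u y)\<^sup>2)"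
proof -
  have op: "open (\<Omega> \<times> (UNIV :: real set))" using \<Omega> by (intro open_Times) auto
  have g: "C_k_on 2 (\<Omega> \<times> UNIV) (lift_g lam u)" by (intro lift_g_C_k_on \<Omega> eigenfunction_C_k_on_2)
  note h = lift_h_harmonic(1)
  have g2: "C_k_on 2 (\<Omega> \<times> UNIV) (\<lambda>y. (lift_g lam u y)\<^sup>2)" and h2: "C_k_on 2 (\<Omega> \<times> UNIV) (\<lambda>y. (lift_h lam u y)\<^sup>2)"
    unfolding power2_eq_square by (intro C_k_on_mult[OF op] g h)+
  have p: "phi_lift lam u = (\<lambda>y. 1 * (lift_g lam u y)\<^sup>2 + 1 * (lift_h lam u y)\<^sup>2)" by (simp add: phi_lift_def fun_eq_iff)
  show "C_k_on 2 (\<Omega> \<times> UNIV) (phi_lift lam u)" unfolding p by (intro C_k_on_add[OF op] C_k_on_mult[OF op] C_k_on_const g2 h2)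
  assume y: "y \<in> \<Omega> \<times> UNIV"
  have "laplacian (lift_g lam u) y = lift_h lam u y + 2 * lam * lift_g lam u y"
    using lift_g_laplacian[OF \<Omega> eigenfunction_C_k_on_2 y, of lam] lam by (simp add: lift_h_def lift_g_def algebra_simps)
  then show "laplacian (phi_lift lam u) y = 2 * ((norm (grad (lift_g lam u) y))\<^sup>2 +
     (norm (grad (lift_h lam u) y))\<^sup>2 + lift_g lam u y * lift_h lam u y + 2 * lam * (lift_g lam u y)\<^sup>2)"
    unfolding p laplacian_lincomb[OF op g2 h2 y] laplacian_square[OF op g y] laplacian_square[OF op h y] lift_h_harmonic(2)[OF y]
    by (simp add: algebra_simps power2_eq_square)
qed

lemma frequency_eq:
  assumes "0 < t" "cball 0 t \<subseteq> \<Omega> \<times> (UNIV :: real set)"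
  shows "frequency lam u 0 t = t * (ball_integral (laplacian (phi_lift lam u)) t / 2) /
    (LINT y:sphere 0 t|hausdorff_measure CARD('n). phi_lift lam u y)"
proof -
  have "(LINT y:ball 0 t|lborel. (norm (grad (lift_g lam u) y))\<^sup>2 + (norm (grad (lift_h lam u) y))\<^sup>2 +
      lift_g lam u y * lift_h lam u y + 2 * lam * (lift_g lam u y)\<^sup>2) =
    (\<integral>y. (1/2) * (indicator (ball 0 t) y * laplacian (phi_lift lam u) y) \<partial>lborel)"
    unfolding set_lebesgue_integral_def
  proof (rule Bochner_Integration.integral_cong[OF refl])
    fix y :: "(real^'n) \<times> real"
    show "indicator (ball 0 t) y *\<^sub>R ((norm (grad (lift_g lam u) y))\<^sup>2 + (norm (grad (lift_h lam u) y))\<^sup>2 +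
      lift_g lam u y * lift_h lam u y + 2 * lam * (lift_g lam u y)\<^sup>2) = (1/2) * (indicator (ball 0 t) y * laplacian (phi_lift lam u) y)"
    proof (cases "y \<in> ball 0 t")
      case True
      then have "y \<in> \<Omega> \<times> UNIV" using assms(2) ball_subset_cball by blast
      then show ?thesis using True by (simp add: phi_lift_laplacian(2))
    qed simp
  qed
  then have e: "(LINT y:ball 0 t|lborel. (norm (grad (lift_g lam u) y))\<^sup>2 + (norm (grad (lift_h lam u) y))\<^sup>2 +
      lift_g lam u y * lift_h lam u y + 2 * lam * (lift_g lam u y)\<^sup>2) = ball_integral (laplacian (phi_lift lam u)) t / 2"
    by (simp add: ball_integral_def)
  show ?thesis unfolding frequency_def Let_def e phi_lift_def ..
qed

text \<open>The point \<open>x\<close> of the open ball has a point of the sphere above it, and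
  there g is nonzero because the exponential factor never vanishes.\<close>

lemma phi_lift_sphere_pos:
  assumes t: "0 < t" "cball 0 t \<subseteq> \<Omega>" and nz: "x \<in> ball 0 t" "u x \<noteq> 0"
  shows "(LINT y:sphere 0 t|hausdorff_measure CARD('n). phi_lift lam u y) > 0"
proof -
  have sub: "cball 0 t \<subseteq> \<Omega> \<times> (UNIV :: real set)" using cball_zero_subset_Times[OF t(2)] .
  define p where "p = (x, sqrt (t\<^sup>2 - (norm x)\<^sup>2))"
  have "(norm x)\<^sup>2 \<le> t\<^sup>2" using nz(1) t by (intro power_mono) auto
  then have np: "norm p = t" using t by (simp add: p_def norm_Pair)
  have "lift_g lam u p \<noteq> 0" using nz by (simp add: lift_g_def p_def)
  then have "phi_lift lam u p > 0" by (simp add: phi_lift_def add_pos_nonneg)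
  moreover have "continuous_on (sphere 0 t) (phi_lift lam u)"
    by (rule continuous_on_subset[OF C_k_on_imp_continuous_on[OF phi_lift_laplacian(1)]]) (use sub in auto)
  ultimately have "(LINT y:sphere 0 t|hausdorff_measure (DIM((real^'n) \<times> real) - 1). phi_lift lam u y) > 0"
    using np t by (intro hausdorff_sphere_integral_pos[where p = p]) (auto simp: phi_lift_def)
  then show ?thesis by simp
qed

text \<open>The ball integral of the Laplacian, times \<open>t\<close>, is twice the frequency times
  the sphere integral. Almost monotonicity bounds the first factor and the derivative of the ball
  integral bounds the second; \<open>K\<close> is the product of the constants that arise.\<close>

lemma phi_lift_growth:
  assumes thr: "\<And>(\<Omega> :: (real^'n) set) lam u y0 r.
        open \<Omega> \<and> connected \<Omega> \<and> bounded \<Omega> \<and> lam > 1 \<and> eigenfunction_on \<Omega> lam u \<and>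
        0 < r \<and> r \<le> 1 \<and> cball y0 r \<subseteq> \<Omega> \<times> UNIV \<and> frequency lam u y0 r \<ge> C0 \<Longrightarrow>
        \<exists>D. ((\<lambda>s. ln (frequency lam u y0 s)) has_real_derivative D) (at r) \<and> D \<ge> - Cstar"
    and C0: "C0 > 0" and Cs: "Cstar > 0" and r0: "0 < r0" "r0 < 1" "cball 0 r0 \<subseteq> \<Omega>"
    and nz: "\<And>t. 0 < t \<Longrightarrow> \<exists>x\<in>ball 0 t. u x \<noteq> 0" and ab: "0 < a" "a \<le> b" "b < r0"
  defines "K \<equiv> exp Cstar * cone_const TYPE((real^'n) \<times> real) / (CARD('n) + 1) * max (frequency lam u 0 r0) C0"
  shows "ball_integral (phi_lift lam u) b \<le> (b / a) powr (real CARD('n) + 1 + 2 * K) * ball_integral (phi_lift lam u) a"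
proof -
  let ?f = "phi_lift lam u" and ?N = "frequency lam u 0"
  let ?S = "\<lambda>t. LINT y:sphere 0 t|hausdorff_measure CARD('n). phi_lift lam u y"
  obtain r1 where r1: "r1 > r0" "cball 0 r1 \<subseteq> \<Omega>" using cball_subset_open_enlarge[OF \<Omega> r0(3)] r0(1) by auto
  have sub1: "cball 0 t \<subseteq> cball (0 :: real^'n) s" if "t \<le> s" for t s using that by auto
  have subO: "cball 0 t \<subseteq> \<Omega> \<times> (UNIV :: real set)" if "t \<le> r1" for t
    by (rule cball_zero_subset_Times) (use sub1[OF that] r1(2) in blast)
  have op: "open (\<Omega> \<times> (UNIV :: real set))" using \<Omega> by (intro open_Times) auto
  have fc: "continuous_on (cball 0 r0) ?f"
    by (rule continuous_on_subset[OF C_k_on_imp_continuous_on[OF phi_lift_laplacian(1)]]) (use subO r1 in auto)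
  have Lc: "continuous_on (cball 0 r0) (laplacian ?f)"
  proof -
    have "C_k_on 0 (\<Omega> \<times> UNIV) (laplacian ?f)"
      by (rule C_k_on_laplacian[OF op]) (use phi_lift_laplacian(1) in \<open>simp add: numeral_2_eq_2\<close>)
    then show ?thesis using continuous_on_subset subO[of r0] r1 by auto
  qed
  have Spos: "?S t > 0" if t: "0 < t" "t \<le> r0" for t
  proof -
    obtain x where "x \<in> ball 0 t" "u x \<noteq> 0" using nz t by blast
    then show ?thesis using phi_lift_sphere_pos[OF t(1)] r0(3) sub1[OF t(2)] by blast
  qed
  have Neq: "?N t = t * (ball_integral (laplacian ?f) t / 2) / ?S t" if "0 < t" "t \<le> r0" for t
    by (rule frequency_eq[OF that(1)]) (use subO[of t] that r1 in auto)
  have Nc: "continuous_on {0<..r0} ?N"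
  proof -
    have "continuous_on {0<..r0} (\<lambda>t. t * (ball_integral (laplacian ?f) t / 2) / ?S t)"
    proof (intro continuous_intros)
      show "continuous_on {0<..r0} (ball_integral (laplacian ?f))"
        by (rule continuous_on_subset[OF continuous_on_ball_integral[OF Lc]]) auto
      show "continuous_on {0<..r0} ?S"
        using continuous_on_hausdorff_sphere_integral[OF fc] by (simp add: phi_lift_def)
      show "\<forall>t\<in>{0<..r0}. ?S t \<noteq> 0" using Spos by fastforce
    qed auto
    then show ?thesis by (rule continuous_on_eq) (use Neq in auto)
  qed
  have Nb: "?N t \<le> exp Cstar * max (?N r0) C0" if t: "0 < t" "t \<le> r0" for t
  proof (rule almost_monotone_bound[OF t(2)])
    show "r0 \<le> t + 1" using t r0 by simp
    show "continuous_on {t..r0} ?N" by (rule continuous_on_subset[OF Nc]) (use t in auto)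
    fix s assume s: "t \<le> s" "s \<le> r0" "C0 \<le> ?N s"
    \<comment> \<open>The monotonicity formula is stated for bounded connected domains, so it is
      applied on a ball slightly larger than the one of radius \<open>r0\<close>, with
      \<open>u\<close> restricted to it.\<close>
    show "\<exists>D. ((\<lambda>s. ln (?N s)) has_real_derivative D) (at s) \<and> - Cstar \<le> D"
    proof (rule thr[of "ball 0 r1"], intro conjI)
      have bs: "ball 0 r1 \<subseteq> \<Omega>" using r1(2) ball_subset_cball by blast
      show "eigenfunction_on (ball 0 r1) lam u"
        unfolding eigenfunction_on_def
      proof (intro conjI)
        show "C_k_on 4 (ball 0 r1) u" by (rule C_k_on_subset[OF u4 bs])
        show "\<forall>x\<in>ball 0 r1. laplacian (laplacian u) x = lam\<^sup>2 * u x" using eq bs by blast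
        show "\<exists>x\<in>ball 0 r1. u x \<noteq> 0" using nz r1 r0 by simp
      qed
      show "cball 0 s \<subseteq> ball (0 :: real^'n) r1 \<times> (UNIV :: real set)"
        by (rule cball_zero_subset_Times) (use s r1 in auto)
    qed (use s t r0 lam in auto)
  qed (use C0 Cs in auto)
  have KK: "K \<ge> 0" unfolding K_def using cone_const_pos[where 'a="(real^'n) \<times> real"] C0 by (intro mult_nonneg_nonneg divide_nonneg_nonneg) auto
  have "ball_integral ?f b \<le> (b / a) powr (real DIM((real^'n) \<times> real) + 2 * K) * ball_integral ?f a"
  proof (rule ball_integral_growth[OF op phi_lift_laplacian(1) r0(1) _ KK _ _ ab])
    show "cball 0 r0 \<subseteq> \<Omega> \<times> (UNIV :: real set)" using subO[of r0] r1 by simp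
    show "0 \<le> ?f y" for y by (simp add: phi_lift_def)
    fix t F' assume t: "0 < t" "t < r0" and F': "(ball_integral ?f has_real_derivative F') (at t)"
    have S: "?S t \<le> cone_const TYPE((real^'n) \<times> real) / (CARD('n) + 1) * F'"
      using hausdorff_sphere_integral_le_derivative[OF t fc _ F'[unfolded ball_integral_def[abs_def]]]
      by (simp add: phi_lift_def add.commute)
    have "t * ball_integral (laplacian ?f) t = 2 * (?N t * ?S t)"
      using Neq[of t] Spos[of t] t by simp
    also have "\<dots> \<le> 2 * ((exp Cstar * max (?N r0) C0) * ?S t)"
      using Nb[of t] Spos[of t] t by (intro mult_left_mono mult_right_mono) auto
    also have "\<dots> \<le> 2 * ((exp Cstar * max (?N r0) C0) * (cone_const TYPE((real^'n) \<times> real) / (CARD('n) + 1) * F'))"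
      using C0 S by (intro mult_left_mono) auto
    also have "\<dots> = 2 * K * F'" by (simp add: K_def)
    finally show "t * ball_integral (laplacian ?f) t \<le> 2 * K * F'" .
  qed
  then show ?thesis by (simp add: add.commute)
qed

end

section \<open>The harmonic extension and unique continuation\<close>

text \<open>The functions \<open>w = \<triangle>u + \<lambda>u\<close> and \<open>v = \<triangle>u - \<lambda>u\<close> satisfy \<open>\<triangle>w = \<lambda>w\<close>,
  \<open>\<triangle>v = -\<lambda>v\<close> and \<open>2\<lambda>u = w - v\<close>. Multiplying \<open>w\<close> by \<open>cos (sqrt \<lambda> t)\<close> and \<open>v\<close> by
  \<open>exp (sqrt \<lambda> t)\<close> makes both harmonic.\<close>

definition harm_ext :: "real \<Rightarrow> (real^'n \<Rightarrow> real) \<Rightarrow> (real^'n) \<times> real \<Rightarrow> real" where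
  "harm_ext lam u y = ((laplacian u (fst y) + lam * u (fst y)) * cos (sqrt lam * snd y)
     - (laplacian u (fst y) - lam * u (fst y)) * exp (sqrt lam * snd y)) / (2 * lam)"

lemma harm_ext_zero: "lam \<noteq> 0 \<Longrightarrow> harm_ext lam u (x, 0) = u x"
  by (simp add: harm_ext_def)

text \<open>The phase \<open>j * pi / 2\<close> turns all derivatives of the cosine into cosines, so
  that they form one family indexed by \<open>j\<close> as for the exponential.\<close>

lemma cos_derivs: "((\<lambda>t. c ^ j * cos (c * t + real j * (pi / 2))) has_real_derivative c ^ Suc j * cos (c * t + real (Suc j) * (pi / 2))) (at t)"
proof -
  have "cos (c * t + real (Suc j) * (pi / 2)) = cos ((c * t + real j * (pi / 2)) + pi / 2)" by (simp add: algebra_simps add_divide_distrib)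
  also have "\<dots> = - sin (c * t + real j * (pi / 2))" by (simp add: cos_add)
  finally have e: "cos (c * t + real (Suc j) * (pi / 2)) = - sin (c * t + real j * (pi / 2))" .
  show ?thesis unfolding e by (auto intro!: derivative_eq_intros)
qed

lemma harm_ext_mv_on:
  fixes u :: "real^'n \<Rightarrow> real"
  assumes \<Omega>: "open \<Omega>" and lam: "lam > 1" and u4: "C_k_on 4 \<Omega> u"
    and eq: "\<And>x. x \<in> \<Omega> \<Longrightarrow> laplacian (laplacian u) x = lam\<^sup>2 * u x"
  shows "mv_on (\<Omega> \<times> UNIV) (harm_ext lam u)"
proof -
  note sl = shifted_laplacian[OF \<Omega> lam u4 eq]
  have op: "open (\<Omega> \<times> (UNIV :: real set))" using \<Omega> by (intro open_Times) auto
  let ?w = "\<lambda>x. laplacian u x + lam * u x" and ?v = "\<lambda>x. laplacian u x + (- lam) * u x"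
  let ?b = "\<lambda>j t. sqrt lam ^ j * cos (sqrt lam * t + real j * (pi / 2))" and ?e = "\<lambda>j t. sqrt lam ^ j * exp (sqrt lam * t)"
  let ?W = "\<lambda>y. ?w (fst y) * ?b 0 (snd y)" and ?V = "\<lambda>y. ?v (fst y) * ?e 0 (snd y)"
  have s2: "sqrt lam * sqrt lam = lam" using lam by simp
  have W2: "C_k_on 2 (\<Omega> \<times> UNIV) ?W"
    by (rule C_k_on_separated_product[where b = ?b and j = 0, OF \<Omega> cos_derivs sl(1)])
  have V2: "C_k_on 2 (\<Omega> \<times> UNIV) ?V"
    by (rule C_k_on_separated_product[where b = ?e and j = 0, OF \<Omega> exp_derivs sl(1)])
  have Wh: "laplacian ?W y = 0" if y: "y \<in> \<Omega> \<times> UNIV" for y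
  proof -
    have "?b (Suc (Suc 0)) t = - lam * ?b 0 t" for t
      using s2 by (simp add: mult.assoc[symmetric])
    moreover have "laplacian ?w (fst y) = lam * ?w (fst y)" by (rule sl(2)) (use y in auto)
    ultimately show ?thesis
      using laplacian_separated_product[where b = ?b and j = 0, OF \<Omega> cos_derivs sl(1) y, of lam] by (simp only:) (simp add: algebra_simps)
  qed
  have Vh: "laplacian ?V y = 0" if y: "y \<in> \<Omega> \<times> UNIV" for y
  proof -
    have "?e (Suc (Suc 0)) t = lam * ?e 0 t" for t
      using s2 by (simp add: mult.assoc[symmetric])
    moreover have "laplacian ?v (fst y) = (- lam) * ?v (fst y)" by (rule sl(2)) (use y in auto)
    ultimately show ?thesis
      using laplacian_separated_product[where b = ?e and j = 0, OF \<Omega> exp_derivs sl(1) y, of "- lam"] by (simp only:) (simp add: algebra_simps)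
  qed
  have U: "harm_ext lam u = (\<lambda>y. (1 / (2 * lam)) * ?W y + (- 1 / (2 * lam)) * ?V y)"
    by (simp add: harm_ext_def fun_eq_iff diff_divide_distrib)
  show ?thesis
  proof (rule harmonic_imp_mv_on[OF op])
    show "C_k_on 2 (\<Omega> \<times> UNIV) (harm_ext lam u)"
      unfolding U by (intro C_k_on_add[OF op] C_k_on_mult[OF op] C_k_on_const W2 V2)
    show "laplacian (harm_ext lam u) y = 0" if "y \<in> \<Omega> \<times> UNIV" for y
      unfolding U laplacian_lincomb[OF op W2 V2 that] Wh[OF that] Vh[OF that] by simp
  qed
qed

text \<open>With v the function \<open>\<lambda>x. laplacian u x - lam * u x\<close>, the extension
  is \<open>u * cos s + v * (cos s - exp s) / (2 * lam)\<close>, and as \<open>lam > 1\<close> both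
  coefficients are at most \<open>exp (sqrt lam * \<rho>)\<close> in modulus. Passing from u and v
  to g and h costs the same factor again, and the square doubles the exponent; hence the 4.\<close>

lemma harm_ext_square_le:
  assumes lam: "lam > 1" and y: "\<bar>snd y\<bar> \<le> \<rho>"
  shows "(harm_ext lam u y)\<^sup>2 \<le> 2 * exp (4 * sqrt lam * \<rho>) * phi_lift lam u y"
proof -
  define s where "s = sqrt lam * snd y"
  define v where "v = laplacian u (fst y) - lam * u (fst y)"
  define E where "E = exp (sqrt lam * \<rho>)"
  have \<rho>: "\<rho> \<ge> 0" using y by linarith
  have sq: "sqrt lam > 0" using lam by simp
  have "\<bar>s\<bar> \<le> sqrt lam * \<rho>" using y sq by (simp add: s_def abs_mult mult_left_mono)
  then have sE: "exp s \<le> E" "exp (- s) \<le> E" by (auto simp: E_def)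
  have E1: "E \<ge> 1" using \<rho> sq by (simp add: E_def)
  have g: "u (fst y) = lift_g lam u y * exp (- s)" by (simp add: lift_g_def s_def exp_minus)
  have h: "v = lift_h lam u y * exp (- s)" by (simp add: lift_h_def lift_g_def v_def s_def exp_minus)
  have U: "harm_ext lam u y = u (fst y) * cos s + v * ((cos s - exp s) / (2 * lam))"
    using lam by (simp add: harm_ext_def s_def[symmetric] v_def field_simps)
  have "\<bar>cos s - exp s\<bar> \<le> 1 + E" using sE abs_cos_le_one[of s] exp_gt_zero[of s] by linarith
  also have "\<dots> \<le> 2 * lam * E" using E1 mult_right_mono[of 1 lam E] lam by linarith
  finally have "\<bar>(cos s - exp s) / (2 * lam)\<bar> \<le> E" using lam by (simp add: abs_divide divide_simps mult_ac)
  then have "\<bar>v * ((cos s - exp s) / (2 * lam))\<bar> \<le> \<bar>v\<bar> * E" by (simp only: abs_mult mult_left_mono abs_ge_zero)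
  also have "\<bar>v\<bar> \<le> \<bar>lift_h lam u y\<bar> * E" unfolding h abs_mult using sE by (intro mult_left_mono) auto
  finally have 1: "\<bar>v * ((cos s - exp s) / (2 * lam))\<bar> \<le> \<bar>lift_h lam u y\<bar> * E * E" using E1 by (simp add: mult_right_mono)
  have "\<bar>u (fst y) * cos s\<bar> \<le> \<bar>u (fst y)\<bar> * 1" unfolding abs_mult by (intro mult_left_mono) auto
  also have "\<bar>u (fst y)\<bar> \<le> \<bar>lift_g lam u y\<bar> * E" unfolding g abs_mult using sE by (intro mult_left_mono) auto
  also have "\<bar>lift_g lam u y\<bar> * E * 1 \<le> \<bar>lift_g lam u y\<bar> * E * E" using E1 by (intro mult_left_mono) auto
  finally have 2: "\<bar>u (fst y) * cos s\<bar> \<le> \<bar>lift_g lam u y\<bar> * E * E" by simp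
  have "\<bar>harm_ext lam u y\<bar> \<le> (\<bar>lift_g lam u y\<bar> + \<bar>lift_h lam u y\<bar>) * (E * E)"
    unfolding U using 1 2 abs_triangle_ineq[of "u (fst y) * cos s" "v * ((cos s - exp s) / (2 * lam))"]
    by (simp add: algebra_simps)
  then have "(harm_ext lam u y)\<^sup>2 \<le> ((\<bar>lift_g lam u y\<bar> + \<bar>lift_h lam u y\<bar>) * (E * E))\<^sup>2"
    using E1 by (subst abs_le_square_iff[symmetric]) (auto simp: abs_mult)
  also have "\<dots> = (\<bar>lift_g lam u y\<bar> + \<bar>lift_h lam u y\<bar>)\<^sup>2 * (E * E * (E * E))" by (simp add: power2_eq_square mult_ac)
  also have "\<dots> \<le> (2 * phi_lift lam u y) * (E * E * (E * E))"
  proof (rule mult_right_mono)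
    have "0 \<le> (\<bar>lift_g lam u y\<bar> - \<bar>lift_h lam u y\<bar>)\<^sup>2" by simp
    then show "(\<bar>lift_g lam u y\<bar> + \<bar>lift_h lam u y\<bar>)\<^sup>2 \<le> 2 * phi_lift lam u y"
      by (simp add: phi_lift_def power2_eq_square algebra_simps)
  qed (use E1 in auto)
  also have "E * E * (E * E) = exp (4 * sqrt lam * \<rho>)" by (simp add: E_def exp_add[symmetric])
  finally show ?thesis by (simp only: mult_ac)
qed

lemma mv_on_trace_partial:
  fixes U :: "'a::euclidean_space \<times> real \<Rightarrow> real"
  assumes mv: "mv_on (\<Omega> \<times> UNIV) U" and \<Omega>: "open \<Omega>" and x: "x \<in> \<Omega>" and z: "\<And>x. x \<in> \<Omega> \<Longrightarrow> z x = U (x, 0)"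
  shows "partial_deriv e z x = partial_deriv (e, 0) U (x, 0)"
proof -
  have m: "(x, 0) \<in> \<Omega> \<times> UNIV" using x by simp
  have 1: "((\<lambda>x. (x, 0 :: real)) has_derivative (\<lambda>v. (v, 0))) (at x)" by (auto intro!: derivative_eq_intros)
  have "((\<lambda>x. U (x, 0)) has_derivative (\<lambda>v. grad U (x, 0) \<bullet> (v, 0))) (at x)"
    by (rule has_derivative_compose[OF 1 mv_on_grad(2)[OF mv m]])
  moreover have "grad U (x, 0) \<bullet> (v, 0) = fst (grad U (x, 0)) \<bullet> v" for v by (simp add: inner_prod_def)
  ultimately have "((\<lambda>x. U (x, 0)) has_derivative (\<lambda>v. fst (grad U (x, 0)) \<bullet> v)) (at x)" by simp
  from partial_deriv_eq[OF this] have "partial_deriv e (\<lambda>x. U (x, 0)) x = grad U (x, 0) \<bullet> (e, 0)"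
    by (simp add: inner_prod_def)
  moreover have "partial_deriv e z x = partial_deriv e (\<lambda>x. U (x, 0)) x" by (rule partial_deriv_cong_open[OF \<Omega> x z])
  ultimately show ?thesis using mv_on_partial_deriv_eq[OF mv m] by simp
qed

section \<open>Derivatives along lines, flat points and unique continuation\<close>

definition line_deriv :: "('a::euclidean_space \<times> real \<Rightarrow> real) \<Rightarrow> 'a \<Rightarrow> 'a \<Rightarrow> nat \<Rightarrow> real \<Rightarrow> real" where
  "line_deriv U x e k t = (partial_deriv (e, 0) ^^ k) U (x + t *\<^sub>R e, 0)"

lemma line_deriv_DERIV:
  assumes mv: "mv_on (\<Omega> \<times> UNIV) U" and m: "x + t *\<^sub>R e \<in> \<Omega>"
  shows "(line_deriv U x e k has_real_derivative line_deriv U x e (Suc k) t) (at t)"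
proof -
  have "((\<lambda>t. (partial_deriv (e, 0) ^^ k) U ((x, 0) + t *\<^sub>R (e, 0))) has_real_derivative
    partial_deriv (e, 0) ((partial_deriv (e, 0) ^^ k) U) ((x, 0) + t *\<^sub>R (e, 0))) (at t)"
    by (rule mv_on_DERIV_line[OF mv_on_iterated[OF mv]]) (use m in simp)
  then show ?thesis by (simp add: line_deriv_def[abs_def])
qed

lemma line_deriv_bound:
  fixes U :: "'a::euclidean_space \<times> real \<Rightarrow> real"
  assumes mv: "mv_on (\<Omega> \<times> UNIV) U" and \<rho>: "0 < \<rho>" "cball (x + t *\<^sub>R e, 0) \<rho> \<subseteq> \<Omega> \<times> (UNIV :: real set)"
    and S: "\<And>y. y \<in> cball (x + t *\<^sub>R e, 0) \<rho> \<Longrightarrow> \<bar>U y\<bar> \<le> S" and e: "norm e \<le> 1"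
    and Q: "grad_const TYPE('a \<times> real) * exp 1 / \<rho> \<le> Q"
  shows "\<bar>line_deriv U x e k t\<bar> \<le> S * fact k * Q ^ k"
proof -
  have "\<bar>line_deriv U x e k t\<bar> \<le> S * fact k * (grad_const TYPE('a \<times> real) * exp 1 / \<rho>) ^ k"
    unfolding line_deriv_def by (rule mv_on_iterated_bound[OF mv \<rho> S]) (use e in \<open>auto simp: norm_Pair\<close>)
  also have "\<dots> \<le> S * fact k * Q ^ k"
  proof (intro mult_left_mono power_mono Q)
    have "0 \<le> S" using S[of "(x + t *\<^sub>R e, 0)"] \<rho>(1) by (simp add: order_trans[OF abs_ge_zero])
    then show "0 \<le> S * fact k" by simp
    show "0 \<le> grad_const TYPE('a \<times> real) * exp 1 / \<rho>" using grad_const_pos[where 'a="'a \<times> real"] \<rho>(1) by simp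
  qed
  finally show ?thesis .
qed

text \<open>Derivatives of one direction at a time are the ones that occur in Taylor expansions
  along segments from \<open>x\<close>. The case \<open>k = 0\<close> includes the value at
  \<open>x\<close>.\<close>

definition flat_at :: "('a::euclidean_space \<times> real \<Rightarrow> real) \<Rightarrow> 'a \<Rightarrow> bool" where
  "flat_at U x \<longleftrightarrow> (\<forall>e k. norm e = 1 \<longrightarrow> (partial_deriv (e, 0) ^^ k) U (x, 0) = 0)"

text \<open>Along each segment from \<open>x\<close> the Taylor polynomials vanish, and the
  remainder of order \<open>k\<close> is at most \<open>S * (Q * h) ^ k\<close> with
  \<open>Q * h \<le> 1 / 2\<close>.\<close>

lemma flat_at_imp_zero_near:
  fixes U :: "'a::euclidean_space \<times> real \<Rightarrow> real"
  assumes mv: "mv_on (\<Omega> \<times> UNIV) U" and \<Omega>: "open \<Omega>" and x: "x \<in> \<Omega>" and fl: "flat_at U x"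
  shows "\<exists>d>0. \<forall>y\<in>ball x d. U (y, 0) = 0"
proof -
  have "open (\<Omega> \<times> (UNIV :: real set))" using \<Omega> by (intro open_Times) auto
  then obtain R where R: "R > 0" "cball (x, 0) R \<subseteq> \<Omega> \<times> (UNIV :: real set)"
    using x open_contains_cball by (metis SigmaI UNIV_I)
  define \<rho> where "\<rho> = R / 2"
  have \<rho>: "\<rho> > 0" using R by (simp add: \<rho>_def)
  have Uc: "continuous_on (cball (x, 0) R) U" using mv R(2) continuous_on_subset by (auto simp: mv_on_def)
  obtain S where S0: "S \<ge> 0" and S: "\<And>y. y \<in> cball (x, 0) R \<Longrightarrow> norm (U y) \<le> S"
    using continuous_on_cball_norm_bound[OF Uc] by blast
  define Q where "Q = grad_const TYPE('a \<times> real) * exp 1 / \<rho>"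
  have Q: "Q > 0" using grad_const_pos[where 'a="'a \<times> real"] \<rho> by (simp add: Q_def)
  define d where "d = min \<rho> (1 / (2 * Q))"
  have d: "d > 0" "d \<le> \<rho>" "Q * d \<le> 1 / 2" using \<rho> Q by (auto simp: d_def min_def field_simps)
  have "U (y, 0) = 0" if y: "y \<in> ball x d" for y
  proof (cases "y = x")
    case True
    obtain b :: 'a where "b \<in> Basis" by (meson nonempty_Basis ex_in_conv)
    then show ?thesis using fl True unfolding flat_at_def
      by (metis funpow_0 norm_Basis)
  next
    case False
    define h where "h = norm (y - x)"
    define e where "e = (y - x) /\<^sub>R h"
    have h: "0 < h" "h < d" using False y by (auto simp: h_def dist_norm norm_minus_commute)
    have e: "norm e = 1" "x + h *\<^sub>R e = y" using h by (auto simp: e_def h_def[symmetric])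
    have sub: "cball (x + t *\<^sub>R e, 0) \<rho> \<subseteq> cball (x, 0 :: real) R" if "0 \<le> t" "t \<le> h" for t
    proof
      fix z assume "z \<in> cball (x + t *\<^sub>R e, 0 :: real) \<rho>"
      moreover have "dist (x, 0 :: real) (x + t *\<^sub>R e, 0) = t" using that e by (simp add: dist_Pair_Pair dist_norm)
      ultimately show "z \<in> cball (x, 0) R" using dist_triangle[of "(x, 0)" z "(x + t *\<^sub>R e, 0)"] that h d by (auto simp: \<rho>_def)
    qed
    have memO: "x + t *\<^sub>R e \<in> \<Omega>" if "0 \<le> t" "t \<le> h" for t
      using sub[OF that] R(2) \<rho> by (metis SigmaD1 centre_in_cball less_imp_le subsetD)
    have le: "\<bar>U (y, 0)\<bar> \<le> S * (1/2) ^ k" for k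
    proof (cases k)
      case 0 then show ?thesis using S[of "(y, 0)"] sub[of h] h e \<rho> by (force simp: subset_iff)
    next
      case (Suc k')
      have "\<exists>t>0. t < h \<and> line_deriv U x e 0 h = (\<Sum>m<k. line_deriv U x e m 0 / fact m * h ^ m) + line_deriv U x e k t / fact k * h ^ k"
        by (rule Maclaurin) (use h Suc line_deriv_DERIV[OF mv memO] in auto)
      then obtain t where t: "0 < t" "t < h" "line_deriv U x e 0 h = (\<Sum>m<k. line_deriv U x e m 0 / fact m * h ^ m) + line_deriv U x e k t / fact k * h ^ k" by blast
      have "line_deriv U x e m 0 = 0" for m using fl e(1) by (simp add: line_deriv_def flat_at_def)
      moreover have "line_deriv U x e 0 h = U (y, 0)" using e by (simp add: line_deriv_def)
      ultimately have "U (y, 0) = line_deriv U x e k t / fact k * h ^ k" using t(3) by simp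
      then have "\<bar>U (y, 0)\<bar> = \<bar>line_deriv U x e k t\<bar> / fact k * h ^ k" using h by (simp add: abs_mult)
      also have "\<dots> \<le> S * Q ^ k * h ^ k"
      proof (intro mult_right_mono)
        have "\<bar>line_deriv U x e k t\<bar> \<le> S * fact k * Q ^ k"
          by (rule line_deriv_bound[OF mv \<rho>]) (use sub[of t] t R(2) S e in \<open>auto simp: Q_def subset_iff\<close>)
        then show "\<bar>line_deriv U x e k t\<bar> / fact k \<le> S * Q ^ k" by (simp add: divide_simps mult_ac)
      qed (use h in auto)
      also have "\<dots> = S * (Q * h) ^ k" by (simp add: power_mult_distrib)
      also have "\<dots> \<le> S * (1/2) ^ k"
      proof (intro mult_left_mono power_mono S0)
        show "Q * h \<le> 1/2" using mult_left_mono[of h d Q] h d Q by linarith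
      qed (use Q h in auto)
      finally show ?thesis .
    qed
    have "(\<lambda>k. S * (1/2) ^ k) \<longlonglongrightarrow> S * 0" by (intro tendsto_intros LIMSEQ_power_zero) auto
    then have "\<bar>U (y, 0)\<bar> \<le> S * 0" by (rule LIMSEQ_le_const) (use le in blast)
    then show ?thesis by simp
  qed
  then show ?thesis using d(1) by blast
qed

lemma zero_near_imp_flat_at:
  fixes U :: "'a::euclidean_space \<times> real \<Rightarrow> real"
  assumes mv: "mv_on (\<Omega> \<times> UNIV) U" and d: "d > 0" "ball x d \<subseteq> \<Omega>" and z: "\<And>y. y \<in> ball x d \<Longrightarrow> U (y, 0) = 0"
  shows "flat_at U x"
  unfolding flat_at_def
proof (intro allI impI)
  fix e :: 'a and k assume e: "norm e = 1"
  have mem: "x + t *\<^sub>R e \<in> ball x d" if "t \<in> {-d<..<d}" for t using that e by (auto simp: dist_norm)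
  have "line_deriv U x e k t = 0" if "t \<in> {-d<..<d}" for t
    using that
  proof (induction k arbitrary: t)
    case 0 then show ?case using z mem by (simp add: line_deriv_def)
  next
    case (Suc k)
    have "(line_deriv U x e k has_real_derivative line_deriv U x e (Suc k) t) (at t)"
      by (rule line_deriv_DERIV[OF mv]) (use mem[OF Suc.prems] d(2) in blast)
    moreover have "(line_deriv U x e k has_real_derivative 0) (at t)"
      by (rule has_field_derivative_transform_within_open[of "\<lambda>t. 0" _ _ "{-d<..<d}"]) (use Suc in auto)
    ultimately show ?case by (rule DERIV_unique)
  qed
  from this[of 0] show "(partial_deriv (e, 0) ^^ k) U (x, 0) = 0" using d by (simp add: line_deriv_def)
qed

text \<open>The flat points are open in \<open>\<Omega>\<close>, because \<open>U\<close> vanishes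
  on the slice near a flat point, and closed in \<open>\<Omega>\<close>, because each defining
  equation is continuous. Connectedness does the rest.\<close>

lemma unique_continuation:
  fixes U :: "'a::euclidean_space \<times> real \<Rightarrow> real"
  assumes mv: "mv_on (\<Omega> \<times> UNIV) U" and \<Omega>: "open \<Omega>" "connected \<Omega>" and x: "x \<in> \<Omega>" and fl: "flat_at U x"
    and y: "y \<in> \<Omega>"
  shows "U (y, 0) = 0"
proof -
  define Z where "Z = {x \<in> \<Omega>. flat_at U x}"
  have "open Z"
    unfolding open_contains_ball
  proof
    fix x assume "x \<in> Z"
    then have x: "x \<in> \<Omega>" "flat_at U x" by (auto simp: Z_def)
    obtain d where d: "d > 0" "\<forall>y\<in>ball x d. U (y, 0) = 0" using flat_at_imp_zero_near[OF mv \<Omega>(1) x] by blast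
    obtain d' where d': "d' > 0" "ball x d' \<subseteq> \<Omega>" using \<Omega>(1) x(1) openE by blast
    define c where "c = min d d' / 2"
    have c: "c > 0" "2 * c \<le> d" "2 * c \<le> d'" using d d' by (auto simp: c_def min_def)
    have "ball x c \<subseteq> Z"
    proof
      fix y assume y: "y \<in> ball x c"
      have s: "ball y c \<subseteq> ball x (2 * c)"
      proof
        fix z assume "z \<in> ball y c"
        then show "z \<in> ball x (2 * c)" using y dist_triangle[of x z y] by auto
      qed
      have s2: "ball x (2 * c) \<subseteq> ball x d" "ball x (2 * c) \<subseteq> ball x d'" using c by auto
      have "flat_at U y" by (rule zero_near_imp_flat_at[OF mv c(1)]) (use s s2 d d' in blast)+
      moreover have "y \<in> \<Omega>" using s s2 d' c(1) centre_in_ball[of y c] by blast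
      ultimately show "y \<in> Z" by (simp add: Z_def)
    qed
    then show "\<exists>e>0. ball x e \<subseteq> Z" using c by blast
  qed
  moreover have "Z \<subseteq> \<Omega>" by (auto simp: Z_def)
  ultimately have "openin (top_of_set \<Omega>) Z" by (simp add: open_openin_trans \<Omega>)
  moreover have "closedin (top_of_set \<Omega>) Z"
  proof -
    have cont: "continuous_on \<Omega> (\<lambda>x. (partial_deriv (e, 0) ^^ k) U (x, 0))" for e k
    proof (rule continuous_on_compose2[of "\<Omega> \<times> UNIV" "(partial_deriv (e, 0) ^^ k) U"])
      show "continuous_on (\<Omega> \<times> UNIV) ((partial_deriv (e, 0) ^^ k) U)" using mv_on_iterated[OF mv] by (simp add: mv_on_def)
    qed (auto intro!: continuous_intros)
    have "Z = \<Omega> \<inter> (\<Inter>(e, k)\<in>{e. norm e = 1} \<times> UNIV. {x \<in> \<Omega>. (partial_deriv (e, 0) ^^ k) U (x, 0) = 0})"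
      by (auto simp: Z_def flat_at_def)
    also have "closedin (top_of_set \<Omega>) \<dots>"
    proof (rule closedin_Int)
      obtain b :: 'a where "b \<in> Basis" by (meson nonempty_Basis ex_in_conv)
      then have "{e :: 'a. norm e = 1} \<times> (UNIV :: nat set) \<noteq> {}" using norm_Basis by blast
      then show "closedin (top_of_set \<Omega>) (\<Inter>(e, k)\<in>{e. norm e = 1} \<times> UNIV. {x \<in> \<Omega>. (partial_deriv (e, 0) ^^ k) U (x, 0) = 0})"
        by (intro closedin_INT) (auto intro!: continuous_closedin_preimage_constant cont)
    qed simp
    finally show ?thesis .
  qed
  ultimately have "Z = {} \<or> Z = \<Omega>" using \<Omega>(2) connected_clopen by blast
  moreover have "x \<in> Z" using x fl by (simp add: Z_def)
  ultimately have "flat_at U y" using y by (auto simp: Z_def)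
  then show ?thesis using flat_at_imp_zero_near[OF mv \<Omega>(1) y] by (metis centre_in_ball)
qed

section \<open>Lower bounds for the eigenfunction\<close>

text \<open>Used where \<open>\<triangle>u\<close> rather than \<open>u\<close> is large: a symmetric second difference with a step
  that balances the third derivative transfers the bound to \<open>u\<close> itself.\<close>

lemma second_derivative_propagation:
  fixes D :: "nat \<Rightarrow> real \<Rightarrow> real"
  assumes Q: "Q > 0" and S: "S > 0"
    and D: "\<And>i t. \<bar>t\<bar> \<le> 1 / (2 * Q) \<Longrightarrow> (D i has_real_derivative D (Suc i) t) (at t)"
    and bd: "\<And>i t. \<bar>t\<bar> \<le> 1 / (2 * Q) \<Longrightarrow> \<bar>D i t\<bar> \<le> S * fact i * Q ^ i"
    and b: "D 2 0 \<noteq> 0"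
  shows "\<exists>t. \<bar>t\<bar> \<le> 1 / (2 * Q) \<and> \<bar>D 2 0\<bar> ^ 3 / (216 * S\<^sup>2 * Q ^ 6) \<le> \<bar>D 0 t\<bar>"
proof -
  define \<beta> where "\<beta> = \<bar>D 2 0\<bar>"
  \<comment> \<open>For this step the third order terms amount to at most a third of the main term
    \<open>\<beta> * h ^ 2\<close>.\<close>
  define h where "h = \<beta> / (6 * S * Q ^ 3)"
  have \<beta>: "\<beta> > 0" using b by (simp add: \<beta>_def)
  have "\<beta> \<le> 2 * S * Q ^ 2" using bd[of 0 2] Q by (simp add: \<beta>_def fact_2 mult_ac)
  then have "h \<le> 2 * S * Q ^ 2 / (6 * S * Q ^ 3)" unfolding h_def using S Q by (intro divide_right_mono) auto
  also have "\<dots> = 1 / (3 * Q)" using S Q by (simp add: power2_eq_square power3_eq_cube)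
  also have "\<dots> \<le> 1 / (2 * Q)" using Q by (intro divide_left_mono) auto
  finally have h: "0 < h" "h \<le> 1 / (2 * Q)" using \<beta> S Q by (auto simp: h_def)
  have pt: "\<exists>\<xi>. \<bar>\<xi>\<bar> \<le> h \<and> D 0 t = D 0 0 + D 1 0 * t + D 2 0 / 2 * t ^ 2 + D 3 \<xi> / 6 * t ^ 3" if t: "t = h \<or> t = - h" for t
  proof -
    have "\<exists>\<xi>. \<bar>\<xi>\<bar> \<le> \<bar>t\<bar> \<and> D 0 t = (\<Sum>m<3. D m 0 / fact m * t ^ m) + D 3 \<xi> / fact 3 * t ^ 3"
      by (rule Maclaurin_bi_le) (use D h t in auto)
    then show ?thesis using t h by (auto simp: eval_nat_numeral)
  qed
  obtain \<xi>1 where \<xi>1: "\<bar>\<xi>1\<bar> \<le> h" "D 0 h = D 0 0 + D 1 0 * h + D 2 0 / 2 * h ^ 2 + D 3 \<xi>1 / 6 * h ^ 3" using pt[of h] by blast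
  obtain \<xi>2 where \<xi>2: "\<bar>\<xi>2\<bar> \<le> h" "D 0 (- h) = D 0 0 + D 1 0 * (- h) + D 2 0 / 2 * (- h) ^ 2 + D 3 \<xi>2 / 6 * (- h) ^ 3" using pt[of "- h"] by blast
  have d3: "\<bar>D 3 \<xi>\<bar> \<le> 6 * S * Q ^ 3" if "\<bar>\<xi>\<bar> \<le> h" for \<xi> using bd[of \<xi> 3] that h by (simp add: fact_numeral mult_ac)
  have sum: "D 0 h + D 0 (- h) - 2 * D 0 0 = D 2 0 * h ^ 2 + (D 3 \<xi>1 - D 3 \<xi>2) / 6 * h ^ 3"
    unfolding \<xi>1(2) \<xi>2(2) by (simp add: field_simps power2_eq_square power3_eq_cube)
  have "\<bar>D 3 \<xi>1 - D 3 \<xi>2\<bar> \<le> 12 * S * Q ^ 3" using d3[OF \<xi>1(1)] d3[OF \<xi>2(1)] by linarith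
  then have "\<bar>D 3 \<xi>1 - D 3 \<xi>2\<bar> / 6 * h ^ 3 \<le> (12 * S * Q ^ 3) / 6 * h ^ 3" using h by (intro mult_right_mono divide_right_mono) auto
  also have "\<dots> = \<beta> * h ^ 2 / 3" using S Q by (simp add: h_def power3_eq_cube power2_eq_square)
  finally have e: "\<bar>(D 3 \<xi>1 - D 3 \<xi>2) / 6 * h ^ 3\<bar> \<le> \<beta> * h ^ 2 / 3" using h by (simp add: abs_mult)
  have "\<beta> * h ^ 2 = \<bar>D 2 0 * h ^ 2\<bar>" by (simp add: \<beta>_def abs_mult)
  then have "(2 / 3) * (\<beta> * h ^ 2) \<le> \<bar>D 0 h + D 0 (- h) - 2 * D 0 0\<bar>" unfolding sum using e by linarith
  then have big: "(2 / 3) * (\<beta> * h ^ 2) \<le> \<bar>D 0 h\<bar> + \<bar>D 0 (- h)\<bar> + 2 * \<bar>D 0 0\<bar>" by linarith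
  have val: "\<beta> * h ^ 2 / 6 = \<beta> ^ 3 / (216 * S\<^sup>2 * Q ^ 6)"
    using S Q by (simp add: h_def power_divide power_mult_distrib power2_eq_square power3_eq_cube eval_nat_numeral)
  \<comment> \<open>The three moduli carry the weights 1, 1 and 2, of total 4, and two thirds
    divided by 4 is one sixth.\<close>
  have disj: "\<beta> * h ^ 2 / 6 \<le> \<bar>D 0 h\<bar> \<or> \<beta> * h ^ 2 / 6 \<le> \<bar>D 0 (- h)\<bar> \<or> \<beta> * h ^ 2 / 6 \<le> \<bar>D 0 0\<bar>"
    using big by linarith
  obtain t where t: "t = h \<or> t = - h \<or> t = 0" "\<beta> * h ^ 2 / 6 \<le> \<bar>D 0 t\<bar>"
    using disj that[of h] that[of "- h"] that[of 0] by auto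
  have "\<bar>t\<bar> \<le> h" using t(1) h(1) by auto
  then have "\<bar>t\<bar> \<le> 1 / (2 * Q)" using h(2) by (rule order_trans)
  moreover have "\<bar>D 2 0\<bar> ^ 3 / (216 * S\<^sup>2 * Q ^ 6) \<le> \<bar>D 0 t\<bar>" using t(2) unfolding val by (simp only: \<beta>_def)
  ultimately show ?thesis by (intro exI conjI)
qed

lemma ball_integral_pos:
  fixes f :: "'a::euclidean_space \<Rightarrow> real"
  assumes f: "continuous_on (cball 0 t) f" "\<And>x. 0 \<le> f x" and x: "x \<in> ball 0 t" "f x > 0"
  shows "ball_integral f t > 0"
proof -
  have i: "integrable lborel (\<lambda>y. indicator (ball 0 t) y * f y)" by (rule integrable_ball_continuous[OF f(1)])
  have nn: "0 \<le> indicator (ball 0 t) y * f y" for y using f(2) by simp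
  have "ball_integral f t \<noteq> 0"
  proof
    assume "ball_integral f t = 0"
    then have ae: "AE y in lborel. indicator (ball 0 t) y * f y = 0"
      unfolding ball_integral_def using integral_nonneg_eq_0_iff_AE[OF i] nn by simp
    have fb: "continuous_on (ball 0 t) f" by (rule continuous_on_subset[OF f(1)]) auto
    define A where "A = ball 0 t \<inter> f -` {0<..}"
    have op: "open A" unfolding A_def by (rule continuous_open_preimage[OF fb]) auto
    have "AE y in lborel. y \<notin> A" using ae
    proof eventually_elim
      case (elim y)
      then show ?case by (auto simp: A_def)
    qed
    then have "emeasure lborel A = 0" using op by (subst (asm) AE_iff_measurable[of A]) (auto simp: borel_open)
    then have "negligible A" using op by (simp add: negligible_iff_emeasure0 borel_open)
    moreover have "x \<in> A" using x by (simp add: A_def)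
    ultimately show False using open_not_negligible[OF op] by blast
  qed
  moreover have "ball_integral f t \<ge> 0" unfolding ball_integral_def by (rule Bochner_Integration.integral_nonneg) (rule nn)
  ultimately show ?thesis by simp
qed

section \<open>Propagation of lower bounds along segments\<close>

definition line_rate :: "'a::euclidean_space itself \<Rightarrow> real" where
  "line_rate _ = max (grad_const TYPE('a \<times> real) * exp 1) 100"

lemma line_rate_ge: "line_rate TYPE('a::euclidean_space) \<ge> 100" "line_rate TYPE('a) > 0"
  by (auto simp: line_rate_def)

text \<open>\<open>S\<close> is the reference size of \<open>U\<close> at scale \<open>r\<close>.
  The bound is required on radius \<open>2 * r\<close> so that every point of norm at most
  \<open>r\<close> has a full ball of radius \<open>r\<close> for the Cauchy estimates.\<close>

definition bounded_ext :: "('a::euclidean_space \<times> real \<Rightarrow> real) \<Rightarrow> 'a set \<Rightarrow> real \<Rightarrow> real \<Rightarrow> bool" where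
  "bounded_ext U \<Omega> r S \<longleftrightarrow> mv_on (\<Omega> \<times> UNIV) U \<and> cball 0 (2 * r) \<subseteq> \<Omega> \<times> (UNIV :: real set) \<and>
     (\<forall>y\<in>cball 0 (2 * r). \<bar>U y\<bar> \<le> S) \<and> r > 0 \<and> S > 0"

lemma bounded_ext_line:
  fixes U :: "'a::euclidean_space \<times> real \<Rightarrow> real"
  assumes b: "bounded_ext U \<Omega> r S" and x: "norm (x + t *\<^sub>R e) \<le> r" and e: "norm e \<le> 1"
  shows "(line_deriv U x e k has_real_derivative line_deriv U x e (Suc k) t) (at t)"
    "\<bar>line_deriv U x e k t\<bar> \<le> S * fact k * (line_rate TYPE('a) / r) ^ k"
proof -
  have mv: "mv_on (\<Omega> \<times> UNIV) U" and sub: "cball 0 (2 * r) \<subseteq> \<Omega> \<times> (UNIV :: real set)"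
    and S: "\<And>y. y \<in> cball 0 (2 * r) \<Longrightarrow> \<bar>U y\<bar> \<le> S" and r: "r > 0" using b by (auto simp: bounded_ext_def)
  have sub2: "cball (x + t *\<^sub>R e, 0) r \<subseteq> cball (0 :: 'a \<times> real) (2 * r)"
  proof
    fix z assume "z \<in> cball (x + t *\<^sub>R e, 0 :: real) r"
    moreover have "dist 0 (x + t *\<^sub>R e, 0 :: real) \<le> r" using x by (simp add: norm_Pair)
    ultimately show "z \<in> cball 0 (2 * r)" using dist_triangle[of 0 z "(x + t *\<^sub>R e, 0)"] unfolding mem_cball by linarith
  qed
  have "(x + t *\<^sub>R e, 0) \<in> \<Omega> \<times> (UNIV :: real set)" using sub sub2 r by (meson centre_in_cball less_imp_le subsetD)
  then show "(line_deriv U x e k has_real_derivative line_deriv U x e (Suc k) t) (at t)"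
    by (intro line_deriv_DERIV[OF mv]) auto
  show "\<bar>line_deriv U x e k t\<bar> \<le> S * fact k * (line_rate TYPE('a) / r) ^ k"
  proof (rule line_deriv_bound[OF mv r _ _ e])
    show "cball (x + t *\<^sub>R e, 0) r \<subseteq> \<Omega> \<times> (UNIV :: real set)" using sub sub2 by blast
    show "\<bar>U y\<bar> \<le> S" if "y \<in> cball (x + t *\<^sub>R e, 0) r" for y using S sub2 that by blast
    show "grad_const TYPE('a \<times> real) * exp 1 / r \<le> line_rate TYPE('a) / r" using r by (intro divide_right_mono) (auto simp: line_rate_def)
  qed
qed

text \<open>The one-dimensional propagation is applied on the ray from \<open>p\<close> through
  \<open>a\<close>, with the interval of length \<open>l\<close> beyond \<open>a\<close> as target;
  so the new point is within \<open>l\<close> of \<open>a\<close>. The cap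
  \<open>r / (2 * line_rate)\<close> on the length is the condition
  \<open>Q * T \<le> 1 / 2\<close>, and as \<open>line_rate\<close> is at least 100 it also keeps
  the ray inside radius \<open>r\<close>.\<close>

lemma propagation_step:
  fixes U :: "'a::euclidean_space \<times> real \<Rightarrow> real"
  assumes b: "bounded_ext U \<Omega> r S" and p: "norm p \<le> r / 2" and a: "dist p a + l \<le> r / (2 * line_rate TYPE('a))" and l: "l > 0"
    and B: "B \<ge> 0" "S * exp (- B) \<le> \<bar>U (p, 0)\<bar>"
  shows "\<exists>p'. dist p' a \<le> l \<and> S * exp (- ((B + 1) * (1 + 2 * ln (2 * exp 1 * r / (line_rate TYPE('a) * l))))) \<le> \<bar>U (p', 0)\<bar>"
proof -
  let ?q = "line_rate TYPE('a)"
  have r: "r > 0" and S: "S > 0" using b by (auto simp: bounded_ext_def)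
  have q: "?q \<ge> 100" "?q > 0" by (rule line_rate_ge)+
  obtain e :: 'a where e: "norm e = 1" "a = p + dist p a *\<^sub>R e"
  proof (cases "p = a")
    case True
    obtain b :: 'a where "b \<in> Basis" by (meson nonempty_Basis ex_in_conv)
    then show thesis using that[of b] True by simp
  next
    case False
    then show thesis using that[of "(a - p) /\<^sub>R dist p a"] by (simp add: dist_norm norm_minus_commute)
  qed
  define T where "T = dist p a + l"
  have T: "T > 0" "T \<le> r / (2 * ?q)" using a l by (auto simp: T_def add_nonneg_pos)
  have "r / (2 * ?q) \<le> r / 2" using r q by (intro divide_left_mono) auto
  then have Tr: "T \<le> r / 2" using T by simp
  have nb: "norm (p + t *\<^sub>R e) \<le> r" if "0 \<le> t" "t \<le> T" for t
    using norm_triangle_ineq[of p "t *\<^sub>R e"] p e that Tr by simp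
  have "\<exists>t. dist p a \<le> t \<and> t \<le> T \<and> S * exp (- ((B + 1) * (1 + 2 * ln (4 * exp 1 * T / l)))) \<le> \<bar>line_deriv U p e 0 t\<bar>"
  proof (rule propagate_lower_bound[where Q = "?q / r"])
    show "(line_deriv U p e i has_real_derivative line_deriv U p e (Suc i) t) (at t)" if "0 \<le> t" "t \<le> T" for i t
      by (rule bounded_ext_line(1)[OF b nb[OF that]]) (use e in simp)
    show "\<bar>line_deriv U p e i t\<bar> \<le> S * fact i * (?q / r) ^ i" if "0 \<le> t" "t \<le> T" for i t
      by (rule bounded_ext_line(2)[OF b nb[OF that]]) (use e in simp)
    show "?q / r * T \<le> 1 / 2" using mult_left_mono[OF T(2), of "?q / r"] r q by simp
    show "S * exp (- B) \<le> \<bar>line_deriv U p e 0 0\<bar>" using B by (simp add: line_deriv_def)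
  qed (use r q T_def l S B in auto)
  then obtain t where t: "dist p a \<le> t" "t \<le> T" "S * exp (- ((B + 1) * (1 + 2 * ln (4 * exp 1 * T / l)))) \<le> \<bar>line_deriv U p e 0 t\<bar>" by blast
  have "a - p = dist p a *\<^sub>R e" using e(2) by (metis add_diff_cancel_left')
  moreover have "(p + t *\<^sub>R e) - a = t *\<^sub>R e - (a - p)" by simp
  ultimately have "(p + t *\<^sub>R e) - a = (t - dist p a) *\<^sub>R e" by (simp only: scaleR_left_diff_distrib)
  then have "dist (p + t *\<^sub>R e) a = t - dist p a" using e(1) t(1) by (simp add: dist_norm)
  then have d: "dist (p + t *\<^sub>R e) a \<le> l" using t(2) by (simp add: T_def)
  have "ln (4 * exp 1 * T / l) \<le> ln (2 * exp 1 * r / (?q * l))"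
  proof (subst ln_le_cancel_iff)
    have "4 * exp 1 * T / l \<le> 4 * exp 1 * (r / (2 * ?q)) / l" using T l by (intro divide_right_mono mult_left_mono) auto
    also have "4 * exp 1 * (r / (2 * ?q)) / l = 2 * exp 1 * r / (?q * l)" using q l by (simp add: field_simps)
    finally show "4 * exp 1 * T / l \<le> 2 * exp 1 * r / (?q * l)" .
  qed (use T l r q in auto)
  then have "(B + 1) * (1 + 2 * ln (4 * exp 1 * T / l)) \<le> (B + 1) * (1 + 2 * ln (2 * exp 1 * r / (?q * l)))"
    using B by (intro mult_left_mono) auto
  then have "S * exp (- ((B + 1) * (1 + 2 * ln (2 * exp 1 * r / (?q * l))))) \<le> S * exp (- ((B + 1) * (1 + 2 * ln (4 * exp 1 * T / l))))"
    using S by simp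
  also have "\<dots> \<le> \<bar>U (p + t *\<^sub>R e, 0)\<bar>" using t(3) by (simp add: line_deriv_def)
  finally show ?thesis using d by blast
qed

text \<open>A single step is too short to reach \<open>a\<close>, so the segment from
  \<open>p\<close> to \<open>a\<close> is walked in \<open>J\<close> steps, where \<open>J\<close>
  depends on the dimension only. A step replaces \<open>A\<close> by
  \<open>(A + 1) * \<kappa>\<close>, the summand 1 being absorbed by \<open>M \<ge> 1\<close>; after
  \<open>J\<close> steps the exponent is still a constant times \<open>M\<close>.\<close>

lemma propagation_chain:
  fixes \<theta> A :: real
  assumes \<theta>: "0 < \<theta>" "\<theta> \<le> 1 / (8 * line_rate TYPE('a::euclidean_space))" and A: "A \<ge> 0"
  shows "\<exists>A'\<ge>0. \<forall>U \<Omega> r S M p (a :: 'a). bounded_ext U \<Omega> r S \<longrightarrow> M \<ge> 1 \<longrightarrow> norm p \<le> r / 8 \<longrightarrow> norm a \<le> r / 8 \<longrightarrow>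
    S * exp (- (A * M)) \<le> \<bar>U (p, 0)\<bar> \<longrightarrow> (\<exists>p'. dist p' a \<le> \<theta> * r \<and> S * exp (- (A' * M)) \<le> \<bar>U (p', 0)\<bar>)"
proof -
  let ?q = "line_rate TYPE('a)"
  have q: "?q \<ge> 100" "?q > 0" by (rule line_rate_ge)+
  define \<kappa> where "\<kappa> = max 1 (1 + 2 * ln (2 * exp 1 / (?q * \<theta>)))"
  have \<kappa>: "\<kappa> \<ge> 1" by (simp add: \<kappa>_def)
  \<comment> \<open>The segment is no longer than \<open>r / 4\<close>, so each step measures at
    most \<open>r / (4 * line_rate)\<close>. The deviations
    \<open>\<theta> * r \<le> r / (8 * line_rate)\<close> at its two ends bring this up to the
    admissible \<open>r / (2 * line_rate)\<close>.\<close>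
  define J where "J = nat \<lceil>?q\<rceil>"
  have J: "real J \<ge> ?q" "real J > 0" using q unfolding J_def by linarith+
  have "\<exists>A'\<ge>0. \<forall>U \<Omega> r S M p (a :: 'a). bounded_ext U \<Omega> r S \<longrightarrow> M \<ge> 1 \<longrightarrow> norm p \<le> r / 8 \<longrightarrow> norm a \<le> r / 8 \<longrightarrow>
    S * exp (- (A * M)) \<le> \<bar>U (p, 0)\<bar> \<longrightarrow>
    (\<exists>p'. dist p' (p + (real i / real J) *\<^sub>R (a - p)) \<le> \<theta> * r \<and> S * exp (- (A' * M)) \<le> \<bar>U (p', 0)\<bar>)" if "i \<le> J" for i
    using that
  proof (induction i)
    case 0
    show ?case
    proof (intro exI[of _ A] conjI A allI impI)
      fix U \<Omega> and r S M :: real and p a :: 'a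
      assume "bounded_ext U \<Omega> r S" "S * exp (- (A * M)) \<le> \<bar>U (p, 0)\<bar>"
      then show "\<exists>p'. dist p' (p + (real 0 / real J) *\<^sub>R (a - p)) \<le> \<theta> * r \<and> S * exp (- (A * M)) \<le> \<bar>U (p', 0)\<bar>"
        using \<theta> by (intro exI[of _ p]) (auto simp: bounded_ext_def)
    qed
  next
    case (Suc i)
    then obtain A1 where A1: "A1 \<ge> 0" "\<And>U \<Omega> r S M p (a :: 'a). bounded_ext U \<Omega> r S \<Longrightarrow> M \<ge> 1 \<Longrightarrow> norm p \<le> r / 8 \<Longrightarrow> norm a \<le> r / 8 \<Longrightarrow>
      S * exp (- (A * M)) \<le> \<bar>U (p, 0)\<bar> \<Longrightarrow>
      (\<exists>p'. dist p' (p + (real i / real J) *\<^sub>R (a - p)) \<le> \<theta> * r \<and> S * exp (- (A1 * M)) \<le> \<bar>U (p', 0)\<bar>)" by force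
    show ?case
    proof (intro exI[of _ "(A1 + 1) * \<kappa>"] conjI allI impI)
      show "0 \<le> (A1 + 1) * \<kappa>" using A1(1) \<kappa> by simp
      fix U \<Omega> and r S M :: real and p a :: 'a
      assume b: "bounded_ext U \<Omega> r S" and M: "M \<ge> 1" and p: "norm p \<le> r / 8" and a: "norm a \<le> r / 8" and s: "S * exp (- (A * M)) \<le> \<bar>U (p, 0)\<bar>"
      have r: "r > 0" and S: "S > 0" using b by (auto simp: bounded_ext_def)
      define ai where "ai i = p + (real i / real J) *\<^sub>R (a - p)" for i
      obtain p1 where p1: "dist p1 (ai i) \<le> \<theta> * r" "S * exp (- (A1 * M)) \<le> \<bar>U (p1, 0)\<bar>"
        using A1(2)[OF b M p a s] unfolding ai_def by blast
      have ap: "norm (a - p) \<le> r / 4" using norm_triangle_ineq4[of a p] p a by simp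
      have nai: "norm (ai i) \<le> r / 8"
      proof -
        have "ai i = (1 - real i / real J) *\<^sub>R p + (real i / real J) *\<^sub>R a" by (simp add: ai_def algebra_simps)
        moreover have "norm ((1 - real i / real J) *\<^sub>R p + (real i / real J) *\<^sub>R a) \<le> (1 - real i / real J) * (r / 8) + (real i / real J) * (r / 8)"
        proof -
          have c1: "0 \<le> 1 - real i / real J" using Suc.prems J by simp
          have c2: "0 \<le> real i / real J" by simp
          show ?thesis
            using norm_triangle_ineq[of "(1 - real i / real J) *\<^sub>R p" "(real i / real J) *\<^sub>R a"]
              mult_left_mono[OF p c1] mult_left_mono[OF a c2] unfolding norm_scaleR abs_of_nonneg[OF c1] abs_of_nonneg[OF c2] by linarith
        qed
        moreover have "(1 - real i / real J) * (r / 8) + (real i / real J) * (r / 8) = r / 8"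
          unfolding distrib_right[symmetric] by simp
        ultimately show ?thesis by metis
      qed
      have \<theta>r: "\<theta> * r \<le> r / (8 * ?q)" using mult_right_mono[OF \<theta>(2), of r] r by simp
      have rq: "r / (8 * ?q) \<le> r / 800" using r q by (intro divide_left_mono) auto
      have np1: "norm p1 \<le> r / 2"
        using norm_triangle_ineq[of "ai i" "p1 - ai i"] nai p1(1) \<theta>r rq r by (simp add: dist_norm)
      have "dist (ai i) (ai (Suc i)) = norm (a - p) / real J"
      proof -
        have "ai (Suc i) - ai i = (1 / real J) *\<^sub>R (a - p)" by (simp add: ai_def algebra_simps add_divide_distrib)
        then have "norm (ai (Suc i) - ai i) = norm ((1 / real J) *\<^sub>R (a - p))" by simp
        then show ?thesis by (simp add: dist_norm norm_minus_commute)
      qed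
      also have "\<dots> \<le> (r / 4) / ?q" using ap J q r by (intro frac_le) auto
      finally have d: "dist p1 (ai (Suc i)) + \<theta> * r \<le> r / (2 * ?q)"
        using dist_triangle[of p1 "ai (Suc i)" "ai i"] p1(1) \<theta>r by simp
      have \<theta>r0: "\<theta> * r > 0" using \<theta> r by simp
      obtain p' where p': "dist p' (ai (Suc i)) \<le> \<theta> * r"
        "S * exp (- ((A1 * M + 1) * (1 + 2 * ln (2 * exp 1 * r / (?q * (\<theta> * r)))))) \<le> \<bar>U (p', 0)\<bar>"
        using propagation_step[OF b np1 d \<theta>r0 _ p1(2)] A1(1) M by auto
      have eq: "2 * exp 1 * r / (?q * (\<theta> * r)) = 2 * exp 1 / (?q * \<theta>)" using r by simp
      have "(A1 * M + 1) * (1 + 2 * ln (2 * exp 1 / (?q * \<theta>))) \<le> (A1 * M + 1) * \<kappa>"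
        using A1(1) M by (intro mult_left_mono) (auto simp: \<kappa>_def)
      also have "\<dots> \<le> (A1 * M + M) * \<kappa>" using M \<kappa> by (intro mult_right_mono) auto
      also have "\<dots> = (A1 + 1) * \<kappa> * M" by (simp add: algebra_simps)
      finally have "S * exp (- ((A1 + 1) * \<kappa> * M)) \<le> S * exp (- ((A1 * M + 1) * (1 + 2 * ln (2 * exp 1 / (?q * \<theta>)))))"
        using S by simp
      then show "\<exists>p'. dist p' (p + (real (Suc i) / real J) *\<^sub>R (a - p)) \<le> \<theta> * r \<and> S * exp (- ((A1 + 1) * \<kappa> * M)) \<le> \<bar>U (p', 0)\<bar>"
        using p' unfolding eq ai_def by (intro exI[of _ p']) auto
    qed
  qed
  from this[of J] show ?thesis using J by simp
qed

section \<open>From the mass on a ball to a large value of the eigenfunction\<close>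

context
  fixes \<Omega> :: "(real^'n) set" and lam :: real and u :: "real^'n \<Rightarrow> real"
  assumes \<Omega>: "open \<Omega>" and lam: "lam > 1" and u4: "C_k_on 4 \<Omega> u"
    and eq: "\<And>x. x \<in> \<Omega> \<Longrightarrow> laplacian (laplacian u) x = lam\<^sup>2 * u x"
begin

lemma phi_lift_continuous:
  assumes "cball 0 t \<subseteq> \<Omega>"
  shows "continuous_on (cball 0 t) (phi_lift lam u)"
  by (rule continuous_on_subset[OF C_k_on_imp_continuous_on[OF phi_lift_laplacian(1)[OF \<Omega> lam u4 eq]]])
     (use cball_zero_subset_Times[OF assms] in auto)

text \<open>The mean value bound for the square of the harmonic extension on
  \<open>cball y r\<close>, a ball that still lies in the one of radius \<open>3 * r\<close>; there
  the comparison with \<open>phi_lift\<close> costs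
  \<open>exp (4 * sqrt lam * (3 * r))\<close>.\<close>

lemma harm_ext_bound:
  assumes r: "r > 0" "cball 0 (3 * r) \<subseteq> \<Omega>" and y: "y \<in> cball 0 (2 * r)"
  shows "mv_const TYPE((real^'n) \<times> real) * r ^ (CARD('n) + 1) * (harm_ext lam u y)\<^sup>2 \<le>
    2 * exp (12 * sqrt lam * r) * ball_integral (phi_lift lam u) (3 * r)"
proof -
  have mv: "mv_on (\<Omega> \<times> UNIV) (harm_ext lam u)" by (rule harm_ext_mv_on[OF \<Omega> lam u4 eq])
  have sub: "cball y r \<subseteq> cball 0 (3 * r)"
  proof
    fix z assume "z \<in> cball y r"
    then show "z \<in> cball 0 (3 * r)" using y dist_triangle[of 0 z y] by auto
  qed
  have subO: "cball 0 (3 * r) \<subseteq> \<Omega> \<times> (UNIV :: real set)" by (rule cball_zero_subset_Times[OF r(2)])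
  have "mv_const TYPE((real^'n) \<times> real) * r ^ DIM((real^'n) \<times> real) * (harm_ext lam u y)\<^sup>2 \<le>
    (\<integral>w. indicator (ball y r) w * (harm_ext lam u w)\<^sup>2 \<partial>lborel)"
    by (rule mv_on_square_bound[OF mv r(1)]) (use sub subO in blast)
  also have "\<dots> \<le> (\<integral>w. 2 * exp (12 * sqrt lam * r) * (indicator (ball 0 (3 * r)) w * phi_lift lam u w) \<partial>lborel)"
  proof (rule integral_mono)
    have "continuous_on (\<Omega> \<times> (UNIV :: real set)) (harm_ext lam u)" using mv by (simp add: mv_on_def)
    then have "continuous_on (cball y r) (harm_ext lam u)" by (rule continuous_on_subset) (use sub subO in blast)
    then show "integrable lborel (\<lambda>w. indicator (ball y r) w * (harm_ext lam u w)\<^sup>2)"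
      by (intro integrable_ball_continuous continuous_intros)
    show "integrable lborel (\<lambda>w. 2 * exp (12 * sqrt lam * r) * (indicator (ball 0 (3 * r)) w * phi_lift lam u w))"
      by (intro integrable_mult_right integrable_ball_continuous phi_lift_continuous[OF r(2)])
    fix w :: "(real^'n) \<times> real"
    have pos: "0 \<le> phi_lift lam u w" by (simp add: phi_lift_def)
    show "indicator (ball y r) w * (harm_ext lam u w)\<^sup>2 \<le> 2 * exp (12 * sqrt lam * r) * (indicator (ball 0 (3 * r)) w * phi_lift lam u w)"
    proof (cases "w \<in> ball y r")
      case True
      then have w: "norm w < 3 * r" using y norm_triangle_ineq[of y "w - y"] by (simp add: dist_norm norm_minus_commute)
      have "\<bar>snd w\<bar> \<le> 3 * r" using w norm_snd_le[where x = "fst w" and y = "snd w"] by simp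
      then have "(harm_ext lam u w)\<^sup>2 \<le> 2 * exp (4 * sqrt lam * (3 * r)) * phi_lift lam u w" by (rule harm_ext_square_le[OF lam])
      then show ?thesis using True w by (simp add: mult_ac)
    qed (use pos in simp)
  qed
  also have "\<dots> = 2 * exp (12 * sqrt lam * r) * ball_integral (phi_lift lam u) (3 * r)"
    unfolding ball_integral_def by (rule integral_mult_right_zero)
  finally show ?thesis by (simp add: add.commute)
qed

text \<open>Otherwise the density would be at most half of its own mean throughout the ball. The
  exponential factor allows for the height \<open>snd y\<close>, so that the base point can be taken
  in the slice R^n.\<close>

lemma lift_base_point:
  assumes t: "t > 0" "cball 0 t \<subseteq> \<Omega>" and F: "ball_integral (phi_lift lam u) t > 0"
  shows "\<exists>x\<in>ball 0 t. ball_integral (phi_lift lam u) t \<le>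
    2 * unit_ball_vol (CARD('n) + 1) * t ^ (CARD('n) + 1) * exp (2 * sqrt lam * t) * ((u x)\<^sup>2 + (laplacian u x - lam * u x)\<^sup>2)"
proof (rule ccontr)
  let ?F = "ball_integral (phi_lift lam u) t"
  define V where "V = measure lborel (ball (0 :: (real^'n) \<times> real) t)"
  have V: "V = unit_ball_vol (CARD('n) + 1) * t ^ (CARD('n) + 1)"
    unfolding V_def using content_ball[of t "0 :: (real^'n) \<times> real"] t by (simp add: add.commute)
  have V0: "V > 0" unfolding V using t by simp
  define E where "E = exp (2 * sqrt lam * t)"
  have E0: "E > 0" by (simp add: E_def)
  assume "\<not> ?thesis"
  then have lt: "2 * V * E * ((u x)\<^sup>2 + (laplacian u x - lam * u x)\<^sup>2) < ?F" if "x \<in> ball 0 t" for x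
    using that by (auto simp: V E_def mult_ac not_le)
  have "(\<integral>y. indicator (ball 0 t) y * phi_lift lam u y \<partial>lborel) \<le> (\<integral>y. indicator (ball (0 :: (real^'n) \<times> real) t) y * (?F / (2 * V)) \<partial>lborel)"
  proof (rule integral_mono)
    show "integrable lborel (\<lambda>y. indicator (ball 0 t) y * phi_lift lam u y)"
      by (rule integrable_ball_continuous[OF phi_lift_continuous[OF t(2)]])
    show "integrable lborel (\<lambda>y :: (real^'n) \<times> real. indicator (ball 0 t) y * (?F / (2 * V)))"
      by (rule integrable_ball_continuous) simp
    fix y :: "(real^'n) \<times> real"
    show "indicator (ball 0 t) y * phi_lift lam u y \<le> indicator (ball 0 t) y * (?F / (2 * V))"
    proof (cases "y \<in> ball 0 t")
      case True
      then have n: "norm y < t" by simp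
      have f: "fst y \<in> ball 0 t" using n norm_fst_le[where x = "fst y" and y = "snd y"] by simp
      have "\<bar>snd y\<bar> \<le> t" using n norm_snd_le[where x = "fst y" and y = "snd y"] by simp
      then have "snd y \<le> t" by linarith
      then have e: "exp (sqrt lam * snd y) ^ 2 \<le> E" unfolding E_def using lam by (simp add: exp_double[symmetric] mult_left_mono)
      have "phi_lift lam u y = ((u (fst y))\<^sup>2 + (laplacian u (fst y) - lam * u (fst y))\<^sup>2) * exp (sqrt lam * snd y) ^ 2"
        by (simp only: phi_lift_def lift_g_def lift_h_def power_mult_distrib distrib_right)
      also have "\<dots> \<le> ((u (fst y))\<^sup>2 + (laplacian u (fst y) - lam * u (fst y))\<^sup>2) * E" using e by (intro mult_left_mono) auto
      also have "\<dots> \<le> ?F / (2 * V)" using lt[OF f] V0 by (simp add: pos_le_divide_eq mult_ac)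
      finally show ?thesis using True by simp
    qed simp
  qed
  also have "\<dots> = V * (?F / (2 * V))" by (simp add: V_def)
  also have "\<dots> = ?F / 2" using V0 by simp
  finally show False using F by (simp add: ball_integral_def)
qed

text \<open>If \<open>u\<close> vanished near 0, its extension would be flat at 0 and
  \<open>u\<close> would vanish on \<open>\<Omega>\<close>. Thus the sphere and ball integrals that
  get divided by or compared are positive at every small radius.\<close>

lemma eigenfunction_nonzero_near:
  assumes con: "connected \<Omega>" and r0: "r0 > 0" "cball 0 r0 \<subseteq> \<Omega>" and nz: "\<exists>x\<in>\<Omega>. u x \<noteq> 0" and t: "t > 0"
  shows "\<exists>x\<in>ball 0 t. u x \<noteq> 0"
proof (rule ccontr)
  assume z: "\<not> ?thesis"
  have mv: "mv_on (\<Omega> \<times> UNIV) (harm_ext lam u)" by (rule harm_ext_mv_on[OF \<Omega> lam u4 eq])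
  have U0: "harm_ext lam u (x, 0) = u x" for x using lam by (intro harm_ext_zero) simp
  define d where "d = min t r0"
  have d: "d > 0" "d \<le> t" "d \<le> r0" using t r0(1) by (auto simp: d_def)
  have flat: "flat_at (harm_ext lam u) 0"
  proof (rule zero_near_imp_flat_at[OF mv d(1)])
    show "ball 0 d \<subseteq> \<Omega>" by (rule order_trans[OF _ r0(2)]) (use d in auto)
    show "harm_ext lam u (y, 0) = 0" if "y \<in> ball 0 d" for y using that z d U0[of y] by auto
  qed
  have "0 \<in> \<Omega>" using r0 by (meson centre_in_cball less_imp_le subsetD)
  then have "harm_ext lam u (y, 0) = 0" if "y \<in> \<Omega>" for y
    by (rule unique_continuation[OF mv \<Omega> con _ flat that])
  then show False using nz U0 by auto
qed

end

text \<open>Some second coordinate derivative carries at least the share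
  \<open>\<beta> / DIM('a)\<close> of the Laplacian, and the second difference along that coordinate
  line yields a large value of \<open>U\<close> itself.\<close>

lemma laplacian_value_propagation:
  fixes U :: "'a::euclidean_space \<times> real \<Rightarrow> real"
  assumes b: "bounded_ext U \<Omega> r S" and \<Omega>: "open \<Omega>" and z: "\<And>x. x \<in> \<Omega> \<Longrightarrow> z x = U (x, 0)"
    and x0: "norm x0 \<le> r / 100" and \<beta>: "\<beta> > 0" "\<beta> \<le> \<bar>laplacian z x0\<bar>"
  shows "\<exists>p. norm p \<le> r / 8 \<and> (\<beta> / DIM('a)) ^ 3 * r ^ 6 / (216 * S\<^sup>2 * line_rate TYPE('a) ^ 6) \<le> \<bar>U (p, 0)\<bar>"
proof -
  let ?q = "line_rate TYPE('a)"
  have q: "?q \<ge> 100" "?q > 0" by (rule line_rate_ge)+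
  have r: "r > 0" and S: "S > 0" and mv: "mv_on (\<Omega> \<times> UNIV) U" and sub: "cball 0 (2 * r) \<subseteq> \<Omega> \<times> (UNIV :: real set)"
    using b by (auto simp: bounded_ext_def)
  have "(x0, 0 :: real) \<in> cball 0 (2 * r)" using x0 r by (simp add: norm_Pair)
  then have x0O: "x0 \<in> \<Omega>" using sub by blast
  have "\<exists>i\<in>Basis. \<beta> / DIM('a) \<le> \<bar>partial_deriv i (partial_deriv i z) x0\<bar>"
  proof (rule ccontr)
    assume "\<not> ?thesis"
    then have "(\<Sum>i\<in>Basis. \<bar>partial_deriv i (partial_deriv i z) x0\<bar>) < (\<Sum>i\<in>(Basis :: 'a set). \<beta> / DIM('a))"
      by (intro sum_strict_mono) (auto simp: not_le)
    also have "\<dots> = \<beta>" by simp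
    finally show False using \<beta>(2) sum_abs[of "\<lambda>i. partial_deriv i (partial_deriv i z) x0" Basis] unfolding laplacian_def by linarith
  qed
  then obtain i :: 'a where i: "i \<in> Basis" "\<beta> / DIM('a) \<le> \<bar>partial_deriv i (partial_deriv i z) x0\<bar>" by blast
  have e: "norm i = 1" using i by simp
  have nb: "norm (x0 + t *\<^sub>R i) \<le> r / 8" if "\<bar>t\<bar> \<le> 1 / (2 * (?q / r))" for t
  proof -
    have "1 / (2 * (?q / r)) = r / (2 * ?q)" by simp
    also have "\<dots> \<le> r / 200" using r q by (intro divide_left_mono) auto
    finally show ?thesis using norm_triangle_ineq[of x0 "t *\<^sub>R i"] x0 e that r by simp
  qed
  have nb': "norm (x0 + t *\<^sub>R i) \<le> r" if "\<bar>t\<bar> \<le> 1 / (2 * (?q / r))" for t using nb[OF that] r by linarith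
  have D2: "line_deriv U x0 i 2 0 = partial_deriv i (partial_deriv i z) x0"
  proof -
    have 1: "partial_deriv i z x = partial_deriv (i, 0) U (x, 0)" if "x \<in> \<Omega>" for x
      by (rule mv_on_trace_partial[OF mv \<Omega> that z])
    have "partial_deriv i (partial_deriv i z) x0 = partial_deriv (i, 0) (partial_deriv (i, 0) U) (x0, 0)"
      by (rule mv_on_trace_partial[OF mv_on_partial_deriv[OF mv] \<Omega> x0O 1])
    then show ?thesis by (simp add: line_deriv_def numeral_2_eq_2)
  qed
  have "\<exists>t. \<bar>t\<bar> \<le> 1 / (2 * (?q / r)) \<and> \<bar>line_deriv U x0 i 2 0\<bar> ^ 3 / (216 * S\<^sup>2 * (?q / r) ^ 6) \<le> \<bar>line_deriv U x0 i 0 t\<bar>"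
  proof (rule second_derivative_propagation[OF _ S])
    show "(line_deriv U x0 i k has_real_derivative line_deriv U x0 i (Suc k) t) (at t)" if "\<bar>t\<bar> \<le> 1 / (2 * (?q / r))" for k t
      by (rule bounded_ext_line(1)[OF b nb'[OF that]]) (use e in simp)
    show "\<bar>line_deriv U x0 i k t\<bar> \<le> S * fact k * (?q / r) ^ k" if "\<bar>t\<bar> \<le> 1 / (2 * (?q / r))" for k t
      by (rule bounded_ext_line(2)[OF b nb'[OF that]]) (use e in simp)
    show "line_deriv U x0 i 2 0 \<noteq> 0"
    proof -
      have "0 < \<beta> / DIM('a)" using \<beta>(1) by simp
      then show ?thesis unfolding D2 using i(2) by linarith
    qed
    show "?q / r > 0" using q r by simp
  qed
  then obtain t where t: "\<bar>t\<bar> \<le> 1 / (2 * (?q / r))" "\<bar>line_deriv U x0 i 2 0\<bar> ^ 3 / (216 * S\<^sup>2 * (?q / r) ^ 6) \<le> \<bar>line_deriv U x0 i 0 t\<bar>" by blast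
  have "(\<beta> / DIM('a)) ^ 3 * r ^ 6 / (216 * S\<^sup>2 * ?q ^ 6) = (\<beta> / DIM('a)) ^ 3 / (216 * S\<^sup>2 * (?q / r) ^ 6)"
    using r q S by (simp add: power_divide)
  also have "\<dots> \<le> \<bar>line_deriv U x0 i 2 0\<bar> ^ 3 / (216 * S\<^sup>2 * (?q / r) ^ 6)"
    unfolding D2 using i(2) \<beta>(1) r q by (intro divide_right_mono power_mono) auto
  also have "\<dots> \<le> \<bar>U (x0 + t *\<^sub>R i, 0)\<bar>" using t(2) by (simp add: line_deriv_def)
  finally show ?thesis using nb[OF t(1)] by blast
qed

text \<open>Here \<open>a\<close> and \<open>l\<close> are the values of \<open>u\<close> and of its
  Laplacian at one point. If \<open>l\<close> is small, the lower bound falls on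
  \<open>4 * lam * \<bar>a\<bar>\<close>, and three factors \<open>exp (- M)\<close> absorb
  \<open>lam\<close>, 2 and 2. This is one place where the bracket has to dominate
  \<open>ln lam\<close>.\<close>

lemma value_or_laplacian_large:
  fixes a l lam :: real
  assumes S: "S > 0" and M: "M \<ge> 1" "ln lam \<le> M" and lam: "lam > 1" and A: "A \<ge> 0"
    and h: "S\<^sup>2 * exp (- (A * M)) \<le> a\<^sup>2 + (l - lam * a)\<^sup>2"
  shows "S * exp (- ((A + 3) * M)) \<le> \<bar>a\<bar> \<or> S * exp (- ((A + 1) * M)) \<le> \<bar>l\<bar>"
proof -
  have "(S * exp (- (A * M)))\<^sup>2 = S\<^sup>2 * exp (- (A * M)) * exp (- (A * M))" by (simp add: power2_eq_square)
  also have "\<dots> \<le> S\<^sup>2 * exp (- (A * M)) * 1" using A M by (intro mult_left_mono) auto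
  also have "\<dots> \<le> (\<bar>a\<bar> + \<bar>l - lam * a\<bar>)\<^sup>2" using h by (simp add: power2_sum) (simp add: add_increasing2)
  finally have "S * exp (- (A * M)) \<le> \<bar>a\<bar> + \<bar>l - lam * a\<bar>" by (rule power2_le_imp_le) simp
  also have "\<bar>l - lam * a\<bar> \<le> \<bar>l\<bar> + lam * \<bar>a\<bar>" using lam by (metis abs_mult abs_of_pos abs_triangle_ineq4 less_trans zero_less_one)
  finally have s: "S * exp (- (A * M)) \<le> \<bar>l\<bar> + (1 + lam) * \<bar>a\<bar>" by (simp add: algebra_simps)
  have e1: "2 * exp (- M) \<le> 1"
  proof -
    have "1 + M \<le> exp M" by (rule exp_ge_add_one_self)
    then have "2 \<le> exp M" using M by linarith
    then show ?thesis by (simp add: exp_minus divide_simps)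
  qed
  have eA: "exp (- ((A + 1) * M)) = exp (- (A * M)) * exp (- M)" by (simp add: exp_add[symmetric] algebra_simps)
  have eA3: "exp (- ((A + 3) * M)) = exp (- (A * M)) * exp (- M) * exp (- M) * exp (- M)" by (simp add: exp_add[symmetric] algebra_simps)
  have lamM: "lam * exp (- M) \<le> 1"
  proof -
    have "lam = exp (ln lam)" using lam by simp
    also have "\<dots> \<le> exp M" using M by simp
    finally show ?thesis by (simp add: exp_minus divide_simps)
  qed
  show ?thesis
  proof (rule disjCI)
    assume "\<not> S * exp (- ((A + 1) * M)) \<le> \<bar>l\<bar>"
    then have "2 * \<bar>l\<bar> < S * exp (- (A * M)) * (2 * exp (- M))" unfolding eA by simp
    also have "\<dots> \<le> S * exp (- (A * M)) * 1" using S e1 by (intro mult_left_mono) auto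
    finally have "S * exp (- (A * M)) \<le> 2 * ((1 + lam) * \<bar>a\<bar>)" using s by linarith
    also have "\<dots> \<le> 4 * lam * \<bar>a\<bar>" using lam mult_right_mono[of 1 lam "\<bar>a\<bar>"] by (simp add: algebra_simps)
    finally have h1: "S * exp (- (A * M)) \<le> 4 * lam * \<bar>a\<bar>" .
    have "S * exp (- ((A + 3) * M)) = S * exp (- (A * M)) * (exp (- M) * exp (- M) * exp (- M))" unfolding eA3 by simp
    also have "\<dots> \<le> 4 * lam * \<bar>a\<bar> * (exp (- M) * exp (- M) * exp (- M))" using h1 by (intro mult_right_mono) auto
    also have "\<dots> = \<bar>a\<bar> * ((lam * exp (- M)) * ((2 * exp (- M)) * (2 * exp (- M))))" by simp
    also have "\<dots> \<le> \<bar>a\<bar> * (1 * (1 * 1))" using lam e1 lamM by (intro mult_left_mono mult_mono) auto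
    finally show "S * exp (- ((A + 3) * M)) \<le> \<bar>a\<bar>" by simp
  qed
qed

text \<open>The loss in passing from the Laplacian to a value, expressed in units of
  \<open>M\<close>: the cube triples the exponent, \<open>r ^ 6\<close> is at least
  \<open>exp (- (6 * M))\<close>, and the numerical constant enters through its logarithm because
  \<open>M \<ge> 1\<close>.\<close>

lemma cubic_lower_bound:
  fixes r q n :: real
  assumes S: "S > 0" and M: "M \<ge> 1" "- ln r \<le> M" and r: "r > 0" and q: "q \<ge> 1" and n: "n \<ge> 1"
  shows "S * exp (- ((3 * A + 6 + ln (216 * n ^ 3 * q ^ 6)) * M)) \<le> (S * exp (- (A * M)) / n) ^ 3 * r ^ 6 / (216 * S\<^sup>2 * q ^ 6)"
proof -
  define c where "c = 216 * n ^ 3 * q ^ 6"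
  have "1 * 1 \<le> n ^ 3 * q ^ 6" using n q by (intro mult_mono one_le_power) auto
  then have c: "c \<ge> 1" by (simp add: c_def)
  have "exp (- M) \<le> r" using M r by (metis exp_le_cancel_iff exp_ln minus_le_iff)
  then have r6: "exp (- (6 * M)) \<le> r ^ 6" using power_mono[of "exp (- M)" r 6] by (simp add: exp_of_nat_mult[symmetric])
  have "ln c * 1 \<le> ln c * M" using c M by (intro mult_left_mono) auto
  then have "exp (- (ln c * M)) \<le> exp (- ln c)" by simp
  also have "\<dots> = 1 / c" using c by (simp add: exp_minus field_simps)
  finally have cM: "exp (- (ln c * M)) \<le> 1 / c" .
  have "S * exp (- ((3 * A + 6 + ln c) * M)) = S * exp (- (3 * (A * M))) * (exp (- (6 * M)) * exp (- (ln c * M)))"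
    by (simp add: exp_add[symmetric] algebra_simps)
  also have "\<dots> \<le> S * exp (- (3 * (A * M))) * (r ^ 6 * (1 / c))" using r6 cM S r by (intro mult_left_mono mult_mono) auto
  also have "exp (- (3 * (A * M))) = exp (- (A * M)) ^ 3" by (simp add: exp_of_nat_mult[symmetric])
  also have "S * exp (- (A * M)) ^ 3 * (r ^ 6 * (1 / c)) = (S * exp (- (A * M)) / n) ^ 3 * r ^ 6 / (216 * S\<^sup>2 * q ^ 6)"
    using S n q by (simp add: c_def power_divide power_mult_distrib power2_eq_square power3_eq_cube mult_ac)
  finally show ?thesis unfolding c_def .
qed

definition nodal_rate :: "real \<Rightarrow> (real^'n \<Rightarrow> real) \<Rightarrow> real \<Rightarrow> real \<Rightarrow> real \<Rightarrow> real" where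
  "nodal_rate lam u r0 C0 r = max (frequency lam u 0 r0) C0 + ln lam + sqrt lam * r - ln r"

text \<open>For \<open>r < 1 / 4\<close> already \<open>- ln r\<close> is at least 1, and the other
  summands are nonnegative; so the bracket dominates each of them as well as every constant up to a
  factor.\<close>

lemma nodal_rate_bounds:
  assumes "lam > 1" "0 < r" "r < 1 / 4" "C0 > 0"
  shows "1 \<le> nodal_rate lam u r0 C0 r" "max (frequency lam u 0 r0) C0 \<le> nodal_rate lam u r0 C0 r"
    "ln lam \<le> nodal_rate lam u r0 C0 r" "sqrt lam * r \<le> nodal_rate lam u r0 C0 r" "- ln r \<le> nodal_rate lam u r0 C0 r"
proof -
  have "exp 1 \<le> (4 :: real)" using exp_le by simp
  then have "1 \<le> ln (4 :: real)" by (subst ln_ge_iff) auto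
  also have "\<dots> \<le> - ln r" using assms ln_le_cancel_iff[of r "1/4"] by (simp add: ln_div)
  finally have "1 \<le> - ln r" .
  moreover have "ln lam \<ge> 0" "sqrt lam * r \<ge> 0" "max (frequency lam u 0 r0) C0 \<ge> 0" using assms by auto
  ultimately show "1 \<le> nodal_rate lam u r0 C0 r" "max (frequency lam u 0 r0) C0 \<le> nodal_rate lam u r0 C0 r"
    "ln lam \<le> nodal_rate lam u r0 C0 r" "sqrt lam * r \<le> nodal_rate lam u r0 C0 r" "- ln r \<le> nodal_rate lam u r0 C0 r"
    unfolding nodal_rate_def by linarith+
qed

text \<open>Accounting for the comparison of the radii \<open>3 * r\<close> and
  \<open>r / 100\<close>, whose quotient is 300. \<open>S2\<close> stands for the squared reference
  size derived from the larger ball, \<open>W\<close> for the density at a base point in the smaller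
  one, and every loss is written as the exponential of a multiple of \<open>M\<close>.\<close>

lemma mass_ratio_bound:
  fixes V mc s r F Ft S2 W M K k :: real
  assumes F: "S2 * (mc * r ^ m) = 2 * exp (12 * s * r) * F"
    and g: "F \<le> 300 powr (m + 2 * K) * Ft"
    and t: "Ft \<le> 2 * V * (r / 100) ^ m * exp (2 * s * (r / 100)) * W"
    and pos: "V > 0" "mc > 0" "r > 0" "s * r \<le> M" "K \<le> k * M" "M \<ge> 1" "W \<ge> 0"
  shows "S2 * exp (- ((\<bar>ln (4 * V / (mc * 100 ^ m))\<bar> + 13 + (m + 2 * k) * ln 300) * M)) \<le> W"
proof -
  define L where "L = ln (4 * V / (mc * 100 ^ m))"
  have c: "4 * V / (mc * 100 ^ m) = exp L" using pos by (simp add: L_def)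
  have p300: "300 powr (m + 2 * K) = exp ((m + 2 * K) * ln 300)" by (simp add: powr_def)
  have "S2 * (mc * r ^ m) \<le> 2 * exp (12 * s * r) * (exp ((m + 2 * K) * ln 300) * (2 * V * (r / 100) ^ m * exp (2 * s * (r / 100)) * W))"
    unfolding F using g t unfolding p300 by (intro mult_left_mono order_trans[OF g[unfolded p300]]) auto
  also have "\<dots> = (exp L * exp (12 * s * r) * exp ((m + 2 * K) * ln 300) * exp (2 * s * (r / 100)) * W) * (mc * r ^ m)"
    unfolding c[symmetric] using pos by (simp add: power_divide)
  finally have "S2 \<le> exp L * exp (12 * s * r) * exp ((m + 2 * K) * ln 300) * exp (2 * s * (r / 100)) * W"
    by (rule mult_right_le_imp_le) (use pos in simp)
  also have "\<dots> = exp (L + 12 * s * r + (m + 2 * K) * ln 300 + 2 * s * (r / 100)) * W" by (simp only: exp_add)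
  also have "\<dots> \<le> exp ((\<bar>L\<bar> + 13 + (m + 2 * k) * ln 300) * M) * W"
  proof (intro mult_right_mono iffD2[OF exp_le_cancel_iff] pos)
    have "L \<le> \<bar>L\<bar> * M" using mult_left_mono[of 1 M "\<bar>L\<bar>"] pos by simp
    moreover have "12 * s * r + 2 * s * (r / 100) \<le> 13 * M"
    proof -
      have "12 * s * r + 2 * s * (r / 100) = (12 + 1 / 50) * (s * r)" by (simp add: algebra_simps)
      then show ?thesis using pos by linarith
    qed
    moreover have "(m + 2 * K) * ln 300 \<le> (m + 2 * k) * ln 300 * M"
    proof -
      have "m + 2 * K \<le> (m + 2 * k) * M" using pos mult_left_mono[of 1 M "real m"] by (simp add: algebra_simps)
      then have "(m + 2 * K) * ln 300 \<le> (m + 2 * k) * M * ln 300" by (rule mult_right_mono) simp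
      then show ?thesis by (simp only: mult_ac)
    qed
    moreover have "(\<bar>L\<bar> + 13 + (m + 2 * k) * ln 300) * M = \<bar>L\<bar> * M + 13 * M + (m + 2 * k) * ln 300 * M"
      by (simp only: distrib_right)
    ultimately show "L + 12 * s * r + (m + 2 * K) * ln 300 + 2 * s * (r / 100) \<le> (\<bar>L\<bar> + 13 + (m + 2 * k) * ln 300) * M"
      by linarith
  qed
  finally have "S2 * exp (- ((\<bar>L\<bar> + 13 + (m + 2 * k) * ln 300) * M)) \<le>
    exp ((\<bar>L\<bar> + 13 + (m + 2 * k) * ln 300) * M) * W * exp (- ((\<bar>L\<bar> + 13 + (m + 2 * k) * ln 300) * M))" by (rule mult_right_mono) simp
  also have "\<dots> = W" by (simp add: exp_minus)
  finally show ?thesis unfolding L_def .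
qed

text \<open>Growth keeps enough mass in the ball of radius \<open>r / 100\<close> to find one good
  point there, and propagation then reaches every centre \<open>a\<close>. All losses are
  exponential in \<open>nodal_rate\<close>, with a factor \<open>A\<close> that depends on the
  dimension, \<open>Cstar\<close> and \<open>\<theta>\<close> but not on the eigenfunction.\<close>

lemma eigenfunction_base_points:
  fixes \<theta> C0 Cstar :: real
  assumes thr: "\<And>(\<Omega> :: (real^'n) set) lam u y0 r.
        open \<Omega> \<and> connected \<Omega> \<and> bounded \<Omega> \<and> lam > 1 \<and> eigenfunction_on \<Omega> lam u \<and>
        0 < r \<and> r \<le> 1 \<and> cball y0 r \<subseteq> \<Omega> \<times> UNIV \<and> frequency lam u y0 r \<ge> C0 \<Longrightarrow>
        \<exists>D. ((\<lambda>s. ln (frequency lam u y0 s)) has_real_derivative D) (at r) \<and> D \<ge> - Cstar"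
    and C0: "C0 > 0" and Cs: "Cstar > 0" and \<theta>: "0 < \<theta>" "\<theta> \<le> 1 / (8 * line_rate TYPE(real^'n))"
  shows "\<exists>A\<ge>0. \<forall>lam r0 (\<Omega> :: (real^'n) set) u r.
    lam > 1 \<longrightarrow> 0 < r0 \<longrightarrow> r0 < 1 \<longrightarrow> open \<Omega> \<longrightarrow> connected \<Omega> \<longrightarrow> cball 0 r0 \<subseteq> \<Omega> \<longrightarrow> eigenfunction_on \<Omega> lam u \<longrightarrow>
    0 < r \<longrightarrow> r < r0 / 4 \<longrightarrow> (\<exists>S. bounded_ext (harm_ext lam u) \<Omega> r S \<and> (\<forall>a. norm a \<le> r / 8 \<longrightarrow>
      (\<exists>p. dist p a \<le> \<theta> * r \<and> S * exp (- (A * nodal_rate lam u r0 C0 r)) \<le> \<bar>harm_ext lam u (p, 0)\<bar>)))"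
proof -
  let ?q = "line_rate TYPE(real^'n)"
  let ?m = "CARD('n) + 1"
  define V where "V = unit_ball_vol (CARD('n) + 1)"
  define mc where "mc = mv_const TYPE((real^'n) \<times> real)"
  define k where "k = exp Cstar * cone_const TYPE((real^'n) \<times> real) / (CARD('n) + 1)"
  define A1 where "A1 = \<bar>ln (4 * V / (mc * 100 ^ ?m))\<bar> + 13 + (?m + 2 * k) * ln 300"
  define c where "c = ln (216 * real DIM(real^'n) ^ 3 * ?q ^ 6)"
  \<comment> \<open>Dominates both outcomes at the base point: \<open>A1 + 3\<close> if the value of
    \<open>u\<close> is large there, and the cubic loss applied to \<open>A1 + 1\<close> if only its
    Laplacian is.\<close>
  define A2 where "A2 = 3 * (A1 + 1) + 6 + c"
  have q: "?q \<ge> 100" "?q > 0" by (rule line_rate_ge)+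
  have n1: "real DIM(real^'n) \<ge> 1" by (simp add: Suc_leI)
  have V: "V > 0" by (simp add: V_def)
  have mc: "mc > 0" unfolding mc_def by (rule mv_const_pos)
  have k: "k \<ge> 0" unfolding k_def using cone_const_pos[where 'a="(real^'n) \<times> real"] by (intro divide_nonneg_nonneg mult_nonneg_nonneg) auto
  have A1: "A1 \<ge> 0" unfolding A1_def using k by (intro add_nonneg_nonneg mult_nonneg_nonneg) auto
  have "1 * 1 \<le> real DIM(real^'n) ^ 3 * ?q ^ 6" using n1 q by (intro mult_mono one_le_power) auto
  then have c: "c \<ge> 0" by (simp add: c_def)
  have A2: "A2 \<ge> 0" "A1 + 3 \<le> A2" using A1 c by (auto simp: A2_def)
  obtain A where A: "A \<ge> 0" "\<And>U \<Omega> r S M p (a :: real^'n). bounded_ext U \<Omega> r S \<Longrightarrow> M \<ge> 1 \<Longrightarrow> norm p \<le> r / 8 \<Longrightarrow> norm a \<le> r / 8 \<Longrightarrow>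
    S * exp (- (A2 * M)) \<le> \<bar>U (p, 0)\<bar> \<Longrightarrow> (\<exists>p'. dist p' a \<le> \<theta> * r \<and> S * exp (- (A * M)) \<le> \<bar>U (p', 0)\<bar>)"
    using propagation_chain[OF \<theta> A2(1)] by metis
  show ?thesis
  proof (rule exI[of _ A], rule conjI[OF A(1)], intro allI impI)
    fix lam r0 r :: real and \<Omega> :: "(real^'n) set" and u :: "real^'n \<Rightarrow> real"
    assume lam: "lam > 1" and r0: "0 < r0" "r0 < 1" and \<Omega>: "open \<Omega>" "connected \<Omega>" and sub0: "cball 0 r0 \<subseteq> \<Omega>"
      and eig: "eigenfunction_on \<Omega> lam u" and r: "0 < r" "r < r0 / 4"
    define M where "M = nodal_rate lam u r0 C0 r"
    have "r < 1 / 4" using r r0 by simp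
    note M = nodal_rate_bounds[OF lam r(1) this C0, of u r0, folded M_def]
    have u4: "C_k_on 4 \<Omega> u" and eq: "\<And>x. x \<in> \<Omega> \<Longrightarrow> laplacian (laplacian u) x = lam\<^sup>2 * u x" and nz: "\<exists>x\<in>\<Omega>. u x \<noteq> 0"
      using eig by (auto simp: eigenfunction_on_def)
    have mv: "mv_on (\<Omega> \<times> UNIV) (harm_ext lam u)" by (rule harm_ext_mv_on[OF \<Omega>(1) lam u4 eq])
    have U0: "harm_ext lam u (x, 0) = u x" for x using lam by (intro harm_ext_zero) simp
    have subs: "cball 0 s \<subseteq> \<Omega>" if "s \<le> r0" for s by (rule order_trans[OF _ sub0]) (use that in auto)
    let ?F = "ball_integral (phi_lift lam u)"
    have near: "\<exists>x\<in>ball 0 t. u x \<noteq> 0" if "t > 0" for t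
      by (rule eigenfunction_nonzero_near[OF \<Omega>(1) lam u4 eq \<Omega>(2) r0(1) sub0 nz that])
    have Fpos: "?F t > 0" if t: "0 < t" "t \<le> r0" for t
    proof -
      obtain x where x: "x \<in> ball 0 t" "u x \<noteq> 0" using near t by blast
      show ?thesis
      proof (rule ball_integral_pos)
        show "continuous_on (cball 0 t) (phi_lift lam u)" by (rule phi_lift_continuous[OF \<Omega>(1) lam u4 eq subs[OF t(2)]])
        show "(x, 0 :: real) \<in> ball 0 t" using x by (simp add: norm_Pair)
        show "0 < phi_lift lam u (x, 0)" using x by (simp add: phi_lift_def lift_g_def add_pos_nonneg)
      qed (simp add: phi_lift_def)
    qed
    \<comment> \<open>Chosen so that \<open>harm_ext_bound\<close> says exactly that the extension
      is at most \<open>S\<close> on radius \<open>2 * r\<close>; the same mass on radius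
      \<open>3 * r\<close> then enters the growth estimate, and no separate comparison of
      \<open>S\<close> with \<open>F\<close> arises.\<close>
    define S where "S = sqrt (2 * exp (12 * sqrt lam * r) * ?F (3 * r) / (mc * r ^ ?m))"
    have F3: "?F (3 * r) > 0" using r r0 by (intro Fpos) auto
    have mcr: "mc * r ^ ?m > 0" using mc r by simp
    have S: "S > 0" unfolding S_def using F3 mcr by simp
    have S2: "S\<^sup>2 * (mc * r ^ ?m) = 2 * exp (12 * sqrt lam * r) * ?F (3 * r)"
      unfolding S_def using F3 mcr mc r by simp
    have sub3: "cball 0 (3 * r) \<subseteq> \<Omega>" by (rule subs) (use r r0 in linarith)
    have be: "bounded_ext (harm_ext lam u) \<Omega> r S"
      unfolding bounded_ext_def
    proof (intro conjI mv r S ballI)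
      show "cball 0 (2 * r) \<subseteq> \<Omega> \<times> (UNIV :: real set)" by (rule cball_zero_subset_Times[OF subs]) (use r r0 in linarith)
      fix y :: "(real^'n) \<times> real" assume y: "y \<in> cball 0 (2 * r)"
      have "mc * r ^ ?m * (harm_ext lam u y)\<^sup>2 \<le> S\<^sup>2 * (mc * r ^ ?m)"
        unfolding S2 unfolding mc_def by (rule harm_ext_bound[OF \<Omega>(1) lam u4 eq r(1) sub3 y])
      then have "(mc * r ^ ?m) * (harm_ext lam u y)\<^sup>2 \<le> (mc * r ^ ?m) * S\<^sup>2" by (simp only: mult.commute)
      then have "\<bar>harm_ext lam u y\<bar>\<^sup>2 \<le> S\<^sup>2" using mcr by (simp only: mult_le_cancel_left_pos power2_abs)
      then show "\<bar>harm_ext lam u y\<bar> \<le> S" by (rule power2_le_imp_le) (use S in simp)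
    qed
    define K where "K = k * max (frequency lam u 0 r0) C0"
    have growth: "?F (3 * r) \<le> (3 * r / (r / 100)) powr (real CARD('n) + 1 + 2 * K) * ?F (r / 100)"
      unfolding K_def k_def
      by (rule phi_lift_growth[OF \<Omega>(1) lam u4 eq thr C0 Cs r0 sub0 near]) (use r in auto)
    obtain x0 where x0: "x0 \<in> ball 0 (r / 100)" "?F (r / 100) \<le> 2 * V * (r / 100) ^ ?m * exp (2 * sqrt lam * (r / 100)) *
        ((u x0)\<^sup>2 + (laplacian u x0 - lam * u x0)\<^sup>2)"
      unfolding V_def using lift_base_point[OF \<Omega>(1) lam u4 eq _ subs Fpos, of "r / 100"] r by auto
    have big: "S\<^sup>2 * exp (- (A1 * M)) \<le> (u x0)\<^sup>2 + (laplacian u x0 - lam * u x0)\<^sup>2"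
      unfolding A1_def
    proof (rule mass_ratio_bound[where m = ?m, OF S2 _ x0(2) V mc r(1)])
      have "3 * r / (r / 100) = 300" using r by simp
      then show "?F (3 * r) \<le> 300 powr (real ?m + 2 * K) * ?F (r / 100)" using growth by (simp add: add.commute)
      show "K \<le> k * M" unfolding K_def using k M by (intro mult_left_mono) auto
    qed (use M in auto)
    have nx0: "norm x0 \<le> r / 100" using x0(1) by simp
    have "\<exists>p. norm p \<le> r / 8 \<and> S * exp (- (A2 * M)) \<le> \<bar>harm_ext lam u (p, 0)\<bar>"
      using value_or_laplacian_large[OF S M(1,3) lam A1 big]
    proof
      assume h: "S * exp (- ((A1 + 3) * M)) \<le> \<bar>u x0\<bar>"
      have "S * exp (- (A2 * M)) \<le> S * exp (- ((A1 + 3) * M))" using S A2 M by simp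
      then show ?thesis using h nx0 r U0 by (intro exI[of _ x0]) auto
    next
      assume h: "S * exp (- ((A1 + 1) * M)) \<le> \<bar>laplacian u x0\<bar>"
      obtain p where p: "norm p \<le> r / 8" "(S * exp (- ((A1 + 1) * M)) / DIM(real^'n)) ^ 3 * r ^ 6 / (216 * S\<^sup>2 * ?q ^ 6) \<le> \<bar>harm_ext lam u (p, 0)\<bar>"
        using laplacian_value_propagation[OF be \<Omega>(1) U0[symmetric] nx0 _ h] S by auto
      have "S * exp (- (A2 * M)) \<le> (S * exp (- ((A1 + 1) * M)) / DIM(real^'n)) ^ 3 * r ^ 6 / (216 * S\<^sup>2 * ?q ^ 6)"
        unfolding A2_def c_def by (rule cubic_lower_bound[OF S M(1,5) r(1) _ n1]) (use q in simp)
      then show ?thesis using p by (intro exI[of _ p]) auto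
    qed
    then obtain p where p: "norm p \<le> r / 8" "S * exp (- (A2 * M)) \<le> \<bar>harm_ext lam u (p, 0)\<bar>" by blast
    have "\<exists>p. dist p a \<le> \<theta> * r \<and> S * exp (- (A * M)) \<le> \<bar>harm_ext lam u (p, 0)\<bar>" if "norm a \<le> r / 8" for a
      by (rule A(2)[OF be M(1) p(1) that p(2)])
    then show "\<exists>S. bounded_ext (harm_ext lam u) \<Omega> r S \<and> (\<forall>a. norm a \<le> r / 8 \<longrightarrow>
      (\<exists>p. dist p a \<le> \<theta> * r \<and> S * exp (- (A * nodal_rate lam u r0 C0 r)) \<le> \<bar>harm_ext lam u (p, 0)\<bar>))"
      using be unfolding M_def by blast
  qed
qed

section \<open>The nodal set\<close>

text \<open>Subtracting the linear part at \<open>x\<close> leaves a function with Lipschitz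
  constant \<open>\<epsilon>\<close> near \<open>x\<close>. Between two zeros of \<open>w\<close>
  only the linear part contributes, so chords of the zero set are almost orthogonal to the
  gradient.\<close>

lemma zero_set_strict_tangency:
  fixes w :: "'a::euclidean_space \<Rightarrow> real"
  assumes \<Omega>: "open \<Omega>" "x \<in> \<Omega>" and w: "\<And>y. y \<in> \<Omega> \<Longrightarrow> (w has_derivative (\<lambda>v. G y \<bullet> v)) (at y)"
    and G: "continuous_on \<Omega> G" and \<epsilon>: "\<epsilon> > 0"
  shows "\<exists>d>0. \<forall>y1\<in>ball x d. \<forall>y2\<in>ball x d. w y1 = 0 \<longrightarrow> w y2 = 0 \<longrightarrow> \<bar>G x \<bullet> (y1 - y2)\<bar> \<le> \<epsilon> * dist y1 y2"
proof -
  obtain d1 where d1: "d1 > 0" "ball x d1 \<subseteq> \<Omega>" using \<Omega> openE by blast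
  have "continuous (at x within \<Omega>) G" using G \<Omega>(2) by (simp add: continuous_on_eq_continuous_within)
  then obtain d2 where d2: "d2 > 0" "\<And>y. y \<in> \<Omega> \<Longrightarrow> dist y x < d2 \<Longrightarrow> dist (G y) (G x) < \<epsilon>"
    using \<epsilon> unfolding continuous_within_eps_delta by metis
  define d where "d = min d1 d2"
  have d: "d > 0" "ball x d \<subseteq> \<Omega>" using d1 d2 by (auto simp: d_def)
  have "\<bar>G x \<bullet> (y1 - y2)\<bar> \<le> \<epsilon> * dist y1 y2" if y: "y1 \<in> ball x d" "y2 \<in> ball x d" "w y1 = 0" "w y2 = 0" for y1 y2
  proof -
    have "norm ((w y1 - G x \<bullet> y1) - (w y2 - G x \<bullet> y2)) \<le> \<epsilon> * norm (y1 - y2)"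
    proof (rule differentiable_bound[where f' = "\<lambda>y v. G y \<bullet> v - G x \<bullet> v" and S = "ball x d"])
      show "((\<lambda>y. w y - G x \<bullet> y) has_derivative (\<lambda>v. G y \<bullet> v - G x \<bullet> v)) (at y within ball x d)" if "y \<in> ball x d" for y
        using has_derivative_at_withinI[OF w] that d(2) by (intro has_derivative_diff bounded_linear_imp_has_derivative bounded_linear_inner_right) auto
      show "onorm (\<lambda>v. G y \<bullet> v - G x \<bullet> v) \<le> \<epsilon>" if "y \<in> ball x d" for y
      proof (rule onorm_bound)
        fix v
        have "dist (G y) (G x) \<le> \<epsilon>" using d2(2)[of y] that d(2) by (force simp: d_def dist_commute)
        have "norm (G y \<bullet> v - G x \<bullet> v) = \<bar>(G y - G x) \<bullet> v\<bar>" by (simp add: inner_diff_left)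
        also have "\<dots> \<le> norm (G y - G x) * norm v" by (rule Cauchy_Schwarz_ineq2)
        also have "\<dots> \<le> \<epsilon> * norm v" using \<open>dist (G y) (G x) \<le> \<epsilon>\<close> by (intro mult_right_mono) (auto simp: dist_norm)
        finally show "norm (G y \<bullet> v - G x \<bullet> v) \<le> \<epsilon> * norm v" .
      qed (use \<epsilon> in simp)
    qed (use y in auto)
    then show ?thesis using y by (simp add: inner_diff_right dist_norm abs_minus_commute)
  qed
  then show ?thesis using d(1) by blast
qed

text \<open>The chord splits into an angular part of size at most
  \<open>R * norm (sgn \<rho>1 - sgn \<rho>2)\<close> and a radial part along
  \<open>sgn \<rho>2\<close>. Tangency bounds the component of the chord along \<open>\<nu>\<close>,
  transversality turns this into a bound for the radial part, and the half of the chord that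
  reappears on the right is absorbed.\<close>

lemma radial_inverse_estimate:
  fixes \<rho>1 \<rho>2 \<nu> :: "'a::euclidean_space"
  assumes \<kappa>: "\<kappa> > 0" and R: "norm \<rho>1 \<le> R" and \<nu>: "norm \<nu> = 1" and nz: "\<rho>1 \<noteq> 0" "\<rho>2 \<noteq> 0"
    and tr: "\<kappa> \<le> \<bar>\<nu> \<bullet> sgn \<rho>2\<bar>" and tan: "\<bar>\<nu> \<bullet> (\<rho>1 - \<rho>2)\<bar> \<le> \<kappa> / 2 * norm (\<rho>1 - \<rho>2)"
  shows "norm (\<rho>1 - \<rho>2) \<le> 2 * (1 + 1 / \<kappa>) * R * norm (sgn \<rho>1 - sgn \<rho>2)"
proof -
  let ?s = "norm (sgn \<rho>1 - sgn \<rho>2)" and ?\<delta> = "norm \<rho>1 - norm \<rho>2"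
  have R0: "0 \<le> R" using R norm_ge_zero order_trans by blast
  have eq: "\<rho>1 - \<rho>2 = norm \<rho>1 *\<^sub>R (sgn \<rho>1 - sgn \<rho>2) + ?\<delta> *\<^sub>R sgn \<rho>2"
    using nz by (simp add: sgn_div_norm algebra_simps)
  have "\<nu> \<bullet> (\<rho>1 - \<rho>2) = norm \<rho>1 * (\<nu> \<bullet> (sgn \<rho>1 - sgn \<rho>2)) + ?\<delta> * (\<nu> \<bullet> sgn \<rho>2)"
    by (subst eq) (simp add: inner_add_right)
  moreover have "\<bar>norm \<rho>1 * (\<nu> \<bullet> (sgn \<rho>1 - sgn \<rho>2))\<bar> \<le> R * ?s"
    using Cauchy_Schwarz_ineq2[of \<nu> "sgn \<rho>1 - sgn \<rho>2"] \<nu> R R0 by (simp add: abs_mult mult_mono)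
  ultimately have "\<bar>?\<delta> * (\<nu> \<bullet> sgn \<rho>2)\<bar> \<le> R * ?s + \<kappa> / 2 * norm (\<rho>1 - \<rho>2)" using tan by linarith
  moreover have "\<bar>?\<delta>\<bar> * \<kappa> \<le> \<bar>?\<delta> * (\<nu> \<bullet> sgn \<rho>2)\<bar>" unfolding abs_mult using tr by (intro mult_left_mono) auto
  ultimately have "\<bar>?\<delta>\<bar> * \<kappa> \<le> R * ?s + \<kappa> / 2 * norm (\<rho>1 - \<rho>2)" by linarith
  then have \<delta>: "\<bar>?\<delta>\<bar> \<le> R * ?s / \<kappa> + norm (\<rho>1 - \<rho>2) / 2" using \<kappa> by (simp add: field_simps)
  have "norm (\<rho>1 - \<rho>2) \<le> norm (norm \<rho>1 *\<^sub>R (sgn \<rho>1 - sgn \<rho>2)) + norm (?\<delta> *\<^sub>R sgn \<rho>2)"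
    by (subst eq) (rule norm_triangle_ineq)
  also have "\<dots> \<le> R * ?s + \<bar>?\<delta>\<bar>" using R nz by (simp add: norm_sgn mult_right_mono)
  finally have "norm (\<rho>1 - \<rho>2) \<le> 2 * (R * ?s) + 2 * (R * ?s / \<kappa>)" using \<delta> by linarith
  then show ?thesis by (simp add: algebra_simps)
qed

text \<open>Near a point with nonzero gradient the zero set is almost tangential while the rays from
  \<open>p\<close> are transversal. Both are open conditions, so they persist on a ball; the
  Lipschitz constant obtained depends on \<open>\<kappa>\<close> and \<open>R\<close> alone,
  whatever \<open>w\<close> is.\<close>

lemma radial_patch:
  fixes w :: "'a::euclidean_space \<Rightarrow> real"
  assumes \<Omega>: "open \<Omega>" "x \<in> \<Omega>" and w: "\<And>y. y \<in> \<Omega> \<Longrightarrow> (w has_derivative (\<lambda>v. G y \<bullet> v)) (at y)"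
    and G: "continuous_on \<Omega> G" "G x \<noteq> 0" and \<kappa>: "\<kappa> > 0" and R: "norm (x - p) < R" and xp: "x \<noteq> p"
    and tr: "\<kappa> * norm (x - p) < \<bar>sgn (G x) \<bullet> (x - p)\<bar>"
  shows "\<exists>d>0. \<forall>y1\<in>ball x d. \<forall>y2\<in>ball x d. w y1 = 0 \<longrightarrow> w y2 = 0 \<longrightarrow>
    dist y1 y2 \<le> 2 * (1 + 1 / \<kappa>) * R * dist (sgn (y1 - p)) (sgn (y2 - p))"
proof -
  define \<nu> where "\<nu> = sgn (G x)"
  have \<nu>: "norm \<nu> = 1" using G(2) by (simp add: \<nu>_def norm_sgn)
  have gx: "norm (G x) > 0" using G(2) by simp
  obtain d1 where d1: "d1 > 0" "\<And>y1 y2. y1 \<in> ball x d1 \<Longrightarrow> y2 \<in> ball x d1 \<Longrightarrow> w y1 = 0 \<Longrightarrow> w y2 = 0 \<Longrightarrow>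
      \<bar>G x \<bullet> (y1 - y2)\<bar> \<le> (norm (G x) * \<kappa> / 2) * dist y1 y2"
    using zero_set_strict_tangency[OF \<Omega> w G(1), of "norm (G x) * \<kappa> / 2"] gx \<kappa> by auto
  define V where "V = {y. norm (y - p) < R} \<inter> {y. \<kappa> * norm (y - p) < \<bar>\<nu> \<bullet> (y - p)\<bar>}"
  have "open V" unfolding V_def by (intro open_Int open_Collect_less continuous_intros)
  moreover have "x \<in> V" using R tr by (simp add: V_def \<nu>_def)
  ultimately obtain d2 where d2: "d2 > 0" "ball x d2 \<subseteq> V" using openE by blast
  have "dist y1 y2 \<le> 2 * (1 + 1 / \<kappa>) * R * dist (sgn (y1 - p)) (sgn (y2 - p))"
    if y: "y1 \<in> ball x (min d1 d2)" "y2 \<in> ball x (min d1 d2)" "w y1 = 0" "w y2 = 0" for y1 y2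
  proof -
    have "y1 \<in> ball x d2" "y2 \<in> ball x d2" using y by auto
    then have V: "y1 \<in> V" "y2 \<in> V" using d2 by auto
    have n: "y1 - p \<noteq> 0" "y2 - p \<noteq> 0" using V by (auto simp: V_def)
    have t: "\<kappa> \<le> \<bar>\<nu> \<bullet> sgn (y2 - p)\<bar>" 
    proof -
      have "\<nu> \<bullet> sgn (y2 - p) = (\<nu> \<bullet> (y2 - p)) / norm (y2 - p)" by (simp add: sgn_div_norm divide_inverse mult.commute)
      then show ?thesis using V(2) n(2) by (simp add: V_def abs_divide pos_le_divide_eq)
    qed
    have "norm (G x) * \<bar>\<nu> \<bullet> (y1 - y2)\<bar> = \<bar>G x \<bullet> (y1 - y2)\<bar>" using gx by (simp add: \<nu>_def sgn_div_norm abs_mult)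
    also have "\<dots> \<le> norm (G x) * (\<kappa> / 2 * norm (y1 - y2))" using d1(2)[of y1 y2] y by (simp add: dist_norm)
    finally have "\<bar>\<nu> \<bullet> (y1 - y2)\<bar> \<le> \<kappa> / 2 * norm (y1 - y2)" using gx by (simp only: mult_le_cancel_left_pos)
    then have "norm ((y1 - p) - (y2 - p)) \<le> 2 * (1 + 1 / \<kappa>) * R * norm (sgn (y1 - p) - sgn (y2 - p))"
      using V by (intro radial_inverse_estimate[OF \<kappa> _ \<nu> n t]) (auto simp: V_def)
    then show ?thesis by (simp add: dist_norm)
  qed
  then show ?thesis using d1(1) d2(1) by (intro exI[of _ "min d1 d2"]) auto
qed

section \<open>Pieces with a Lipschitz radial inverse\<close>

lemma hausdorff_outer_radial_compact:
  fixes K :: "'a::euclidean_space set"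
  assumes K: "compact K" "p \<notin> K" and L: "L > 0"
    and inv: "\<And>x y. x \<in> K \<Longrightarrow> y \<in> K \<Longrightarrow> dist x y \<le> L * dist (sgn (x - p)) (sgn (y - p))"
  defines "P \<equiv> (\<lambda>x. sgn (x - p)) ` K"
  shows "hausdorff_outer (DIM('a) - 1) K \<le> ennreal (L ^ (DIM('a) - 1)) * (ennreal (cone_const TYPE('a)) * emeasure lborel (dcone 1 P))"
    "compact P"
proof -
  let ?\<pi> = "\<lambda>x. sgn (x - p)"
  have "inj_on ?\<pi> K"
  proof (rule inj_onI)
    fix x y assume "x \<in> K" "y \<in> K" "?\<pi> x = ?\<pi> y"
    then show "x = y" using inv[of x y] by simp
  qed
  then have f: "inv_into K ?\<pi> (?\<pi> x) = x" if "x \<in> K" for x using that by (rule inv_into_f_f)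
  have img: "inv_into K ?\<pi> ` P = K" unfolding P_def image_image using f by simp
  have "continuous_on K ?\<pi>" unfolding sgn_div_norm using K(2) by (intro continuous_intros) auto
  then show P: "compact P" unfolding P_def using K(1) by (rule compact_continuous_image)
  have sph: "P \<subseteq> sphere 0 1" using K(2) by (auto simp: P_def norm_sgn)
  have "hausdorff_outer (DIM('a) - 1) (inv_into K ?\<pi> ` P) \<le> ennreal (L ^ (DIM('a) - 1)) * hausdorff_outer (DIM('a) - 1) P"
    by (rule hausdorff_outer_lipschitz_image[OF L]) (use f inv in \<open>auto simp: P_def\<close>)
  also have "\<dots> \<le> ennreal (L ^ (DIM('a) - 1)) * (ennreal (cone_const TYPE('a)) * emeasure lborel (dcone 1 P))"
    by (intro mult_left_mono hausdorff_outer_sphere_le_cone P sph) simp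
  finally show "hausdorff_outer (DIM('a) - 1) K \<le> ennreal (L ^ (DIM('a) - 1)) * (ennreal (cone_const TYPE('a)) * emeasure lborel (dcone 1 P))"
    unfolding img .
qed

text \<open>The pieces are disjoint, so those whose cones contain \<open>y\<close> are met by the
  ray in direction \<open>sgn y\<close> at different parameters; hence at most \<open>N\<close> of
  the cones contain \<open>y\<close>. Integrating this multiplicity over the unit ball gives the
  bound.\<close>

lemma disjoint_cones_multiplicity:
  fixes K :: "'i \<Rightarrow> 'a::euclidean_space set"
  assumes I: "finite I" and K: "\<And>i. i \<in> I \<Longrightarrow> compact (K i)" "\<And>i. i \<in> I \<Longrightarrow> p \<notin> K i"
    and dis: "disjoint_family_on K I"
    and P: "\<And>i. i \<in> I \<Longrightarrow> compact ((\<lambda>x. sgn (x - p)) ` K i)"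
    and cnt: "\<And>\<omega> X. norm \<omega> = 1 \<Longrightarrow> finite X \<Longrightarrow> X \<subseteq> {t. t > 0 \<and> p + t *\<^sub>R \<omega> \<in> (\<Union>i\<in>I. K i)} \<Longrightarrow> real (card X) \<le> N"
  shows "(\<Sum>i\<in>I. emeasure lborel (dcone 1 ((\<lambda>x. sgn (x - p)) ` K i))) \<le> ennreal (N * unit_ball_vol DIM('a))"
proof -
  let ?P = "\<lambda>i. (\<lambda>x. sgn (x - p)) ` K i"
  have N: "N \<ge> 0"
  proof -
    obtain b :: 'a where "b \<in> Basis" by (meson nonempty_Basis ex_in_conv)
    then show ?thesis using cnt[of b "{}"] by simp
  qed
  have bor: "dcone 1 (?P i) \<in> sets borel" if "i \<in> I" for i using P[OF that] by (intro dcone_borel borel_compact)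
  have le: "(\<Sum>i\<in>I. indicator (dcone 1 (?P i)) y) \<le> ennreal N * indicator (ball 0 1) y" for y :: 'a
  proof (cases "y \<noteq> 0 \<and> norm y < 1")
    case True
    define I' where "I' = {i \<in> I. sgn y \<in> ?P i}"
    have fin: "finite I'" using I by (simp add: I'_def)
    have "(\<Sum>i\<in>I. indicator (dcone 1 (?P i)) y :: ennreal) = (\<Sum>i\<in>I. if i \<in> I' then 1 else 0)"
      using True by (intro sum.cong) (auto simp: I'_def dcone_def indicator_def)
    also have "\<dots> = of_nat (card I')" using I by (simp add: sum.If_cases Int_def I'_def)
    finally have s: "(\<Sum>i\<in>I. indicator (dcone 1 (?P i)) y :: ennreal) = of_nat (card I')" .
    have "\<exists>t>0. p + t *\<^sub>R sgn y \<in> K i" if "i \<in> I'" for i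
    proof -
      have iI: "i \<in> I" "sgn y \<in> ?P i" using that unfolding I'_def by blast+
      then obtain x where x: "x \<in> K i" "sgn y = sgn (x - p)" by blast
      then have xp: "x \<noteq> p" using K(2) iI by blast
      then have "p + norm (x - p) *\<^sub>R sgn y = x" unfolding x(2) by (simp add: sgn_div_norm)
      then show ?thesis using x(1) xp by (intro exI[of _ "norm (x - p)"]) auto
    qed
    then obtain t where t: "\<And>i. i \<in> I' \<Longrightarrow> t i > 0" "\<And>i. i \<in> I' \<Longrightarrow> p + t i *\<^sub>R sgn y \<in> K i" by metis
    have "inj_on t I'"
    proof (rule inj_onI, rule ccontr)
      fix i k assume ik: "i \<in> I'" "k \<in> I'" "t i = t k" "i \<noteq> k"
      then have "K i \<inter> K k = {}" using dis by (auto simp: I'_def disjoint_family_on_def)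
      then show False using t(2)[of i] t(2)[of k] ik by auto
    qed
    then have "card I' = card (t ` I')" by (simp add: card_image)
    also have "real \<dots> \<le> N"
      by (rule cnt[of "sgn y"]) (use True t fin in \<open>auto simp: norm_sgn I'_def\<close>)
    finally have "real (card I') \<le> N" .
    then have "of_nat (card I') \<le> ennreal N" by (metis ennreal_leI ennreal_of_nat_eq_real_of_nat)
    then show ?thesis unfolding s using True by simp
  next
    case False
    then have "(\<Sum>i\<in>I. indicator (dcone 1 (?P i)) y :: ennreal) = 0" by (intro sum.neutral) (auto simp: dcone_def)
    then show ?thesis by simp
  qed
  have "(\<Sum>i\<in>I. emeasure lborel (dcone 1 (?P i))) = (\<Sum>i\<in>I. \<integral>\<^sup>+y. indicator (dcone 1 (?P i)) y \<partial>lborel)"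
    by (intro sum.cong) (use bor in \<open>auto simp: nn_integral_indicator\<close>)
  also have "\<dots> = (\<integral>\<^sup>+y. (\<Sum>i\<in>I. indicator (dcone 1 (?P i)) y) \<partial>lborel)"
    by (rule nn_integral_sum[symmetric]) (use bor in auto)
  also have "\<dots> \<le> (\<integral>\<^sup>+y. ennreal N * indicator (ball 0 1) (y :: 'a) \<partial>lborel)" by (intro nn_integral_mono le)
  also have "\<dots> = ennreal N * emeasure lborel (ball (0 :: 'a) 1)" by (simp add: nn_integral_cmult_indicator)
  also have "\<dots> = ennreal (N * unit_ball_vol DIM('a))" using N by (simp add: emeasure_ball ennreal_mult)
  finally show ?thesis .
qed

text \<open>The radial projection from \<open>p\<close> has an \<open>L\<close>-Lipschitz inverse on
  \<open>K\<close>. Phrased without the inverse, the property passes to subsets at once.\<close>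

definition radially_thin :: "'a::euclidean_space \<Rightarrow> real \<Rightarrow> 'a set \<Rightarrow> bool" where
  "radially_thin p L K \<longleftrightarrow> p \<notin> K \<and> (\<forall>x\<in>K. \<forall>y\<in>K. dist x y \<le> L * dist (sgn (x - p)) (sgn (y - p)))"

lemma radially_thin_subset: "radially_thin p L K \<Longrightarrow> C \<subseteq> K \<Longrightarrow> radially_thin p L C"
  by (auto simp: radially_thin_def)

text \<open>Multiplicity of cones is controlled for one centre at a time, so the pieces are grouped
  by the base point from which they are projected.\<close>

lemma disjoint_radially_thin_sum:
  fixes K :: "nat \<Rightarrow> 'a::euclidean_space set" and p :: "'b \<Rightarrow> 'a"
  assumes J: "finite J" "\<And>i. i < m \<Longrightarrow> j i \<in> J" and L: "L > 0"
    and K: "\<And>i. i < m \<Longrightarrow> compact (K i)" "\<And>i. i < m \<Longrightarrow> radially_thin (p (j i)) L (K i)" "\<And>i. i < m \<Longrightarrow> K i \<subseteq> Z"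
    and dis: "disjoint_family_on K {..<m}"
    and cnt: "\<And>b \<omega> X. b \<in> J \<Longrightarrow> norm \<omega> = 1 \<Longrightarrow> finite X \<Longrightarrow> X \<subseteq> {t. t > 0 \<and> p b + t *\<^sub>R \<omega> \<in> Z} \<Longrightarrow> real (card X) \<le> N"
  shows "(\<Sum>i<m. hausdorff_outer (DIM('a) - 1) (K i)) \<le>
    of_nat (card J) * (ennreal (L ^ (DIM('a) - 1)) * (ennreal (cone_const TYPE('a)) * ennreal (N * unit_ball_vol DIM('a))))"
proof -
  let ?P = "\<lambda>b i. (\<lambda>x. sgn (x - p b)) ` K i" and ?c = "ennreal (L ^ (DIM('a) - 1))" and ?d = "ennreal (cone_const TYPE('a))"
  have thin: "p (j i) \<notin> K i" "\<And>x y. x \<in> K i \<Longrightarrow> y \<in> K i \<Longrightarrow> dist x y \<le> L * dist (sgn (x - p (j i))) (sgn (y - p (j i)))"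
    if "i < m" for i using K(2)[OF that] by (auto simp: radially_thin_def)
  note rc = hausdorff_outer_radial_compact[OF K(1) thin(1) L thin(2)]
  have "(\<Sum>i<m. hausdorff_outer (DIM('a) - 1) (K i)) \<le> (\<Sum>i<m. ?c * (?d * emeasure lborel (dcone 1 (?P (j i) i))))"
    by (intro sum_mono rc(1)) auto
  also have "\<dots> = (\<Sum>b\<in>J. \<Sum>i\<in>{i \<in> {..<m}. j i = b}. ?c * (?d * emeasure lborel (dcone 1 (?P (j i) i))))"
    by (rule sum.group[symmetric]) (use J in auto)
  also have "\<dots> \<le> (\<Sum>b\<in>J. ?c * (?d * ennreal (N * unit_ball_vol DIM('a))))"
  proof (rule sum_mono)
    fix b assume b: "b \<in> J"
    let ?I = "{i \<in> {..<m}. j i = b}"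
    have "(\<Sum>i\<in>?I. ?c * (?d * emeasure lborel (dcone 1 (?P (j i) i)))) = (\<Sum>i\<in>?I. ?c * (?d * emeasure lborel (dcone 1 (?P b i))))"
      by (intro sum.cong) auto
    also have "\<dots> = ?c * (?d * (\<Sum>i\<in>?I. emeasure lborel (dcone 1 (?P b i))))" by (simp only: sum_distrib_left)
    also have "\<dots> \<le> ?c * (?d * ennreal (N * unit_ball_vol DIM('a)))"
    proof (intro mult_left_mono disjoint_cones_multiplicity)
      show "compact (?P b i)" if "i \<in> ?I" for i using rc(2)[of i] that by auto
      show "disjoint_family_on K ?I" by (rule disjoint_family_on_mono[OF _ dis]) auto
      show "real (card X) \<le> N" if "norm \<omega> = 1" "finite X" "X \<subseteq> {t. t > 0 \<and> p b + t *\<^sub>R \<omega> \<in> (\<Union>i\<in>?I. K i)}" for \<omega> X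
        by (rule cnt[OF b that(1,2)]) (use that(3) K(3) in \<open>auto simp: subset_iff\<close>)
    qed (use K(1) thin(1) in auto)
    finally show "(\<Sum>i\<in>?I. ?c * (?d * emeasure lborel (dcone 1 (?P (j i) i)))) \<le> ?c * (?d * ennreal (N * unit_ball_vol DIM('a)))" .
  qed
  finally show ?thesis by simp
qed

text \<open>The sets have to be made disjoint without losing compactness: from \<open>K i\<close> the points closer than
  \<open>1 / (m + 1)\<close> to an earlier \<open>K l\<close> are removed, and \<open>m\<close> tends to infinity.\<close>

lemma countable_radially_thin_union:
  fixes K :: "nat \<Rightarrow> 'a::euclidean_space set" and p :: "'b \<Rightarrow> 'a"
  assumes J: "finite J" "\<And>i. j i \<in> J" and L: "L > 0"
    and K: "\<And>i. compact (K i)" "\<And>i. radially_thin (p (j i)) L (K i)" "\<And>i. K i \<subseteq> Z"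
    and cnt: "\<And>b \<omega> X. b \<in> J \<Longrightarrow> norm \<omega> = 1 \<Longrightarrow> finite X \<Longrightarrow> X \<subseteq> {t. t > 0 \<and> p b + t *\<^sub>R \<omega> \<in> Z} \<Longrightarrow> real (card X) \<le> N"
  shows "hausdorff_outer (DIM('a) - 1) (\<Union>i. K i) \<le>
    of_nat (card J) * (ennreal (L ^ (DIM('a) - 1)) * (ennreal (cone_const TYPE('a)) * ennreal (N * unit_ball_vol DIM('a))))"
    (is "_ \<le> ?R")
proof -
  let ?H = "hausdorff_outer (DIM('a) - 1) :: 'a set \<Rightarrow> ennreal" and ?M = "hausdorff_measure (DIM('a) - 1) :: 'a measure"
  define C where "C m i = K i \<inter> {x. \<forall>l<i. \<forall>y\<in>K l. 1 / real (Suc m) \<le> dist x y}" for m i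
  define D where "D m = (\<Union>i<m. C m i)" for m
  have Cc: "compact (C m i)" for m i
  proof -
    have "{x. \<forall>l<i. \<forall>y\<in>K l. 1 / real (Suc m) \<le> dist x y} = (\<Inter>l\<in>{..<i}. \<Inter>y\<in>K l. {x. 1 / real (Suc m) \<le> dist x y})" by auto
    also have "closed \<dots>" by (intro closed_INT ballI closed_Collect_le continuous_intros)
    finally show ?thesis unfolding C_def using K(1) by (intro compact_Int_closed)
  qed
  have CK: "C m i \<subseteq> K i" for m i by (auto simp: C_def)
  have Db: "D m \<in> sets borel" for m unfolding D_def using Cc by (intro sets.finite_UN borel_compact) auto
  have Cmono: "C m i \<subseteq> C m' i" if "m \<le> m'" for m m' i
  proof -
    have "1 / real (Suc m') \<le> 1 / real (Suc m)" using that by (intro divide_left_mono) auto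
    then show ?thesis unfolding C_def by (force intro: order_trans)
  qed
  have inc: "incseq D"
    unfolding incseq_def D_def using Cmono by (fastforce simp: subset_iff)
  have un: "(\<Union>i. K i) \<subseteq> (\<Union>m. D m)"
  proof
    fix x assume "x \<in> (\<Union>i. K i)"
    then obtain i0 where i0: "x \<in> K i0" by blast
    \<comment> \<open>The first piece that contains \<open>x\<close>. The finitely many earlier ones
      form a closed set that misses \<open>x\<close>, so \<open>x\<close> keeps a positive distance
      from it and survives the removal for all large \<open>m\<close>.\<close>
    define i where "i = (LEAST i. x \<in> K i)"
    have i: "x \<in> K i" "\<And>l. l < i \<Longrightarrow> x \<notin> K l" unfolding i_def using i0 by (auto intro: LeastI dest: not_less_Least)
    have "open (- (\<Union>l<i. K l))" using K(1) by (intro open_Compl closed_UN) (auto intro: compact_imp_closed)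
    moreover have "x \<in> - (\<Union>l<i. K l)" using i(2) by auto
    ultimately obtain e where e: "e > 0" "ball x e \<subseteq> - (\<Union>l<i. K l)" using openE by blast
    obtain n where n: "1 / real (Suc n) < e" using nat_approx_posE[OF e(1)] by blast
    define m where "m = max n (Suc i)"
    have "1 / real (Suc m) \<le> 1 / real (Suc n)" unfolding m_def by (intro divide_left_mono) auto
    then have me: "1 / real (Suc m) \<le> e" using n by linarith
    have "1 / real (Suc m) \<le> dist x y" if "l < i" "y \<in> K l" for l y
    proof -
      have "y \<notin> ball x e" using e(2) that by auto
      then show ?thesis using me by auto
    qed
    then have "x \<in> C m i" using i(1) by (auto simp: C_def)
    then show "x \<in> (\<Union>m. D m)" unfolding D_def by (auto simp: m_def intro!: exI[of _ m] bexI[of _ i])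
  qed
  have DM: "?H (D m) \<le> ?R" for m
  proof -
    have "?H (D m) \<le> (\<Sum>i<m. ?H (C m i))"
    proof -
      have "emeasure ?M (\<Union>i\<in>{..<m}. C m i) \<le> (\<Sum>i\<in>{..<m}. emeasure ?M (C m i))"
        by (rule emeasure_subadditive_finite) (use Cc in \<open>auto intro: borel_compact\<close>)
      then show ?thesis using emeasure_hausdorff_measure Db[of m] Cc unfolding D_def
        by (simp add: emeasure_hausdorff_measure borel_compact)
    qed
    also have "\<dots> \<le> ?R"
    proof (rule disjoint_radially_thin_sum[OF J(1) J(2) L Cc _ _ _ cnt])
      show "radially_thin (p (j i)) L (C m i)" for i by (rule radially_thin_subset[OF K(2) CK])
      show "C m i \<subseteq> Z" for i using CK K(3) by blast
      show "disjoint_family_on (C m) {..<m}"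
        unfolding disjoint_family_on_def
      proof (intro ballI impI)
        have *: "C m i \<inter> C m l = {}" if "l < i" for i l :: nat
        proof (rule ccontr)
          assume "C m i \<inter> C m l \<noteq> {}"
          then obtain x where "x \<in> C m i" "x \<in> K l" by (auto simp: C_def)
          then have "1 / real (Suc m) \<le> dist x x" using that unfolding C_def by blast
          then show False by simp
        qed
        fix i l :: nat assume "i \<noteq> l"
        then show "C m i \<inter> C m l = {}" using *[of i l] *[of l i] by (cases "i < l") auto
      qed
    qed auto
    finally show ?thesis .
  qed
  \<comment> \<open>The limit in \<open>m\<close> is continuity from below, which belongs to the
    measure on Borel sets and not to the outer measure.\<close>
  have UD: "(\<Union>m. D m) \<in> sets borel" using Db by (intro sets.countable_UN) auto
  have "?H (\<Union>i. K i) \<le> ?H (\<Union>m. D m)" by (rule hausdorff_outer_mono[OF un])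
  also have "\<dots> = emeasure ?M (\<Union>m. D m)" using UD by (simp add: emeasure_hausdorff_measure)
  also have "\<dots> = (SUP m. emeasure ?M (D m))" by (rule SUP_emeasure_incseq[symmetric]) (use Db inc in auto)
  also have "\<dots> = (SUP m. ?H (D m))" using Db by (simp add: emeasure_hausdorff_measure)
  also have "\<dots> \<le> ?R" by (rule SUP_least) (rule DM)
  finally show ?thesis .
qed

section \<open>Stratification by the order of vanishing\<close>

definition iter_deriv :: "('a::euclidean_space \<times> real \<Rightarrow> real) \<Rightarrow> 'a list \<Rightarrow> 'a \<times> real \<Rightarrow> real" where
  "iter_deriv U es = foldr (\<lambda>e W. partial_deriv (e, 0) W) es U"

lemma iter_deriv_simps [simp]: "iter_deriv U [] = U" "iter_deriv U (e # es) = partial_deriv (e, 0) (iter_deriv U es)"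
  by (simp_all add: iter_deriv_def)

lemma iter_deriv_replicate: "iter_deriv U (replicate k e) = (partial_deriv (e, 0) ^^ k) U"
  by (induction k) auto

lemma mv_on_iter_deriv: "mv_on W U \<Longrightarrow> mv_on W (iter_deriv U es)"
  by (induction es) (auto intro: mv_on_partial_deriv)

text \<open>The derivative \<open>iter_deriv U es\<close> vanishes on \<open>E\<close> and has a
  nonzero gradient at \<open>x\<close>, and \<open>sel\<close> offers a base point whose ray to
  \<open>x\<close> is transversal to the corresponding hypersurface. Half of the radius is used so
  that the piece is cut out by a closed ball and remains compact when \<open>E\<close> is.\<close>

lemma stratum_radially_thin:
  fixes U :: "'a::euclidean_space \<times> real \<Rightarrow> real" and p :: "'a \<Rightarrow> 'a"
  assumes mv: "mv_on (\<Omega> \<times> UNIV) U" and \<Omega>: "open \<Omega>" and x: "x \<in> \<Omega>"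
    and E: "\<And>y. y \<in> E \<Longrightarrow> iter_deriv U es (y, 0) = 0" "\<And>y. y \<in> E \<Longrightarrow> U (y, 0) = 0" and ne: "iter_deriv U (e # es) (x, 0) \<noteq> 0"
    and \<kappa>: "\<kappa> > 0" and R: "\<And>b. b \<in> Basis \<Longrightarrow> norm (x - p b) < R" and p: "\<And>b. b \<in> Basis \<Longrightarrow> U (p b, 0) \<noteq> 0" and U0: "U (x, 0) = 0"
    and sel: "\<And>\<nu>. norm \<nu> = 1 \<Longrightarrow> \<exists>b\<in>Basis. \<kappa> * norm (x - p b) < \<bar>\<nu> \<bullet> (x - p b)\<bar>"
  shows "\<exists>d>0. \<exists>b\<in>Basis. radially_thin (p b) (2 * (1 + 1 / \<kappa>) * R) (E \<inter> cball x d)"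
proof -
  let ?W = "iter_deriv U es"
  define G where "G y = fst (grad ?W (y, 0))" for y
  have mvW: "mv_on (\<Omega> \<times> UNIV) ?W" by (rule mv_on_iter_deriv[OF mv])
  have w: "((\<lambda>x. ?W (x, 0)) has_derivative (\<lambda>v. G y \<bullet> v)) (at y)" if "y \<in> \<Omega>" for y
  proof -
    have 1: "((\<lambda>x. (x, 0 :: real)) has_derivative (\<lambda>v. (v, 0))) (at y)" by (auto intro!: derivative_eq_intros)
    have "((\<lambda>x. ?W (x, 0)) has_derivative (\<lambda>v. grad ?W (y, 0) \<bullet> (v, 0))) (at y)"
      by (rule has_derivative_compose[OF 1 mv_on_grad(2)[OF mvW]]) (use that in simp)
    moreover have "grad ?W (y, 0) \<bullet> (v, 0) = G y \<bullet> v" for v by (simp add: inner_prod_def G_def)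
    ultimately show ?thesis by simp
  qed
  have Gc: "continuous_on \<Omega> G"
    unfolding G_def by (intro continuous_on_fst continuous_on_compose2[OF mv_on_grad(1)[OF mvW]] continuous_intros) auto
  have "iter_deriv U (e # es) (x, 0) = G x \<bullet> e"
    using mv_on_partial_deriv_eq[OF mvW, of "(x, 0)"] x by (simp add: G_def inner_prod_def)
  then have Gx: "G x \<noteq> 0" using ne by auto
  then have "norm (sgn (G x)) = 1" by (simp add: norm_sgn)
  then obtain b where b: "b \<in> Basis" "\<kappa> * norm (x - p b) < \<bar>sgn (G x) \<bullet> (x - p b)\<bar>" using sel by blast
  have xp: "x \<noteq> p b" using p[OF b(1)] U0 by metis
  obtain d where d: "d > 0" "\<And>y1 y2. y1 \<in> ball x d \<Longrightarrow> y2 \<in> ball x d \<Longrightarrow> ?W (y1, 0) = 0 \<Longrightarrow> ?W (y2, 0) = 0 \<Longrightarrow>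
      dist y1 y2 \<le> 2 * (1 + 1 / \<kappa>) * R * dist (sgn (y1 - p b)) (sgn (y2 - p b))"
    using radial_patch[OF \<Omega> x w Gc Gx \<kappa> R[OF b(1)] xp b(2)] by blast
  have "radially_thin (p b) (2 * (1 + 1 / \<kappa>) * R) (E \<inter> cball x (d / 2))"
    unfolding radially_thin_def
  proof (intro conjI ballI)
    show "p b \<notin> E \<inter> cball x (d / 2)" using E(2) p[OF b(1)] by blast
    fix y1 y2 assume y: "y1 \<in> E \<inter> cball x (d / 2)" "y2 \<in> E \<inter> cball x (d / 2)"
    then show "dist y1 y2 \<le> 2 * (1 + 1 / \<kappa>) * R * dist (sgn (y1 - p b)) (sgn (y2 - p b))"
      using d E(1) by (intro d(2)) auto
  qed
  then show ?thesis using d(1) b(1) by (intro exI[of _ "d / 2"]) auto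
qed

text \<open>The zero set is stratified by the order of vanishing. On the points of order exactly \<open>k + 1\<close>
  some derivative of order \<open>k\<close> vanishes with nonzero gradient, so this stratum lies locally in a
  hypersurface, on which the projection from a suitable base point is bi-Lipschitz.\<close>

lemma nodal_set_decomposition:
  fixes U :: "'a::euclidean_space \<times> real \<Rightarrow> real" and p :: "'a \<Rightarrow> 'a"
  assumes mv: "mv_on (\<Omega> \<times> UNIV) U" and \<Omega>: "open \<Omega>" and B: "compact B" "B \<subseteq> \<Omega>" and nf: "\<And>x. x \<in> B \<Longrightarrow> \<not> flat_at U x"
    and \<kappa>: "\<kappa> > 0" and R: "\<And>b x. b \<in> Basis \<Longrightarrow> x \<in> B \<Longrightarrow> norm (x - p b) < R" and p: "\<And>b. b \<in> Basis \<Longrightarrow> U (p b, 0) \<noteq> 0"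
    and sel: "\<And>x \<nu>. x \<in> B \<Longrightarrow> norm \<nu> = 1 \<Longrightarrow> \<exists>b\<in>Basis. \<kappa> * norm (x - p b) < \<bar>\<nu> \<bullet> (x - p b)\<bar>"
  shows "\<exists>(K :: nat \<Rightarrow> 'a set) j. (\<forall>i. j i \<in> Basis \<and> compact (K i) \<and> radially_thin (p (j i)) (2 * (1 + 1 / \<kappa>) * R) (K i) \<and>
    K i \<subseteq> {x \<in> B. U (x, 0) = 0}) \<and> {x \<in> B. U (x, 0) = 0} \<subseteq> (\<Union>i. K i)"
proof -
  let ?L = "2 * (1 + 1 / \<kappa>) * R" and ?Z = "{x \<in> B. U (x, 0) = 0}"
  define E where "E k = {x \<in> B. \<forall>es. length es \<le> k \<longrightarrow> iter_deriv U es (x, 0) = 0}" for k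
  have EZ: "E k \<subseteq> ?Z" for k
  proof
    fix x assume "x \<in> E k"
    then have "x \<in> B \<and> (\<forall>es. length es \<le> k \<longrightarrow> iter_deriv U es (x, 0) = 0)" by (simp add: E_def)
    then show "x \<in> ?Z" by (metis (mono_tags, lifting) iter_deriv_simps(1) le0 list.size(3) mem_Collect_eq)
  qed
  have Ec: "compact (E k)" for k
  proof -
    have "E k = B \<inter> (\<Inter>es\<in>{es. length es \<le> k}. {x \<in> B. iter_deriv U es (x, 0) = 0})" by (auto simp: E_def)
    also have "compact \<dots>"
    proof (intro compact_Int_closed B(1) closed_INT ballI)
      fix es :: "'a list"
      have "continuous_on (\<Omega> \<times> UNIV) (iter_deriv U es)" using mv_on_iter_deriv[OF mv] by (simp add: mv_on_def)
      then have "continuous_on B (\<lambda>x. iter_deriv U es (x, 0))"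
        by (rule continuous_on_compose2) (use B in \<open>auto intro!: continuous_intros\<close>)
      then show "closed {x \<in> B. iter_deriv U es (x, 0) = 0}"
        by (rule continuous_closed_preimage_constant) (use B in \<open>simp add: compact_imp_closed\<close>)
    qed
    finally show ?thesis .
  qed
  have patch: "\<exists>d>0. \<exists>b\<in>Basis. radially_thin (p b) ?L (E k \<inter> cball x d)" if x: "x \<in> E k" "x \<notin> E (Suc k)" for k x
  proof -
    have xB: "x \<in> B" "U (x, 0) = 0" using EZ x(1) by auto
    obtain es where es: "length es \<le> Suc k" "iter_deriv U es (x, 0) \<noteq> 0" using x(2) xB by (auto simp: E_def)
    have "\<not> length es \<le> k" using x(1) es(2) by (auto simp: E_def)
    then obtain e es' where e: "es = e # es'" "length es' = k" using es(1) by (cases es) auto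
    show ?thesis
    proof (rule stratum_radially_thin[OF mv \<Omega> _ _ _ _ \<kappa> R p xB(2) sel])
      show "x \<in> \<Omega>" using xB B by blast
      show "iter_deriv U es' (y, 0) = 0" if "y \<in> E k" for y using that e(2) by (auto simp: E_def)
      show "U (y, 0) = 0" if "y \<in> E k" for y using that EZ by blast
      show "iter_deriv U (e # es') (x, 0) \<noteq> 0" using es(2) e(1) by blast
    qed (use xB in auto)
  qed
  obtain d b where db: "\<And>k x. x \<in> E k \<Longrightarrow> x \<notin> E (Suc k) \<Longrightarrow> d k x > 0 \<and> b k x \<in> Basis \<and> radially_thin (p (b k x)) ?L (E k \<inter> cball x (d k x))"
  proof -
    have "\<forall>k x. \<exists>c. x \<in> E k \<longrightarrow> x \<notin> E (Suc k) \<longrightarrow> fst c > 0 \<and> snd c \<in> Basis \<and> radially_thin (p (snd c)) ?L (E k \<inter> cball x (fst c))"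
      using patch by (simp only: split_paired_Ex fst_conv snd_conv) blast
    then obtain c where "\<forall>k x. x \<in> E k \<longrightarrow> x \<notin> E (Suc k) \<longrightarrow> fst (c k x) > 0 \<and> snd (c k x) \<in> Basis \<and>
        radially_thin (p (snd (c k x))) ?L (E k \<inter> cball x (fst (c k x)))"
      unfolding choice_iff by blast
    then show thesis by (intro that[of "\<lambda>k x. fst (c k x)" "\<lambda>k x. snd (c k x)"]) auto
  qed
  have "\<exists>T. T \<subseteq> E k - E (Suc k) \<and> countable T \<and> E k - E (Suc k) \<subseteq> (\<Union>x\<in>T. cball x (d k x))" for k
  proof -
    let ?F = "(\<lambda>x. ball x (d k x)) ` (E k - E (Suc k))"
    obtain F' where F': "F' \<subseteq> ?F" "countable F'" "\<Union>F' = \<Union>?F" by (rule Lindelof[of ?F]) auto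
    then obtain T where T: "T \<subseteq> E k - E (Suc k)" "countable T" "F' = (\<lambda>x. ball x (d k x)) ` T"
      using countable_subset_image[of F' "\<lambda>x. ball x (d k x)" "E k - E (Suc k)"] by blast
    have "E k - E (Suc k) \<subseteq> \<Union>?F" using db by force
    also have "\<dots> \<subseteq> (\<Union>x\<in>T. cball x (d k x))" unfolding F'(3)[symmetric] T(3) by (intro UN_mono ball_subset_cball) auto
    finally show ?thesis using T by blast
  qed
  then obtain T where T: "\<And>k. T k \<subseteq> E k - E (Suc k)" "\<And>k. countable (T k)" "\<And>k. E k - E (Suc k) \<subseteq> (\<Union>x\<in>T k. cball x (d k x))" by metis
  obtain b0 :: 'a where b0: "b0 \<in> Basis" by (meson nonempty_Basis ex_in_conv)
  \<comment> \<open>The empty piece keeps the countable family nonempty, so that it can be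
    enumerated by all natural numbers.\<close>
  define F where "F = insert (b0, {}) ((\<lambda>(k, x). (b k x, E k \<inter> cball x (d k x))) ` (SIGMA k:UNIV. T k))"
  have Fc: "countable F" "F \<noteq> {}" unfolding F_def by (auto intro!: countable_SIGMA T)
  have good: "fst c \<in> Basis \<and> compact (snd c) \<and> radially_thin (p (fst c)) ?L (snd c) \<and> snd c \<subseteq> ?Z" if cF: "c \<in> F" for c
  proof -
    consider "c = (b0, {})" | k x where "x \<in> T k" "c = (b k x, E k \<inter> cball x (d k x))" using cF unfolding F_def by auto
    then show ?thesis
    proof cases
      case 1 then show ?thesis using b0 by (simp add: radially_thin_def)
    next
      case (2 k x)
      then have "x \<in> E k" "x \<notin> E (Suc k)" using T(1) by auto
      then show ?thesis using 2 db EZ[of k] Ec[of k] by (auto intro: compact_Int_closed)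
    qed
  qed
  have cov: "?Z \<subseteq> (\<Union>c\<in>F. snd c)"
  proof
    fix x assume x: "x \<in> ?Z"
    then obtain e k where "norm e = 1" "(partial_deriv (e, 0) ^^ k) U (x, 0) \<noteq> 0" using nf unfolding flat_at_def by blast
    then have "x \<notin> E k" unfolding E_def iter_deriv_replicate[symmetric] by (auto intro!: exI[of _ "replicate k e"])
    \<comment> \<open>The first stratum that misses \<open>x\<close>. It exists since
      \<open>x\<close> is not flat, and it is not the one of index 0 since \<open>U\<close> vanishes
      at \<open>x\<close>; so \<open>x\<close> lies in the difference of two consecutive
      strata.\<close>
    define m where "m = (LEAST k. x \<notin> E k)"
    have m: "x \<notin> E m" unfolding m_def by (rule LeastI[where P = "\<lambda>k. x \<notin> E k"]) fact
    moreover have "x \<in> E 0" using x by (auto simp: E_def)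
    ultimately obtain k' where k': "m = Suc k'" by (metis not0_implies_Suc)
    have "x \<in> E k'" using not_less_Least[of k' "\<lambda>k. x \<notin> E k"] k' unfolding m_def by auto
    then have "x \<in> E k' - E (Suc k')" using m k' by auto
    then obtain y where y: "y \<in> T k'" "x \<in> cball y (d k' y)" using T(3) by blast
    then have "(b k' y, E k' \<inter> cball y (d k' y)) \<in> F" unfolding F_def by force
    then show "x \<in> (\<Union>c\<in>F. snd c)" using y \<open>x \<in> E k'\<close> by force
  qed
  have r: "range (from_nat_into F) = F" by (rule range_from_nat_into[OF Fc(2,1)])
  have "?Z \<subseteq> (\<Union>i. snd (from_nat_into F i))"
  proof
    fix x assume "x \<in> ?Z"
    then obtain c where c: "c \<in> F" "x \<in> snd c" using cov by auto
    then obtain i where "c = from_nat_into F i" using r by (metis rangeE)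
    then show "x \<in> (\<Union>i. snd (from_nat_into F i))" using c(2) by auto
  qed
  moreover have "from_nat_into F i \<in> F" for i using Fc(2) by (rule from_nat_into)
  ultimately show ?thesis using good
    by (intro exI[of _ "\<lambda>i. snd (from_nat_into F i)"] exI[of _ "\<lambda>i. fst (from_nat_into F i)"]) auto
qed

section \<open>The local estimate and the covering argument\<close>

lemma exists_large_coordinate:
  fixes \<nu> :: "'a::euclidean_space"
  assumes "norm \<nu> = 1"
  shows "\<exists>b\<in>Basis. 1 / DIM('a) \<le> \<bar>\<nu> \<bullet> b\<bar>"
proof (rule ccontr)
  assume "\<not> ?thesis"
  then have "(\<Sum>b\<in>Basis. \<bar>\<nu> \<bullet> b\<bar>) < (\<Sum>b\<in>(Basis :: 'a set). 1 / DIM('a))"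
    by (intro sum_strict_mono) (auto simp: not_le)
  also have "\<dots> = 1" by simp
  finally show False using norm_le_l1[of \<nu>] assms by simp
qed

text \<open>The base points lie at distance about \<open>2 * \<sigma>\<close> from the centre of a
  much smaller ball, so a ray that hits this ball does so within length \<open>3 * \<sigma>\<close>.
  With \<open>\<sigma> = r / (6 * q)\<close> that length meets the condition
  \<open>q / r * (3 * \<sigma>) \<le> 1 / 2\<close> of the zero count with equality.\<close>

lemma nodal_set_ball_bound:
  fixes U :: "'a::euclidean_space \<times> real \<Rightarrow> real"
  defines "q \<equiv> line_rate TYPE('a)" and "n \<equiv> real DIM('a)"
  assumes be: "bounded_ext U \<Omega> r S" and \<Omega>: "open \<Omega>" and nf: "\<And>x. x \<in> \<Omega> \<Longrightarrow> \<not> flat_at U x"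
    and bp: "\<And>a. norm a \<le> r / 8 \<Longrightarrow> \<exists>p. dist p a \<le> r / (24 * q * n) \<and> S * exp (- M) \<le> \<bar>U (p, 0)\<bar>"
    and a: "norm a \<le> r / 16"
  shows "hausdorff_outer (DIM('a) - 1) {x \<in> cball a (r / (24 * q * n)). U (x, 0) = 0} \<le>
    of_nat DIM('a) * (ennreal (((1 + 2 * n) * r / q) ^ (DIM('a) - 1)) * (ennreal (cone_const TYPE('a)) * ennreal (M / ln 2 * unit_ball_vol n)))"
proof -
  have r: "r > 0" and S: "S > 0" and mv: "mv_on (\<Omega> \<times> UNIV) U" and sub: "cball 0 (2 * r) \<subseteq> \<Omega> \<times> (UNIV :: real set)"
    using be by (auto simp: bounded_ext_def)
  have q: "q \<ge> 100" "q > 0" unfolding q_def by (rule line_rate_ge)+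
  have n: "n \<ge> 1" unfolding n_def by (simp add: Suc_leI)
  define \<sigma> where "\<sigma> = r / (6 * q)"
  define l where "l = r / (24 * q * n)"
  have \<sigma>: "\<sigma> > 0" "\<sigma> \<le> r / 600"
  proof -
    show "\<sigma> > 0" using r q by (simp add: \<sigma>_def)
    show "\<sigma> \<le> r / 600" unfolding \<sigma>_def using r q by (intro divide_left_mono) auto
  qed
  have l\<sigma>: "l = \<sigma> / (4 * n)" using q n by (simp add: l_def \<sigma>_def)
  have l: "l > 0" "l \<le> \<sigma> / 4"
  proof -
    show "l > 0" unfolding l\<sigma> using \<sigma> n by simp
    show "l \<le> \<sigma> / 4" unfolding l\<sigma> using \<sigma> n by (intro divide_left_mono) auto
  qed
  have "\<exists>p. dist p (a + (2 * \<sigma>) *\<^sub>R b) \<le> l \<and> S * exp (- M) \<le> \<bar>U (p, 0)\<bar>" if "b \<in> Basis" for b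
  proof -
    have "norm (a + (2 * \<sigma>) *\<^sub>R b) \<le> r / 8" using norm_triangle_ineq[of a "(2 * \<sigma>) *\<^sub>R b"] a \<sigma> that r by simp
    then show ?thesis unfolding l_def by (rule bp)
  qed
  then obtain p where p: "\<And>b. b \<in> Basis \<Longrightarrow> dist (p b) (a + (2 * \<sigma>) *\<^sub>R b) \<le> l" "\<And>b. b \<in> Basis \<Longrightarrow> S * exp (- M) \<le> \<bar>U (p b, 0)\<bar>" by metis
  \<comment> \<open>The base points sit near \<open>a + 2\<sigma>b\<close>, so every hyperplane through a point of the ball is transversal
    to the ray from at least one of them.\<close>
  let ?B = "cball a l"
  have offset: "\<exists>e. x - p b = e - (2 * \<sigma>) *\<^sub>R b \<and> norm e \<le> 2 * l" if "b \<in> Basis" "x \<in> ?B" for x b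
  proof -
    have "norm ((x - a) - (p b - (a + (2 * \<sigma>) *\<^sub>R b))) \<le> 2 * l"
      using norm_triangle_ineq4[of "x - a" "p b - (a + (2 * \<sigma>) *\<^sub>R b)"] p(1)[OF that(1)] that(2) by (simp add: dist_norm norm_minus_commute)
    then show ?thesis by (intro exI[of _ "(x - a) - (p b - (a + (2 * \<sigma>) *\<^sub>R b))"]) simp
  qed
  have xp: "norm (x - p b) \<le> 5 / 2 * \<sigma>" if b: "b \<in> Basis" and x: "x \<in> ?B" for x b
  proof -
    obtain e where "x - p b = e - (2 * \<sigma>) *\<^sub>R b" "norm e \<le> 2 * l" using offset[OF b x] by blast
    then show ?thesis using norm_triangle_ineq4[of e "(2 * \<sigma>) *\<^sub>R b"] b \<sigma> l by simp
  qed
  have sel: "\<exists>b\<in>Basis. 1 / (2 * n) * norm (x - p b) < \<bar>\<nu> \<bullet> (x - p b)\<bar>" if x: "x \<in> ?B" and \<nu>: "norm \<nu> = 1" for x \<nu>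
  proof -
    obtain b where b: "b \<in> Basis" "1 / n \<le> \<bar>\<nu> \<bullet> b\<bar>" using exists_large_coordinate[OF \<nu>] unfolding n_def by blast
    obtain e where e: "x - p b = e - (2 * \<sigma>) *\<^sub>R b" "norm e \<le> 2 * l" using offset[OF b(1) x] by blast
    have "\<bar>\<nu> \<bullet> e\<bar> \<le> 2 * l" using Cauchy_Schwarz_ineq2[of \<nu> e] \<nu> e(2) by simp
    moreover have "2 * \<sigma> * (1 / n) \<le> 2 * \<sigma> * \<bar>\<nu> \<bullet> b\<bar>" using b(2) \<sigma> by (intro mult_left_mono) auto
    moreover have "\<bar>\<nu> \<bullet> (x - p b)\<bar> \<ge> 2 * \<sigma> * \<bar>\<nu> \<bullet> b\<bar> - \<bar>\<nu> \<bullet> e\<bar>"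
      unfolding e(1) inner_diff_right inner_scaleR_right using \<sigma> abs_triangle_ineq2[of "2 * \<sigma> * (\<nu> \<bullet> b)" "\<nu> \<bullet> e"] by (simp add: abs_mult abs_minus_commute)
    ultimately have lo: "2 * \<sigma> * (1 / n) - 2 * l \<le> \<bar>\<nu> \<bullet> (x - p b)\<bar>" by linarith
    have "1 / (2 * n) * norm (x - p b) \<le> 1 / (2 * n) * (5 / 2 * \<sigma>)" using xp[OF b(1) x] n by (intro mult_left_mono) auto
    \<comment> \<open>Inserting \<open>l\<close>, the two sides are
      \<open>5 * \<sigma> / (4 * n)\<close> and \<open>3 * \<sigma> / (2 * n)\<close>.\<close>
    also have "\<dots> < 2 * \<sigma> * (1 / n) - 2 * l" unfolding l\<sigma> using \<sigma> n by (simp add: field_simps)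
    finally show ?thesis using lo b(1) by force
  qed
  have pn: "norm (p b + t *\<^sub>R \<omega>) \<le> r" if b: "b \<in> Basis" and \<omega>: "norm \<omega> = 1" and t: "0 \<le> t" "t \<le> 3 * \<sigma>" for b t \<omega>
  proof -
    have "norm (a + (2 * \<sigma>) *\<^sub>R b + (p b - (a + (2 * \<sigma>) *\<^sub>R b)) + t *\<^sub>R \<omega>) \<le> norm a + 2 * \<sigma> + l + 3 * \<sigma>"
      by (intro norm_triangle_mono) (use b \<omega> t p(1)[OF b] \<sigma> in \<open>auto simp: dist_norm\<close>)
    also have "\<dots> \<le> r" using a \<sigma> l r by simp
    finally show ?thesis by simp
  qed
  have BO: "?B \<subseteq> \<Omega>"
  proof
    fix x assume "x \<in> ?B"
    then have "norm x \<le> norm a + l" using norm_triangle_ineq[of a "x - a"] by (simp add: dist_norm norm_minus_commute)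
    then have "(x, 0 :: real) \<in> cball 0 (2 * r)" using a l \<sigma> r by (simp add: norm_Pair)
    then show "x \<in> \<Omega>" using sub by blast
  qed
  have p0: "U (p b, 0) \<noteq> 0" if "b \<in> Basis" for b
  proof -
    have "S * exp (- M) > 0" using S by simp
    then show ?thesis using p(2)[OF that] by auto
  qed
  let ?Z = "{x \<in> ?B. U (x, 0) = 0}"
  \<comment> \<open>The Lipschitz constant of the radial inverses for transversality
    \<open>1 / (2 * n)\<close> and distance bound \<open>3 * \<sigma>\<close>; being of order
    \<open>r\<close>, it produces the factor \<open>r ^ (DIM('a) - 1)\<close>.\<close>
  have L: "2 * (1 + 1 / (1 / (2 * n))) * (3 * \<sigma>) = (1 + 2 * n) * r / q" using q n by (simp add: \<sigma>_def field_simps)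
  obtain K :: "nat \<Rightarrow> 'a set" and j where K: "\<And>i. j i \<in> Basis" "\<And>i. compact (K i)" "\<And>i. radially_thin (p (j i)) ((1 + 2 * n) * r / q) (K i)"
      "\<And>i. K i \<subseteq> ?Z" "?Z \<subseteq> (\<Union>i. K i)"
  proof -
    have "\<exists>(K :: nat \<Rightarrow> 'a set) j. (\<forall>i. j i \<in> Basis \<and> compact (K i) \<and> radially_thin (p (j i)) (2 * (1 + 1 / (1 / (2 * n))) * (3 * \<sigma>)) (K i) \<and>
      K i \<subseteq> ?Z) \<and> ?Z \<subseteq> (\<Union>i. K i)"
    proof (rule nodal_set_decomposition[OF mv \<Omega> compact_cball BO _ _ _ p0 sel])
      show "norm (x - p b) < 3 * \<sigma>" if "b \<in> Basis" "x \<in> ?B" for b x using xp[OF that] \<sigma> by simp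
    qed (use nf BO n in auto)
    then show thesis unfolding L using that by blast
  qed
  have cnt: "real (card X) \<le> M / ln 2" if b: "b \<in> Basis" and \<omega>: "norm \<omega> = 1" and X: "finite X" "X \<subseteq> {t. t > 0 \<and> p b + t *\<^sub>R \<omega> \<in> ?Z}" for b \<omega> X
  proof -
    have "card X * ln 2 \<le> M"
    proof (rule zero_count_bound[where D = "line_deriv U (p b) \<omega>" and T = "3 * \<sigma>" and Q = "q / r" and S = S])
      show "(line_deriv U (p b) \<omega> i has_real_derivative line_deriv U (p b) \<omega> (Suc i) t) (at t)" if "0 \<le> t" "t \<le> 3 * \<sigma>" for i t
        by (rule bounded_ext_line(1)[OF be pn[OF b \<omega> that]]) (use \<omega> in simp)
      show "\<bar>line_deriv U (p b) \<omega> i t\<bar> \<le> S * fact i * (q / r) ^ i" if "0 \<le> t" "t \<le> 3 * \<sigma>" for i t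
        unfolding q_def by (rule bounded_ext_line(2)[OF be pn[OF b \<omega> that]]) (use \<omega> in simp)
      show "q / r * (3 * \<sigma>) \<le> 1 / 2" using q r by (simp add: \<sigma>_def)
      show "X \<subseteq> {0<..3 * \<sigma>}"
      proof
        fix t assume t: "t \<in> X"
        then have "t > 0" "p b + t *\<^sub>R \<omega> \<in> ?B" using X(2) by auto
        then show "t \<in> {0<..3 * \<sigma>}" using xp[OF b, of "p b + t *\<^sub>R \<omega>"] \<omega> \<sigma> by simp
      qed
      show "line_deriv U (p b) \<omega> 0 t = 0" if "t \<in> X" for t using that X(2) by (auto simp: line_deriv_def)
      show "S * exp (- M) \<le> \<bar>line_deriv U (p b) \<omega> 0 0\<bar>" using p(2)[OF b] by (simp add: line_deriv_def)
    qed (use q r \<sigma> S X in auto)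
    then show ?thesis by (simp add: pos_le_divide_eq)
  qed
  have "hausdorff_outer (DIM('a) - 1) ?Z \<le> hausdorff_outer (DIM('a) - 1) (\<Union>i. K i)" by (rule hausdorff_outer_mono[OF K(5)])
  also have "\<dots> \<le> of_nat (card (Basis :: 'a set)) * (ennreal (((1 + 2 * n) * r / q) ^ (DIM('a) - 1)) *
      (ennreal (cone_const TYPE('a)) * ennreal (M / ln 2 * unit_ball_vol DIM('a))))"
    by (rule countable_radially_thin_union[where j = j and p = p and K = K and Z = "?Z", OF finite_Basis K(1) _ K(2,3,4) cnt]) (use r q n in auto)
  finally show ?thesis unfolding l_def n_def .
qed

lemma hausdorff_outer_finite_UN_le:
  assumes "finite I" "\<And>i. i \<in> I \<Longrightarrow> hausdorff_outer s (A i) \<le> c"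
  shows "hausdorff_outer s (\<Union>i\<in>I. A i) \<le> of_nat (card I) * c"
  using assms
proof (induction I)
  case (insert i I)
  have "hausdorff_outer s (\<Union>i\<in>insert i I. A i) \<le> hausdorff_outer s (A i) + hausdorff_outer s (\<Union>i\<in>I. A i)"
    using hausdorff_outer_Un[of s "A i" "\<Union>i\<in>I. A i"] by simp
  also have "\<dots> \<le> c + of_nat (card I) * c" using insert by (intro add_mono) auto
  finally show ?case using insert by (simp add: algebra_simps)
qed simp

text \<open>The neighbourhood of the closed ball is an open connected \<open>\<Omega>\<close>;
  connectedness excludes a \<open>u\<close> that vanishes near the ball and is nonzero elsewhere.
  The constant is chosen after \<open>C0\<close> and before all other data.\<close>

theorem theorem4p3:
  fixes C0 :: real
  assumes "CARD('n::finite) \<ge> 2"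
    and "C0 > 0"
    and "monotonicity_threshold TYPE('n) C0"
  shows "\<exists>C>0. \<forall>lam r0 (\<Omega> :: (real^'n) set) u r.
           lam > 1 \<and> 0 < r0 \<and> r0 < 1 \<and>
           open \<Omega> \<and> connected \<Omega> \<and> cball 0 r0 \<subseteq> \<Omega> \<and> eigenfunction_on \<Omega> lam u \<and>
           0 < r \<and> r < r0 / 4 \<longrightarrow>
           hausdorff_outer (CARD('n) - 1) ({x. u x = 0} \<inter> ball 0 (r / 16))
             \<le> ennreal (C * (max (frequency lam u 0 r0) C0 + ln lam + sqrt lam * r - ln r)
                          * r ^ (CARD('n) - 1))"
proof -
  let ?n = "real CARD('n)" and ?s = "CARD('n) - 1"
  define q where "q = line_rate TYPE(real^'n)"
  have q: "q \<ge> 100" "q > 0" unfolding q_def by (rule line_rate_ge)+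
  have n: "?n \<ge> 1" by (simp add: Suc_leI)
  \<comment> \<open>In units of \<open>r\<close>, both the radius of the small balls on which the
    local estimate holds and the accuracy with which base points are located.\<close>
  define \<theta> where "\<theta> = 1 / (24 * q * ?n)"
  have \<theta>: "0 < \<theta>" "\<theta> \<le> 1 / (8 * q)"
  proof -
    have "8 * q * 1 \<le> 24 * q * ?n" using q n by (intro mult_mono) auto
    then have "8 * q \<le> 24 * q * ?n" by simp
    then show "\<theta> \<le> 1 / (8 * q)" unfolding \<theta>_def using q by (intro divide_left_mono) auto
    show "0 < \<theta>" unfolding \<theta>_def using q by simp
  qed
  obtain Cstar where Cs: "Cstar > 0" and thr: "\<And>(\<Omega> :: (real^'n) set) lam u y0 r.
        open \<Omega> \<and> connected \<Omega> \<and> bounded \<Omega> \<and> lam > 1 \<and> eigenfunction_on \<Omega> lam u \<and>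
        0 < r \<and> r \<le> 1 \<and> cball y0 r \<subseteq> \<Omega> \<times> UNIV \<and> frequency lam u y0 r \<ge> C0 \<Longrightarrow>
        \<exists>D. ((\<lambda>s. ln (frequency lam u y0 s)) has_real_derivative D) (at r) \<and> D \<ge> - Cstar"
    using assms(3) unfolding monotonicity_threshold_def by blast
  have "\<exists>A\<ge>0. \<forall>lam r0 (\<Omega> :: (real^'n) set) u r.
    lam > 1 \<longrightarrow> 0 < r0 \<longrightarrow> r0 < 1 \<longrightarrow> open \<Omega> \<longrightarrow> connected \<Omega> \<longrightarrow> cball 0 r0 \<subseteq> \<Omega> \<longrightarrow> eigenfunction_on \<Omega> lam u \<longrightarrow>
    0 < r \<longrightarrow> r < r0 / 4 \<longrightarrow> (\<exists>S. bounded_ext (harm_ext lam u) \<Omega> r S \<and> (\<forall>a. norm a \<le> r / 8 \<longrightarrow>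
      (\<exists>p. dist p a \<le> \<theta> * r \<and> S * exp (- (A * nodal_rate lam u r0 C0 r)) \<le> \<bar>harm_ext lam u (p, 0)\<bar>)))"
    by (rule eigenfunction_base_points[OF _ assms(2) Cs \<theta>[unfolded q_def]]) (rule thr, assumption)
  then obtain A where A: "A \<ge> 0" and base: "\<forall>lam r0 (\<Omega> :: (real^'n) set) u r.
    lam > 1 \<longrightarrow> 0 < r0 \<longrightarrow> r0 < 1 \<longrightarrow> open \<Omega> \<longrightarrow> connected \<Omega> \<longrightarrow> cball 0 r0 \<subseteq> \<Omega> \<longrightarrow> eigenfunction_on \<Omega> lam u \<longrightarrow>
    0 < r \<longrightarrow> r < r0 / 4 \<longrightarrow> (\<exists>S. bounded_ext (harm_ext lam u) \<Omega> r S \<and> (\<forall>a. norm a \<le> r / 8 \<longrightarrow>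
      (\<exists>p. dist p a \<le> \<theta> * r \<and> S * exp (- (A * nodal_rate lam u r0 C0 r)) \<le> \<bar>harm_ext lam u (p, 0)\<bar>)))"
    by (elim exE conjE that)
  \<comment> \<open>The cover is fixed at unit scale and dilated by \<open>r\<close> later, so the
    number of balls depends on the dimension only.\<close>
  obtain G :: "(real^'n) set" where G: "finite G" "G \<subseteq> cball 0 (1 / 16)" "cball 0 (1 / 16) \<subseteq> (\<Union>g\<in>G. ball g \<theta>)"
    by (rule compactE_image[OF compact_cball[of "0 :: real^'n" "1 / 16"], of "cball 0 (1 / 16)" "\<lambda>g. ball g \<theta>"]) (use \<theta> in auto)
  define cc where "cc = cone_const TYPE(real^'n)"
  define D where "D = ?n * ((1 + 2 * ?n) / q) ^ ?s * cc * (A / ln 2 * unit_ball_vol ?n)"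
  have cc: "cc > 0" unfolding cc_def by (rule cone_const_pos)
  have D: "D \<ge> 0" unfolding D_def using cc A q by simp
  show ?thesis
  proof (intro exI[of _ "card G * D + 1"] conjI allI impI)
    \<comment> \<open>\<open>D\<close> is only known to be nonnegative; the summand 1 makes the
      constant positive.\<close>
    show "card G * D + 1 > 0" using D by (simp add: add_nonneg_pos)
    fix lam r0 r :: real and \<Omega> :: "(real^'n) set" and u :: "real^'n \<Rightarrow> real"
    assume hyp: "lam > 1 \<and> 0 < r0 \<and> r0 < 1 \<and> open \<Omega> \<and> connected \<Omega> \<and> cball 0 r0 \<subseteq> \<Omega> \<and> eigenfunction_on \<Omega> lam u \<and> 0 < r \<and> r < r0 / 4"
    then have lam: "lam > 1" and r0: "0 < r0" "r0 < 1" and \<Omega>: "open \<Omega>" "connected \<Omega>" and sub0: "cball 0 r0 \<subseteq> \<Omega>"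
      and eig: "eigenfunction_on \<Omega> lam u" and r: "0 < r" "r < r0 / 4" by auto
    let ?U = "harm_ext lam u"
    define M where "M = nodal_rate lam u r0 C0 r"
    have "r < 1 / 4" using r r0 by simp
    from nodal_rate_bounds(1)[OF lam r(1) this assms(2), of u r0] have M: "M \<ge> 1" by (simp add: M_def)
    obtain S where be: "bounded_ext ?U \<Omega> r S" and bp: "\<And>a. norm a \<le> r / 8 \<Longrightarrow> \<exists>p. dist p a \<le> \<theta> * r \<and> S * exp (- (A * M)) \<le> \<bar>?U (p, 0)\<bar>"
      using base[rule_format, OF lam r0 \<Omega> sub0 eig r] unfolding M_def by blast
    have mv: "mv_on (\<Omega> \<times> UNIV) ?U" using be by (simp add: bounded_ext_def)
    have U0: "?U (x, 0) = u x" for x using lam by (intro harm_ext_zero) simp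
    have nf: "\<not> flat_at ?U x" if "x \<in> \<Omega>" for x
    proof
      assume fl: "flat_at ?U x"
      obtain y where "y \<in> \<Omega>" "u y \<noteq> 0" using eig by (auto simp: eigenfunction_on_def)
      then show False using unique_continuation[OF mv \<Omega> that fl] U0 by metis
    qed
    have \<theta>r: "r / (24 * q * ?n) = \<theta> * r" by (simp add: \<theta>_def)
    have "hausdorff_outer ?s {x \<in> cball (r *\<^sub>R g) (\<theta> * r). u x = 0} \<le> ennreal (D * M * r ^ ?s)" if g: "g \<in> G" for g
    proof -
      have "norm (r *\<^sub>R g) \<le> r / 16" using G(2) g r by (force simp: mult_left_mono)
      from nodal_set_ball_bound[OF be \<Omega>(1) nf _ this, of "A * M"] bp
      have "hausdorff_outer ?s {x \<in> cball (r *\<^sub>R g) (\<theta> * r). u x = 0} \<le>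
        of_nat CARD('n) * (ennreal (((1 + 2 * ?n) * r / q) ^ ?s) * (ennreal cc * ennreal (A * M / ln 2 * unit_ball_vol ?n)))"
        unfolding U0 q_def[symmetric] cc_def[symmetric] by (simp add: \<theta>r)
      also have "\<dots> = ennreal (?n * (((1 + 2 * ?n) * r / q) ^ ?s * (cc * (A * M / ln 2 * unit_ball_vol ?n))))"
      proof -
        have "0 \<le> ((1 + 2 * ?n) * r / q) ^ ?s" using q r by simp
        moreover have "0 \<le> A * M / ln 2 * unit_ball_vol ?n" using A M by simp
        ultimately show ?thesis using cc
          by (simp only: ennreal_of_nat_eq_real_of_nat ennreal_mult[symmetric] mult_nonneg_nonneg less_imp_le of_nat_0_le_iff)
      qed
      also have "?n * (((1 + 2 * ?n) * r / q) ^ ?s * (cc * (A * M / ln 2 * unit_ball_vol ?n))) = D * M * r ^ ?s"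
        by (simp add: D_def power_mult_distrib power_divide)
      finally show ?thesis .
    qed
    then have U: "hausdorff_outer ?s (\<Union>g\<in>G. {x \<in> cball (r *\<^sub>R g) (\<theta> * r). u x = 0}) \<le> of_nat (card G) * ennreal (D * M * r ^ ?s)"
      by (rule hausdorff_outer_finite_UN_le[OF G(1)])
    have "{x. u x = 0} \<inter> ball 0 (r / 16) \<subseteq> (\<Union>g\<in>G. {x \<in> cball (r *\<^sub>R g) (\<theta> * r). u x = 0})"
    proof
      fix x assume x: "x \<in> {x. u x = 0} \<inter> ball 0 (r / 16)"
      then have "(1 / r) *\<^sub>R x \<in> cball 0 (1 / 16)" using r by (simp add: field_simps)
      then have "(1 / r) *\<^sub>R x \<in> (\<Union>g\<in>G. ball g \<theta>)" using G(3) by blast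
      then obtain g where g: "g \<in> G" "dist g ((1 / r) *\<^sub>R x) < \<theta>" by auto
      have "r *\<^sub>R g - x = r *\<^sub>R (g - (1 / r) *\<^sub>R x)" using r by (simp add: scaleR_diff_right)
      then have "dist (r *\<^sub>R g) x = r * dist g ((1 / r) *\<^sub>R x)" using r by (simp add: dist_norm)
      also have "\<dots> \<le> \<theta> * r" using g r by (simp add: mult.commute mult_left_mono)
      finally show "x \<in> (\<Union>g\<in>G. {x \<in> cball (r *\<^sub>R g) (\<theta> * r). u x = 0})" using g x by auto
    qed
    then have "hausdorff_outer ?s ({x. u x = 0} \<inter> ball 0 (r / 16)) \<le> of_nat (card G) * ennreal (D * M * r ^ ?s)"
      using U by (rule order_trans[OF hausdorff_outer_mono])
    also have "\<dots> = ennreal (card G * (D * M * r ^ ?s))" using D M r by (simp add: ennreal_mult ennreal_of_nat_eq_real_of_nat)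
    also have "\<dots> \<le> ennreal ((card G * D + 1) * M * r ^ ?s)"
      using M r by (intro ennreal_leI) (simp add: algebra_simps)
    finally show "hausdorff_outer ?s ({x. u x = 0} \<inter> ball 0 (r / 16))
      \<le> ennreal ((card G * D + 1) * (max (frequency lam u 0 r0) C0 + ln lam + sqrt lam * r - ln r) * r ^ ?s)"
      unfolding M_def nodal_rate_def .
  qed
qed

end
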